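(* Let $\delta$ be a matrix of free polynomials in $d$ variables and let $I=\{\phi\in H^\infty(G_\delta):\ \phi|_{\mathcal M_1^d}=0\}$. Then $H^\infty(G_\delta)/I$ is isometrically isomorphic to $H^\infty_{\delta,\mathrm{com}}$.
   Context: $\mathcal M^d=\bigcup_n\mathcal M_n^d$ ($d$-tuples of $n\times n$ complex matrices; $\mathcal M_1^d=\mathbb C^d$); $G_\delta=\{M\in\mathcal M^d:\|\delta(M)\|<1\}$. $H^\infty(G_\delta)$ is the Banach algebra of bounded nc-functions on $G_\delta$ (maps $\phi$ with $\phi(x)\in\mathcal M_n$ for $x\in G_\delta\cap\mathcal M_n^d$, $\phi(x\oplus y)=\phi(x)\oplus\phi(y)$, $\phi(s^{-1}xs)=s^{-1}\phi(x)s$ whenever $s$ is invertible and $x,s^{-1}xs\in G_\delta$), with norm $\sup_{x\in G_\delta}\|\phi(x)\|$; the quotient carries the quotient norm. For a holomorphic function $f$ on $G_\delta\cap\mathbb C^d$, $\|f\|_{\delta,\mathrm{com}}=\sup\|f(T)\|$, where $T$ ranges over commuting $d$-tuples in $\mathcal M_n^d$ (any $n$) with $\|\delta(T)\|\le1$ and joint spectrum $\sigma(T)\subseteq G_\delta$, and $f(T)$ is defined by the (Taylor) holomorphic functional calculus; $H^\infty_{\delta,\mathrm{com}}$ is the Banach algebra of holomorphic functions on $G_\delta\cap\mathbb C^d$ with $\|f\|_{\delta,\mathrm{com}}<\infty$. *)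

theory Defs
  imports "HOL-Analysis.Analysis" "Jordan_Normal_Form.Matrix"
begin

text \<open>Points of C^d are elements of complex^'d (d = CARD('d)); d-tuples of n x n
 matrices are functions 'd => complex mat whose values all lie in carrier_mat n n.\<close>

type_synonym 'd mtuple = "'d \<Rightarrow> complex mat"

definition is_mtuple :: "nat \<Rightarrow> 'd mtuple \<Rightarrow> bool" where
  "is_mtuple n X \<longleftrightarrow> (\<forall>i. X i \<in> carrier_mat n n)"

text \<open>Free (noncommutative) polynomials in the variables 'd: finitely supported
 coefficient functions on words.\<close>
type_synonym 'd fpoly = "'d list \<Rightarrow> complex"

definition is_fpoly :: "'d fpoly \<Rightarrow> bool" where
  "is_fpoly p \<longleftrightarrow> finite {w. p w \<noteq> 0}"

definition word_eval :: "nat \<Rightarrow> 'd mtuple \<Rightarrow> 'd list \<Rightarrow> complex mat" where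
  "word_eval n X w = foldr (\<lambda>i M. X i * M) w (1\<^sub>m n)"

definition fp_eval :: "nat \<Rightarrow> 'd fpoly \<Rightarrow> 'd mtuple \<Rightarrow> complex mat" where
  "fp_eval n p X = mat n n (\<lambda>(r, c). \<Sum>w\<in>{w. p w \<noteq> 0}. p w * index_mat (word_eval n X w) (r, c))"

definition is_fpoly_matrix :: "nat \<Rightarrow> nat \<Rightarrow> (nat \<Rightarrow> nat \<Rightarrow> 'd fpoly) \<Rightarrow> bool" where
  "is_fpoly_matrix a b \<delta> \<longleftrightarrow> (\<forall>i<a. \<forall>j<b. is_fpoly (\<delta> i j))"

definition delta_eval :: "nat \<Rightarrow> nat \<Rightarrow> (nat \<Rightarrow> nat \<Rightarrow> 'd fpoly) \<Rightarrow> nat \<Rightarrow> 'd mtuple \<Rightarrow> complex mat" where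
  "delta_eval a b \<delta> n X = mat (a * n) (b * n)
     (\<lambda>(r, c). index_mat (fp_eval n (\<delta> (r div n) (c div n)) X) (r mod n, c mod n))"

definition vnorm :: "complex vec \<Rightarrow> real" where
  "vnorm v = sqrt (\<Sum>i<dim_vec v. (cmod (vec_index v i))\<^sup>2)"

definition opnorm :: "complex mat \<Rightarrow> real" where
  "opnorm A = Sup {vnorm (A *\<^sub>v v) | v. v \<in> carrier_vec (dim_col A) \<and> vnorm v \<le> 1}"

definition Gd :: "nat \<Rightarrow> nat \<Rightarrow> (nat \<Rightarrow> nat \<Rightarrow> 'd fpoly) \<Rightarrow> nat \<Rightarrow> 'd mtuple set" where
  "Gd a b \<delta> n = {X. is_mtuple n X \<and> opnorm (delta_eval a b \<delta> n X) < 1}"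

definition Gall :: "nat \<Rightarrow> nat \<Rightarrow> (nat \<Rightarrow> nat \<Rightarrow> 'd fpoly) \<Rightarrow> 'd mtuple set" where
  "Gall a b \<delta> = (\<Union>n\<in>{1..}. Gd a b \<delta> n)"

definition dsum_tuple :: "nat \<Rightarrow> nat \<Rightarrow> 'd mtuple \<Rightarrow> 'd mtuple \<Rightarrow> 'd mtuple" where
  "dsum_tuple n m X Y = (\<lambda>i. four_block_mat (X i) (0\<^sub>m n m) (0\<^sub>m m n) (Y i))"

text \<open>nc functions on G_delta (values outside G_delta are irrelevant).\<close>
definition is_nc_fun :: "nat \<Rightarrow> nat \<Rightarrow> (nat \<Rightarrow> nat \<Rightarrow> 'd fpoly) \<Rightarrow> ('d mtuple \<Rightarrow> complex mat) \<Rightarrow> bool" where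
  "is_nc_fun a b \<delta> \<phi> \<longleftrightarrow>
     (\<forall>n\<ge>1. \<forall>X\<in>Gd a b \<delta> n. \<phi> X \<in> carrier_mat n n) \<and>
     (\<forall>n\<ge>1. \<forall>m\<ge>1. \<forall>X\<in>Gd a b \<delta> n. \<forall>Y\<in>Gd a b \<delta> m.
        \<phi> (dsum_tuple n m X Y) = four_block_mat (\<phi> X) (0\<^sub>m n m) (0\<^sub>m m n) (\<phi> Y)) \<and>
     (\<forall>n\<ge>1. \<forall>X\<in>Gd a b \<delta> n. \<forall>s\<in>carrier_mat n n. \<forall>t\<in>carrier_mat n n.
        s * t = 1\<^sub>m n \<longrightarrow> t * s = 1\<^sub>m n \<longrightarrow> (\<lambda>i. t * X i * s) \<in> Gd a b \<delta> n \<longrightarrow>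
        \<phi> (\<lambda>i. t * X i * s) = t * \<phi> X * s)"

definition Hinf :: "nat \<Rightarrow> nat \<Rightarrow> (nat \<Rightarrow> nat \<Rightarrow> 'd fpoly) \<Rightarrow> ('d mtuple \<Rightarrow> complex mat) set" where
  "Hinf a b \<delta> = {\<phi>. is_nc_fun a b \<delta> \<phi> \<and> (\<exists>C. \<forall>X\<in>Gall a b \<delta>. opnorm (\<phi> X) \<le> C)}"

definition Hinf_norm :: "nat \<Rightarrow> nat \<Rightarrow> (nat \<Rightarrow> nat \<Rightarrow> 'd fpoly) \<Rightarrow> ('d mtuple \<Rightarrow> complex mat) \<Rightarrow> real" where
  "Hinf_norm a b \<delta> \<phi> = Sup (insert 0 {opnorm (\<phi> X) | X. X \<in> Gall a b \<delta>})"

definition nc_add :: "('d mtuple \<Rightarrow> complex mat) \<Rightarrow> ('d mtuple \<Rightarrow> complex mat) \<Rightarrow> ('d mtuple \<Rightarrow> complex mat)" where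
  "nc_add \<phi> \<psi> = (\<lambda>X. \<phi> X + \<psi> X)"
definition nc_mult :: "('d mtuple \<Rightarrow> complex mat) \<Rightarrow> ('d mtuple \<Rightarrow> complex mat) \<Rightarrow> ('d mtuple \<Rightarrow> complex mat)" where
  "nc_mult \<phi> \<psi> = (\<lambda>X. \<phi> X * \<psi> X)"
definition nc_smult :: "complex \<Rightarrow> ('d mtuple \<Rightarrow> complex mat) \<Rightarrow> ('d mtuple \<Rightarrow> complex mat)" where
  "nc_smult c \<phi> = (\<lambda>X. c \<cdot>\<^sub>m \<phi> X)"
definition nc_one :: "'d mtuple \<Rightarrow> complex mat" where
  "nc_one = (\<lambda>X. 1\<^sub>m (dim_row (X (SOME i. True))))"

definition scal :: "complex ^ 'd \<Rightarrow> 'd mtuple" where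
  "scal z = (\<lambda>i. mat 1 1 (\<lambda>_. vec_nth z i))"

definition Iideal :: "nat \<Rightarrow> nat \<Rightarrow> (nat \<Rightarrow> nat \<Rightarrow> 'd fpoly) \<Rightarrow> ('d mtuple \<Rightarrow> complex mat) set" where
  "Iideal a b \<delta> = {\<phi>\<in>Hinf a b \<delta>. \<forall>X\<in>Gd a b \<delta> 1. \<phi> X = 0\<^sub>m 1 1}"

definition coset :: "nat \<Rightarrow> nat \<Rightarrow> (nat \<Rightarrow> nat \<Rightarrow> 'd fpoly) \<Rightarrow> ('d mtuple \<Rightarrow> complex mat) \<Rightarrow> ('d mtuple \<Rightarrow> complex mat) set" where
  "coset a b \<delta> \<phi> = {\<psi>\<in>Hinf a b \<delta>. \<exists>\<eta>\<in>Iideal a b \<delta>. \<forall>X\<in>Gall a b \<delta>. \<psi> X = \<phi> X + \<eta> X}"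

definition quotient_space :: "nat \<Rightarrow> nat \<Rightarrow> (nat \<Rightarrow> nat \<Rightarrow> 'd fpoly) \<Rightarrow> ('d mtuple \<Rightarrow> complex mat) set set" where
  "quotient_space a b \<delta> = coset a b \<delta> ` Hinf a b \<delta>"

definition quotient_norm :: "nat \<Rightarrow> nat \<Rightarrow> (nat \<Rightarrow> nat \<Rightarrow> 'd fpoly) \<Rightarrow> ('d mtuple \<Rightarrow> complex mat) set \<Rightarrow> real" where
  "quotient_norm a b \<delta> A = Inf (Hinf_norm a b \<delta> ` A)"

definition Ucom :: "nat \<Rightarrow> nat \<Rightarrow> (nat \<Rightarrow> nat \<Rightarrow> 'd fpoly) \<Rightarrow> (complex ^ 'd) set" where
  "Ucom a b \<delta> = {z. scal z \<in> Gd a b \<delta> 1}"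

definition holo_on :: "(complex ^ 'd \<Rightarrow> complex) \<Rightarrow> (complex ^ 'd) set \<Rightarrow> bool" where
  "holo_on f U \<longleftrightarrow> (\<forall>z\<in>U. \<exists>L. (f has_derivative L) (at z) \<and>
       (\<forall>c w. L (\<chi> i. c * vec_nth w i) = c * L w))"

definition fp_scalar :: "'d fpoly \<Rightarrow> complex ^ 'd \<Rightarrow> complex" where
  "fp_scalar p z = index_mat (fp_eval 1 p (scal z)) (0, 0)"

definition commuting :: "'d mtuple \<Rightarrow> bool" where
  "commuting T \<longleftrightarrow> (\<forall>i j. T i * T j = T j * T i)"

text \<open>Joint spectrum of a commuting tuple of matrices (= Taylor spectrum).\<close>
definition jspec :: "nat \<Rightarrow> 'd mtuple \<Rightarrow> (complex ^ 'd) set" where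
  "jspec n T = {mu. \<exists>v\<in>carrier_vec n. v \<noteq> 0\<^sub>v n \<and> (\<forall>i. T i *\<^sub>v v = vec_nth mu i \<cdot>\<^sub>v v)}"

text \<open>Holomorphic functional calculus for a commuting n-tuple of n x n matrices:
 f(T) = p(T) for any polynomial p with f - p vanishing to order n at every point
 of the joint spectrum.\<close>
definition fcalc :: "nat \<Rightarrow> (complex ^ 'd \<Rightarrow> complex) \<Rightarrow> 'd mtuple \<Rightarrow> complex mat" where
  "fcalc n f T = fp_eval n (SOME p. is_fpoly p \<and> (\<forall>mu\<in>jspec n T. \<exists>C e. e > 0 \<and>
      (\<forall>z. norm (z - mu) < e \<longrightarrow> cmod (f z - fp_scalar p z) \<le> C * norm (z - mu) ^ n))) T"

definition com_norm :: "nat \<Rightarrow> nat \<Rightarrow> (nat \<Rightarrow> nat \<Rightarrow> 'd fpoly) \<Rightarrow> (complex ^ 'd \<Rightarrow> complex) \<Rightarrow> ereal" where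
  "com_norm a b \<delta> f = Sup (insert 0 {ereal (opnorm (fcalc n f T)) | n T. n \<ge> 1 \<and> is_mtuple n T \<and> commuting T \<and>
      opnorm (delta_eval a b \<delta> n T) \<le> 1 \<and> jspec n T \<subseteq> Ucom a b \<delta>})"

text \<open>H^infty_{delta,com}: functions holomorphic on G_delta cap C^d with finite
 com-norm; as a set of HOL functions we take them extensional (0 off the domain).\<close>
definition Hcom :: "nat \<Rightarrow> nat \<Rightarrow> (nat \<Rightarrow> nat \<Rightarrow> 'd fpoly) \<Rightarrow> (complex ^ 'd \<Rightarrow> complex) set" where
  "Hcom a b \<delta> = {f. holo_on f (Ucom a b \<delta>) \<and> (\<forall>z. z \<notin> Ucom a b \<delta> \<longrightarrow> f z = 0) \<and>
       com_norm a b \<delta> f < \<infinity>}"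

definition com_one :: "nat \<Rightarrow> nat \<Rightarrow> (nat \<Rightarrow> nat \<Rightarrow> 'd fpoly) \<Rightarrow> complex ^ 'd \<Rightarrow> complex" where
  "com_one a b \<delta> = (\<lambda>z. if z \<in> Ucom a b \<delta> then 1 else 0)"

end

theory Submission
  imports Defs "HOL-Complex_Analysis.Complex_Analysis" "Jordan_Normal_Form.Spectral_Radius"
    "HOL-Library.Function_Algebras"
begin

text \<open>The isomorphism is induced by restriction to scalar points.

  Restriction does not increase the norm: a commuting tuple T with joint spectrum in the scalar part
  of the domain is intertwined with tuples \<mu> + t M, M a truncated shift, that lie in the domain.
  Adding small multiples of the forms pulled back along these intertwiners to the standard inner
  product turns T into a tuple similar to T in the domain, at which the nc function takes the value
  of the functional calculus. The value at \<mu> + t M is found by approximating M by tuples with distinct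
  joint eigenvalues on a grid.

  Conversely, let f have com-norm at most c. On finitely many points the commuting tuples that are
  diagonalizable with these points as joint eigenvalues show, by separation of convex cones, that
  1 - f(z) cnj (f(w)) / c^2 is a sum of Agler kernels. The lurking isometry argument yields a transfer
  function realization of a nc function of norm at most c interpolating f at these points, and
  compactness (Tychonoff) gives one interpolating f everywhere. Hence f has liftings of norm
  arbitrarily close to, in fact equal to, its com-norm.\<close>

section \<open>Operator norms\<close>

text \<open>At a commuting tuple T of the com-norm \<open>\<delta>\<close> is only a contraction, so
  T need not lie in the domain, and shrinking T does not help because \<open>\<delta>\<close> is not
  homogeneous. The freedom used instead is the inner product: the contraction condition is linear in
  the form, so adding a form for which it holds strictly makes it strict. Strict forms exist because
  for small t the tuple \<mu> + t M is close to the scalar tuple \<mu>, where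
  \<open>\<delta>\<close> has norm below 1. Jets of order n suffice, since in dimension n joint
  generalized eigenspaces have nilpotency order at most n. In the converse direction the strict
  inequality at finitely many points bounds the coefficients of a kernel in the cone by its
  diagonal, so that a nearest point exists. An additional column on which \<open>\<delta>\<close> is
  replaced by 0 puts all positive semidefinite kernels into the cone and forces the separating form
  to be positive definite. The bound c on the interpolating nc function is the same for every number
  of points, as the compactness argument demands.\<close>

definition nrm2 :: "nat \<Rightarrow> (nat \<Rightarrow> complex) \<Rightarrow> real" where
  "nrm2 n x = (\<Sum>k<n. (cmod (x k))\<^sup>2)"

text \<open>Vectors are functions on all naturals of which only the first \<open>dim_col A\<close>
  entries are read. This spares carrier conditions when blocks, slices or sums of vectors are
  formed.\<close>

definition app :: "complex mat \<Rightarrow> (nat \<Rightarrow> complex) \<Rightarrow> nat \<Rightarrow> complex" where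
  "app A x = (\<lambda>r. \<Sum>k<dim_col A. A $$ (r, k) * x k)"

text \<open>The quantified form of a norm bound; the supremum behind \<open>opnorm\<close> is met
  only where the two are compared. The clause \<open>0 \<le> c\<close> is there because the
  inequality contains only the square of c.\<close>

definition bdd_by :: "real \<Rightarrow> complex mat \<Rightarrow> bool" where
  "bdd_by c A \<longleftrightarrow> 0 \<le> c \<and> (\<forall>x. nrm2 (dim_row A) (app A x) \<le> c\<^sup>2 * nrm2 (dim_col A) x)"

lemma nrm2_nonneg [simp]: "0 \<le> nrm2 n x"
  by (simp add: nrm2_def sum_nonneg)

lemma nrm2_cong: "(\<And>k. k < n \<Longrightarrow> x k = y k) \<Longrightarrow> nrm2 n x = nrm2 n y"
  by (simp add: nrm2_def)

lemma nrm2_scale: "nrm2 n (\<lambda>k. c * x k) = (cmod c)\<^sup>2 * nrm2 n x"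
  by (simp add: nrm2_def norm_mult power_mult_distrib sum_distrib_left)

lemma sqrt_nrm2: "sqrt (nrm2 n x) = L2_set (\<lambda>k. cmod (x k)) {..<n}"
  by (simp add: nrm2_def L2_set_def)

lemma nrm2_triangle: "sqrt (nrm2 n (\<lambda>k. x k + y k)) \<le> sqrt (nrm2 n x) + sqrt (nrm2 n y)"
proof -
  have "L2_set (\<lambda>k. cmod (x k + y k)) {..<n} \<le> L2_set (\<lambda>k. cmod (x k) + cmod (y k)) {..<n}"
    by (intro L2_set_mono norm_triangle_ineq) auto
  also have "\<dots> \<le> L2_set (\<lambda>k. cmod (x k)) {..<n} + L2_set (\<lambda>k. cmod (y k)) {..<n}"
    by (rule L2_set_triangle_ineq)
  finally show ?thesis by (simp add: sqrt_nrm2)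
qed

lemma nrm2_eq_0_iff: "nrm2 n x = 0 \<longleftrightarrow> (\<forall>k<n. x k = 0)"
  by (auto simp: nrm2_def sum_nonneg_eq_0_iff)

lemma nrm2_component: "k < n \<Longrightarrow> (cmod (x k))\<^sup>2 \<le> nrm2 n x"
  unfolding nrm2_def by (rule member_le_sum) auto

lemma cauchy_schwarz: "(cmod (\<Sum>k<n. x k * y k))\<^sup>2 \<le> nrm2 n x * nrm2 n y"
proof -
  have "cmod (\<Sum>k<n. x k * y k) \<le> (\<Sum>k<n. \<bar>cmod (x k)\<bar> * \<bar>cmod (y k)\<bar>)"
    using norm_sum[of "\<lambda>k. x k * y k" "{..<n}"] by (simp add: norm_mult)
  also have "\<dots> \<le> L2_set (\<lambda>k. cmod (x k)) {..<n} * L2_set (\<lambda>k. cmod (y k)) {..<n}"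
    by (rule L2_set_mult_ineq)
  finally have "(cmod (\<Sum>k<n. x k * y k))\<^sup>2 \<le> (sqrt (nrm2 n x) * sqrt (nrm2 n y))\<^sup>2"
    by (intro power_mono) (auto simp: sqrt_nrm2)
  then show ?thesis by (simp add: power_mult_distrib)
qed

lemma app_cong: "(\<And>k. k < dim_col A \<Longrightarrow> x k = y k) \<Longrightarrow> app A x = app A y"
  by (simp add: app_def)

lemma app_mult:
  assumes "dim_col A = dim_row B" "r < dim_row A"
  shows "app (A * B) x r = app A (app B x) r"
proof -
  have "app (A * B) x r = (\<Sum>k<dim_col B. (\<Sum>l<dim_row B. A $$ (r,l) * B $$ (l,k)) * x k)"
    using assms by (simp add: app_def times_mat_def scalar_prod_def atLeast0LessThan)
  also have "\<dots> = (\<Sum>l<dim_row B. A $$ (r,l) * (\<Sum>k<dim_col B. B $$ (l,k) * x k))"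
    by (simp add: sum_distrib_left sum_distrib_right mult.assoc) (rule sum.swap)
  finally show ?thesis using assms by (simp add: app_def)
qed

lemma app_add:
  assumes "dim_row A = dim_row B" "dim_col A = dim_col B" "r < dim_row A"
  shows "app (A + B) x r = app A x r + app B x r"
  using assms by (simp add: app_def sum.distrib distrib_right)

lemma app_one: "r < n \<Longrightarrow> app (1\<^sub>m n) x r = x r"
  by (simp add: app_def if_distrib[of "\<lambda>u. u * _"] cong: if_cong)

lemma app_smult: "r < dim_row A \<Longrightarrow> app (c \<cdot>\<^sub>m A) x r = c * app A x r"
  by (simp add: app_def sum_distrib_left mult.assoc)

lemma app_lin: "app A (\<lambda>k. x k + y k) r = app A x r + app A y r"
  by (simp add: app_def sum.distrib algebra_simps)

lemma app_scale: "app A (\<lambda>k. c * x k) r = c * app A x r"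
  by (simp add: app_def sum_distrib_left algebra_simps)

lemma app_unit: "j < dim_col A \<Longrightarrow> app A (\<lambda>k. if k = j then 1 else 0) r = A $$ (r, j)"
  by (simp add: app_def if_distrib cong: if_cong)

lemma nrm2_unit: "j < n \<Longrightarrow> nrm2 n (\<lambda>k. if k = j then 1 else 0) = 1"
  by (simp add: nrm2_def if_distrib[of cmod] if_distrib[of "\<lambda>u. u^2"] cong: if_cong)

lemma mat_eq_app:
  assumes "A \<in> carrier_mat m n" "B \<in> carrier_mat m n" "\<And>x r. r < m \<Longrightarrow> app A x r = app B x r"
  shows "A = B"
proof (rule eq_matI)
  fix i j assume "i < dim_row B" "j < dim_col B"
  then show "A $$ (i,j) = B $$ (i,j)"
    using assms(3)[of i "\<lambda>k. if k = j then 1 else 0"] assms(1,2) by (simp add: app_unit)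
qed (use assms in auto)

text \<open>Cauchy-Schwarz in every row. The resulting Frobenius norm is a crude bound, but it is
  continuous in the entries and shows that the set below \<open>opnorm\<close> is bounded.\<close>

lemma app_bound: "nrm2 m (app A x) \<le> (\<Sum>r<m. nrm2 (dim_col A) (\<lambda>k. A $$ (r,k))) * nrm2 (dim_col A) x"
  unfolding sum_distrib_right nrm2_def[of m] app_def
  by (intro sum_mono cauchy_schwarz)

lemma bdd_by_Frobenius: "bdd_by (sqrt (\<Sum>r<dim_row A. nrm2 (dim_col A) (\<lambda>k. A $$ (r,k)))) A"
  using app_bound[of "dim_row A" A] by (simp add: bdd_by_def sum_nonneg)

lemma bdd_by_nonneg: "bdd_by c A \<Longrightarrow> 0 \<le> c"
  by (simp add: bdd_by_def)

lemma bdd_byD: "bdd_by c A \<Longrightarrow> nrm2 (dim_row A) (app A x) \<le> c\<^sup>2 * nrm2 (dim_col A) x"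
  by (simp add: bdd_by_def)

lemma bdd_byD': "bdd_by c A \<Longrightarrow> sqrt (nrm2 (dim_row A) (app A x)) \<le> c * sqrt (nrm2 (dim_col A) x)"
  using bdd_byD[of c A x] real_sqrt_le_mono[of "nrm2 (dim_row A) (app A x)" "c\<^sup>2 * nrm2 (dim_col A) x"]
  by (simp add: real_sqrt_mult bdd_by_def)

lemma bdd_byI':
  assumes "0 \<le> c" "\<And>x. sqrt (nrm2 (dim_row A) (app A x)) \<le> c * sqrt (nrm2 (dim_col A) x)"
  shows "bdd_by c A"
  unfolding bdd_by_def
proof (intro conjI allI assms(1))
  fix x
  have "(sqrt (nrm2 (dim_row A) (app A x)))\<^sup>2 \<le> (c * sqrt (nrm2 (dim_col A) x))\<^sup>2"
    by (intro power_mono assms) auto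
  then show "nrm2 (dim_row A) (app A x) \<le> c\<^sup>2 * nrm2 (dim_col A) x" by (simp add: power_mult_distrib)
qed

lemma bdd_by_mono: "bdd_by c A \<Longrightarrow> c \<le> d \<Longrightarrow> bdd_by d A"
  unfolding bdd_by_def by (meson mult_right_mono nrm2_nonneg order_trans power_mono)

lemma bdd_by_mult:
  assumes "bdd_by c A" "bdd_by d B" "dim_col A = dim_row B"
  shows "bdd_by (c * d) (A * B)"
proof (rule bdd_byI')
  show "0 \<le> c * d" using assms by (simp add: bdd_by_def)
  fix x
  have "sqrt (nrm2 (dim_row A) (app A (app B x))) \<le> c * sqrt (nrm2 (dim_row B) (app B x))"
    using bdd_byD'[OF assms(1)] assms(3) by simp
  also have "\<dots> \<le> c * (d * sqrt (nrm2 (dim_col B) x))"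
    by (intro mult_left_mono bdd_byD' assms) (use assms in \<open>auto simp: bdd_by_def\<close>)
  finally show "sqrt (nrm2 (dim_row (A * B)) (app (A * B) x)) \<le> c * d * sqrt (nrm2 (dim_col (A * B)) x)"
    using assms(3) nrm2_cong[of "dim_row A" "app (A*B) x" "app A (app B x)"] by (simp add: app_mult)
qed

lemma bdd_by_add:
  assumes "bdd_by c A" "bdd_by d B" "dim_row A = dim_row B" "dim_col A = dim_col B"
  shows "bdd_by (c + d) (A + B)"
proof (rule bdd_byI')
  show "0 \<le> c + d" using assms by (simp add: bdd_by_def)
  fix x
  have "nrm2 (dim_row A) (app (A+B) x) = nrm2 (dim_row A) (\<lambda>k. app A x k + app B x k)"
    using assms by (intro nrm2_cong app_add) auto
  then show "sqrt (nrm2 (dim_row (A + B)) (app (A + B) x)) \<le> (c + d) * sqrt (nrm2 (dim_col (A + B)) x)"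
    using nrm2_triangle[of "dim_row A" "app A x" "app B x"] bdd_byD'[OF assms(1), of x] bdd_byD'[OF assms(2), of x] assms(3,4)
    by (simp add: algebra_simps)
qed

lemma bdd_by_smult: "bdd_by c A \<Longrightarrow> bdd_by (cmod k * c) (k \<cdot>\<^sub>m A)"
proof -
  assume a: "bdd_by c A"
  have "nrm2 (dim_row A) (app (k \<cdot>\<^sub>m A) x) = (cmod k)\<^sup>2 * nrm2 (dim_row A) (app A x)" for x
    using nrm2_cong[of "dim_row A" "app (k \<cdot>\<^sub>m A) x" "\<lambda>r. k * app A x r"] by (simp add: app_smult nrm2_scale)
  with a show ?thesis
    unfolding bdd_by_def by (auto simp add: power_mult_distrib mult.assoc intro!: mult_left_mono)
qed

lemma bdd_by_one: "bdd_by 1 (1\<^sub>m n)"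
  using nrm2_cong[of n "app (1\<^sub>m n) x" x for x] by (simp add: bdd_by_def app_one)

lemma bdd_by_entry:
  assumes "bdd_by c A" "i < dim_row A" "j < dim_col A"
  shows "cmod (A $$ (i,j)) \<le> c"
proof -
  have "(cmod (A $$ (i,j)))\<^sup>2 \<le> nrm2 (dim_row A) (app A (\<lambda>k. if k = j then 1 else 0))"
    using nrm2_component[OF assms(2), of "app A (\<lambda>k. if k = j then 1 else 0)"] assms by (simp add: app_unit)
  also have "\<dots> \<le> c\<^sup>2"
    using bdd_byD[OF assms(1), of "\<lambda>k. if k = j then 1 else 0"] assms(3) by (simp add: nrm2_unit)
  finally show ?thesis using assms(1) by (simp add: bdd_by_def abs_le_square_iff[symmetric])
qed

section \<open>Comparison with the supremum \<open>opnorm\<close>\<close>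

lemma vnorm_nrm2: "vnorm v = sqrt (nrm2 (dim_vec v) (vec_index v))"
  by (simp add: vnorm_def nrm2_def)

lemma vnorm_mult_vec:
  assumes "dim_vec v = dim_col A"
  shows "vnorm (A *\<^sub>v v) = sqrt (nrm2 (dim_row A) (app A (vec_index v)))"
proof -
  have "nrm2 (dim_row A) (vec_index (A *\<^sub>v v)) = nrm2 (dim_row A) (app A (vec_index v))"
    using assms by (intro nrm2_cong) (simp add: app_def scalar_prod_def atLeast0LessThan)
  then show ?thesis by (simp add: vnorm_nrm2)
qed

lemma opnorm_le:
  assumes "bdd_by c A" shows "opnorm A \<le> c"
  unfolding opnorm_def
proof (rule cSup_least)
  show "{vnorm (A *\<^sub>v v) |v. v \<in> carrier_vec (dim_col A) \<and> vnorm v \<le> 1} \<noteq> {}"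
    by (auto intro!: exI[of _ "0\<^sub>v (dim_col A)"] simp: vnorm_def)
  fix y assume "y \<in> {vnorm (A *\<^sub>v v) |v. v \<in> carrier_vec (dim_col A) \<and> vnorm v \<le> 1}"
  then obtain v where v: "v \<in> carrier_vec (dim_col A)" "vnorm v \<le> 1" "y = vnorm (A *\<^sub>v v)" by blast
  have "y \<le> c * vnorm v"
    using bdd_byD'[OF assms, of "vec_index v"] v vnorm_mult_vec[of v A] by (simp add: vnorm_nrm2[of v])
  also have "\<dots> \<le> c * 1" using v assms by (intro mult_left_mono) (auto simp: bdd_by_def)
  finally show "y \<le> c" by simp
qed

lemma opnorm_upper:
  assumes "nrm2 (dim_col A) x \<le> 1" shows "sqrt (nrm2 (dim_row A) (app A x)) \<le> opnorm A"
proof -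
  let ?v = "vec (dim_col A) x"
  have "vnorm (A *\<^sub>v ?v) = sqrt (nrm2 (dim_row A) (app A x))"
    using app_cong[of A "vec_index ?v" x] by (simp add: vnorm_mult_vec)
  moreover have "vnorm ?v \<le> 1"
    using assms nrm2_cong[of "dim_col A" "vec_index ?v" x] by (simp add: vnorm_nrm2)
  moreover have "bdd_above {vnorm (A *\<^sub>v v) |v. v \<in> carrier_vec (dim_col A) \<and> vnorm v \<le> 1}"
  proof (rule bdd_aboveI)
    fix y assume "y \<in> {vnorm (A *\<^sub>v v) |v. v \<in> carrier_vec (dim_col A) \<and> vnorm v \<le> 1}"
    then obtain v where v: "v \<in> carrier_vec (dim_col A)" "vnorm v \<le> 1" "y = vnorm (A *\<^sub>v v)" by blast
    let ?c = "sqrt (\<Sum>r<dim_row A. nrm2 (dim_col A) (\<lambda>k. A $$ (r,k)))"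
    have "y \<le> ?c * vnorm v"
      using bdd_byD'[OF bdd_by_Frobenius, of A "vec_index v"] v vnorm_mult_vec[of v A] by (simp add: vnorm_nrm2[of v])
    also have "\<dots> \<le> ?c * 1" using v by (intro mult_left_mono) (auto simp: sum_nonneg)
    finally show "y \<le> ?c" by simp
  qed
  ultimately show ?thesis
    unfolding opnorm_def by (intro cSup_upper) (auto intro!: exI[of _ ?v])
qed

lemma opnorm_nonneg: "0 \<le> opnorm A"
  using opnorm_upper[of A "\<lambda>_. 0"] by (simp add: nrm2_def app_def)

lemma bdd_by_opnorm: "bdd_by (opnorm A) A"
proof (rule bdd_byI'[OF opnorm_nonneg])
  fix x
  show "sqrt (nrm2 (dim_row A) (app A x)) \<le> opnorm A * sqrt (nrm2 (dim_col A) x)"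
  proof (cases "nrm2 (dim_col A) x = 0")
    case True
    then have "app A x = (\<lambda>_. 0)" by (auto simp: nrm2_eq_0_iff app_def)
    then show ?thesis using True by (simp add: nrm2_def)
  next
    case False
    define s where "s = sqrt (nrm2 (dim_col A) x)"
    have s: "s > 0" "s\<^sup>2 = nrm2 (dim_col A) x" using False by (auto simp: s_def less_le)
    have "sqrt (nrm2 (dim_row A) (app A (\<lambda>k. complex_of_real (inverse s) * x k))) \<le> opnorm A"
      using s False by (intro opnorm_upper) (simp only: nrm2_scale, simp add: norm_inverse power_inverse)
    moreover have "app A (\<lambda>k. complex_of_real (inverse s) * x k) = (\<lambda>r. complex_of_real (inverse s) * app A x r)"
      by (intro ext app_scale)
    ultimately have "inverse s * sqrt (nrm2 (dim_row A) (app A x)) \<le> opnorm A"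
      using s(1) by (simp only: nrm2_scale real_sqrt_mult) (simp add: norm_inverse)
    then show ?thesis using s(1) by (simp add: field_simps s_def)
  qed
qed

lemma opnorm_le_iff: "0 \<le> c \<Longrightarrow> opnorm A \<le> c \<longleftrightarrow> bdd_by c A"
  using bdd_by_mono[OF bdd_by_opnorm] opnorm_le by blast

text \<open>The norm itself serves as r. In this form membership in the domain supplies a number r <
  1 with which one can compute.\<close>

lemma opnorm_less_iff: "opnorm A < c \<longleftrightarrow> (\<exists>r<c. bdd_by r A)"
  using bdd_by_opnorm[of A] opnorm_le order_le_less_trans by blast

lemma opnorm_mult: "dim_col A = dim_row B \<Longrightarrow> opnorm (A * B) \<le> opnorm A * opnorm B"
  by (intro opnorm_le bdd_by_mult bdd_by_opnorm)

lemma opnorm_add: "dim_row A = dim_row B \<Longrightarrow> dim_col A = dim_col B \<Longrightarrow> opnorm (A + B) \<le> opnorm A + opnorm B"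
  by (intro opnorm_le bdd_by_add bdd_by_opnorm)

lemma opnorm_smult: "opnorm (k \<cdot>\<^sub>m A) \<le> cmod k * opnorm A"
  by (intro opnorm_le bdd_by_smult bdd_by_opnorm)

section \<open>Kronecker products and intertwining tuples\<close>

lemma sum_lessThan_add: "(\<Sum>k<m + n. g k) = (\<Sum>k<m. g k) + (\<Sum>j<n. g (m + j))" for m n :: nat
  by (induction n) (simp_all add: add.assoc)

text \<open>Block vectors are flattened as k = i * n + j, with block number \<open>k div n\<close>
  and position \<open>k mod n\<close>; this is the layout of \<open>delta_eval\<close> and of
  \<open>kron\<close>.\<close>

lemma sum_div_mod: "(\<Sum>k<b * n. f (k div n) (k mod n)) = (\<Sum>i<b. \<Sum>j<n. f i j)" for b n :: nat
proof (induction b)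
  case (Suc b)
  have "(\<Sum>j<n. f ((b * n + j) div n) ((b * n + j) mod n)) = (\<Sum>j<n. f b j)"
    by (intro sum.cong) auto
  moreover have "Suc b * n = b * n + n" by simp
  ultimately show ?case using Suc by (simp only: sum_lessThan_add sum.lessThan_Suc)
qed simp

lemma sum_pick:
  fixes g :: "nat \<Rightarrow> 'j \<Rightarrow> complex"
  shows "q < a \<Longrightarrow> (\<Sum>i<a. \<Sum>j\<in>J. (if q = i then 1 else 0) * g i j) = (\<Sum>j\<in>J. g q j)"
    and "q < a \<Longrightarrow> (\<Sum>i<a. \<Sum>j\<in>J. (if i = q then 1 else 0) * g i j) = (\<Sum>j\<in>J. g q j)"
  unfolding sum_distrib_left[symmetric] by (simp_all add: if_distrib[of "\<lambda>u. u * _"] cong: if_cong)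

lemma nrm2_block: "nrm2 (b * n) x = (\<Sum>i<b. nrm2 n (\<lambda>s. x (i * n + s)))"
proof -
  have "nrm2 (b * n) x = (\<Sum>k<b * n. (cmod (x ((k div n) * n + k mod n)))\<^sup>2)" by (simp add: nrm2_def)
  then show ?thesis using sum_div_mod[of "\<lambda>i j. (cmod (x (i * n + j)))\<^sup>2" n b] by (simp add: nrm2_def)
qed

text \<open>Besides the cut into blocks, a flattened vector can be cut into slices of equal
  position. A factor \<open>kron V (1\<^sub>m n)\<close> acts on each slice separately, a factor
  \<open>kron (1\<^sub>m k) M\<close> on each block.\<close>

lemma nrm2_slice: "nrm2 (b * n) x = (\<Sum>s<n. nrm2 b (\<lambda>i. x (i * n + s)))"
  unfolding nrm2_block unfolding nrm2_def by (rule sum.swap)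

definition kron :: "complex mat \<Rightarrow> complex mat \<Rightarrow> complex mat" where
  "kron A B = mat (dim_row A * dim_row B) (dim_col A * dim_col B)
     (\<lambda>(r, c). A $$ (r div dim_row B, c div dim_col B) * B $$ (r mod dim_row B, c mod dim_col B))"

lemma kron_dim [simp]: "dim_row (kron A B) = dim_row A * dim_row B" "dim_col (kron A B) = dim_col A * dim_col B"
  by (simp_all add: kron_def)

lemma div_mod_less: "r < p * s \<Longrightarrow> r div s < p \<and> r mod s < s" for r p s :: nat
  by (metis less_mult_imp_div_less mod_less_divisor mult_0_right not_gr_zero not_less_zero)

lemma kron_index: "r < dim_row A * dim_row B \<Longrightarrow> c < dim_col A * dim_col B \<Longrightarrow>
   kron A B $$ (r, c) = A $$ (r div dim_row B, c div dim_col B) * B $$ (r mod dim_row B, c mod dim_col B)"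
  by (simp add: kron_def)

lemma app_kron:
  assumes "r < dim_row A * dim_row B"
  shows "app (kron A B) x r =
    (\<Sum>i<dim_col A. A $$ (r div dim_row B, i) * app B (\<lambda>s. x (i * dim_col B + s)) (r mod dim_row B))"
proof -
  have "app (kron A B) x r = (\<Sum>k<dim_col A * dim_col B. A $$ (r div dim_row B, k div dim_col B) *
      (B $$ (r mod dim_row B, k mod dim_col B) * x (k div dim_col B * dim_col B + k mod dim_col B)))"
    unfolding app_def kron_dim by (intro sum.cong refl) (use assms in \<open>simp add: kron_index mult.assoc\<close>)
  also have "\<dots> = (\<Sum>i<dim_col A. \<Sum>s<dim_col B. A $$ (r div dim_row B, i) * (B $$ (r mod dim_row B, s) * x (i * dim_col B + s)))"
    by (rule sum_div_mod)
  finally show ?thesis by (simp add: app_def sum_distrib_left)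
qed

lemma mat_mult_index: "i < dim_row A \<Longrightarrow> j < dim_col B \<Longrightarrow> dim_col A = dim_row B \<Longrightarrow>
   (A * B) $$ (i, j) = (\<Sum>k<dim_row B. A $$ (i,k) * B $$ (k,j))" for A :: "complex mat"
  by (simp add: scalar_prod_def atLeast0LessThan)

lemma kron_mult:
  assumes "dim_col A = dim_row C" "dim_col B = dim_row D"
  shows "kron A B * kron C D = kron (A * C) (B * D)"
proof (rule eq_matI)
  fix r c assume rc: "r < dim_row (kron (A * C) (B * D))" "c < dim_col (kron (A * C) (B * D))"
  then have r: "r < dim_row A * dim_row B" and c: "c < dim_col C * dim_col D" by auto
  note r' = div_mod_less[OF r] and c' = div_mod_less[OF c]
  have "(kron A B * kron C D) $$ (r, c) = (\<Sum>k<dim_row C * dim_row D. kron A B $$ (r, k) * kron C D $$ (k, c))"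
    using r c assms by (subst mat_mult_index) auto
  also have "\<dots> = (\<Sum>k<dim_row C * dim_row D. (A $$ (r div dim_row B, k div dim_row D) * C $$ (k div dim_row D, c div dim_col D)) *
       (B $$ (r mod dim_row B, k mod dim_row D) * D $$ (k mod dim_row D, c mod dim_col D)))"
    using r c assms by (intro sum.cong refl) (simp add: kron_index)
  also have "\<dots> = (\<Sum>i<dim_row C. \<Sum>j<dim_row D. (A $$ (r div dim_row B, i) * C $$ (i, c div dim_col D)) *
       (B $$ (r mod dim_row B, j) * D $$ (j, c mod dim_col D)))"
    by (rule sum_div_mod)
  also have "\<dots> = (A * C) $$ (r div dim_row B, c div dim_col D) * (B * D) $$ (r mod dim_row B, c mod dim_col D)"
    using r' c' assms by (simp only: mat_mult_index sum_product)
  finally show "(kron A B * kron C D) $$ (r, c) = kron (A * C) (B * D) $$ (r, c)"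
    using r c by (simp add: kron_index del: index_mult_mat(1))
qed auto

lemma kron_one: "kron (1\<^sub>m k) (1\<^sub>m n) = 1\<^sub>m (k * n)"
proof (rule eq_matI)
  fix i j assume ij: "i < dim_row (1\<^sub>m (k * n) :: complex mat)" "j < dim_col (1\<^sub>m (k * n) :: complex mat)"
  then have b: "i div n < k" "j div n < k" "i mod n < n" "j mod n < n" using div_mod_less by auto
  have "i = j \<longleftrightarrow> i div n = j div n \<and> i mod n = j mod n"
    by (metis div_mult_mod_eq)
  then show "kron (1\<^sub>m k) (1\<^sub>m n) $$ (i, j) = 1\<^sub>m (k * n) $$ (i, j)"
    using ij b by (auto simp: kron_index)
qed auto

lemma app_kron_one_right:
  assumes "p < dim_row V" "s < n"
  shows "app (kron V (1\<^sub>m n)) x (p * n + s) = app V (\<lambda>i. x (i * n + s)) p"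
proof -
  have "p * n + s < dim_row V * n"
    using assms by (metis add.commute add_less_mono1 less_le_trans mult_Suc Suc_leI mult_le_mono1)
  then show ?thesis using assms by (simp add: app_kron app_one) (simp add: app_def)
qed

lemma bdd_by_kron_one_right:
  assumes "bdd_by c V" shows "bdd_by c (kron V (1\<^sub>m n))"
  unfolding bdd_by_def
proof (intro conjI allI)
  show "0 \<le> c" using assms by (rule bdd_by_nonneg)
  fix x
  have "nrm2 (dim_row (kron V (1\<^sub>m n))) (app (kron V (1\<^sub>m n)) x) = (\<Sum>s<n. nrm2 (dim_row V) (app V (\<lambda>i. x (i * n + s))))"
    unfolding kron_dim nrm2_slice index_one_mat by (intro sum.cong refl nrm2_cong) (auto simp: app_kron_one_right)
  also have "\<dots> \<le> (\<Sum>s<n. c\<^sup>2 * nrm2 (dim_col V) (\<lambda>i. x (i * n + s)))"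
    by (intro sum_mono bdd_byD assms)
  finally show "nrm2 (dim_row (kron V (1\<^sub>m n))) (app (kron V (1\<^sub>m n)) x) \<le> c\<^sup>2 * nrm2 (dim_col (kron V (1\<^sub>m n))) x"
    by (simp add: nrm2_slice sum_distrib_left)
qed

lemma app_kron_one_left:
  assumes "i < k" "s < dim_row M"
  shows "app (kron (1\<^sub>m k) M) x (i * dim_row M + s) = app M (\<lambda>s. x (i * dim_col M + s)) s"
proof -
  have "i * dim_row M + s < k * dim_row M"
    using assms by (metis add.commute add_less_mono1 less_le_trans mult_Suc Suc_leI mult_le_mono1)
  then show ?thesis using assms
    by (simp add: app_kron if_distrib[of "\<lambda>u. u * _"] cong: if_cong)
qed

section \<open>Evaluation of free polynomials and intertwiners\<close>

lemma word_eval_Nil [simp]: "word_eval n X [] = 1\<^sub>m n"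
  by (simp add: word_eval_def)

lemma word_eval_Cons [simp]: "word_eval n X (i # w) = X i * word_eval n X w"
  by (simp add: word_eval_def)

lemma word_eval_carrier: "is_mtuple n X \<Longrightarrow> word_eval n X w \<in> carrier_mat n n"
  by (induction w) (auto simp: is_mtuple_def intro!: mult_carrier_mat)

lemma word_eval_dim: "is_mtuple n X \<Longrightarrow> dim_row (word_eval n X w) = n \<and> dim_col (word_eval n X w) = n"
  using word_eval_carrier by blast

lemma is_mtuple_dim: "is_mtuple n X \<Longrightarrow> X i \<in> carrier_mat n n \<and> dim_row (X i) = n \<and> dim_col (X i) = n"
  unfolding is_mtuple_def by (metis carrier_matD)

lemma fp_eval_carrier [simp]: "fp_eval n p X \<in> carrier_mat n n"
  and fp_eval_dim [simp]: "dim_row (fp_eval n p X) = n" "dim_col (fp_eval n p X) = n"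
  by (simp_all add: fp_eval_def)

lemma delta_carrier [simp]: "delta_eval a b \<delta> n X \<in> carrier_mat (a * n) (b * n)"
  and delta_dim [simp]: "dim_row (delta_eval a b \<delta> n X) = a * n" "dim_col (delta_eval a b \<delta> n X) = b * n"
  by (simp_all add: delta_eval_def)

text \<open>S may be rectangular. Thus one relation covers similarities, inclusions of direct
  summands, embeddings as invariant subspaces and joint eigenvectors (n = 1).\<close>

definition intw :: "nat \<Rightarrow> nat \<Rightarrow> complex mat \<Rightarrow> 'd mtuple \<Rightarrow> 'd mtuple \<Rightarrow> bool" where
  "intw n m S X Y \<longleftrightarrow> is_mtuple n X \<and> is_mtuple m Y \<and> S \<in> carrier_mat m n \<and> (\<forall>i. S * X i = Y i * S)"

lemma intw_word:
  assumes "intw n m S X Y"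
  shows "S * word_eval n X w = word_eval m Y w * S"
proof (induction w)
  case Nil
  then show ?case using assms by (auto simp: intw_def)
next
  case (Cons i w)
  from assms have X: "X i \<in> carrier_mat n n" and Y: "Y i \<in> carrier_mat m m" and S: "S \<in> carrier_mat m n"
    and SX: "S * X i = Y i * S" and mX: "is_mtuple n X" and mY: "is_mtuple m Y"
    by (auto simp: intw_def is_mtuple_def)
  note W = word_eval_carrier[OF mX, of w] and W' = word_eval_carrier[OF mY, of w]
  have "S * (X i * word_eval n X w) = Y i * S * word_eval n X w"
    using assoc_mult_mat[OF S X W] SX by simp
  also have "\<dots> = Y i * (word_eval m Y w * S)"
    using assoc_mult_mat[OF Y S W] Cons by simp
  also have "\<dots> = Y i * word_eval m Y w * S" using assoc_mult_mat[OF Y W' S] by simp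
  finally show ?case by simp
qed

lemma intw_fp:
  assumes "intw n m S X Y"
  shows "S * fp_eval n p X = fp_eval m p Y * S"
proof (rule eq_matI)
  from assms have S: "S \<in> carrier_mat m n" and mX: "is_mtuple n X" and mY: "is_mtuple m Y"
    by (auto simp: intw_def)
  let ?P = "{w. p w \<noteq> 0}"
  fix r c assume "r < dim_row (fp_eval m p Y * S)" "c < dim_col (fp_eval m p Y * S)"
  then have rc: "r < m" "c < n" using S by auto
  have 1: "(S * fp_eval n p X) $$ (r,c) = (\<Sum>w\<in>?P. p w * (S * word_eval n X w) $$ (r,c))"
  proof -
    have "(S * fp_eval n p X) $$ (r,c) = (\<Sum>k<n. \<Sum>w\<in>?P. S $$ (r,k) * (p w * word_eval n X w $$ (k,c)))"
      using S rc by (subst mat_mult_index) (auto simp: fp_eval_def sum_distrib_left)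
    also have "\<dots> = (\<Sum>w\<in>?P. p w * (\<Sum>k<n. S $$ (r,k) * word_eval n X w $$ (k,c)))"
      unfolding sum_distrib_left by (subst sum.swap) (simp add: mult.left_commute)
    also have "\<dots> = (\<Sum>w\<in>?P. p w * (S * word_eval n X w) $$ (r,c))"
      using S rc word_eval_dim[OF mX] by (intro sum.cong refl) (subst mat_mult_index, auto)
    finally show ?thesis .
  qed
  have 2: "(fp_eval m p Y * S) $$ (r,c) = (\<Sum>w\<in>?P. p w * (word_eval m Y w * S) $$ (r,c))"
  proof -
    have "(fp_eval m p Y * S) $$ (r,c) = (\<Sum>k<m. \<Sum>w\<in>?P. p w * word_eval m Y w $$ (r,k) * S $$ (k,c))"
      using S rc by (subst mat_mult_index) (auto simp: fp_eval_def sum_distrib_right)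
    also have "\<dots> = (\<Sum>w\<in>?P. p w * (\<Sum>k<m. word_eval m Y w $$ (r,k) * S $$ (k,c)))"
      unfolding sum_distrib_left by (subst sum.swap) (simp add: mult.assoc)
    also have "\<dots> = (\<Sum>w\<in>?P. p w * (word_eval m Y w * S) $$ (r,c))"
      using S rc word_eval_dim[OF mY] by (intro sum.cong refl) (subst mat_mult_index, auto)
    finally show ?thesis .
  qed
  show "(S * fp_eval n p X) $$ (r,c) = (fp_eval m p Y * S) $$ (r,c)"
    unfolding 1 2 using intw_word[OF assms] by simp
qed (use assms in \<open>auto simp: intw_def\<close>)

lemma delta_index: "r < a * n \<Longrightarrow> c < b * n \<Longrightarrow>
  delta_eval a b \<delta> n X $$ (r, c) = fp_eval n (\<delta> (r div n) (c div n)) X $$ (r mod n, c mod n)"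
  by (simp add: delta_eval_def)

text \<open>Every entry of \<open>\<delta>\<close> is a polynomial and is intertwined by S; the
  Kronecker factors apply S in each of the a, respectively b, blocks.\<close>

lemma intw_delta:
  assumes "intw n m S X Y"
  shows "kron (1\<^sub>m a) S * delta_eval a b \<delta> n X = delta_eval a b \<delta> m Y * kron (1\<^sub>m b) S"
proof (rule eq_matI)
  from assms have S: "S \<in> carrier_mat m n" by (auto simp: intw_def)
  then have dS: "dim_row S = m" "dim_col S = n" by auto
  fix r c assume "r < dim_row (delta_eval a b \<delta> m Y * kron (1\<^sub>m b) S)" "c < dim_col (delta_eval a b \<delta> m Y * kron (1\<^sub>m b) S)"
  then have r: "r < a * m" and c: "c < b * n" using dS by auto
  note r' = div_mod_less[OF r] and c' = div_mod_less[OF c]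
  let ?p = "\<delta> (r div m) (c div n)"
  have "(kron (1\<^sub>m a) S * delta_eval a b \<delta> n X) $$ (r,c) = (\<Sum>k<a*n. kron (1\<^sub>m a) S $$ (r,k) * delta_eval a b \<delta> n X $$ (k,c))"
    using r c dS by (subst mat_mult_index) auto
  also have "\<dots> = (\<Sum>k<a*n. (if r div m = k div n then 1 else 0) *
      (S $$ (r mod m, k mod n) * fp_eval n (\<delta> (k div n) (c div n)) X $$ (k mod n, c mod n)))"
    using r c r' dS by (intro sum.cong refl) (auto simp: kron_index delta_index dest: div_mod_less)
  also have "\<dots> = (\<Sum>i<a. \<Sum>j<n. (if r div m = i then 1 else 0) * (S $$ (r mod m, j) * fp_eval n (\<delta> i (c div n)) X $$ (j, c mod n)))"
    by (rule sum_div_mod)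
  also have "\<dots> = (\<Sum>j<n. S $$ (r mod m, j) * fp_eval n ?p X $$ (j, c mod n))"
    using r' by (simp only: sum_pick)
  also have "\<dots> = (S * fp_eval n ?p X) $$ (r mod m, c mod n)"
    using r' c' dS by (subst mat_mult_index) auto
  also have "\<dots> = (fp_eval m ?p Y * S) $$ (r mod m, c mod n)" using intw_fp[OF assms] by simp
  also have "\<dots> = (\<Sum>j<m. fp_eval m ?p Y $$ (r mod m, j) * S $$ (j, c mod n))"
    using r' c' dS by (subst mat_mult_index) auto
  also have "\<dots> = (\<Sum>i<b. \<Sum>j<m. (if i = c div n then 1 else 0) * (fp_eval m (\<delta> (r div m) i) Y $$ (r mod m, j) * S $$ (j, c mod n)))"
    using c' by (simp only: sum_pick)
  also have "\<dots> = (\<Sum>k<b*m. (if k div m = c div n then 1 else 0) *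
     (fp_eval m (\<delta> (r div m) (k div m)) Y $$ (r mod m, k mod m) * S $$ (k mod m, c mod n)))"
    by (rule sum_div_mod[symmetric])
  also have "\<dots> = (\<Sum>k<b*m. delta_eval a b \<delta> m Y $$ (r,k) * kron (1\<^sub>m b) S $$ (k,c))"
    using r c c' dS by (intro sum.cong refl) (auto simp: kron_index delta_index dest: div_mod_less)
  also have "\<dots> = (delta_eval a b \<delta> m Y * kron (1\<^sub>m b) S) $$ (r,c)"
    using r c dS by (subst mat_mult_index) auto
  finally show "(kron (1\<^sub>m a) S * delta_eval a b \<delta> n X) $$ (r,c) = (delta_eval a b \<delta> m Y * kron (1\<^sub>m b) S) $$ (r,c)" .
qed (use assms in \<open>auto simp: intw_def\<close>)

section \<open>Noncommutative functions\<close>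

lemma dsum_mtuple: "is_mtuple n X \<Longrightarrow> is_mtuple m Y \<Longrightarrow> is_mtuple (n + m) (dsum_tuple n m X Y)"
  by (auto simp: is_mtuple_def dsum_tuple_def)

lemma word_eval_dsum:
  assumes "is_mtuple n X" "is_mtuple m Y"
  shows "word_eval (n + m) (dsum_tuple n m X Y) w =
    four_block_mat (word_eval n X w) (0\<^sub>m n m) (0\<^sub>m m n) (word_eval m Y w)"
proof (induction w)
  case Nil
  show ?case by (rule eq_matI) auto
next
  case (Cons i w)
  have "X i \<in> carrier_mat n n" "Y i \<in> carrier_mat m m" using assms by (auto simp: is_mtuple_def)
  note c = this word_eval_carrier[OF assms(1), of w] word_eval_carrier[OF assms(2), of w]
  show ?case
    unfolding word_eval_Cons Cons unfolding dsum_tuple_def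
    by (subst mult_four_block_mat[OF c(1) _ _ c(2) c(3) _ _ c(4)]) (use c in auto)
qed

lemma fp_eval_dsum:
  assumes "is_mtuple n X" "is_mtuple m Y"
  shows "fp_eval (n + m) p (dsum_tuple n m X Y) =
    four_block_mat (fp_eval n p X) (0\<^sub>m n m) (0\<^sub>m m n) (fp_eval m p Y)"
  by (rule eq_matI)
    (auto simp: fp_eval_def word_eval_dsum[OF assms] word_eval_dim[OF assms(1)] word_eval_dim[OF assms(2)])

lemma app_diag_block:
  assumes "A \<in> carrier_mat p q" "B \<in> carrier_mat s t" "r < p + s"
  shows "app (four_block_mat A (0\<^sub>m p t) (0\<^sub>m s q) B) x r =
     (if r < p then app A x r else app B (\<lambda>k. x (q + k)) (r - p))"
  using assms by (auto simp: app_def sum_lessThan_add)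

lemma GdD: "X \<in> Gd a b \<delta> n \<Longrightarrow> is_mtuple n X"
  by (simp add: Gd_def)

lemma Gd_iff: "X \<in> Gd a b \<delta> n \<longleftrightarrow> is_mtuple n X \<and> (\<exists>r<1. bdd_by r (delta_eval a b \<delta> n X))"
  by (simp add: Gd_def opnorm_less_iff)

lemma delta_row:
  assumes "i < a" "s < n"
  shows "app (delta_eval a b \<delta> n X) x (i * n + s) = (\<Sum>j<b. app (fp_eval n (\<delta> i j) X) (\<lambda>t. x (j * n + t)) s)"
proof -
  have l: "i * n + s < a * n"
    using assms by (metis add.commute add_less_mono1 less_le_trans mult_Suc Suc_leI mult_le_mono1)
  have "app (delta_eval a b \<delta> n X) x (i * n + s) =
     (\<Sum>k<b*n. fp_eval n (\<delta> i (k div n)) X $$ (s, k mod n) * x (k div n * n + k mod n))"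
    unfolding app_def delta_dim by (intro sum.cong refl) (use l assms in \<open>auto simp: delta_index\<close>)
  also have "\<dots> = (\<Sum>j<b. \<Sum>t<n. fp_eval n (\<delta> i j) X $$ (s, t) * x (j * n + t))"
    by (rule sum_div_mod)
  finally show ?thesis by (simp add: app_def)
qed

text \<open>After the permutation that separates the coordinates of X from those of Y in all blocks,
  \<open>\<delta>\<close> of the direct sum is the direct sum of the two values. \<open>x1\<close>
  and \<open>x2\<close> are the two halves of x under this permutation.\<close>

lemma delta_dsum_bdd:
  assumes X: "is_mtuple n X" "bdd_by r (delta_eval a b \<delta> n X)"
    and Y: "is_mtuple m Y" "bdd_by r (delta_eval a b \<delta> m Y)"
  shows "bdd_by r (delta_eval a b \<delta> (n + m) (dsum_tuple n m X Y))" (is "bdd_by r ?D")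
  unfolding bdd_by_def
proof (intro conjI allI)
  show "0 \<le> r" using X(2) by (rule bdd_by_nonneg)
  fix x :: "nat \<Rightarrow> complex"
  define x1 where "x1 = (\<lambda>k. x ((k div n) * (n + m) + k mod n))"
  define x2 where "x2 = (\<lambda>k. x ((k div m) * (n + m) + n + k mod m))"
  have split: "nrm2 (c * (n + m)) y = (\<Sum>i<c. nrm2 n (\<lambda>s. y (i * (n + m) + s)) + nrm2 m (\<lambda>s. y (i * (n + m) + n + s)))" for c y
    unfolding nrm2_block by (simp add: nrm2_def sum_lessThan_add add.assoc)
  have e1: "app ?D x (i * (n + m) + s) = app (delta_eval a b \<delta> n X) x1 (i * n + s)" if "i < a" "s < n" for i s
  proof -
    have "app (fp_eval (n + m) (\<delta> i j) (dsum_tuple n m X Y)) (\<lambda>t. x (j * (n + m) + t)) s =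
          app (fp_eval n (\<delta> i j) X) (\<lambda>t. x1 (j * n + t)) s" for j
      unfolding fp_eval_dsum[OF X(1) Y(1)]
      using that by (subst app_diag_block[OF fp_eval_carrier fp_eval_carrier]) (auto simp: x1_def app_def)
    then show ?thesis using that by (simp add: delta_row)
  qed
  have e2: "app ?D x (i * (n + m) + n + s) = app (delta_eval a b \<delta> m Y) x2 (i * m + s)" if "i < a" "s < m" for i s
  proof -
    have "app (fp_eval (n + m) (\<delta> i j) (dsum_tuple n m X Y)) (\<lambda>t. x (j * (n + m) + t)) (n + s) =
          app (fp_eval m (\<delta> i j) Y) (\<lambda>t. x2 (j * m + t)) s" for j
      unfolding fp_eval_dsum[OF X(1) Y(1)]
      using that by (subst app_diag_block[OF fp_eval_carrier fp_eval_carrier]) (auto simp: x2_def app_def add.assoc)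
    then show ?thesis using that delta_row[of i a "n + s" "n + m"] by (simp add: delta_row add.assoc)
  qed
  have "nrm2 (a * (n + m)) (app ?D x) = nrm2 (a * n) (app (delta_eval a b \<delta> n X) x1) + nrm2 (a * m) (app (delta_eval a b \<delta> m Y) x2)"
    unfolding split nrm2_block[of a n] nrm2_block[of a m] sum.distrib[symmetric]
    by (intro sum.cong refl arg_cong2[of _ _ _ _ "(+)"] nrm2_cong) (auto simp: e1 e2)
  also have "\<dots> \<le> r\<^sup>2 * nrm2 (b * n) x1 + r\<^sup>2 * nrm2 (b * m) x2"
    using bdd_byD[OF X(2), of x1] bdd_byD[OF Y(2), of x2] by (intro add_mono) auto
  also have "nrm2 (b * n) x1 = (\<Sum>i<b. nrm2 n (\<lambda>s. x (i * (n + m) + s)))"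
    unfolding nrm2_block by (intro sum.cong refl nrm2_cong) (simp add: x1_def)
  also have "nrm2 (b * m) x2 = (\<Sum>i<b. nrm2 m (\<lambda>s. x (i * (n + m) + n + s)))"
    unfolding nrm2_block by (intro sum.cong refl nrm2_cong) (simp add: x2_def)
  also have "r\<^sup>2 * (\<Sum>i<b. nrm2 n (\<lambda>s. x (i * (n + m) + s))) + r\<^sup>2 * (\<Sum>i<b. nrm2 m (\<lambda>s. x (i * (n + m) + n + s)))
     = r\<^sup>2 * nrm2 (b * (n + m)) x"
    unfolding split by (simp add: sum.distrib distrib_left)
  finally show "nrm2 (dim_row ?D) (app ?D x) \<le> r\<^sup>2 * nrm2 (dim_col ?D) x" by simp
qed

lemma Gd_dsum:
  assumes "X \<in> Gd a b \<delta> n" "Y \<in> Gd a b \<delta> m"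
  shows "dsum_tuple n m X Y \<in> Gd a b \<delta> (n + m)"
proof -
  obtain r s where "r < 1" "bdd_by r (delta_eval a b \<delta> n X)" "s < 1" "bdd_by s (delta_eval a b \<delta> m Y)"
    using assms by (auto simp: Gd_iff)
  then have "bdd_by (max r s) (delta_eval a b \<delta> n X)" "bdd_by (max r s) (delta_eval a b \<delta> m Y)" "max r s < 1"
    by (auto intro: bdd_by_mono)
  moreover have "is_mtuple n X" "is_mtuple m Y" using assms by (auto simp: Gd_def)
  ultimately show ?thesis
    using delta_dsum_bdd[of n X "max r s" a b \<delta> m Y] dsum_mtuple[of n X m Y] unfolding Gd_iff by blast
qed

text \<open>Entrywise convergence along an arbitrary filter, so that sequences, neighbourhoods and
  punctured neighbourhoods of a parameter are treated at once.\<close>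

definition tconv :: "nat \<Rightarrow> ('t \<Rightarrow> 'd mtuple) \<Rightarrow> 'd mtuple \<Rightarrow> 't filter \<Rightarrow> bool" where
  "tconv n X Y F \<longleftrightarrow> (\<forall>t. is_mtuple n (X t)) \<and> is_mtuple n Y \<and>
     (\<forall>i r c. r < n \<longrightarrow> c < n \<longrightarrow> ((\<lambda>t. X t i $$ (r, c)) \<longlongrightarrow> Y i $$ (r, c)) F)"

lemma tendsto_word_eval:
  assumes "tconv n X Y F"
  shows "r < n \<Longrightarrow> c < n \<Longrightarrow> ((\<lambda>t. word_eval n (X t) w $$ (r, c)) \<longlongrightarrow> word_eval n Y w $$ (r, c)) F"
proof (induction w arbitrary: r)
  case Nil
  show ?case by simp
next
  case (Cons i w)
  have mX: "is_mtuple n (X t)" for t using assms by (auto simp: tconv_def)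
  have mY: "is_mtuple n Y" using assms by (auto simp: tconv_def)
  have "(X t i * word_eval n (X t) w) $$ (r, c) = (\<Sum>k<n. X t i $$ (r, k) * word_eval n (X t) w $$ (k, c))" for t
    using Cons.prems is_mtuple_dim[OF mX] word_eval_dim[OF mX] by (subst mat_mult_index) auto
  moreover have "(Y i * word_eval n Y w) $$ (r, c) = (\<Sum>k<n. Y i $$ (r, k) * word_eval n Y w $$ (k, c))"
    using Cons.prems is_mtuple_dim[OF mY] word_eval_dim[OF mY] by (subst mat_mult_index) auto
  moreover have "((\<lambda>t. \<Sum>k<n. X t i $$ (r, k) * word_eval n (X t) w $$ (k, c)) \<longlongrightarrow>
      (\<Sum>k<n. Y i $$ (r, k) * word_eval n Y w $$ (k, c))) F"
    using assms Cons.prems by (intro tendsto_sum tendsto_mult Cons.IH) (auto simp: tconv_def)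
  ultimately show ?case by simp
qed

lemma tendsto_fp_eval:
  assumes "tconv n X Y F" "r < n" "c < n"
  shows "((\<lambda>t. fp_eval n p (X t) $$ (r, c)) \<longlongrightarrow> fp_eval n p Y $$ (r, c)) F"
  using assms unfolding fp_eval_def by (auto intro!: tendsto_sum tendsto_mult tendsto_word_eval)

lemma opnorm_perturb:
  assumes "bdd_by r B" "A \<in> carrier_mat m k" "B \<in> carrier_mat m k"
  shows "bdd_by (r + sqrt (\<Sum>i<m. nrm2 k (\<lambda>j. A $$ (i,j) - B $$ (i,j)))) A"
proof -
  have "A = B + (A - B)" using assms by (intro eq_matI) auto
  moreover have "bdd_by (r + sqrt (\<Sum>i<dim_row (A - B). nrm2 (dim_col (A - B)) (\<lambda>j. (A - B) $$ (i,j)))) (B + (A - B))"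
    using assms by (intro bdd_by_add bdd_by_Frobenius) auto
  moreover have "(\<Sum>i<dim_row (A - B). nrm2 (dim_col (A - B)) (\<lambda>j. (A - B) $$ (i,j))) = (\<Sum>i<m. nrm2 k (\<lambda>j. A $$ (i,j) - B $$ (i,j)))"
    using assms by (intro sum.cong nrm2_cong) (auto simp: nrm2_def)
  ultimately show ?thesis by simp
qed

text \<open>The norm of \<open>\<delta>\<close> exceeds the bound r < 1 at the limit by at most the
  Frobenius norm of the difference, which tends to 0 because the entries of \<open>\<delta>\<close>
  are polynomials.\<close>

lemma Gd_open:
  assumes "tconv n X Y F" "Y \<in> Gd a b \<delta> n"
  shows "eventually (\<lambda>t. X t \<in> Gd a b \<delta> n) F"
proof -
  obtain r where r: "r < 1" "bdd_by r (delta_eval a b \<delta> n Y)" using assms(2) by (auto simp: Gd_iff)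
  let ?e = "\<lambda>t. r + sqrt (\<Sum>i<a*n. nrm2 (b*n) (\<lambda>j. delta_eval a b \<delta> n (X t) $$ (i,j) - delta_eval a b \<delta> n Y $$ (i,j)))"
  have "((\<lambda>t. delta_eval a b \<delta> n (X t) $$ (i,j)) \<longlongrightarrow> delta_eval a b \<delta> n Y $$ (i,j)) F"
    if "i < a * n" "j < b * n" for i j
    using that div_mod_less[of i a n] div_mod_less[of j b n] by (auto simp: delta_index intro!: tendsto_fp_eval assms)
  then have "(?e \<longlongrightarrow> r + sqrt (\<Sum>i<a*n. \<Sum>j<b*n. (cmod (delta_eval a b \<delta> n Y $$ (i,j) - delta_eval a b \<delta> n Y $$ (i,j)))\<^sup>2)) F"
    unfolding nrm2_def by (intro tendsto_intros) auto
  then have "eventually (\<lambda>t. ?e t < 1) F"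
    by (rule order_tendstoD) (use r in simp)
  then show ?thesis
  proof eventually_elim
    case (elim t)
    then show ?case
      using opnorm_perturb[OF r(2), of "delta_eval a b \<delta> n (X t)" "a*n" "b*n"] assms(1) by (auto simp: Gd_iff tconv_def)
  qed
qed

lemma nc_carrier: "is_nc_fun a b \<delta> \<phi> \<Longrightarrow> n \<ge> 1 \<Longrightarrow> X \<in> Gd a b \<delta> n \<Longrightarrow> \<phi> X \<in> carrier_mat n n"
  by (simp add: is_nc_fun_def)

lemma nc_dsum: "is_nc_fun a b \<delta> \<phi> \<Longrightarrow> n \<ge> 1 \<Longrightarrow> m \<ge> 1 \<Longrightarrow> X \<in> Gd a b \<delta> n \<Longrightarrow> Y \<in> Gd a b \<delta> m \<Longrightarrow>
   \<phi> (dsum_tuple n m X Y) = four_block_mat (\<phi> X) (0\<^sub>m n m) (0\<^sub>m m n) (\<phi> Y)"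
  by (simp add: is_nc_fun_def)

lemma nc_sim: "is_nc_fun a b \<delta> \<phi> \<Longrightarrow> n \<ge> 1 \<Longrightarrow> X \<in> Gd a b \<delta> n \<Longrightarrow> s \<in> carrier_mat n n \<Longrightarrow> t \<in> carrier_mat n n
  \<Longrightarrow> s * t = 1\<^sub>m n \<Longrightarrow> t * s = 1\<^sub>m n \<Longrightarrow> (\<lambda>i. t * X i * s) \<in> Gd a b \<delta> n \<Longrightarrow> \<phi> (\<lambda>i. t * X i * s) = t * \<phi> X * s"
  by (simp add: is_nc_fun_def)

text \<open>An intertwiner S of X and Y makes the unipotent block matrix with off-diagonal entry S
  commute with the direct sum of Y and X.\<close>

lemma nc_intw:
  assumes nc: "is_nc_fun a b \<delta> \<phi>" and n: "n \<ge> 1" "m \<ge> 1"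
    and X: "X \<in> Gd a b \<delta> n" and Y: "Y \<in> Gd a b \<delta> m" and S: "intw n m S X Y"
  shows "S * \<phi> X = \<phi> Y * S"
proof -
  have Sc: "S \<in> carrier_mat m n" and SX: "\<And>i. S * X i = Y i * S" using S by (auto simp: intw_def)
  have Xc: "X i \<in> carrier_mat n n" and Yc: "Y i \<in> carrier_mat m m" for i
    using GdD[OF X] GdD[OF Y] by (auto simp: is_mtuple_def)
  define Z where "Z = dsum_tuple m n Y X"
  have Z: "Z \<in> Gd a b \<delta> (m + n)" unfolding Z_def by (rule Gd_dsum[OF Y X])
  define s where "s = four_block_mat (1\<^sub>m m) S (0\<^sub>m n m) (1\<^sub>m n)"
  define t where "t = four_block_mat (1\<^sub>m m) (- S) (0\<^sub>m n m) (1\<^sub>m n)"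
  have sc: "s \<in> carrier_mat (m + n) (m + n)" and tc: "t \<in> carrier_mat (m + n) (m + n)"
    using Sc by (auto simp: s_def t_def)
  have one: "four_block_mat (1\<^sub>m m) (0\<^sub>m m n) (0\<^sub>m n m) (1\<^sub>m n) = (1\<^sub>m (m + n) :: complex mat)"
    by (rule eq_matI) auto
  have mS: "- S \<in> carrier_mat m n" using Sc by auto
  have [simp]: "- 0\<^sub>m n n = (0\<^sub>m n n :: complex mat)" by (rule eq_matI) auto
  have st: "s * t = 1\<^sub>m (m + n)"
    unfolding s_def t_def
    by (subst mult_four_block_mat[OF one_carrier_mat Sc zero_carrier_mat one_carrier_mat one_carrier_mat mS zero_carrier_mat one_carrier_mat])
      (use Sc mS one in \<open>auto simp: uminus_l_inv_mat\<close>)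
  have ts: "t * s = 1\<^sub>m (m + n)" by (rule mat_mult_left_right_inverse[OF sc tc st])
  have Zi: "Z i \<in> carrier_mat (m + n) (m + n)" for i using GdD[OF Z] by (auto simp: is_mtuple_def)
  have comm: "Z i * s = s * Z i" for i
    unfolding Z_def dsum_tuple_def s_def
    by (subst mult_four_block_mat[OF Yc _ _ Xc one_carrier_mat Sc zero_carrier_mat one_carrier_mat], simp, simp,
        subst mult_four_block_mat[OF one_carrier_mat Sc zero_carrier_mat one_carrier_mat Yc _ _ Xc], simp, simp)
      (use Xc[of i] Yc[of i] Sc SX in auto)
  have "t * Z i * s = Z i" for i
  proof -
    have "t * Z i * s = t * (s * Z i)" using assoc_mult_mat[OF tc Zi sc] comm by simp
    also have "\<dots> = Z i" using assoc_mult_mat[OF tc sc Zi] ts Zi left_mult_one_mat by metis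
    finally show ?thesis .
  qed
  then have tZs: "(\<lambda>i. t * Z i * s) = Z" by auto
  have "\<phi> Z = t * \<phi> Z * s"
    using nc_sim[OF nc _ Z sc tc st ts] tZs Z n by simp
  have pZ: "\<phi> Z \<in> carrier_mat (m + n) (m + n)" using nc_carrier[OF nc _ Z] n by simp
  have pZs: "\<phi> Z * s \<in> carrier_mat (m + n) (m + n)" using pZ sc by (rule mult_carrier_mat)
  have "s * \<phi> Z = s * (t * (\<phi> Z * s))"
    using \<open>\<phi> Z = t * \<phi> Z * s\<close> assoc_mult_mat[OF tc pZ sc] by simp
  also have "\<dots> = s * t * (\<phi> Z * s)" using assoc_mult_mat[OF sc tc pZs] by simp
  finally have eq: "s * \<phi> Z = \<phi> Z * s" using st left_mult_one_mat[OF pZs] by simp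
  have pX: "\<phi> X \<in> carrier_mat n n" and pY: "\<phi> Y \<in> carrier_mat m m" using nc_carrier[OF nc] n X Y by auto
  have fZ: "\<phi> Z = four_block_mat (\<phi> Y) (0\<^sub>m m n) (0\<^sub>m n m) (\<phi> X)"
    unfolding Z_def by (rule nc_dsum[OF nc]) (use n X Y in auto)
  have l: "s * \<phi> Z = four_block_mat (\<phi> Y) (S * \<phi> X) (0\<^sub>m n m) (\<phi> X)"
    unfolding fZ s_def
    by (subst mult_four_block_mat[OF one_carrier_mat Sc zero_carrier_mat one_carrier_mat pY _ _ pX]) (use pX pY Sc in auto)
  have r: "\<phi> Z * s = four_block_mat (\<phi> Y) (\<phi> Y * S) (0\<^sub>m n m) (\<phi> X)"
    unfolding fZ s_def
    by (subst mult_four_block_mat[OF pY _ _ pX one_carrier_mat Sc zero_carrier_mat one_carrier_mat]) (use pX pY Sc in auto)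
  show ?thesis
  proof (rule eq_matI)
    fix i j assume "i < dim_row (\<phi> Y * S)" "j < dim_col (\<phi> Y * S)"
    then have ij: "i < m" "j < n" using pY Sc by auto
    have "(s * \<phi> Z) $$ (i, m + j) = (\<phi> Z * s) $$ (i, m + j)" using eq by simp
    then show "(S * \<phi> X) $$ (i, j) = (\<phi> Y * S) $$ (i, j)"
      unfolding l r using ij pX pY Sc by (simp del: index_mult_mat(1))
  qed (use pX pY Sc in auto)
qed

lemma intwI:
  assumes "is_mtuple n X" "is_mtuple m Y" "S \<in> carrier_mat m n"
    "\<And>i x r. r < m \<Longrightarrow> app S (app (X i) x) r = app (Y i) (app S x) r"
  shows "intw n m S X Y"
  unfolding intw_def
proof (intro conjI allI assms(1-3))
  fix i
  show "S * X i = Y i * S"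
  proof (rule mat_eq_app[of _ m n])
    fix x :: "nat \<Rightarrow> complex" and r assume "r < m"
    then show "app (S * X i) x r = app (Y i * S) x r"
      using assms(3) assms(4)[of r i x] is_mtuple_dim[OF assms(1), of i] is_mtuple_dim[OF assms(2), of i]
      by (simp add: app_mult)
  next
    show "S * X i \<in> carrier_mat m n" "Y i * S \<in> carrier_mat m n"
      using assms(1-3) by (meson is_mtuple_def mult_carrier_mat)+
  qed
qed

lemma app_intw:
  assumes "S * A = B * S" "A \<in> carrier_mat n n" "B \<in> carrier_mat m m" "S \<in> carrier_mat m n" "r < m"
  shows "app S (app A x) r = app B (app S x) r"
  using assms app_mult[of S A r x] app_mult[of B S r x] by simp

lemma nc_intw_app:
  assumes "is_nc_fun a b \<delta> \<phi>" "n \<ge> 1" "m \<ge> 1" "X \<in> Gd a b \<delta> n" "Y \<in> Gd a b \<delta> m" "intw n m S X Y" "r < m"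
  shows "app S (app (\<phi> X) x) r = app (\<phi> Y) (app S x) r"
  using nc_intw[OF assms(1-6)] nc_carrier[OF assms(1)] assms by (intro app_intw) (auto simp: intw_def)

lemma app_four_block:
  assumes "A \<in> carrier_mat p q" "B \<in> carrier_mat p t" "C \<in> carrier_mat s q" "D \<in> carrier_mat s t" "r < p + s"
  shows "app (four_block_mat A B C D) x r =
     (if r < p then app A x r + app B (\<lambda>k. x (q + k)) r else app C x (r - p) + app D (\<lambda>k. x (q + k)) (r - p))"
  using assms by (auto simp: app_def sum_lessThan_add)

text \<open>The inclusions of the two summands of a direct sum, as matrices; \<open>blk2\<close> is
  the inclusion of the second one.\<close>

definition blk1 :: "nat \<Rightarrow> nat \<Rightarrow> complex mat" where
  "blk1 n m = mat (n + m) n (\<lambda>(r, s). if r = s then 1 else 0)"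

definition blk2 :: "nat \<Rightarrow> nat \<Rightarrow> complex mat" where
  "blk2 n m = mat (n + m) m (\<lambda>(r, s). if r = n + s then 1 else 0)"

lemma blk1_carrier [simp]: "blk1 n m \<in> carrier_mat (n + m) n" "dim_row (blk1 n m) = n + m" "dim_col (blk1 n m) = n"
  by (simp_all add: blk1_def)

lemma blk2_carrier [simp]: "blk2 n m \<in> carrier_mat (n + m) m" "dim_row (blk2 n m) = n + m" "dim_col (blk2 n m) = m"
  by (simp_all add: blk2_def)

lemma app_blk1: "r < n + m \<Longrightarrow> app (blk1 n m) x r = (if r < n then x r else 0)"
  by (auto simp: app_def blk1_def if_distrib[of "\<lambda>u. u * _"] cong: if_cong)

lemma app_blk2: "r < n + m \<Longrightarrow> app (blk2 n m) x r = (if r < n then 0 else x (r - n))"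
proof -
  assume r: "r < n + m"
  have "app (blk2 n m) x r = (\<Sum>k<m. (if r = n + k then x k else 0))"
    unfolding app_def blk2_carrier by (intro sum.cong refl) (use r in \<open>auto simp: blk2_def\<close>)
  also have "\<dots> = (\<Sum>k<m. (if k = r - n then (if r < n then 0 else x k) else 0))"
    by (intro sum.cong refl) auto
  finally show ?thesis using r by auto
qed

lemma app_cong_eq: "A = B \<Longrightarrow> (\<And>k. k < dim_col B \<Longrightarrow> x k = y k) \<Longrightarrow> app A x r = app B y r"
  using app_cong[of B x y] by simp

lemma intw_blk1:
  assumes "is_mtuple n X" "is_mtuple m Y"
  shows "intw n (n + m) (blk1 n m) X (dsum_tuple n m X Y)"
proof (rule intwI)
  fix i x r assume r: "r < n + m"
  have c: "X i \<in> carrier_mat n n" "Y i \<in> carrier_mat m m" using assms by (auto simp: is_mtuple_def)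
  show "app (blk1 n m) (app (X i) x) r = app (dsum_tuple n m X Y i) (app (blk1 n m) x) r"
    unfolding dsum_tuple_def app_diag_block[OF c r] app_blk1[OF r]
    using c r by (auto simp: app_def[of "X i"] app_def[of "Y i"] app_blk1)
qed (use assms dsum_mtuple in auto)

lemma intw_blk2:
  assumes "is_mtuple n X" "is_mtuple m Y"
  shows "intw m (n + m) (blk2 n m) Y (dsum_tuple n m X Y)"
proof (rule intwI)
  fix i x r assume r: "r < n + m"
  have c: "X i \<in> carrier_mat n n" "Y i \<in> carrier_mat m m" using assms by (auto simp: is_mtuple_def)
  show "app (blk2 n m) (app (Y i) x) r = app (dsum_tuple n m X Y i) (app (blk2 n m) x) r"
    unfolding dsum_tuple_def app_diag_block[OF c r] app_blk2[OF r]
    using c r by (auto simp: app_def[of "X i"] app_def[of "Y i"] app_blk2)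
qed (use assms dsum_mtuple in auto)

text \<open>Converse of \<open>nc_intw\<close>: the inclusions \<open>blk1\<close>,
  \<open>blk2\<close> give the direct sum axiom and an invertible S the similarity axiom. For nc
  functions that are constructed, only linear equations between entries remain to be checked, and
  these survive limits.\<close>

lemma is_nc_funI:
  fixes \<phi> :: "'d mtuple \<Rightarrow> complex mat"
  assumes c: "\<And>n X. n \<ge> 1 \<Longrightarrow> X \<in> Gd a b \<delta> n \<Longrightarrow> \<phi> X \<in> carrier_mat n n"
    and i: "\<And>n m S X Y. n \<ge> 1 \<Longrightarrow> m \<ge> 1 \<Longrightarrow> X \<in> Gd a b \<delta> n \<Longrightarrow> Y \<in> Gd a b \<delta> m \<Longrightarrow> intw n m S X Y \<Longrightarrow> S * \<phi> X = \<phi> Y * S"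
  shows "is_nc_fun a b \<delta> \<phi>"
  unfolding is_nc_fun_def
proof (intro conjI allI impI ballI)
  fix n X assume "1 \<le> n" "X \<in> Gd a b \<delta> n"
  then show "\<phi> X \<in> carrier_mat n n" by (rule c)
next
  fix n m :: nat and X Y :: "'d mtuple"
  assume nm: "1 \<le> n" "1 \<le> m" and X: "X \<in> Gd a b \<delta> n" and Y: "Y \<in> Gd a b \<delta> m"
  define D where "D = dsum_tuple n m X Y"
  have D: "D \<in> Gd a b \<delta> (n + m)" unfolding D_def by (rule Gd_dsum[OF X Y])
  have pX: "\<phi> X \<in> carrier_mat n n" and pY: "\<phi> Y \<in> carrier_mat m m" and pD: "\<phi> D \<in> carrier_mat (n + m) (n + m)"
    using c nm X Y D by auto
  have 1: "blk1 n m * \<phi> X = \<phi> D * blk1 n m"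
    using intw_blk1[OF GdD[OF X] GdD[OF Y]] nm X D i[of n "n + m" X D] by (auto simp: D_def)
  have 2: "blk2 n m * \<phi> Y = \<phi> D * blk2 n m"
    using intw_blk2[OF GdD[OF X] GdD[OF Y]] nm Y D i[of m "n + m" Y D] by (auto simp: D_def)
  have "\<phi> D = four_block_mat (\<phi> X) (0\<^sub>m n m) (0\<^sub>m m n) (\<phi> Y)"
  proof (rule mat_eq_app[OF pD])
    fix x :: "nat \<Rightarrow> complex" and r assume r: "r < n + m"
    have "app (\<phi> D) x r = app (\<phi> D) (\<lambda>k. app (blk1 n m) x k + app (blk2 n m) (\<lambda>k. x (n + k)) k) r"
      using pD by (intro app_cong_eq) (auto simp: app_blk1 app_blk2)
    also have "\<dots> = app (blk1 n m) (app (\<phi> X) x) r + app (blk2 n m) (app (\<phi> Y) (\<lambda>k. x (n + k))) r"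
      unfolding app_lin using app_intw[OF 1 pX pD _ r] app_intw[OF 2 pY pD _ r] by simp
    also have "\<dots> = app (four_block_mat (\<phi> X) (0\<^sub>m n m) (0\<^sub>m m n) (\<phi> Y)) x r"
      using r by (simp add: app_diag_block[OF pX pY r] app_blk1 app_blk2)
    finally show "app (\<phi> D) x r = app (four_block_mat (\<phi> X) (0\<^sub>m n m) (0\<^sub>m m n) (\<phi> Y)) x r" .
  qed (use pX pY in auto)
  then show "\<phi> (dsum_tuple n m X Y) = four_block_mat (\<phi> X) (0\<^sub>m n m) (0\<^sub>m m n) (\<phi> Y)" by (simp add: D_def)
next
  fix n and X :: "'d mtuple" and s t :: "complex mat"
  assume n: "1 \<le> n" and X: "X \<in> Gd a b \<delta> n" and s: "s \<in> carrier_mat n n" and t: "t \<in> carrier_mat n n"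
    and st: "s * t = 1\<^sub>m n" and ts: "t * s = 1\<^sub>m n" and Y: "(\<lambda>i. t * X i * s) \<in> Gd a b \<delta> n"
  let ?Y = "\<lambda>i. t * X i * s"
  have Xi: "X i \<in> carrier_mat n n" for i using GdD[OF X] by (auto simp: is_mtuple_def)
  have "s * (t * X i * s) = X i * s" for i
  proof -
    have "s * (t * X i * s) = s * (t * X i) * s"
      using assoc_mult_mat[OF s mult_carrier_mat[OF t Xi] s] by simp
    also have "\<dots> = s * t * X i * s" using assoc_mult_mat[OF s t Xi] by simp
    also have "\<dots> = X i * s" using st left_mult_one_mat[OF Xi] by simp
    finally show ?thesis .
  qed
  then have "intw n n s ?Y X" using s GdD[OF X] GdD[OF Y] by (simp add: intw_def)
  from i[OF n n Y X this] have e: "s * \<phi> ?Y = \<phi> X * s" .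
  have pX: "\<phi> X \<in> carrier_mat n n" and pY: "\<phi> ?Y \<in> carrier_mat n n" using c[OF n] X Y by auto
  have "\<phi> ?Y = t * s * \<phi> ?Y" using ts pY by simp
  also have "\<dots> = t * (\<phi> X * s)" using e assoc_mult_mat[OF t s pY] by simp
  also have "\<dots> = t * \<phi> X * s" using assoc_mult_mat[OF t pX s] by simp
  finally show "\<phi> ?Y = t * \<phi> X * s" .
qed

text \<open>The block tuple with diagonal Y, X t and corner c (Y - X t) is similar to their direct sum, and
  \<phi> maps it to the block matrix with corner c (\<phi> Y - \<phi> (X t)). It tends to the direct sum of Y with
  itself, so it eventually lies in the domain, which bounds that corner by C.\<close>

lemma nc_continuous:
  fixes X :: "'t \<Rightarrow> 'd mtuple"
  assumes nc: "is_nc_fun a b \<delta> \<phi>" and C: "\<And>Z. Z \<in> Gall a b \<delta> \<Longrightarrow> opnorm (\<phi> Z) \<le> C"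
    and n: "n \<ge> 1" and X: "tconv n X Y F" and Y: "Y \<in> Gd a b \<delta> n" and rs: "r < n" "s < n"
  shows "((\<lambda>t. \<phi> (X t) $$ (r, s)) \<longlongrightarrow> \<phi> Y $$ (r, s)) F"
proof (rule tendstoI)
  fix e :: real assume e: "e > 0"
  have mX: "is_mtuple n (X t)" for t using X by (auto simp: tconv_def)
  have mY: "is_mtuple n Y" using X by (auto simp: tconv_def)
  have Xi: "X t i \<in> carrier_mat n n" and Yi: "Y i \<in> carrier_mat n n" for t i using mX mY by (auto simp: is_mtuple_def)
  note dX = carrier_matD[OF Xi] and dY = carrier_matD[OF Yi]
  have "dsum_tuple n n Y Y \<in> Gall a b \<delta>" using Gd_dsum[OF Y Y] n by (auto simp: Gall_def)
  from C[OF this] have C0: "0 \<le> C" using opnorm_nonneg order_trans by blast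
  \<comment> \<open>The corner entry of \<open>\<phi> (W t)\<close> will be c times the difference
    of the two values and at most C in modulus, so c has to exceed C / e.\<close>
  define c where "c = C / e + 1"
  have c: "c > 0" "C < c * e" using C0 e by (auto simp: c_def field_simps)
  let ?c = "complex_of_real c"
  define W where "W t i = four_block_mat (Y i) (?c \<cdot>\<^sub>m (Y i - X t i)) (0\<^sub>m n n) (X t i)" for t i
  have Ei: "?c \<cdot>\<^sub>m (Y i - X t i) \<in> carrier_mat n n" for i t using Xi[of t i] Yi[of i] unfolding carrier_mat_def by simp
  have mW: "is_mtuple (n + n) (W t)" for t using Xi Yi by (auto simp: is_mtuple_def W_def)
  have "tconv (n + n) W (dsum_tuple n n Y Y) F"
    unfolding tconv_def
  proof (intro conjI allI impI mW dsum_mtuple mY)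
    fix i p q assume pq: "p < n + n" "q < n + n"
    have cv: "((\<lambda>t. X t i $$ (r, c)) \<longlongrightarrow> Y i $$ (r, c)) F" if "r < n" "c < n" for r c using X that by (auto simp: tconv_def)
    have cv0: "((\<lambda>t. ?c * (Y i $$ (r, c) - X t i $$ (r, c))) \<longlongrightarrow> ?c * (Y i $$ (r, c) - Y i $$ (r, c))) F" if "r < n" "c < n" for r c
      by (intro tendsto_intros cv that)
    show "((\<lambda>t. W t i $$ (p, q)) \<longlongrightarrow> dsum_tuple n n Y Y i $$ (p, q)) F"
      using pq cv cv0 by (simp add: W_def dsum_tuple_def dX dY)
  qed
  from Gd_open[OF this Gd_dsum[OF Y Y]] have ev: "eventually (\<lambda>t. W t \<in> Gd a b \<delta> (n + n)) F" .
  from ev Gd_open[OF X Y] show "eventually (\<lambda>t. dist (\<phi> (X t) $$ (r, s)) (\<phi> Y $$ (r, s)) < e) F"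
  proof eventually_elim
    case (elim t)
    \<comment> \<open>K x is the vector with blocks -c x and x. Its range is invariant under the
      upper triangular tuple \<open>W t\<close>, which acts there as \<open>X t\<close>.\<close>
    define K where "K = blk2 n n + (- ?c) \<cdot>\<^sub>m blk1 n n"
    have Kc: "K \<in> carrier_mat (n + n) n" by (simp add: K_def)
    have aK: "app K x k = (if k < n then - ?c * x k else x (k - n))" if "k < n + n" for x k
      using that unfolding K_def by (subst app_add) (auto simp: app_smult app_blk1 app_blk2)
    have aW: "app (W t i) x k = (if k < n then app (Y i) x k + ?c * (app (Y i) (\<lambda>k. x (n + k)) k - app (X t i) (\<lambda>k. x (n + k)) k)
        else app (X t i) (\<lambda>k. x (n + k)) (k - n))" if "k < n + n" for i x k
      unfolding W_def app_four_block[OF Yi Ei zero_carrier_mat Xi that]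
      using dX dY that by (auto simp: app_def sum_distrib_left sum_subtractf algebra_simps)
    have "intw n (n + n) K (X t) (W t)"
    proof (rule intwI[OF mX mW Kc])
      fix i x k assume k: "k < n + n"
      have *: "app (X t i) (\<lambda>k. app K x (n + k)) j = app (X t i) x j" "app (Y i) (\<lambda>k. app K x (n + k)) j = app (Y i) x j" for j
        by (intro app_cong_eq refl; use dX dY in \<open>simp add: aK\<close>)+
      have **: "app (Y i) (app K x) j = - ?c * app (Y i) x j" for j
      proof -
        have "app (Y i) (app K x) j = app (Y i) (\<lambda>k. - ?c * x k) j"
          by (intro app_cong_eq refl) (use dY in \<open>simp add: aK\<close>)
        then show ?thesis by (simp only: app_scale)
      qed
      show "app K (app (X t i) x) k = app (W t i) (app K x) k"
        using k by (auto simp: aK aW * ** ring_distribs)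
    qed
    from nc_intw_app[OF nc n _ elim(2) elim(1) this, of r "\<lambda>k. if k = s then 1 else 0"]
    have 1: "app K (app (\<phi> (X t)) (\<lambda>k. if k = s then 1 else 0)) r = app (\<phi> (W t)) (app K (\<lambda>k. if k = s then 1 else 0)) r"
      using n rs by simp
    have "intw n (n + n) (blk1 n n) Y (W t)"
    proof (rule intwI[OF mY mW blk1_carrier(1)])
      fix i x k assume k: "k < n + n"
      show "app (blk1 n n) (app (Y i) x) k = app (W t i) (app (blk1 n n) x) k"
        using k dX dY by (auto simp: aW app_blk1 app_def[of "X t i"] app_def[of "Y i"])
    qed
    from nc_intw_app[OF nc n _ Y elim(1) this, of r "\<lambda>k. if k = s then 1 else 0"]
    have 2: "app (blk1 n n) (app (\<phi> Y) (\<lambda>k. if k = s then 1 else 0)) r = app (\<phi> (W t)) (app (blk1 n n) (\<lambda>k. if k = s then 1 else 0)) r"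
      using n rs by simp
    have pX: "\<phi> (X t) \<in> carrier_mat n n" and pY: "\<phi> Y \<in> carrier_mat n n" and pW: "\<phi> (W t) \<in> carrier_mat (n + n) (n + n)"
      using nc_carrier[OF nc] n elim Y by auto
    have "app (\<phi> (W t)) (app K (\<lambda>k. if k = s then 1 else 0)) r =
      app (\<phi> (W t)) (\<lambda>k. - ?c * (if k = s then 1 else 0) + (if k = n + s then 1 else 0)) r"
      using pW rs by (intro app_cong_eq) (auto simp: aK)
    also have "\<dots> = - ?c * \<phi> (W t) $$ (r, s) + \<phi> (W t) $$ (r, n + s)"
      using pW rs unfolding app_lin app_scale by (simp add: app_unit)
    finally have 3: "- ?c * \<phi> (X t) $$ (r, s) = - ?c * \<phi> (W t) $$ (r, s) + \<phi> (W t) $$ (r, n + s)"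
      using 1 pX rs by (simp add: aK app_unit)
    have "app (\<phi> (W t)) (app (blk1 n n) (\<lambda>k. if k = s then 1 else 0)) r = app (\<phi> (W t)) (\<lambda>k. if k = s then 1 else 0) r"
      using pW rs by (intro app_cong_eq) (auto simp: app_blk1)
    then have "\<phi> Y $$ (r, s) = \<phi> (W t) $$ (r, s)" using 2 pY pW rs by (simp add: app_blk1 app_unit)
    with 3 have "?c * (\<phi> Y $$ (r, s) - \<phi> (X t) $$ (r, s)) = \<phi> (W t) $$ (r, n + s)" by (simp add: algebra_simps)
    moreover have "cmod (\<phi> (W t) $$ (r, n + s)) \<le> C"
    proof -
      have "W t \<in> Gall a b \<delta>" using elim(1) n by (auto simp: Gall_def)
      then have "bdd_by C (\<phi> (W t))" using C C0 by (simp add: opnorm_le_iff)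
      then show ?thesis using pW rs by (intro bdd_by_entry) auto
    qed
    ultimately have "c * cmod (\<phi> Y $$ (r, s) - \<phi> (X t) $$ (r, s)) < c * e"
      using c by (metis norm_mult norm_of_real abs_of_pos order_le_less_trans)
    then show ?case using c by (simp add: dist_norm norm_minus_commute)
  qed
qed

section \<open>Taylor polynomials of separately holomorphic functions\<close>

definition upd :: "complex ^ 'd \<Rightarrow> 'd \<Rightarrow> complex \<Rightarrow> complex ^ 'd" where
  "upd z i \<zeta> = (\<chi> j. if j = i then \<zeta> else vec_nth z j)"

lemma upd_nth [simp]: "vec_nth (upd z i \<zeta>) j = (if j = i then \<zeta> else vec_nth z j)"
  by (simp add: upd_def)

lemma upd_same [simp]: "upd z i (vec_nth z i) = z"
  by (simp add: Finite_Cartesian_Product.vec_eq_iff)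

lemma continuous_on_upd:
  assumes "continuous_on A f" "continuous_on A g"
  shows "continuous_on A (\<lambda>x. upd (f x) i (g x))"
  unfolding upd_def
proof (rule continuous_on_vec_lambda)
  fix j show "continuous_on A (\<lambda>x. if j = i then g x else vec_nth (f x) j)"
    using assms by (cases "j = i") (auto intro: continuous_on_component)
qed

section \<open>Polynomial functions\<close>

definition polydisc :: "real \<Rightarrow> (complex ^ 'd) set" where
  "polydisc r = {z. \<forall>i. cmod (vec_nth z i) \<le> r}"

text \<open>Generated by multiplication with single coordinates, which matches prepending a letter
  to a word; so induction turns such a function directly into a free polynomial.\<close>

inductive_set polf :: "(complex ^ 'd \<Rightarrow> complex) set" where
  polf_const: "(\<lambda>_. c) \<in> polf"
| polf_add: "f \<in> polf \<Longrightarrow> g \<in> polf \<Longrightarrow> (\<lambda>z. f z + g z) \<in> polf"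
| polf_coord: "f \<in> polf \<Longrightarrow> (\<lambda>z. vec_nth z j * f z) \<in> polf"

lemma polf_scale: "f \<in> polf \<Longrightarrow> (\<lambda>z. c * f z) \<in> polf"
proof (induction rule: polf.induct)
  case (polf_add f g)
  then show ?case using polf.polf_add by (simp add: distrib_left)
next
  case (polf_coord f j)
  then show ?case using polf.polf_coord[of "\<lambda>z. c * f z" j] by (simp add: mult.left_commute)
qed (auto intro: polf.polf_const)

lemma polf_mult: "f \<in> polf \<Longrightarrow> g \<in> polf \<Longrightarrow> (\<lambda>z. f z * g z) \<in> polf"
proof (induction rule: polf.induct)
  case (polf_add f h)
  then show ?case using polf.polf_add by (simp add: distrib_right)
next
  case (polf_coord f j)
  then show ?case using polf.polf_coord[of "\<lambda>z. f z * g z" j] by (simp add: mult.assoc)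
qed (auto intro: polf_scale)

lemma polf_nth: "(\<lambda>z. vec_nth z j) \<in> polf"
  using polf_coord[OF polf_const[of 1], of j] by simp

lemma polf_diff: "f \<in> polf \<Longrightarrow> g \<in> polf \<Longrightarrow> (\<lambda>z. f z - g z) \<in> polf"
  using polf_add[of f "\<lambda>z. -1 * g z"] polf_scale[of g "-1"] by simp

lemma polf_power: "f \<in> polf \<Longrightarrow> (\<lambda>z. f z ^ k) \<in> polf"
  by (induction k) (auto intro: polf_const polf_mult)

lemma polf_sum: "finite A \<Longrightarrow> (\<And>a. a \<in> A \<Longrightarrow> f a \<in> polf) \<Longrightarrow> (\<lambda>z. \<Sum>a\<in>A. f a z) \<in> polf"
  by (induction A rule: finite_induct) (auto intro: polf_const polf_add)

lemma polf_prod: "finite A \<Longrightarrow> (\<And>a. a \<in> A \<Longrightarrow> f a \<in> polf) \<Longrightarrow> (\<lambda>z. \<Prod>a\<in>A. f a z) \<in> polf"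
  by (induction A rule: finite_induct) (auto intro: polf_const polf_mult)

lemma polf_shift: "f \<in> polf \<Longrightarrow> (\<lambda>z. f (z - \<mu>)) \<in> polf"
proof (induction rule: polf.induct)
  case (polf_coord f j)
  have "(\<lambda>z. vec_nth z j - vec_nth \<mu> j) \<in> polf" by (intro polf_diff polf_nth polf_const)
  from polf_mult[OF this polf_coord.IH] show ?case by simp
qed (auto intro: polf.intros)

section \<open>Iterated Cauchy expansions on a polydisc\<close>

context
  fixes r :: real
  assumes r: "r > 0"
begin

abbreviation circ :: "real \<Rightarrow> complex" where "circ \<equiv> circlepath 0 r"

lemma norm_circ: "cmod (circ t) = r"
  using r by (simp add: circlepath norm_mult)

lemma circ_nz: "circ t \<noteq> 0"
  using norm_circ[of t] r by auto

lemma continuous_circ: "continuous_on A circ"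
  unfolding circlepath by (intro continuous_intros)

lemma upd_polydisc: "z \<in> polydisc r \<Longrightarrow> cmod \<zeta> \<le> r \<Longrightarrow> upd z i \<zeta> \<in> polydisc r"
  by (simp add: polydisc_def)

text \<open>The k-th Taylor coefficient in the variable i. On the circle the measure d\<zeta> / (2
  \<pi> i \<zeta>) becomes dt, so Cauchy's integral turns into an average over the unit
  interval.\<close>

definition circle_avg :: "'d \<Rightarrow> nat \<Rightarrow> (complex ^ 'd \<Rightarrow> complex) \<Rightarrow> complex ^ 'd \<Rightarrow> complex" where
  "circle_avg i k f z = integral {0..1} (\<lambda>t. f (upd z i (circ t)) / circ t ^ k)"

lemma circle_avg_cont_on:
  assumes "continuous_on (polydisc r) f" "z \<in> polydisc r"
  shows "continuous_on {0..1} (\<lambda>t. f (upd z i (circ t)) / circ t ^ k)"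
proof -
  have "continuous_on {0..1} (\<lambda>t. f (upd z i (circ t)))"
    by (rule continuous_on_compose2[OF assms(1)])
      (use assms(2) norm_circ in \<open>auto intro!: continuous_on_upd continuous_circ upd_polydisc continuous_intros\<close>)
  then show ?thesis by (intro continuous_intros continuous_circ) (auto simp: circ_nz)
qed

lemma circle_avg_integrable:
  assumes "continuous_on (polydisc r) f" "z \<in> polydisc r"
  shows "(\<lambda>t. f (upd z i (circ t)) / circ t ^ k) integrable_on {0..1}"
  using circle_avg_cont_on[OF assms] by (rule integrable_continuous_real)

lemma continuous_on_circle_avg:
  assumes "continuous_on (polydisc r) f"
  shows "continuous_on (polydisc r) (circle_avg i k f)"
proof -
  have "continuous_on (polydisc r \<times> cbox 0 1) (\<lambda>(z, t). f (upd z i (circ t)) / circ t ^ k)"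
  proof -
    have "continuous_on (polydisc r \<times> cbox 0 1) (\<lambda>x. f (upd (fst x) i (circ (snd x))))"
      by (rule continuous_on_compose2[OF assms])
        (use norm_circ in \<open>auto intro!: continuous_on_upd continuous_on_compose2[OF continuous_circ[of UNIV]] upd_polydisc continuous_intros\<close>)
    moreover have "continuous_on (polydisc r \<times> cbox 0 1) (\<lambda>x. circ (snd x))"
      by (rule continuous_on_compose2[OF continuous_circ[of UNIV]]) (auto intro: continuous_intros)
    ultimately show ?thesis unfolding case_prod_beta by (intro continuous_intros) (auto simp: circ_nz)
  qed
  from integral_continuous_on_param[OF this] show ?thesis by (simp add: circle_avg_def[abs_def])
qed

lemma circle_avg_bound:
  assumes "\<And>t. cmod (f (upd z i (circ t))) \<le> B" "B \<ge> 0"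
    "continuous_on {0..1} (\<lambda>t. f (upd z i (circ t)) / circ t ^ k)"
  shows "cmod (circle_avg i k f z) \<le> B / r ^ k"
proof -
  have "cmod (integral {0..1} (\<lambda>t. f (upd z i (circ t)) / circ t ^ k)) \<le> (B / r ^ k) * (1 - 0)"
    using assms r by (intro integral_bound) (auto simp: norm_divide norm_power norm_circ intro!: divide_right_mono)
  then show ?thesis by (simp add: circle_avg_def)
qed

text \<open>The Taylor polynomial in the i-th coordinate, with Cauchy integrals as coefficients.\<close>

definition coord_expansion :: "nat \<Rightarrow> 'd \<Rightarrow> (complex ^ 'd \<Rightarrow> complex) \<Rightarrow> complex ^ 'd \<Rightarrow> complex" where
  "coord_expansion n i f z = (\<Sum>k<n. vec_nth z i ^ k * circle_avg i k f z)"

lemma continuous_on_coord_expansion: "continuous_on (polydisc r) f \<Longrightarrow> continuous_on (polydisc r) (coord_expansion n i f)"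
  unfolding coord_expansion_def[abs_def] by (intro continuous_intros continuous_on_circle_avg continuous_on_component)

lemma circle_avg_diff:
  assumes "continuous_on (polydisc r) f" "continuous_on (polydisc r) g" "z \<in> polydisc r"
  shows "circle_avg i k (\<lambda>z. f z - g z) z = circle_avg i k f z - circle_avg i k g z"
  unfolding circle_avg_def diff_divide_distrib by (rule integral_diff) (intro circle_avg_integrable assms)+

lemma coord_expansion_diff:
  assumes "continuous_on (polydisc r) f" "continuous_on (polydisc r) g" "z \<in> polydisc r"
  shows "coord_expansion n i (\<lambda>z. f z - g z) z = coord_expansion n i f z - coord_expansion n i g z"
  using circle_avg_diff[OF assms] by (simp add: coord_expansion_def sum_subtractf right_diff_distrib)

text \<open>Each of the n terms is at most B because the i-th coordinate of z has modulus at most r.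
  Only points that agree with z off the coordinate i enter, so an error estimate in the other
  coordinates is preserved.\<close>

lemma coord_expansion_bound:
  assumes "\<And>t. cmod (f (upd z i (circ t))) \<le> B" "continuous_on (polydisc r) f" "z \<in> polydisc r" "B \<ge> 0"
  shows "cmod (coord_expansion n i f z) \<le> real n * B"
proof -
  have "cmod (coord_expansion n i f z) \<le> (\<Sum>k<n. cmod (vec_nth z i) ^ k * (B / r ^ k))"
    unfolding coord_expansion_def
  proof (rule sum_norm_le)
    fix k
    show "cmod (vec_nth z i ^ k * circle_avg i k f z) \<le> cmod (vec_nth z i) ^ k * (B / r ^ k)"
      unfolding norm_mult norm_power
      by (intro mult_left_mono circle_avg_bound[OF assms(1,4) circle_avg_cont_on[OF assms(2,3)]]) simp
  qed
  also have "\<dots> \<le> (\<Sum>k<n. B)"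
  proof (rule sum_mono)
    fix k
    have "cmod (vec_nth z i) ^ k \<le> r ^ k" using assms(3) by (intro power_mono) (auto simp: polydisc_def)
    then show "cmod (vec_nth z i) ^ k * (B / r ^ k) \<le> B"
      using r assms(4) by (simp add: field_simps mult_left_mono)
  qed
  finally show ?thesis by simp
qed

text \<open>Cauchy's formula minus the first n terms of the geometric series for \<zeta> / (\<zeta>
  - w) leaves the kernel \<zeta> / (\<zeta> - w) times (w / \<zeta>)^n. The factor 2 bounds |\<zeta>
  / (\<zeta> - w)| for |w| at most r / 2.\<close>

lemma coord_expansion_error:
  assumes hol: "(\<lambda>\<zeta>. f (upd z i \<zeta>)) holomorphic_on cball 0 r"
    and M: "\<And>t. cmod (f (upd z i (circ t))) \<le> M" and w: "cmod (vec_nth z i) \<le> r / 2"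
  shows "cmod (f z - coord_expansion n i f z) \<le> 2 * M * (cmod (vec_nth z i) / r) ^ n"
proof -
  define F where "F = (\<lambda>\<zeta>. f (upd z i \<zeta>))"
  define w where "w = vec_nth z i"
  have wr: "cmod w < r" using w r by (simp add: w_def)
  have ne: "circ t \<noteq> w" for t using norm_circ[of t] wr by auto
  have cF: "continuous_on {0..1} (\<lambda>t. F (circ t))"
    by (rule continuous_on_compose2[OF holomorphic_on_imp_continuous_on[OF hol[folded F_def]] continuous_circ])
      (auto simp: norm_circ)
  have "((\<lambda>u. F u / (u - w)) has_contour_integral (2 * of_real pi * \<i> * F w)) (circlepath 0 r)"
    using hol wr by (intro Cauchy_integral_circlepath_simple) (auto simp: F_def)
  then have A: "((\<lambda>t. F (circ t) / (circ t - w) * vector_derivative circ (at t within {0..1})) has_integral (2 * of_real pi * \<i> * F w)) {0..1}"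
    by (simp add: has_contour_integral_def)
  define K where "K = 2 * complex_of_real pi * \<i>"
  have K0: "inverse K * K = 1" by (rule left_inverse) (simp add: K_def)
  have vd: "vector_derivative circ (at t within {0..1}) = K * circ t" if "t \<in> {0..1}" for t
    using vector_derivative_circlepath01[of t 0 r] that by (simp add: circlepath K_def mult_ac)
  have "((\<lambda>t. K * (F (circ t) * circ t / (circ t - w))) has_integral (K * F w)) {0..1}"
    by (rule has_integral_eq[OF _ A[folded K_def]]) (simp add: vd)
  from has_integral_mult_right[OF this, of "inverse K"]
  have 1: "((\<lambda>t. F (circ t) * circ t / (circ t - w)) has_integral F w) {0..1}"
    by (simp only: mult.assoc[symmetric] K0 mult_1_left)
  have "((\<lambda>t. w ^ k * (F (circ t) / circ t ^ k)) has_integral (w ^ k * circle_avg i k f z)) {0..1}" for k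
  proof -
    have "(\<lambda>t. F (circ t) / circ t ^ k) integrable_on {0..1}"
      by (intro integrable_continuous_real continuous_intros cF continuous_circ) (simp add: circ_nz)
    from has_integral_mult_right[OF integrable_integral[OF this], of "w ^ k"] show ?thesis
      by (simp add: circle_avg_def F_def)
  qed
  then have 2: "((\<lambda>t. \<Sum>k<n. w ^ k * (F (circ t) / circ t ^ k)) has_integral coord_expansion n i f z) {0..1}"
    unfolding coord_expansion_def w_def[symmetric] by (intro has_integral_sum) auto
  have fz: "F w = f z" by (simp add: F_def w_def)
  have geo: "F (circ t) * circ t / (circ t - w) - (\<Sum>k<n. w ^ k * (F (circ t) / circ t ^ k)) =
       F (circ t) * circ t / (circ t - w) * (w / circ t) ^ n" for t
  proof -
    let ?q = "w / circ t"
    have q: "?q \<noteq> 1" using ne[of t] circ_nz[of t] by auto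
    have "(\<Sum>k<n. w ^ k * (F (circ t) / circ t ^ k)) = F (circ t) * (\<Sum>k<n. ?q ^ k)"
      by (simp add: sum_distrib_left power_divide algebra_simps)
    also have "(\<Sum>k<n. ?q ^ k) = (1 - ?q ^ n) / (1 - ?q)" using q by (simp only: sum_gp_strict if_False)
    also have "1 - ?q = (circ t - w) / circ t" using circ_nz[of t] by (simp add: field_simps)
    finally have "(\<Sum>k<n. w ^ k * (F (circ t) / circ t ^ k)) = F (circ t) * ((1 - ?q ^ n) / ((circ t - w) / circ t))" .
    moreover have "u * v / d - u * ((1 - Q) / (d / v)) = u * v / d * Q" for u v d Q :: complex
      by (cases "d = 0") (simp_all add: field_simps)
    ultimately show ?thesis by simp
  qed
  have "((\<lambda>t. F (circ t) * circ t / (circ t - w) * (w / circ t) ^ n) has_integral (f z - coord_expansion n i f z)) {0..1}"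
    using has_integral_diff[OF 1 2] unfolding geo fz .
  moreover have "cmod (F (circ t) * circ t / (circ t - w) * (w / circ t) ^ n) \<le> 2 * M * (cmod w / r) ^ n" for t
  proof -
    have "r / 2 \<le> cmod (circ t - w)"
      using norm_triangle_ineq2[of "circ t" w] w by (simp add: norm_circ w_def)
    moreover from this have "0 < cmod (circ t - w)" using r by linarith
    ultimately have "r / cmod (circ t - w) \<le> 2" by (simp add: divide_le_eq)
    then have "cmod (F (circ t)) * (r / cmod (circ t - w)) \<le> M * 2"
      using M[of t] r by (intro mult_mono) (auto simp: F_def intro: order_trans[OF norm_ge_zero])
    then have "cmod (F (circ t)) * (r / cmod (circ t - w)) * (cmod w / r) ^ n \<le> M * 2 * (cmod w / r) ^ n"
      using r by (intro mult_right_mono) auto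
    then show ?thesis by (simp add: norm_mult norm_divide norm_power norm_circ mult_ac)
  qed
  moreover have "0 \<le> 2 * M * (cmod w / r) ^ n" using order_trans[OF norm_ge_zero M[of 0]] r by simp
  ultimately show ?thesis
    using has_integral_bound[of "2 * M * (cmod w / r) ^ n" "\<lambda>t. F (circ t) * circ t / (circ t - w) * (w / circ t) ^ n" "f z - coord_expansion n i f z" 0 1]
    by (simp add: w_def)
qed

primrec coord_expansions :: "nat \<Rightarrow> 'd list \<Rightarrow> (complex ^ 'd \<Rightarrow> complex) \<Rightarrow> complex ^ 'd \<Rightarrow> complex" where
  "coord_expansions n [] f = f"
| "coord_expansions n (i # is) f = coord_expansion n i (coord_expansions n is f)"

lemma continuous_on_coord_expansions: "continuous_on (polydisc r) f \<Longrightarrow> continuous_on (polydisc r) (coord_expansions n is f)"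
  by (induction "is") (auto intro: continuous_on_coord_expansion)

text \<open>Writing E for the expansion in the new coordinate and g for the previous approximation,
  f - E g = (f - E f) + E (f - g). Cauchy's formula is applied to f itself; for the second term
  continuity and the bound on E are enough.\<close>

lemma coord_expansions_error:
  assumes f: "continuous_on (polydisc r) f"
    and hol: "\<And>z i. z \<in> polydisc r \<Longrightarrow> (\<lambda>\<zeta>. f (upd z i \<zeta>)) holomorphic_on cball 0 r"
    and M: "\<And>z. z \<in> polydisc r \<Longrightarrow> cmod (f z) \<le> M" and M0: "M \<ge> 0"
    and "distinct is"
  shows "\<exists>C\<ge>0. \<forall>z\<in>polydisc r. (\<forall>j\<in>set is. cmod (vec_nth z j) \<le> r / 2) \<longrightarrow>
     cmod (f z - coord_expansions n is f z) \<le> C * (\<Sum>j\<in>set is. cmod (vec_nth z j) ^ n)"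
  using \<open>distinct is\<close>
proof (induction "is")
  case Nil
  show ?case by (auto intro: exI[of _ 0])
next
  case (Cons i "is")
  then obtain C where C: "C \<ge> 0" "\<And>z. z \<in> polydisc r \<Longrightarrow> (\<forall>j\<in>set is. cmod (vec_nth z j) \<le> r / 2) \<Longrightarrow>
     cmod (f z - coord_expansions n is f z) \<le> C * (\<Sum>j\<in>set is. cmod (vec_nth z j) ^ n)" by auto
  have i: "i \<notin> set is" using Cons.prems by simp
  let ?D = "2 * M / r ^ n + real n * C"
  show ?case
  proof (intro exI[of _ ?D] conjI ballI impI)
    show "0 \<le> ?D" using M0 r C by simp
    fix z assume z: "z \<in> polydisc r" and s: "\<forall>j\<in>set (i # is). cmod (vec_nth z j) \<le> r / 2"
    let ?S = "\<Sum>j\<in>set is. cmod (vec_nth z j) ^ n"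
    have S0: "?S \<ge> 0" by (intro sum_nonneg) simp
    have 1: "cmod (f z - coord_expansion n i f z) \<le> 2 * M / r ^ n * cmod (vec_nth z i) ^ n"
      using coord_expansion_error[OF hol[OF z], where M = M and n = n] M upd_polydisc[OF z] s by (simp add: norm_circ power_divide)
    have "cmod (coord_expansion n i (\<lambda>z. f z - coord_expansions n is f z) z) \<le> real n * (C * ?S)"
    proof (rule coord_expansion_bound[OF _ _ z])
      fix t
      have "(\<Sum>j\<in>set is. cmod (vec_nth (upd z i (circ t)) j) ^ n) = ?S"
        using i by (intro sum.cong) auto
      then show "cmod (f (upd z i (circ t)) - coord_expansions n is f (upd z i (circ t))) \<le> C * ?S"
        using C(2)[of "upd z i (circ t)"] upd_polydisc[OF z, of "circ t" i] s i by (auto simp: norm_circ)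
    qed (use f continuous_on_coord_expansions[OF f] C S0 in \<open>auto intro!: continuous_intros\<close>)
    then have 2: "cmod (coord_expansion n i f z - coord_expansions n (i # is) f z) \<le> real n * (C * ?S)"
      using coord_expansion_diff[OF f continuous_on_coord_expansions[OF f] z] by simp
    have "cmod (f z - coord_expansions n (i # is) f z) \<le> cmod (f z - coord_expansion n i f z) + cmod (coord_expansion n i f z - coord_expansions n (i # is) f z)"
      using norm_triangle_ineq[of "f z - coord_expansion n i f z" "coord_expansion n i f z - coord_expansions n (i # is) f z"] by simp
    also have "\<dots> \<le> 2 * M / r ^ n * cmod (vec_nth z i) ^ n + real n * C * ?S" using 1 2 by (simp add: mult.assoc)
    also have "\<dots> \<le> ?D * cmod (vec_nth z i) ^ n + ?D * ?S"
      using M0 r C S0 by (intro add_mono mult_right_mono) auto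
    finally show "cmod (f z - coord_expansions n (i # is) f z) \<le> ?D * (\<Sum>j\<in>set (i # is). cmod (vec_nth z j) ^ n)"
      using i by (simp add: distrib_left)
  qed
qed

text \<open>Polynomials in the coordinates of S with coefficients that are continuous functions of the
  remaining coordinates; averaging over one more coordinate stays within this class.\<close>

inductive_set PC :: "'d set \<Rightarrow> (complex ^ 'd \<Rightarrow> complex) set" for S where
  PC_base: "continuous_on (polydisc r) c \<Longrightarrow>
    (\<And>z w. z \<in> polydisc r \<Longrightarrow> w \<in> polydisc r \<Longrightarrow> (\<And>j. j \<notin> S \<Longrightarrow> vec_nth z j = vec_nth w j) \<Longrightarrow> c z = c w) \<Longrightarrow> c \<in> PC S"
| PC_add: "f \<in> PC S \<Longrightarrow> g \<in> PC S \<Longrightarrow> (\<lambda>z. f z + g z) \<in> PC S"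
| PC_coord: "f \<in> PC S \<Longrightarrow> j \<in> S \<Longrightarrow> (\<lambda>z. vec_nth z j * f z) \<in> PC S"
| PC_cong: "f \<in> PC S \<Longrightarrow> (\<And>z. z \<in> polydisc r \<Longrightarrow> g z = f z) \<Longrightarrow> g \<in> PC S"

lemma PC_continuous: "f \<in> PC S \<Longrightarrow> continuous_on (polydisc r) f"
proof (induction rule: PC.induct)
  case (PC_base c)
  show ?case by (rule PC_base.hyps(1))
next
  case (PC_add f g)
  then show ?case by (intro continuous_on_add) auto
next
  case (PC_coord f j)
  then show ?case by (intro continuous_on_mult continuous_on_component continuous_on_id) auto
next
  case (PC_cong f g)
  then show ?case using continuous_on_cong[of "polydisc r" "polydisc r" g f] by auto
qed

lemma PC_circle_avg:
  fixes S :: "('d :: finite) set"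
  assumes "f \<in> PC S" "i \<notin> S" shows "circle_avg i k f \<in> PC (insert i S)"
  using assms
proof (induction rule: PC.induct)
  case (PC_base c)
  show ?case
  proof (rule PC.PC_base)
    show "continuous_on (polydisc r) (circle_avg i k c)" by (rule continuous_on_circle_avg[OF PC_base.hyps(1)])
    fix z w assume zw: "z \<in> polydisc r" "w \<in> polydisc r" "\<And>j. j \<notin> insert i S \<Longrightarrow> vec_nth z j = vec_nth w j"
    have "c (upd z i (circ t)) = c (upd w i (circ t))" for t
      using zw by (intro PC_base.hyps(2) upd_polydisc) (auto simp: norm_circ)
    then show "circle_avg i k c z = circle_avg i k c w" by (simp add: circle_avg_def)
  qed
next
  case (PC_add f g)
  have e: "circle_avg i k (\<lambda>z. f z + g z) z = circle_avg i k f z + circle_avg i k g z" if "z \<in> polydisc r" for z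
    unfolding circle_avg_def add_divide_distrib
    by (rule integral_add) (use PC_add.hyps PC_continuous that in \<open>auto intro!: circle_avg_integrable\<close>)
  have m: "(\<lambda>z. circle_avg i k f z + circle_avg i k g z) \<in> PC (insert i S)"
    by (intro PC.PC_add PC_add.IH PC_add.prems)
  show ?case by (rule PC.PC_cong[OF m e])
next
  case (PC_coord f j)
  then have "j \<noteq> i" by auto
  then have e: "circle_avg i k (\<lambda>z. vec_nth z j * f z) z = vec_nth z j * circle_avg i k f z" for z
    by (simp add: circle_avg_def flip: integral_mult_right)
  have m: "(\<lambda>z. vec_nth z j * circle_avg i k f z) \<in> PC (insert i S)"
    by (intro PC.PC_coord PC_coord.IH PC_coord.prems insertI2 PC_coord.hyps)
  show ?case by (rule PC.PC_cong[OF m e])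
next
  case (PC_cong f g)
  have "circle_avg i k g z = circle_avg i k f z" if "z \<in> polydisc r" for z
    unfolding circle_avg_def using PC_cong.hyps(2)[OF upd_polydisc[OF that]] by (simp add: norm_circ)
  then show ?case by (rule PC.PC_cong[OF PC_cong.IH[OF PC_cong.prems]])
qed

lemma PC_pow: "f \<in> PC S \<Longrightarrow> i \<in> S \<Longrightarrow> (\<lambda>z. vec_nth z i ^ k * f z) \<in> PC S"
proof (induction k)
  case (Suc k)
  then have "(\<lambda>z. vec_nth z i * (vec_nth z i ^ k * f z)) \<in> PC S" by (intro PC_coord) auto
  then show ?case by (simp add: mult.assoc)
qed simp

lemma PC_coord_expansion: "f \<in> PC S \<Longrightarrow> i \<notin> S \<Longrightarrow> coord_expansion n i f \<in> PC (insert i S)"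
proof (induction n)
  case 0
  show ?case unfolding coord_expansion_def[abs_def] by (auto intro: PC_base)
next
  case (Suc n)
  have "(\<lambda>z. coord_expansion n i f z + vec_nth z i ^ n * circle_avg i n f z) \<in> PC (insert i S)"
    using Suc by (intro PC_add PC_pow PC_circle_avg) auto
  then show ?case by (simp add: coord_expansion_def[abs_def])
qed

lemma PC_coord_expansions: "continuous_on (polydisc r) f \<Longrightarrow> distinct is \<Longrightarrow> coord_expansions n is f \<in> PC (set is)"
proof (induction "is")
  case Nil
  show ?case
  proof (rule PC_base)
    show "continuous_on (polydisc r) (coord_expansions n [] f)" using Nil by simp
    fix z w :: "complex ^ 'a" assume "\<And>j. j \<notin> set [] \<Longrightarrow> vec_nth z j = vec_nth w j"
    then have "z = w" by (simp add: Finite_Cartesian_Product.vec_eq_iff)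
    then show "coord_expansions n [] f z = coord_expansions n [] f w" by simp
  qed
next
  case (Cons i "is")
  then show ?case using PC_coord_expansion[of "coord_expansions n is f" "set is" i n] by simp
qed

text \<open>With every coordinate in S there is nothing left for the coefficients to depend on: they
  are constants, read off at 0.\<close>

lemma PC_polf: "f \<in> PC UNIV \<Longrightarrow> \<exists>p\<in>polf. \<forall>z\<in>polydisc r. f z = p z"
proof (induction rule: PC.induct)
  case (PC_base c)
  have "(0 :: complex ^ 'd) \<in> polydisc r" using r by (simp add: polydisc_def)
  then have "\<forall>z\<in>polydisc r. c z = c 0" by (intro ballI PC_base.hyps(2)) simp_all
  then show ?case by (intro bexI[of _ "\<lambda>_. c 0"] polf_const) auto
next
  case (PC_add f g)
  then obtain p q where "p \<in> polf" "q \<in> polf" "\<forall>z\<in>polydisc r. f z = p z" "\<forall>z\<in>polydisc r. g z = q z" by auto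
  then show ?case by (intro bexI[of _ "\<lambda>z. p z + q z"] polf_add) auto
next
  case (PC_coord f j)
  then obtain p where "p \<in> polf" "\<forall>z\<in>polydisc r. f z = p z" by auto
  then show ?case by (intro bexI[of _ "\<lambda>z. vec_nth z j * p z"] polf_coord) auto
qed auto

end

lemma norm_le_sum_nth: "norm z \<le> (\<Sum>i\<in>UNIV. cmod (vec_nth z i))" for z :: "complex ^ 'd"
  unfolding norm_vec_def by (rule L2_set_le_sum) simp

text \<open>The order of contact demanded of the polynomial in \<open>fcalc\<close>.\<close>

definition jet_eq :: "nat \<Rightarrow> (complex ^ 'd) \<Rightarrow> (complex ^ 'd \<Rightarrow> complex) \<Rightarrow> (complex ^ 'd \<Rightarrow> complex) \<Rightarrow> bool" where
  "jet_eq n \<mu> f g \<longleftrightarrow> (\<exists>C e. e > 0 \<and> (\<forall>z. norm (z - \<mu>) < e \<longrightarrow> cmod (f z - g z) \<le> C * norm (z - \<mu>) ^ n))"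

text \<open>Holomorphy in a form that can be verified one variable at a time for restrictions of nc
  functions. \<open>holo_on_sepholo\<close> and \<open>sepholo_holo_on\<close> relate it to
  \<open>holo_on\<close>.\<close>

definition sepholo :: "(complex ^ 'd \<Rightarrow> complex) \<Rightarrow> (complex ^ 'd) set \<Rightarrow> bool" where
  "sepholo f U \<longleftrightarrow> continuous_on U f \<and> (\<forall>z\<in>U. \<forall>i. (\<lambda>\<zeta>. f (upd z i \<zeta>)) field_differentiable at (vec_nth z i))"

text \<open>On a closed polydisc around \<mu> the function is bounded, so the iterated expansion
  over all coordinates applies; having no coordinates left, it is a polynomial.\<close>

lemma taylor_polynomial:
  fixes f :: "complex ^ 'd::finite \<Rightarrow> complex"
  assumes U: "open U" "\<mu> \<in> U" and f: "sepholo f U"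
  shows "\<exists>p\<in>polf. jet_eq n \<mu> f p"
proof -
  obtain e where e: "e > 0" "ball \<mu> e \<subseteq> U" using U openE by blast
  \<comment> \<open>The Euclidean norm is at most the sum of the moduli of the coordinates, so a
    polydisc of this radius stays inside the ball of radius e.\<close>
  define r where "r = e / (real CARD('d) + 1)"
  have r: "r > 0" using e by (simp add: r_def)
  define F where "F = (\<lambda>z. f (\<mu> + z))"
  have sub: "\<mu> + z \<in> U" if "z \<in> polydisc r" for z
  proof -
    have "norm z \<le> (\<Sum>i\<in>UNIV. cmod (vec_nth z i))" by (rule norm_le_sum_nth)
    also have "\<dots> \<le> real CARD('d) * r" using that by (intro sum_bounded_above) (simp add: polydisc_def)
    also have "\<dots> < e" using e by (simp add: r_def field_simps)
    finally show ?thesis using e(2) by (auto simp: dist_norm)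
  qed
  have cF: "continuous_on (polydisc r) F"
    unfolding F_def by (rule continuous_on_compose2[of U f]) (use f sub in \<open>auto simp: sepholo_def intro!: continuous_intros\<close>)
  have hol: "(\<lambda>\<zeta>. F (upd z i \<zeta>)) holomorphic_on cball 0 r" if z: "z \<in> polydisc r" for z i
    unfolding holomorphic_on_def
  proof
    fix \<zeta> :: complex assume "\<zeta> \<in> cball 0 r"
    then have u: "upd z i \<zeta> \<in> polydisc r" using upd_polydisc[OF r z] by (simp add: dist_norm)
    have "(\<lambda>\<xi>. f (upd (\<mu> + upd z i \<zeta>) i \<xi>)) field_differentiable at (vec_nth \<mu> i + \<zeta>)"
      using f sub[OF u] unfolding sepholo_def by (auto dest!: bspec spec[of _ i])
    then have "((\<lambda>\<xi>. f (upd (\<mu> + upd z i \<zeta>) i \<xi>)) \<circ> (\<lambda>\<xi>. vec_nth \<mu> i + \<xi>)) field_differentiable at \<zeta>"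
      by (intro field_differentiable_compose) (auto intro!: derivative_intros)
    moreover have "upd (\<mu> + upd z i \<zeta>) i (vec_nth \<mu> i + \<xi>) = \<mu> + upd z i \<xi>" for \<xi>
      by (simp add: Finite_Cartesian_Product.vec_eq_iff)
    ultimately show "(\<lambda>\<zeta>. F (upd z i \<zeta>)) field_differentiable at \<zeta> within cball 0 r"
      by (simp add: o_def F_def field_differentiable_at_within)
  qed
  have "compact (polydisc r :: (complex ^ 'd) set)"
  proof (rule compact_eq_bounded_closed[THEN iffD2], intro conjI)
    show "bounded (polydisc r :: (complex ^ 'd) set)"
      unfolding bounded_iff
    proof (intro exI ballI)
      fix z :: "complex ^ 'd" assume "z \<in> polydisc r"
      then show "norm z \<le> real CARD('d) * r"
        using norm_le_sum_nth[of z] sum_bounded_above[of UNIV "\<lambda>i. cmod (vec_nth z i)" r] by (simp add: polydisc_def)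
    qed
    show "closed (polydisc r :: (complex ^ 'd) set)"
      unfolding polydisc_def by (intro closed_Collect_all closed_Collect_le continuous_intros continuous_on_component)
  qed
  then have "bounded (F ` polydisc r)" using cF compact_continuous_image compact_imp_bounded by blast
  then obtain M where M: "\<And>z. z \<in> polydisc r \<Longrightarrow> cmod (F z) \<le> M" "M \<ge> 0"
    unfolding bounded_pos by (metis imageI less_imp_le)
  obtain js :: "'d list" where js: "set js = UNIV" "distinct js" using finite_distinct_list[OF finite[of "UNIV :: 'd set"]] by blast
  obtain C where C: "C \<ge> 0" "\<And>z. z \<in> polydisc r \<Longrightarrow> (\<forall>j. cmod (vec_nth z j) \<le> r / 2) \<Longrightarrow>
     cmod (F z - coord_expansions r n js F z) \<le> C * (\<Sum>j\<in>UNIV. cmod (vec_nth z j) ^ n)"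
    using coord_expansions_error[OF r cF hol M js(2), of n] js(1) by auto
  obtain p where p: "p \<in> polf" "\<And>z. z \<in> polydisc r \<Longrightarrow> coord_expansions r n js F z = p z"
    using PC_polf[OF r PC_coord_expansions[OF r cF js(2), of n, unfolded js(1)]] by blast
  show ?thesis
  proof (intro bexI[of _ "\<lambda>z. p (z - \<mu>)"] polf_shift p(1))
    show "jet_eq n \<mu> f (\<lambda>z. p (z - \<mu>))"
      unfolding jet_eq_def
    proof (intro exI conjI allI impI)
      show "r / 2 > 0" using r by simp
      fix z assume z: "norm (z - \<mu>) < r / 2"
      have le: "cmod (vec_nth (z - \<mu>) j) \<le> norm (z - \<mu>)" for j by (rule Finite_Cartesian_Product.norm_nth_le)
      have le': "cmod (vec_nth (z - \<mu>) j) \<le> r / 2" for j using le[of j] z by linarith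
      have P: "z - \<mu> \<in> polydisc r" unfolding polydisc_def mem_Collect_eq
      proof
        fix j show "cmod (vec_nth (z - \<mu>) j) \<le> r" using le'[of j] r by linarith
      qed
      have "cmod (F (z - \<mu>) - p (z - \<mu>)) \<le> C * (\<Sum>j\<in>UNIV. cmod (vec_nth (z - \<mu>) j) ^ n)"
        using C(2)[OF P] le' p(2)[OF P] by simp
      also have "\<dots> \<le> C * (\<Sum>j\<in>(UNIV::'d set). norm (z - \<mu>) ^ n)"
        using le C by (intro mult_left_mono sum_mono power_mono) auto
      finally show "cmod (f z - p (z - \<mu>)) \<le> C * real CARD('d) * norm (z - \<mu>) ^ n"
        by (simp add: F_def mult.assoc)
    qed
  qed
qed

section \<open>The functional calculus\<close>

definition wmon :: "'d list \<Rightarrow> complex ^ 'd \<Rightarrow> complex" where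
  "wmon w z = prod_list (map (vec_nth z) w)"

lemma scal_mtuple: "is_mtuple 1 (scal z)"
  by (simp add: is_mtuple_def scal_def)

lemma scal_dim [simp]: "dim_row (scal z i) = Suc 0" "dim_col (scal z i) = Suc 0"
  by (simp_all add: scal_def)

lemma word_eval_scal_dim [simp]:
  "dim_row (word_eval (Suc 0) (scal z) w) = Suc 0" "dim_col (word_eval (Suc 0) (scal z) w) = Suc 0"
  using word_eval_dim[OF scal_mtuple] by auto

lemma word_eval_scal: "word_eval 1 (scal z) w $$ (0, 0) = wmon w z"
proof (induction w)
  case (Cons i w)
  have "word_eval 1 (scal z) (i # w) $$ (0,0) = (\<Sum>k<1. scal z i $$ (0, k) * word_eval 1 (scal z) w $$ (k, 0))"
    unfolding word_eval_Cons
    by (subst mat_mult_index) auto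
  then show ?case using Cons by (simp add: wmon_def scal_def)
qed (simp add: wmon_def)

lemma fp_scalar_eq: "fp_scalar p z = (\<Sum>w\<in>{w. p w \<noteq> 0}. p w * wmon w z)"
  by (simp add: fp_scalar_def fp_eval_def word_eval_scal[unfolded One_nat_def])

lemma fp_scalar_superset:
  assumes "finite A" "{w. p w \<noteq> 0} \<subseteq> A"
  shows "fp_scalar p z = (\<Sum>w\<in>A. p w * wmon w z)"
  unfolding fp_scalar_eq by (rule sum.mono_neutral_left) (use assms in auto)

text \<open>Multiplication by a coordinate prepends its letter to all words. Any order of the
  letters would do, as scalars commute.\<close>

lemma polf_fpoly: "g \<in> polf \<Longrightarrow> \<exists>p. is_fpoly p \<and> fp_scalar p = g"
proof (induction rule: polf.induct)
  case (polf_const c)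
  let ?p = "\<lambda>w. if w = [] then c else 0"
  have "{w. ?p w \<noteq> 0} \<subseteq> {[]}" by auto
  then have "is_fpoly ?p" "fp_scalar ?p = (\<lambda>_. c)"
    using finite_subset[of "{w. ?p w \<noteq> 0}" "{[]}"] fp_scalar_superset[of "{[]}" ?p]
    by (auto simp: is_fpoly_def wmon_def)
  then show ?case by blast
next
  case (polf_add f g)
  then obtain p q where p: "is_fpoly p" "fp_scalar p = f" and q: "is_fpoly q" "fp_scalar q = g" by blast
  let ?A = "{w. p w \<noteq> 0} \<union> {w. q w \<noteq> 0}"
  have A: "finite ?A" using p q by (simp add: is_fpoly_def)
  have s: "{w. p w + q w \<noteq> 0} \<subseteq> ?A" by auto
  have "fp_scalar (\<lambda>w. p w + q w) z = f z + g z" for z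
    using fp_scalar_superset[OF A s, of z] fp_scalar_superset[OF A, of p z] fp_scalar_superset[OF A, of q z] p q
    by (auto simp: sum.distrib distrib_right)
  moreover have "is_fpoly (\<lambda>w. p w + q w)" unfolding is_fpoly_def using finite_subset[OF s A] .
  ultimately show ?case by blast
next
  case (polf_coord f j)
  then obtain p where p: "is_fpoly p" "fp_scalar p = f" by blast
  define q where "q w = (case w of [] \<Rightarrow> 0 | i # u \<Rightarrow> if i = j then p u else 0)" for w
  have s: "{w. q w \<noteq> 0} = (#) j ` {w. p w \<noteq> 0}"
  proof (rule Set.set_eqI)
    fix w show "w \<in> {w. q w \<noteq> 0} \<longleftrightarrow> w \<in> (#) j ` {w. p w \<noteq> 0}" by (cases w) (auto simp: q_def)
  qed
  have "fp_scalar q z = vec_nth z j * f z" for z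
    unfolding fp_scalar_eq s p(2)[symmetric]
    by (subst sum.reindex) (auto simp: q_def wmon_def sum_distrib_left mult_ac)
  moreover have "is_fpoly q" using p(1) unfolding is_fpoly_def s by simp
  ultimately show ?case by blast
qed

section \<open>Jets: order of vanishing at a point\<close>

definition jet0 :: "nat \<Rightarrow> (complex ^ 'd) \<Rightarrow> (complex ^ 'd \<Rightarrow> complex) \<Rightarrow> bool" where
  "jet0 n \<mu> g \<longleftrightarrow> (\<exists>C e. e > 0 \<and> (\<forall>z. norm (z - \<mu>) < e \<longrightarrow> cmod (g z) \<le> C * norm (z - \<mu>) ^ n))"

lemma jet_eq_jet0: "jet_eq n \<mu> f g \<longleftrightarrow> jet0 n \<mu> (\<lambda>z. f z - g z)"
  by (simp add: jet_eq_def jet0_def)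

lemma jet0_add:
  assumes "jet0 n \<mu> f" "jet0 n \<mu> g" shows "jet0 n \<mu> (\<lambda>z. f z + g z)"
proof -
  obtain C e where 1: "e > 0" "\<And>z. norm (z - \<mu>) < e \<Longrightarrow> cmod (f z) \<le> C * norm (z - \<mu>) ^ n"
    using assms(1) by (auto simp: jet0_def)
  obtain D d where 2: "d > 0" "\<And>z. norm (z - \<mu>) < d \<Longrightarrow> cmod (g z) \<le> D * norm (z - \<mu>) ^ n"
    using assms(2) by (auto simp: jet0_def)
  show ?thesis unfolding jet0_def
  proof (intro exI conjI allI impI)
    show "min e d > 0" using 1 2 by simp
    fix z assume "norm (z - \<mu>) < min e d"
    then show "cmod (f z + g z) \<le> (C + D) * norm (z - \<mu>) ^ n"
      using 1(2)[of z] 2(2)[of z] norm_triangle_ineq[of "f z" "g z"] by (simp add: distrib_right)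
  qed
qed

lemma jet0_zero: "jet0 n \<mu> (\<lambda>_. 0)"
  unfolding jet0_def by (intro exI[of _ 0] exI[of _ 1]) auto

lemma jet0_sum: "finite A \<Longrightarrow> (\<And>a. a \<in> A \<Longrightarrow> jet0 n \<mu> (f a)) \<Longrightarrow> jet0 n \<mu> (\<lambda>z. \<Sum>a\<in>A. f a z)"
  by (induction A rule: finite_induct) (auto intro: jet0_zero jet0_add)

lemma jet0_mult:
  assumes "jet0 n \<mu> f" "jet0 m \<mu> g" shows "jet0 (n + m) \<mu> (\<lambda>z. f z * g z)"
proof -
  obtain C e where 1: "e > 0" "\<And>z. norm (z - \<mu>) < e \<Longrightarrow> cmod (f z) \<le> C * norm (z - \<mu>) ^ n"
    using assms(1) by (auto simp: jet0_def)
  obtain D d where 2: "d > 0" "\<And>z. norm (z - \<mu>) < d \<Longrightarrow> cmod (g z) \<le> D * norm (z - \<mu>) ^ m"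
    using assms(2) by (auto simp: jet0_def)
  show ?thesis unfolding jet0_def
  proof (intro exI conjI allI impI)
    show "min e d > 0" using 1 2 by simp
    fix z assume z: "norm (z - \<mu>) < min e d"
    have "cmod (f z * g z) \<le> (C * norm (z - \<mu>) ^ n) * (D * norm (z - \<mu>) ^ m)"
      unfolding norm_mult using 1(2)[of z] 2(2)[of z] z
      by (intro mult_mono) (auto intro: order_trans[OF norm_ge_zero])
    then show "cmod (f z * g z) \<le> (C * D) * norm (z - \<mu>) ^ (n + m)" by (simp add: power_add mult_ac)
  qed
qed

lemma jet0_power: "jet0 m \<mu> f \<Longrightarrow> jet0 (m * n) \<mu> (\<lambda>z. f z ^ n)"
proof (induction n)
  case 0
  show ?case unfolding jet0_def by (intro exI[of _ 1] conjI) auto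
next
  case (Suc n)
  from jet0_mult[OF Suc.prems Suc.IH[OF Suc.prems]] show ?case by simp
qed

lemma polf_lipschitz: "h \<in> polf \<Longrightarrow> \<exists>C\<ge>0. \<forall>z. norm (z - \<mu>) < 1 \<longrightarrow> cmod (h z - h \<mu>) \<le> C * norm (z - \<mu>)"
proof (induction rule: polf.induct)
  case (polf_const c)
  show ?case by (intro exI[of _ 0]) simp
next
  case (polf_add f g)
  then obtain C D where C: "C \<ge> 0" "\<And>z. norm (z - \<mu>) < 1 \<Longrightarrow> cmod (f z - f \<mu>) \<le> C * norm (z - \<mu>)"
    and D: "D \<ge> 0" "\<And>z. norm (z - \<mu>) < 1 \<Longrightarrow> cmod (g z - g \<mu>) \<le> D * norm (z - \<mu>)" by blast
  show ?case
  proof (intro exI[of _ "C + D"] conjI allI impI)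
    fix z assume "norm (z - \<mu>) < 1"
    then show "cmod (f z + g z - (f \<mu> + g \<mu>)) \<le> (C + D) * norm (z - \<mu>)"
      using C(2)[of z] D(2)[of z] norm_triangle_ineq[of "f z - f \<mu>" "g z - g \<mu>"] by (simp add: algebra_simps)
  qed (use C D in simp)
next
  case (polf_coord f j)
  then obtain C where C: "C \<ge> 0" "\<And>z. norm (z - \<mu>) < 1 \<Longrightarrow> cmod (f z - f \<mu>) \<le> C * norm (z - \<mu>)" by blast
  show ?case
  proof (intro exI[of _ "(norm \<mu> + 1) * C + cmod (f \<mu>)"] conjI allI impI)
    fix z assume z: "norm (z - \<mu>) < 1"
    have "cmod (vec_nth z j) \<le> norm z" by (rule Finite_Cartesian_Product.norm_nth_le)
    also have "\<dots> \<le> norm \<mu> + 1" using z norm_triangle_ineq[of \<mu> "z - \<mu>"] by simp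
    finally have 1: "cmod (vec_nth z j) \<le> norm \<mu> + 1" .
    have 2: "cmod (vec_nth z j - vec_nth \<mu> j) \<le> norm (z - \<mu>)"
      using Finite_Cartesian_Product.norm_nth_le[of "z - \<mu>" j] by simp
    have "cmod (vec_nth z j * f z - vec_nth \<mu> j * f \<mu>) = cmod (vec_nth z j * (f z - f \<mu>) + (vec_nth z j - vec_nth \<mu> j) * f \<mu>)"
      by (simp add: algebra_simps)
    also have "\<dots> \<le> cmod (vec_nth z j) * cmod (f z - f \<mu>) + cmod (vec_nth z j - vec_nth \<mu> j) * cmod (f \<mu>)"
      by (metis norm_mult norm_triangle_ineq)
    also have "\<dots> \<le> (norm \<mu> + 1) * (C * norm (z - \<mu>)) + norm (z - \<mu>) * cmod (f \<mu>)"
      using 1 2 C(2)[OF z] by (intro add_mono mult_mono mult_right_mono) auto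
    finally show "cmod (vec_nth z j * f z - vec_nth \<mu> j * f \<mu>) \<le> ((norm \<mu> + 1) * C + cmod (f \<mu>)) * norm (z - \<mu>)"
      by (simp add: algebra_simps)
  qed (use C in simp)
qed

lemma polf_jet0_1:
  assumes "h \<in> polf" "h \<mu> = 0" shows "jet0 1 \<mu> h"
proof -
  obtain C where "\<And>z. norm (z - \<mu>) < 1 \<Longrightarrow> cmod (h z - h \<mu>) \<le> C * norm (z - \<mu>)"
    using polf_lipschitz[OF assms(1)] by blast
  then show ?thesis unfolding jet0_def using assms(2) by (intro exI[of _ C] exI[of _ 1]) auto
qed

lemma polf_jet0_0:
  assumes "h \<in> polf" shows "jet0 0 \<mu> h"
proof -
  obtain C where C: "C \<ge> 0" "\<And>z. norm (z - \<mu>) < 1 \<Longrightarrow> cmod (h z - h \<mu>) \<le> C * norm (z - \<mu>)"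
    using polf_lipschitz[OF assms] by blast
  show ?thesis unfolding jet0_def
  proof (rule exI[of _ "C + cmod (h \<mu>)"], rule exI[of _ 1], intro conjI allI impI)
    fix z assume z: "norm (z - \<mu>) < 1"
    have "C * norm (z - \<mu>) \<le> C * 1" using C z by (intro mult_left_mono) auto
    then show "cmod (h z) \<le> (C + cmod (h \<mu>)) * norm (z - \<mu>) ^ 0"
      using C(2)[OF z] norm_triangle_ineq[of "h z - h \<mu>" "h \<mu>"] by simp
  qed simp
qed

lemma jet0_mult_polf: "jet0 n \<mu> f \<Longrightarrow> h \<in> polf \<Longrightarrow> jet0 n \<mu> (\<lambda>z. f z * h z)"
  using jet0_mult[OF _ polf_jet0_0, of n \<mu> f h] by simp

lemma jet0_uminus: "jet0 n \<mu> f \<Longrightarrow> jet0 n \<mu> (\<lambda>z. - f z)"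
  by (simp add: jet0_def)

text \<open>Take l affine with l(\<mu>) = 1 and l(\<nu>) = 0, and e = 1 - (1 - l^n)^n. At \<mu> the
  factor 1 - l^n vanishes, so 1 - e vanishes to order n; and e is divisible by l^n, which vanishes
  to order n at \<nu>.\<close>

lemma separating_polynomial:
  assumes "\<mu> \<noteq> \<nu>"
  shows "\<exists>e\<in>polf. jet0 n \<mu> (\<lambda>z. 1 - e z) \<and> jet0 n \<nu> e"
proof -
  obtain i where i: "vec_nth \<mu> i \<noteq> vec_nth \<nu> i" using assms by (auto simp: Finite_Cartesian_Product.vec_eq_iff)
  define l where "l z = (vec_nth z i - vec_nth \<nu> i) * inverse (vec_nth \<mu> i - vec_nth \<nu> i)" for z
  have l: "l \<in> polf" unfolding l_def[abs_def] by (intro polf_mult polf_diff polf_nth polf_const)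
  have lv: "l \<mu> = 1" "l \<nu> = 0" using i by (auto simp: l_def)
  have b: "(\<lambda>z. 1 - l z ^ n) \<in> polf" by (intro polf_diff polf_const polf_power l)
  have e: "(\<lambda>z. 1 - (1 - l z ^ n) ^ n) \<in> polf" by (intro polf_diff polf_const polf_power b)
  have 1: "jet0 n \<mu> (\<lambda>z. (1 - l z ^ n) ^ n)"
    using jet0_power[OF polf_jet0_1[OF b, of \<mu>], of n] lv by simp
  have "jet0 n \<nu> (\<lambda>z. l z ^ n)" using jet0_power[OF polf_jet0_1[OF l, of \<nu>], of n] lv by simp
  then have "jet0 n \<nu> (\<lambda>z. l z ^ n * (\<Sum>k<n. (1 - l z ^ n) ^ k))"
    by (intro jet0_mult_polf polf_sum polf_power b) auto
  moreover have "1 - (1 - l z ^ n) ^ n = l z ^ n * (\<Sum>k<n. (1 - l z ^ n) ^ k)" for z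
    using one_diff_power_eq[of "1 - l z ^ n" n] by simp
  ultimately have 2: "jet0 n \<nu> (\<lambda>z. 1 - (1 - l z ^ n) ^ n)" by presburger
  show ?thesis using e 1 2 by (intro bexI[OF _ e]) auto
qed

text \<open>The products \<open>q \<mu>\<close> of separating polynomials form a partition of unity
  at the level of jets: \<open>q \<mu>\<close> is 1 at \<mu> and 0 at the other points, each time to
  order n. They glue the prescribed polynomials.\<close>

lemma hermite_interpolation:
  fixes P :: "complex ^ 'd \<Rightarrow> complex ^ 'd \<Rightarrow> complex"
  assumes "finite \<Lambda>" "\<And>\<mu>. \<mu> \<in> \<Lambda> \<Longrightarrow> P \<mu> \<in> polf"
  shows "\<exists>p\<in>polf. \<forall>\<mu>\<in>\<Lambda>. jet0 n \<mu> (\<lambda>z. P \<mu> z - p z)"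
proof -
  define e where "e \<mu> \<nu> = (SOME e. e \<in> polf \<and> jet0 n \<mu> (\<lambda>z. 1 - e z) \<and> jet0 n \<nu> e)" for \<mu> \<nu> :: "complex ^ 'd"
  have e: "e \<mu> \<nu> \<in> polf \<and> jet0 n \<mu> (\<lambda>z. 1 - e \<mu> \<nu> z) \<and> jet0 n \<nu> (e \<mu> \<nu>)" if "\<mu> \<noteq> \<nu>" for \<mu> \<nu>
  proof -
    have "\<exists>e. e \<in> polf \<and> jet0 n \<mu> (\<lambda>z. 1 - e z) \<and> jet0 n \<nu> e"
      using separating_polynomial[OF that, of n] by blast
    from someI_ex[OF this] show ?thesis unfolding e_def .
  qed
  define q where "q \<mu> z = (\<Prod>\<nu>\<in>\<Lambda> - {\<mu>}. e \<mu> \<nu> z)" for \<mu> z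
  have q: "q \<mu> \<in> polf" for \<mu> unfolding q_def[abs_def] using assms(1) e by (intro polf_prod) auto
  have q1: "jet0 n \<mu> (\<lambda>z. 1 - q \<mu> z)" for \<mu>
  proof -
    have "finite A \<Longrightarrow> \<mu> \<notin> A \<Longrightarrow> jet0 n \<mu> (\<lambda>z. 1 - (\<Prod>\<nu>\<in>A. e \<mu> \<nu> z))" for A
    proof (induction A rule: finite_induct)
      case (insert \<nu> A)
      have "jet0 n \<mu> (\<lambda>z. (1 - e \<mu> \<nu> z) + (1 - (\<Prod>\<nu>\<in>A. e \<mu> \<nu> z)) * e \<mu> \<nu> z)"
        using insert e[of \<mu> \<nu>] by (intro jet0_add jet0_mult_polf) auto
      then show ?case using insert by (simp add: algebra_simps)
    qed (simp add: jet0_zero)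
    then show ?thesis using assms(1) by (simp add: q_def)
  qed
  have q2: "jet0 n \<mu> (q \<nu>)" if "\<mu> \<in> \<Lambda>" "\<mu> \<noteq> \<nu>" for \<mu> \<nu>
  proof -
    have "q \<nu> z = e \<nu> \<mu> z * (\<Prod>\<kappa>\<in>\<Lambda> - {\<nu>} - {\<mu>}. e \<nu> \<kappa> z)" for z
      unfolding q_def by (rule prod.remove) (use assms that in auto)
    then have "q \<nu> = (\<lambda>z. e \<nu> \<mu> z * (\<Prod>\<kappa>\<in>\<Lambda> - {\<nu>} - {\<mu>}. e \<nu> \<kappa> z))" by auto
    moreover have "jet0 n \<mu> (\<lambda>z. e \<nu> \<mu> z * (\<Prod>\<kappa>\<in>\<Lambda> - {\<nu>} - {\<mu>}. e \<nu> \<kappa> z))"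
      using that e[of \<nu> \<mu>] assms(1) e by (intro jet0_mult_polf polf_prod) auto
    ultimately show ?thesis by simp
  qed
  define p where "p z = (\<Sum>\<mu>\<in>\<Lambda>. q \<mu> z * P \<mu> z)" for z
  show ?thesis
  proof (intro bexI[of _ p] ballI)
    show "p \<in> polf" unfolding p_def[abs_def] using assms q by (intro polf_sum polf_mult) auto
    fix \<mu> assume \<mu>: "\<mu> \<in> \<Lambda>"
    have "P \<mu> z - p z = (1 - q \<mu> z) * P \<mu> z + - (\<Sum>\<nu>\<in>\<Lambda> - {\<mu>}. q \<nu> z * P \<nu> z)" for z
      unfolding p_def using sum.remove[OF assms(1) \<mu>, of "\<lambda>\<mu>. q \<mu> z * P \<mu> z"] by (simp add: algebra_simps)
    moreover have "jet0 n \<mu> (\<lambda>z. (1 - q \<mu> z) * P \<mu> z + - (\<Sum>\<nu>\<in>\<Lambda> - {\<mu>}. q \<nu> z * P \<nu> z))"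
      using assms \<mu> q1 q2 by (intro jet0_add jet0_uminus jet0_sum jet0_mult_polf) auto
    ultimately show "jet0 n \<mu> (\<lambda>z. P \<mu> z - p z)" by simp
  qed
qed

text \<open>Each coordinate of a joint eigenvalue is an eigenvalue of the corresponding
  matrix.\<close>

lemma finite_jspec:
  assumes "is_mtuple n T" shows "finite (jspec n T :: (complex ^ 'd::finite) set)"
proof -
  have "finite (PiE UNIV (\<lambda>i. spectrum (T i)))"
    using assms by (intro finite_PiE) (auto simp: is_mtuple_def intro: card_finite_spectrum)
  moreover have "jspec n T \<subseteq> vec_lambda ` (PiE UNIV (\<lambda>i. spectrum (T i)))"
  proof
    fix \<mu> :: "complex ^ 'd" assume "\<mu> \<in> jspec n T"
    then obtain v where v: "v \<in> carrier_vec n" "v \<noteq> 0\<^sub>v n" "\<And>i. T i *\<^sub>v v = vec_nth \<mu> i \<cdot>\<^sub>v v"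
      by (auto simp: jspec_def)
    have "vec_nth \<mu> i \<in> spectrum (T i)" for i
      using v is_mtuple_dim[OF assms, of i] by (auto simp: spectrum_def eigenvalue_def eigenvector_def)
    then show "\<mu> \<in> vec_lambda ` (PiE UNIV (\<lambda>i. spectrum (T i)))"
      by (intro image_eqI[of _ _ "vec_nth \<mu>"]) auto
  qed
  ultimately show ?thesis using finite_subset by blast
qed

text \<open>A polynomial with the required jets exists, so the choice inside \<open>fcalc\<close>
  picks one. Norm estimates are later proved from the jets alone and therefore hold for the chosen
  polynomial.\<close>

lemma fcalc_poly:
  fixes f :: "complex ^ 'd::finite \<Rightarrow> complex"
  assumes U: "open U" "sepholo f U" and T: "is_mtuple n T" "jspec n T \<subseteq> U"
  shows "\<exists>p. is_fpoly p \<and> (\<forall>\<mu>\<in>jspec n T. jet0 n \<mu> (\<lambda>z. f z - fp_scalar p z)) \<and> fcalc n f T = fp_eval n p T"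
proof -
  have "\<forall>\<mu>\<in>jspec n T. \<exists>p\<in>polf. jet_eq n \<mu> f p" using taylor_polynomial[OF U(1) _ U(2)] T by blast
  then obtain P where P: "\<And>\<mu>. \<mu> \<in> jspec n T \<Longrightarrow> P \<mu> \<in> polf" "\<And>\<mu>. \<mu> \<in> jspec n T \<Longrightarrow> jet0 n \<mu> (\<lambda>z. f z - P \<mu> z)"
    unfolding jet_eq_jet0 by metis
  obtain p where p: "p \<in> polf" "\<And>\<mu>. \<mu> \<in> jspec n T \<Longrightarrow> jet0 n \<mu> (\<lambda>z. P \<mu> z - p z)"
    using hermite_interpolation[OF finite_jspec[OF T(1)], where n = n and P = P] P(1) by blast
  obtain q where q: "is_fpoly q" "fp_scalar q = p" using polf_fpoly[OF p(1)] by blast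
  have "jet0 n \<mu> (\<lambda>z. f z - fp_scalar q z)" if "\<mu> \<in> jspec n T" for \<mu>
    using jet0_add[OF P(2)[OF that] p(2)[OF that]] q by simp
  with q(1) have ex: "\<exists>p. is_fpoly p \<and> (\<forall>\<mu>\<in>jspec n T. \<exists>C e. e > 0 \<and>
      (\<forall>z. norm (z - \<mu>) < e \<longrightarrow> cmod (f z - fp_scalar p z) \<le> C * norm (z - \<mu>) ^ n))"
    by (auto simp: jet0_def)
  show ?thesis using someI_ex[OF ex] unfolding fcalc_def jet0_def by blast
qed

lemma open_Ucom: "open (Ucom a b \<delta> :: (complex ^ 'd::finite) set)"
proof (subst open_subopen, intro ballI)
  fix z :: "complex ^ 'd" assume z: "z \<in> Ucom a b \<delta>"
  have "tconv 1 scal (scal z) (nhds z)"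
    unfolding tconv_def using scal_mtuple by (auto simp: scal_def intro: tendsto_vec_nth filterlim_ident)
  from Gd_open[OF this] z have "eventually (\<lambda>w. w \<in> Ucom a b \<delta>) (nhds z)" by (simp add: Ucom_def)
  then show "\<exists>T. open T \<and> z \<in> T \<and> T \<subseteq> Ucom a b \<delta>" unfolding eventually_nhds by blast
qed

lemma holo_on_sepholo:
  fixes f :: "complex ^ 'd::finite \<Rightarrow> complex"
  assumes "holo_on f U" shows "sepholo f U"
  unfolding sepholo_def
proof (intro conjI ballI allI)
  show "continuous_on U f"
    using assms unfolding holo_on_def
    by (intro continuous_at_imp_continuous_on ballI) (blast intro: has_derivative_continuous)
  fix z i assume z: "z \<in> U"
  then obtain L where L: "(f has_derivative L) (at z)" "\<And>c w. L (\<chi> i. c * vec_nth w i) = c * L w"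
    using assms by (auto simp: holo_on_def)
  define g :: "complex \<Rightarrow> complex ^ 'd" where "g c = (\<chi> j. if j = i then c else 0)" for c
  have "linear g" by (rule linearI) (auto simp: g_def Finite_Cartesian_Product.vec_eq_iff)
  then have "bounded_linear g" by (simp add: linear_conv_bounded_linear)
  then have "(g has_derivative g) (at (vec_nth z i))" by (rule bounded_linear_imp_has_derivative)
  then have "((\<lambda>\<zeta>. upd z i 0 + g \<zeta>) has_derivative g) (at (vec_nth z i))"
    by (auto intro!: derivative_eq_intros)
  moreover have "(\<lambda>\<zeta>. upd z i 0 + g \<zeta>) = upd z i"
    by (rule ext) (simp add: g_def Finite_Cartesian_Product.vec_eq_iff)
  ultimately have "(upd z i has_derivative g) (at (vec_nth z i))" by (simp only:)
  then have "(f \<circ> upd z i has_derivative L \<circ> g) (at (vec_nth z i))"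
    by (rule diff_chain_at) (simp add: L(1))
  moreover have "L (g c) = c * L (g 1)" for c
  proof -
    have "g c = (\<chi> j. c * vec_nth (g 1) j)" by (simp add: g_def Finite_Cartesian_Product.vec_eq_iff)
    then show ?thesis using L(2)[of c "g 1"] by simp
  qed
  then have "L \<circ> g = (*) (L (g 1))" by (intro ext) (metis comp_apply mult.commute)
  ultimately have "(f \<circ> upd z i has_field_derivative L (g 1)) (at (vec_nth z i))"
    unfolding has_field_derivative_def by (simp only:)
  then show "(\<lambda>\<zeta>. f (upd z i \<zeta>)) field_differentiable at (vec_nth z i)"
    by (auto simp: field_differentiable_def o_def)
qed

lemma polf_has_derivative:
  "h \<in> polf \<Longrightarrow> \<exists>L. (h has_derivative L) (at z) \<and> (\<forall>c w. L (\<chi> i. c * vec_nth w i) = c * L w)"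
  for h :: "complex ^ 'd::finite \<Rightarrow> complex"
proof (induction rule: polf.induct)
  case (polf_const c)
  show ?case by (intro exI[of _ "\<lambda>_. 0"]) auto
next
  case (polf_add f g)
  then obtain L M where "(f has_derivative L) (at z)" "\<forall>c w. L (\<chi> i. c * vec_nth w i) = c * L w"
    "(g has_derivative M) (at z)" "\<forall>c w. M (\<chi> i. c * vec_nth w i) = c * M w" by blast
  then show ?case by (intro exI[of _ "\<lambda>w. L w + M w"]) (auto intro!: derivative_eq_intros simp: distrib_left)
next
  case (polf_coord f j)
  then obtain L where L: "(f has_derivative L) (at z)" "\<forall>c w. L (\<chi> i. c * vec_nth w i) = c * L w" by blast
  have "((\<lambda>z. vec_nth z j) has_derivative (\<lambda>w. vec_nth w j)) (at z)"
    by (rule bounded_linear_imp_has_derivative) (rule bounded_linear_vec_nth)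
  from has_derivative_mult[OF this L(1)] L(2) show ?case
    by (intro exI[of _ "\<lambda>w. vec_nth z j * L w + vec_nth w j * f z"]) (auto simp: algebra_simps)
qed

text \<open>Osgood's lemma: f differs from a Taylor polynomial of second order contact by a
  quadratic error, so f inherits the complex linear derivative of that polynomial.\<close>

lemma sepholo_holo_on:
  fixes f :: "complex ^ 'd::finite \<Rightarrow> complex"
  assumes "open U" "sepholo f U" shows "holo_on f U"
  unfolding holo_on_def
proof
  fix z assume "z \<in> U"
  then obtain p where p: "p \<in> polf" "jet0 2 z (\<lambda>w. f w - p w)"
    using taylor_polynomial[OF assms(1) _ assms(2), of z 2] by (auto simp: jet_eq_jet0)
  obtain L where L: "(p has_derivative L) (at z)" "\<And>c w. L (\<chi> i. c * vec_nth w i) = c * L w"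
    using polf_has_derivative[OF p(1)] by blast
  obtain C e where C: "e > 0" "\<And>w. norm (w - z) < e \<Longrightarrow> cmod (f w - p w) \<le> C * norm (w - z) ^ 2"
    using p(2) by (auto simp: jet0_def)
  have z0: "f z - p z = 0" using C(2)[of z] C(1) by simp
  have "((\<lambda>w. f w - p w) has_derivative (\<lambda>_. 0)) (at z)"
    unfolding has_derivative_at_alt
  proof (intro conjI allI impI)
    fix \<epsilon> :: real assume \<epsilon>: "\<epsilon> > 0"
    define d where "d = min e (\<epsilon> / (\<bar>C\<bar> + 1))"
    have d: "d > 0" using \<epsilon> C by (simp add: d_def)
    show "\<exists>d>0. \<forall>y. norm (y - z) < d \<longrightarrow> norm (f y - p y - (f z - p z) - 0) \<le> \<epsilon> * norm (y - z)"
    proof (intro exI[of _ d] conjI allI impI d)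
      fix y assume y: "norm (y - z) < d"
      have "C * norm (y - z) \<le> (\<bar>C\<bar> + 1) * norm (y - z)" by (intro mult_right_mono) auto
      also have "\<dots> \<le> (\<bar>C\<bar> + 1) * (\<epsilon> / (\<bar>C\<bar> + 1))" using y by (intro mult_left_mono) (auto simp: d_def)
      also have "\<dots> = \<epsilon>" by simp
      finally have "C * norm (y - z) * norm (y - z) \<le> \<epsilon> * norm (y - z)" by (intro mult_right_mono) auto
      moreover have "cmod (f y - p y) \<le> C * norm (y - z) ^ 2" using C(2) y by (simp add: d_def)
      ultimately show "norm (f y - p y - (f z - p z) - 0) \<le> \<epsilon> * norm (y - z)" using z0 by (simp add: power2_eq_square)
    qed
  qed simp
  from has_derivative_add[OF this L(1)] have "(f has_derivative L) (at z)" by simp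
  with L(2) show "\<exists>L. (f has_derivative L) (at z) \<and> (\<forall>c w. L (\<chi> i. c * vec_nth w i) = c * L w)" by blast
qed

section \<open>Holomorphy of scalar restrictions\<close>

text \<open>At an upper triangular 2 x 2 tuple with diagonal z, \<open>upd z i \<zeta>\<close> and
  corner e in the variable i, the corner of \<phi> is e times the difference quotient. Continuity of
  \<phi> at \<zeta> = z i supplies the derivative; a small e keeps the tuple in the domain.\<close>

lemma nc_scal_sepholo:
  fixes \<phi> :: "('d::finite) mtuple \<Rightarrow> complex mat"
  assumes nc: "is_nc_fun a b \<delta> \<phi>" and C: "\<And>Z. Z \<in> Gall a b \<delta> \<Longrightarrow> opnorm (\<phi> Z) \<le> C"
  shows "sepholo (\<lambda>z. \<phi> (scal z) $$ (0, 0)) (Ucom a b \<delta>)"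
  unfolding sepholo_def
proof (intro conjI ballI allI)
  show "continuous_on (Ucom a b \<delta>) (\<lambda>z. \<phi> (scal z) $$ (0, 0))"
    unfolding continuous_on_def
  proof
    fix z :: "complex ^ 'd" assume z: "z \<in> Ucom a b \<delta>"
    have "tconv 1 scal (scal z) (at z within Ucom a b \<delta>)"
      unfolding tconv_def using scal_mtuple by (auto simp: scal_def intro: tendsto_vec_nth)
    from nc_continuous[OF nc C _ this] z
    show "((\<lambda>z. \<phi> (scal z) $$ (0, 0)) \<longlongrightarrow> \<phi> (scal z) $$ (0, 0)) (at z within Ucom a b \<delta>)"
      by (simp add: Ucom_def)
  qed
  fix z :: "complex ^ 'd" and i assume z: "z \<in> Ucom a b \<delta>"
  then have zG: "scal z \<in> Gd a b \<delta> 1" by (simp add: Ucom_def)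
  define W where "W e \<zeta> j = mat 2 2 (\<lambda>(r, c). if r = 0 then (if c = 0 then vec_nth z j else if j = i then e else 0)
     else if c = 0 then 0 else vec_nth (upd z i \<zeta>) j)" for e \<zeta> j
  have mW: "is_mtuple 2 (W e \<zeta>)" for e \<zeta> by (simp add: is_mtuple_def W_def)
  let ?z = "vec_nth z i"
  have "tconv 2 (\<lambda>k. W (complex_of_real (inverse (real (Suc k)))) ?z) (dsum_tuple 1 1 (scal z) (scal z)) sequentially"
    unfolding tconv_def
  proof (intro conjI allI impI mW)
    show "is_mtuple 2 (dsum_tuple 1 1 (scal z) (scal z))"
      using dsum_mtuple[OF scal_mtuple scal_mtuple, of z z] by (simp add: numeral_2_eq_2)
    fix j r c assume rc: "r < (2::nat)" "c < (2::nat)"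
    have "(\<lambda>k. complex_of_real (inverse (real (Suc k)))) \<longlonglongrightarrow> complex_of_real 0"
      by (intro tendsto_of_real LIMSEQ_inverse_real_of_nat)
    then show "(\<lambda>k. W (complex_of_real (inverse (real (Suc k)))) ?z j $$ (r, c)) \<longlonglongrightarrow> dsum_tuple 1 1 (scal z) (scal z) j $$ (r, c)"
      using rc by (cases "j = i") (auto simp: W_def dsum_tuple_def scal_def less_2_cases_iff)
  qed
  moreover have "dsum_tuple 1 1 (scal z) (scal z) \<in> Gd a b \<delta> 2"
    using Gd_dsum[OF zG zG] by (simp add: numeral_2_eq_2)
  ultimately have "eventually (\<lambda>k. W (complex_of_real (inverse (real (Suc k)))) ?z \<in> Gd a b \<delta> 2) sequentially"
    by (rule Gd_open)
  then obtain k where k: "W (complex_of_real (inverse (real (Suc k)))) ?z \<in> Gd a b \<delta> 2"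
    by (auto simp: eventually_sequentially)
  define e where "e = complex_of_real (inverse (real (Suc k)))"
  have e: "e \<noteq> 0" "W e ?z \<in> Gd a b \<delta> 2" using k by (simp_all add: e_def del: of_nat_Suc)
  have tl: "((\<lambda>\<zeta>. if j = i then \<zeta> else vec_nth z j) \<longlongrightarrow> vec_nth z j) (at ?z)" for j
    by (cases "j = i") auto
  have conv: "tconv 2 (W e) (W e ?z) (at ?z)"
    unfolding tconv_def using mW
    by (auto simp: W_def less_2_cases_iff intro!: tl)
  have lim: "((\<lambda>\<zeta>. \<phi> (W e \<zeta>) $$ (0, 1) / e) \<longlongrightarrow> \<phi> (W e ?z) $$ (0, 1) / e) (at ?z)"
    by (intro tendsto_intros nc_continuous[OF nc C _ conv e(2)] e) auto
  have "tconv 1 (\<lambda>\<zeta>. scal (upd z i \<zeta>)) (scal z) (at ?z)"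
    unfolding tconv_def
  proof (intro conjI allI impI scal_mtuple)
    fix j r c assume "r < (1::nat)" "c < (1::nat)"
    then show "((\<lambda>\<zeta>. scal (upd z i \<zeta>) j $$ (r, c)) \<longlongrightarrow> scal z j $$ (r, c)) (at ?z)"
      using tl[of j] by (simp add: scal_def)
  qed
  from Gd_open[OF this zG] have ev1: "eventually (\<lambda>\<zeta>. scal (upd z i \<zeta>) \<in> Gd a b \<delta> 1) (at ?z)" .
  have ev: "eventually (\<lambda>\<zeta>. \<phi> (W e \<zeta>) $$ (0, 1) / e =
     (\<phi> (scal (upd z i \<zeta>)) $$ (0, 0) - \<phi> (scal (upd z i ?z)) $$ (0, 0)) / (\<zeta> - ?z)) (at ?z)"
    using ev1 Gd_open[OF conv e(2)] eventually_neq_at_within[of ?z ?z UNIV]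
  proof eventually_elim
    case (elim \<zeta>)
    \<comment> \<open>The joint eigenvector of \<open>W e \<zeta>\<close> for the second diagonal
      point; the first one has the unit vector \<open>blk1 1 1\<close>.\<close>
    define K where "K = mat 2 1 (\<lambda>(r, c::nat). if r = 0 then e / (\<zeta> - ?z) else 1)"
    have "intw 1 2 K (scal (upd z i \<zeta>)) (W e \<zeta>)"
    proof (rule intwI[OF scal_mtuple mW])
      show "K \<in> carrier_mat 2 1" by (simp add: K_def)
      fix j x r assume "r < (2::nat)"
      then show "app K (app (scal (upd z i \<zeta>) j) x) r = app (W e \<zeta> j) (app K x) r"
        using elim(3) by (auto simp: app_def W_def K_def scal_def less_2_cases_iff numeral_2_eq_2 field_simps)
    qed
    from nc_intw_app[OF nc _ _ elim(1,2) this, of 0 "\<lambda>_. 1"]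
    have 1: "app K (app (\<phi> (scal (upd z i \<zeta>))) (\<lambda>_. 1)) 0 = app (\<phi> (W e \<zeta>)) (app K (\<lambda>_. 1)) 0" by simp
    have "intw 1 2 (blk1 1 1) (scal z) (W e \<zeta>)"
    proof (rule intwI[OF scal_mtuple mW])
      show "blk1 1 1 \<in> carrier_mat 2 1" using blk1_carrier(1)[of 1 1] by (simp add: numeral_2_eq_2)
      fix j x r assume "r < (2::nat)"
      then show "app (blk1 1 1) (app (scal z j) x) r = app (W e \<zeta> j) (app (blk1 1 1) x) r"
        by (auto simp: app_def W_def blk1_def scal_def less_2_cases_iff numeral_2_eq_2)
    qed
    from nc_intw_app[OF nc _ _ zG elim(2) this, of 0 "\<lambda>_. 1"]
    have 2: "app (blk1 1 1) (app (\<phi> (scal z)) (\<lambda>_. 1)) 0 = app (\<phi> (W e \<zeta>)) (app (blk1 1 1) (\<lambda>_. 1)) 0" by simp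
    have c: "\<phi> (scal z) \<in> carrier_mat 1 1" "\<phi> (scal (upd z i \<zeta>)) \<in> carrier_mat 1 1" "\<phi> (W e \<zeta>) \<in> carrier_mat 2 2"
      using nc_carrier[OF nc] zG elim by auto
    have 3: "\<phi> (W e \<zeta>) $$ (0, 0) = \<phi> (scal z) $$ (0, 0)"
      using 2 c by (simp add: app_def[of "\<phi> _"] app_blk1 numeral_2_eq_2)
    have "e / (\<zeta> - ?z) * \<phi> (scal (upd z i \<zeta>)) $$ (0, 0) = \<phi> (W e \<zeta>) $$ (0, 0) * (e / (\<zeta> - ?z)) + \<phi> (W e \<zeta>) $$ (0, 1)"
      using 1 c by (simp add: app_def K_def numeral_2_eq_2)
    then have "\<phi> (W e \<zeta>) $$ (0, 1) = e * ((\<phi> (scal (upd z i \<zeta>)) $$ (0, 0) - \<phi> (scal z) $$ (0, 0)) / (\<zeta> - ?z))"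
      unfolding 3 by (simp add: field_simps diff_divide_distrib)
    then show ?case using e(1) by simp
  qed
  have "((\<lambda>\<zeta>. \<phi> (scal (upd z i \<zeta>)) $$ (0, 0)) has_field_derivative (\<phi> (W e ?z) $$ (0, 1) / e)) (at ?z)"
    unfolding has_field_derivative_iff by (rule Lim_transform_eventually[OF lim ev])
  then show "(\<lambda>\<zeta>. \<phi> (scal (upd z i \<zeta>)) $$ (0, 0)) field_differentiable at ?z"
    by (auto simp: field_differentiable_def)
qed

section \<open>Joint generalized eigenspaces\<close>

text \<open>A zero row makes the coefficient matrix square. Its transpose kills the last unit
  vector, so the determinant is 0 and the matrix has a kernel vector.\<close>

lemma linear_dependence:
  fixes w :: "nat \<Rightarrow> nat \<Rightarrow> complex"
  shows "\<exists>c. (\<exists>k\<le>n. c k \<noteq> 0) \<and> (\<forall>r<n. (\<Sum>k\<le>n. c k * w k r) = 0)"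
proof -
  define B where "B = mat (Suc n) (Suc n) (\<lambda>(r, k). if r < n then w k r else 0)"
  have B: "B \<in> carrier_mat (Suc n) (Suc n)" "transpose_mat B \<in> carrier_mat (Suc n) (Suc n)" by (simp_all add: B_def)
  let ?u = "unit_vec (Suc n) n :: complex vec"
  have "transpose_mat B *\<^sub>v ?u = 0\<^sub>v (Suc n)"
    by (rule eq_vecI) (auto simp: B_def scalar_prod_right_unit)
  moreover have "?u \<noteq> 0\<^sub>v (Suc n)"
  proof
    assume "?u = 0\<^sub>v (Suc n)"
    then have "vec_index ?u n = vec_index (0\<^sub>v (Suc n)) n" by simp
    then show False by simp
  qed
  ultimately have "det (transpose_mat B) = 0"
    unfolding det_0_iff_vec_prod_zero_field[OF B(2)] using unit_vec_carrier by blast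
  then have "det B = 0" using B det_transpose by metis
  then obtain v where v: "v \<in> carrier_vec (Suc n)" "v \<noteq> 0\<^sub>v (Suc n)" "B *\<^sub>v v = 0\<^sub>v (Suc n)"
    using det_0_iff_vec_prod_zero_field[OF B(1)] by blast
  show ?thesis
  proof (intro exI[of _ "vec_index v"] conjI allI impI)
    show "\<exists>k\<le>n. vec_index v k \<noteq> 0"
    proof (rule ccontr)
      assume "\<not> ?thesis"
      then have "v = 0\<^sub>v (Suc n)" using v(1) by (intro eq_vecI) auto
      with v(2) show False ..
    qed
    fix r assume r: "r < n"
    have "vec_index (B *\<^sub>v v) r = 0" using v(3) r by simp
    then have "(\<Sum>k<Suc n. w k r * vec_index v k) = 0"
      using r v(1) by (simp add: B_def scalar_prod_def atLeast0LessThan)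
    then show "(\<Sum>k\<le>n. vec_index v k * w k r) = 0" by (simp add: lessThan_Suc_atMost mult.commute)
  qed
qed

section \<open>Generalized eigenspaces in an abstract complex vector space\<close>

locale cvec = vector_space sc for sc :: "complex \<Rightarrow> 'v::ab_group_add \<Rightarrow> 'v"
begin

definition clin :: "('v \<Rightarrow> 'v) \<Rightarrow> bool" where
  "clin A \<longleftrightarrow> (\<forall>u v. A (u + v) = A u + A v) \<and> (\<forall>c v. A (sc c v) = sc c (A v))"

lemma clin_add: "clin A \<Longrightarrow> A (u + v) = A u + A v"
  and clin_scale: "clin A \<Longrightarrow> A (sc c v) = sc c (A v)"
  by (simp_all add: clin_def)

lemma clin_zero: "clin A \<Longrightarrow> A 0 = 0"
  using clin_scale[of A 0 0] by simp

lemma clin_diff: "clin A \<Longrightarrow> A (u - v) = A u - A v"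
  using clin_add[of A u "sc (-1) v"] clin_scale[of A "-1" v] by simp

abbreviation shift :: "('v \<Rightarrow> 'v) \<Rightarrow> complex \<Rightarrow> 'v \<Rightarrow> 'v" where
  "shift A a \<equiv> (\<lambda>v. A v - sc a v)"

lemma clin_shift: "clin A \<Longrightarrow> clin (shift A a)"
  by (simp add: clin_def scale_right_distrib scale_right_diff_distrib mult.commute)

lemma clin_funpow: "clin A \<Longrightarrow> clin (A ^^ k)"
  by (induction k) (auto simp: clin_def)

primrec prodl :: "('v \<Rightarrow> 'v) \<Rightarrow> complex list \<Rightarrow> 'v \<Rightarrow> 'v" where
  "prodl A [] v = v"
| "prodl A (a # as) v = prodl A as (A v - sc a v)"

text \<open>The fundamental theorem of algebra splits off one linear factor of p at a time; each
  root a replaces v by A v - a v and lowers the degree.\<close>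

lemma annihilating_list:
  assumes "clin A" "p \<noteq> 0" "degree p \<le> N" "(\<Sum>k\<le>N. sc (coeff p k) ((A ^^ k) v)) = 0"
  shows "\<exists>as. prodl A as v = 0"
  using assms(2-)
proof (induction N arbitrary: p v)
  case 0
  then have "sc (coeff p 0) v = 0" "coeff p 0 \<noteq> 0" by (auto dest: degree_eq_zeroE elim!: degree_eq_zeroE)
  then show ?case by (intro exI[of _ "[]"]) auto
next
  case (Suc N)
  show ?case
  proof (cases "degree p = 0")
    case True
    then obtain c where c: "p = [:c:]" by (rule degree_eq_zeroE)
    have "(\<Sum>k\<le>Suc N. sc (coeff p k) ((A ^^ k) v)) = (\<Sum>k\<in>{0}. sc (coeff p k) ((A ^^ k) v))"
      by (intro sum.mono_neutral_right) (auto simp: c coeff_pCons split: nat.splits)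
    then have "sc c v = 0" "c \<noteq> 0" using Suc.prems c by auto
    then show ?thesis by (intro exI[of _ "[]"]) auto
  next
    case False
    then obtain a where "poly p a = 0" using fundamental_theorem_of_algebra[of p] by (auto simp: constant_degree)
    then obtain q where q: "p = [:- a, 1:] * q" by (auto simp: poly_eq_0_iff_dvd)
    have q0: "q \<noteq> 0" using Suc.prems(1) q by auto
    have "degree p = Suc (degree q)" unfolding q using q0 by (subst degree_mult_eq) auto
    then have dq: "degree q \<le> N" using Suc.prems by simp
    have co: "coeff p k = (case k of 0 \<Rightarrow> 0 | Suc j \<Rightarrow> coeff q j) - a * coeff q k" for k
      unfolding q by (simp add: coeff_pCons split: nat.splits)
    have sw: "(A ^^ k) (A v) = A ((A ^^ k) v)" for k by (metis funpow_swap1)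
    have "(\<Sum>k\<le>N. sc (coeff q k) ((A ^^ k) (A v - sc a v))) =
      (\<Sum>k\<le>N. sc (coeff q k) ((A ^^ Suc k) v)) - (\<Sum>k\<le>N. sc (a * coeff q k) ((A ^^ k) v))"
      using assms(1) by (simp add: clin_diff[OF clin_funpow] clin_scale[OF clin_funpow] sw scale_right_diff_distrib
        sum_subtractf mult.commute)
    also have "(\<Sum>k\<le>N. sc (coeff q k) ((A ^^ Suc k) v)) = (\<Sum>k\<le>Suc N. sc (case k of 0 \<Rightarrow> 0 | Suc j \<Rightarrow> coeff q j) ((A ^^ k) v))"
      unfolding sum.atMost_Suc_shift[of _ N] by simp
    also have "(\<Sum>k\<le>N. sc (a * coeff q k) ((A ^^ k) v)) = (\<Sum>k\<le>Suc N. sc (a * coeff q k) ((A ^^ k) v))"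
      using dq by (simp add: coeff_eq_0)
    also have "(\<Sum>k\<le>Suc N. sc (case k of 0 \<Rightarrow> 0 | Suc j \<Rightarrow> coeff q j) ((A ^^ k) v)) - (\<Sum>k\<le>Suc N. sc (a * coeff q k) ((A ^^ k) v))
       = (\<Sum>k\<le>Suc N. sc (coeff p k) ((A ^^ k) v))"
      unfolding sum_subtractf[symmetric] by (simp only: co scale_left_diff_distrib)
    also have "\<dots> = 0" by (rule Suc.prems)
    finally obtain as where "prodl A as (A v - sc a v) = 0" using Suc.IH[OF q0 dq] by blast
    then show ?thesis by (intro exI[of _ "a # as"]) simp
  qed
qed

text \<open>On a generalized eigenspace for l the map A - a is (l - a) + N with N nilpotent, hence
  invertible. The recursive solution is (u - w) / (l - a), where w solves the equation for N u, a
  vector of smaller nilpotency order.\<close>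

lemma gen_eigen_solve:
  assumes A: "clin A" and W: "subspace W" "\<And>v. v \<in> W \<Longrightarrow> A v \<in> W" and ne: "l \<noteq> a"
  shows "u \<in> W \<Longrightarrow> (shift A l ^^ K) u = 0 \<Longrightarrow> \<exists>u'\<in>W. A u' - sc a u' = u \<and> (shift A l ^^ K) u' = 0"
proof (induction K arbitrary: u)
  case 0
  then have "u = 0" by simp
  then show ?case using W A by (intro bexI[of _ 0]) (auto simp: clin_zero subspace_0)
next
  case (Suc K)
  let ?N = "shift A l"
  note N = clin_shift[OF A, of l]
  have "(?N ^^ K) (?N u) = 0" using Suc.prems(2) by (simp only: funpow_Suc_right o_apply)
  moreover have "?N u \<in> W" using Suc.prems W by (intro subspace_diff subspace_scale) auto
  ultimately obtain w where w: "w \<in> W" "A w - sc a w = ?N u" "(?N ^^ K) w = 0" using Suc.IH by blast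
  let ?u = "sc (inverse (l - a)) (u - w)"
  show ?case
  proof (intro bexI[of _ ?u] conjI)
    have "A (u - w) - sc a (u - w) = (A u - sc a u) - (A w - sc a w)"
      using A by (simp add: clin_diff scale_right_diff_distrib)
    also have "\<dots> = sc (l - a) u" unfolding w(2) by (simp add: scale_left_diff_distrib)
    finally have "A (u - w) - sc a (u - w) = sc (l - a) u" .
    moreover have "A ?u - sc a ?u = sc (inverse (l - a)) (A (u - w) - sc a (u - w))"
      unfolding clin_scale[OF A] by (simp add: scale_right_diff_distrib mult.commute)
    ultimately show "A ?u - sc a ?u = u" using ne by simp
    have 0: "(?N ^^ Suc K) w = 0" using w(3) clin_zero[OF N] by simp
    show "(?N ^^ Suc K) ?u = 0"
      unfolding clin_scale[OF clin_funpow[OF N]] clin_diff[OF clin_funpow[OF N]] 0 Suc.prems(2) by simp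
    show "?u \<in> W" using Suc.prems(1) w(1) W(1) by (intro subspace_diff subspace_scale) auto
  qed
qed

text \<open>By induction (A - a) v is a sum of generalized eigenvectors. Those with eigenvalue other
  than a are images under A - a of vectors of the same kind; after subtracting these preimages y, a
  power of A - a kills v - y. The subspace W is carried along for the joint version.\<close>

lemma gen_eigen_span:
  assumes A: "clin A" and W: "subspace W" "\<And>v. v \<in> W \<Longrightarrow> A v \<in> W"
  shows "v \<in> W \<Longrightarrow> prodl A as v = 0 \<Longrightarrow> v \<in> span {u \<in> W. \<exists>l K. (shift A l ^^ K) u = 0}"
proof (induction as arbitrary: v)
  case Nil
  then show ?case using span_zero by simp
next
  case (Cons a as)
  let ?G = "{u \<in> W. \<exists>l K. (shift A l ^^ K) u = 0}"
  let ?N = "shift A a"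
  note N = clin_shift[OF A, of a]
  note NK = clin_funpow[OF N]
  have Nv: "?N v \<in> W" using Cons.prems W by (intro subspace_diff subspace_scale) auto
  have "?N v \<in> span ?G" using Cons.IH[OF Nv] Cons.prems(2) by simp
  then have "\<exists>y\<in>span ?G \<inter> W. \<exists>w\<in>W. \<exists>K. ?N y = ?N v - w \<and> (?N ^^ K) w = 0"
  proof (induction rule: span_induct_alt)
    case base
    have "0 \<in> W" using W(1) by (rule subspace_0)
    then show ?case using span_zero clin_zero[OF N] by (intro bexI[of _ 0] exI[of _ 0]) auto
  next
    case (step c u x)
    then obtain y w K where y: "y \<in> span ?G" "y \<in> W" "w \<in> W" "?N y = x - w" "(?N ^^ K) w = 0" by blast
    from step(1) obtain l M where u: "u \<in> W" "(shift A l ^^ M) u = 0" by blast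
    show ?case
    proof (cases "l = a")
      case True
      have 0: "(?N ^^ (M + K)) w = 0" "(?N ^^ (K + M)) u = 0"
        unfolding funpow_add o_apply using y(5) u(2) True clin_zero[OF NK] by simp_all
      have "?N y = (sc c u + x) - (sc c u + w)" using y(4) by simp
      moreover have "(?N ^^ (K + M)) (sc c u + w) = 0"
        unfolding clin_add[OF NK] clin_scale[OF NK] using 0 by (simp add: add.commute)
      moreover have "sc c u + w \<in> W" using u y W(1) by (intro subspace_add subspace_scale) auto
      ultimately show ?thesis using y by blast
    next
      case False
      from gen_eigen_solve[OF A W False u(1) u(2)]
      obtain u' where u': "u' \<in> W" "?N u' = u" "(shift A l ^^ M) u' = 0" by blast
      have "?N (sc c u' + y) = sc c (?N u') + ?N y" unfolding clin_add[OF N] clin_scale[OF N] ..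
      then have "?N (sc c u' + y) = (sc c u + x) - w" unfolding u'(2) y(4) by simp
      moreover have "sc c u' + y \<in> W" using u' y W(1) by (intro subspace_add subspace_scale) auto
      moreover have "sc c u' + y \<in> span ?G"
        using u' by (intro span_add span_scale y(1)) (auto intro: span_base)
      ultimately show ?thesis using y by blast
    qed
  qed
  then obtain y w K where y: "y \<in> span ?G" "y \<in> W" "?N y = ?N v - w" "(?N ^^ K) w = 0" by blast
  have "?N (v - y) = w" unfolding clin_diff[OF N] y(3) by simp
  then have "(?N ^^ Suc K) (v - y) = 0" using y(4) by (simp only: funpow_Suc_right o_apply)
  moreover have "v - y \<in> W" using Cons.prems(1) y(2) W(1) by (intro subspace_diff)
  ultimately have "v - y \<in> span ?G" by (intro span_base) blast
  from span_add[OF this y(1)] show ?case by simp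
qed

text \<open>The vectors annihilated by every product of m maps T i - l i with i in J. The recursion
  avoids multi-indices and fits inductions that peel off one map.\<close>

primrec joint_gen :: "'d set \<Rightarrow> ('d \<Rightarrow> 'v \<Rightarrow> 'v) \<Rightarrow> ('d \<Rightarrow> complex) \<Rightarrow> nat \<Rightarrow> 'v set" where
  "joint_gen J T l 0 = {0}"
| "joint_gen J T l (Suc m) = {u. \<forall>i\<in>J. shift (T i) (l i) u \<in> joint_gen J T l m}"

lemma subspace_joint_gen: "(\<And>i. clin (T i)) \<Longrightarrow> subspace (joint_gen J T l m)"
proof (induction m)
  case (Suc m)
  note N = clin_shift[OF Suc.prems] and S = Suc.IH[OF Suc.prems]
  show ?case unfolding joint_gen.simps
  proof (rule subspaceI; unfold mem_Collect_eq; intro ballI)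
    fix i assume "i \<in> J"
    show "shift (T i) (l i) 0 \<in> joint_gen J T l m" unfolding clin_zero[OF N] by (rule subspace_0[OF S])
  next
    fix x y i
    assume "\<forall>i\<in>J. shift (T i) (l i) x \<in> joint_gen J T l m" "\<forall>i\<in>J. shift (T i) (l i) y \<in> joint_gen J T l m" "i \<in> J"
    then show "shift (T i) (l i) (x + y) \<in> joint_gen J T l m" unfolding clin_add[OF N] by (intro subspace_add[OF S]) auto
  next
    fix c x i assume "\<forall>i\<in>J. shift (T i) (l i) x \<in> joint_gen J T l m" "i \<in> J"
    then show "shift (T i) (l i) (sc c x) \<in> joint_gen J T l m" unfolding clin_scale[OF N] by (intro subspace_scale[OF S]) auto
  qed
qed simp

lemma joint_gen_mono: "(\<And>i. clin (T i)) \<Longrightarrow> joint_gen J T l m \<subseteq> joint_gen J T l (Suc m)"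
proof (induction m)
  case 0
  then show ?case using clin_zero[OF clin_shift[OF 0]] by auto
qed auto

lemma joint_gen_invariant:
  assumes "\<And>i. clin (T i)" "clin B" "\<And>v. v \<in> W \<Longrightarrow> B v \<in> W" "\<And>i v. v \<in> W \<Longrightarrow> T i v \<in> W" "subspace W"
    "\<And>i v. v \<in> W \<Longrightarrow> T i (B v) = B (T i v)"
  shows "u \<in> W \<Longrightarrow> u \<in> joint_gen J T l m \<Longrightarrow> B u \<in> joint_gen J T l m"
proof (induction m arbitrary: u)
  case 0
  then show ?case using clin_zero[OF assms(2)] by simp
next
  case (Suc m)
  have "shift (T i) (l i) (B u) = B (shift (T i) (l i) u)" for i
    using assms(6)[OF Suc.prems(1)] by (simp add: clin_diff[OF assms(2)] clin_scale[OF assms(2)])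
  moreover have "shift (T i) (l i) u \<in> W" for i
    using Suc.prems(1) assms by (intro subspace_diff subspace_scale) auto
  ultimately show ?case using Suc by auto
qed

text \<open>A pigeonhole argument: among m + K commuting factors there are m with index in J or K
  with index j. Here it appears as an induction on m + K in which one factor of either kind is
  removed.\<close>

lemma joint_gen_insert:
  assumes T: "\<And>i. clin (T i)" "\<And>i v. v \<in> W \<Longrightarrow> T i v \<in> W" "subspace W"
    and comm: "\<And>i k v. v \<in> W \<Longrightarrow> T i (T k v) = T k (T i v)" and j: "j \<notin> J"
  shows "w \<in> W \<Longrightarrow> w \<in> joint_gen J T l m \<Longrightarrow> (shift (T j) a ^^ K) w = 0 \<Longrightarrow> w \<in> joint_gen (insert j J) T (l(j := a)) (m + K)"
proof (induction "m + K" arbitrary: m K w)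
  case 0
  then show ?case by simp
next
  case (Suc s)
  note N = clin_shift[OF T(1)]
  have z: "0 \<in> joint_gen (insert j J) T (l(j := a)) (m + K)" using subspace_joint_gen[OF T(1)] by (rule subspace_0)
  have NW: "shift (T i) c w \<in> W" for i c using Suc.prems(1) T by (intro subspace_diff subspace_scale) auto
  show ?case
  proof (cases "m = 0 \<or> K = 0")
    case True
    then have "w = 0" using Suc.prems by auto
    then show ?thesis using z by simp
  next
    case False
    then obtain m' K' where mK: "m = Suc m'" "K = Suc K'" by (meson not0_implies_Suc)
    have 1: "shift (T i) (l i) w \<in> joint_gen (insert j J) T (l(j := a)) (m' + K)" if "i \<in> J" for i
    proof (rule Suc.hyps(1))
      show "s = m' + K" using Suc.hyps(2) mK by simp
      show "shift (T i) (l i) w \<in> joint_gen J T l m'" using Suc.prems(2) mK that by simp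
      have c: "shift (T j) a (shift (T i) (l i) v) = shift (T i) (l i) (shift (T j) a v)" if "v \<in> W" for v
        using comm[OF that, of i j] T(1) by (simp add: clin_diff clin_scale scale_right_diff_distrib mult.commute)
      have "(shift (T j) a ^^ k) v \<in> W \<and> (shift (T j) a ^^ k) (shift (T i) (l i) v) = shift (T i) (l i) ((shift (T j) a ^^ k) v)" if "v \<in> W" for k v
      proof (induction k)
        case (Suc k)
        have "shift (T j) a ((shift (T j) a ^^ k) v) \<in> W" using Suc T by (intro subspace_diff subspace_scale) auto
        then show ?case using Suc c[of "(shift (T j) a ^^ k) v"] by simp
      qed (use that in simp)
      from this[OF Suc.prems(1), of K] show "(shift (T j) a ^^ K) (shift (T i) (l i) w) = 0"
        using Suc.prems(3) clin_zero[OF N] by simp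
    qed (rule NW)
    have 2: "shift (T j) a w \<in> joint_gen (insert j J) T (l(j := a)) (m + K')"
    proof (rule Suc.hyps(1))
      show "s = m + K'" using Suc.hyps(2) mK by simp
      have comm': "shift (T j) a w \<in> joint_gen J T l m"
        using joint_gen_invariant[OF T(1) T(1) T(2) T(2) T(3) comm Suc.prems(1,2), of j] Suc.prems(2) subspace_joint_gen[OF T(1)]
        by (intro subspace_diff subspace_scale) auto
      then show "shift (T j) a w \<in> joint_gen J T l m" .
      show "(shift (T j) a ^^ K') (shift (T j) a w) = 0"
        using Suc.prems(3) unfolding mK by (simp only: funpow_Suc_right o_apply)
    qed (rule NW)
    show ?thesis using 1 2 j mK by auto
  qed
qed

text \<open>One operator at a time: each space \<open>joint_gen J T l m\<close> within V is
  invariant under the next operator by commutativity, and splits again into generalized eigenspaces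
  of it.\<close>

lemma joint_gen_eigen_span:
  assumes T: "\<And>i. clin (T i)" "\<And>i v. v \<in> V \<Longrightarrow> T i v \<in> V" "subspace V"
    and comm: "\<And>i k v. v \<in> V \<Longrightarrow> T i (T k v) = T k (T i v)"
    and ann: "\<And>i v. v \<in> V \<Longrightarrow> \<exists>as. prodl (T i) as v = 0"
    and "finite J"
  shows "v \<in> V \<Longrightarrow> v \<in> span {u \<in> V. \<exists>l m. u \<in> joint_gen J T l m}"
  using \<open>finite J\<close>
proof (induction J arbitrary: v rule: finite_induct)
  case empty
  have "v \<in> joint_gen {} T l (Suc 0)" for l by simp
  with empty show ?case by (intro span_base) blast
next
  case (insert j J)
  let ?G = "{u \<in> V. \<exists>l m. u \<in> joint_gen (insert j J) T l m}"
  have "{u \<in> V. \<exists>l m. u \<in> joint_gen J T l m} \<subseteq> span ?G"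
  proof
    fix u assume "u \<in> {u \<in> V. \<exists>l m. u \<in> joint_gen J T l m}"
    then obtain l m where u: "u \<in> V" "u \<in> joint_gen J T l m" by blast
    let ?W = "V \<inter> joint_gen J T l m"
    have W: "subspace ?W" using T(3) subspace_joint_gen[OF T(1)] by (rule subspace_inter)
    have WT: "T j w \<in> ?W" if "w \<in> ?W" for w
      using that T(2)[of w j] joint_gen_invariant[where T = T and B = "T j" and W = V and u = w, OF T(1) T(1) T(2) T(2) T(3) comm] by blast
    obtain as where "prodl (T j) as u = 0" using ann[OF u(1)] by blast
    then have "u \<in> span {w \<in> ?W. \<exists>a K. (shift (T j) a ^^ K) w = 0}"
      using u by (intro gen_eigen_span[OF T(1) W WT]) auto
    moreover have "{w \<in> ?W. \<exists>a K. (shift (T j) a ^^ K) w = 0} \<subseteq> ?G"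
      using joint_gen_insert[where T = T and W = V, OF T comm insert.hyps(2)] by blast
    ultimately show "u \<in> span ?G" using span_mono by blast
  qed
  then show ?case using insert.IH[OF insert.prems] span_minimal[OF _ subspace_span] by blast
qed

text \<open>Apply the maps T i - l i as long as some result is nonzero; the last nonzero vector is
  killed by all of them.\<close>

lemma joint_eigenvector:
  assumes T: "\<And>i. clin (T i)" "\<And>i v. v \<in> V \<Longrightarrow> T i v \<in> V" "subspace V"
  shows "u \<in> V \<Longrightarrow> u \<noteq> 0 \<Longrightarrow> u \<in> joint_gen UNIV T l m \<Longrightarrow> \<exists>w\<in>V. w \<noteq> 0 \<and> (\<forall>i. T i w = sc (l i) w)"
proof (induction m arbitrary: u)
  case (Suc m)
  show ?case
  proof (cases "\<forall>i. shift (T i) (l i) u = 0")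
    case True
    then show ?thesis using Suc.prems by (intro bexI[of _ u]) auto
  next
    case False
    then obtain i where i: "shift (T i) (l i) u \<noteq> 0" by blast
    have "shift (T i) (l i) u \<in> V" using Suc.prems(1) T by (intro subspace_diff subspace_scale) auto
    from Suc.IH[OF this i] show ?thesis using Suc.prems(3) by simp
  qed
qed simp

text \<open>A chain of vectors obtained by applying n of the nilpotent maps one after another is linearly
  dependent in dimension n, which is only possible if it reaches 0.\<close>

lemma joint_gen_dimension_bound:
  assumes T: "\<And>i. clin (T i)" "\<And>i v. v \<in> V \<Longrightarrow> T i v \<in> V" "subspace V"
    and dep: "\<And>w. (\<And>k. k \<le> n \<Longrightarrow> w k \<in> V) \<Longrightarrow> \<exists>c. (\<exists>k\<le>n. c k \<noteq> 0) \<and> (\<Sum>k\<le>n. sc (c k) (w k)) = 0"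
    and u: "u \<in> V" "u \<in> joint_gen UNIV T l m"
  shows "u \<in> joint_gen UNIV T l n"
proof (rule ccontr)
  assume nz: "u \<notin> joint_gen UNIV T l n"
  let ?N = "\<lambda>i. shift (T i) (l i)" and ?joint_gen = "joint_gen UNIV T l"
  note N = clin_shift[OF T(1)]
  have ex: "\<exists>i. ?N i v \<notin> ?joint_gen k" if "v \<notin> ?joint_gen (Suc k)" for v k using that by auto
  define step where "step k v = ?N (SOME i. ?N i v \<notin> ?joint_gen k) v" for k v
  define w where "w = rec_nat u (\<lambda>k v. step (n - Suc k) v)"
  have w0: "w 0 = u" and wS: "\<And>k. w (Suc k) = step (n - Suc k) (w k)" by (simp_all add: w_def)
  have wnz: "k \<le> n \<Longrightarrow> w k \<notin> ?joint_gen (n - k)" for k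
  proof (induction k)
    case (Suc k)
    then have "w k \<notin> ?joint_gen (Suc (n - Suc k))" by (simp add: Suc_diff_Suc del: joint_gen.simps)
    from someI_ex[OF ex[OF this]] show ?case unfolding wS step_def .
  qed (use w0 nz in simp)
  have wV: "w k \<in> V" for k
    by (induction k) (use w0 u wS T in \<open>auto simp: step_def intro!: subspace_diff subspace_scale\<close>)
  have wZ1: "w (Suc k) \<in> ?joint_gen p" if "w k \<in> ?joint_gen (Suc p)" for k p
    using that unfolding wS step_def by simp
  have wZ: "w (k + Suc q) \<in> ?joint_gen p" if "w k \<in> ?joint_gen (Suc p)" for k p q
  proof (induction q)
    case 0
    show ?case using wZ1[OF that] by simp
  next
    case (Suc q)
    then have "w (k + Suc q) \<in> ?joint_gen (Suc p)" using joint_gen_mono[where T = T, OF T(1)] by blast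
    from wZ1[OF this] show ?case by simp
  qed
  obtain c where c: "\<exists>k\<le>n. c k \<noteq> 0" "(\<Sum>k\<le>n. sc (c k) (w k)) = 0" using dep[of w] wV by blast
  define k where "k = (LEAST k. c k \<noteq> 0)"
  obtain k0 where k0: "k0 \<le> n" "c k0 \<noteq> 0" using c(1) by blast
  have ck: "c k \<noteq> 0" "k \<le> n"
    using LeastI[of "\<lambda>k. c k \<noteq> 0", OF k0(2)] Least_le[of "\<lambda>k. c k \<noteq> 0", OF k0(2)] k0(1) by (auto simp: k_def)
  have ck': "c j = 0" if "j < k" for j using that not_less_Least unfolding k_def by blast
  have sub: "subspace (?joint_gen p)" for p by (rule subspace_joint_gen[OF T(1)])
  \<comment> \<open>The relation expresses \<open>w k\<close> by later vectors of the chain, and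
    these lie at least one level deeper. So \<open>w k\<close> drops level by level down to 0,
    contrary to \<open>wnz\<close>.\<close>
  have down: "w k \<in> ?joint_gen p" if "w k \<in> ?joint_gen (Suc p)" for p
  proof -
    have "(\<Sum>j\<le>n. sc (c j) (w j)) = sc (c k) (w k) + (\<Sum>j\<in>{..n} - {k}. sc (c j) (w j))"
      by (rule sum.remove) (use ck in auto)
    then have "sc (c k) (w k) = - (\<Sum>j\<in>{..n} - {k}. sc (c j) (w j))"
      using c(2) by (simp add: eq_neg_iff_add_eq_0)
    moreover have "(\<Sum>j\<in>{..n} - {k}. sc (c j) (w j)) \<in> ?joint_gen p"
    proof (rule subspace_sum[OF sub])
      fix j assume j: "j \<in> {..n} - {k}"
      show "sc (c j) (w j) \<in> ?joint_gen p"
      proof (cases "j < k")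
        case True
        then show ?thesis using ck' subspace_0[OF sub] by simp
      next
        case False
        then have "j = k + Suc (j - Suc k)" using j by auto
        then have "w j \<in> ?joint_gen p" using wZ[OF that] by metis
        then show ?thesis by (rule subspace_scale[OF sub])
      qed
    qed
    ultimately have "sc (c k) (w k) \<in> ?joint_gen p" using subspace_neg[OF sub] by simp
    then have "sc (inverse (c k)) (sc (c k) (w k)) \<in> ?joint_gen p" by (rule subspace_scale[OF sub])
    then show ?thesis using ck by simp
  qed
  have "w j \<in> ?joint_gen m" for j
  proof (induction j)
    case (Suc j)
    then have "w j \<in> ?joint_gen (Suc m)" using joint_gen_mono[where T = T, OF T(1)] by blast
    then show ?case by (rule wZ1)
  qed (use w0 u in simp)
  then have wk: "w k \<in> ?joint_gen m" .
  have "w k \<in> ?joint_gen p \<Longrightarrow> w k \<in> ?joint_gen 0" for p by (induction p) (use down in blast)+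
  from this[OF wk] have "w k \<in> ?joint_gen 0" .
  moreover have "?joint_gen 0 \<subseteq> ?joint_gen p" for p using subspace_0[OF sub] by simp
  ultimately show False using wnz[OF ck(2)] by blast
qed

end

section \<open>Rows and columns of a commuting matrix tuple\<close>

definition cs :: "complex \<Rightarrow> (nat \<Rightarrow> complex) \<Rightarrow> nat \<Rightarrow> complex" where
  "cs c v = (\<lambda>k. c * v k)"

interpretation cvs: cvec cs
  by unfold_locales (auto simp: cs_def fun_eq_iff algebra_simps)

text \<open>The n-dimensional space realized inside a type of functions: entries beyond n are 0, so
  that equality of vectors is equality of functions.\<close>

definition Vn :: "nat \<Rightarrow> (nat \<Rightarrow> complex) set" where
  "Vn n = {v. \<forall>k\<ge>n. v k = 0}"

lemma subspace_Vn: "cvs.subspace (Vn n)"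
  by (auto simp: cvs.subspace_def Vn_def cs_def)

lemma linear_dependence_Vn:
  assumes "\<And>k. k \<le> n \<Longrightarrow> w k \<in> Vn n"
  shows "\<exists>c. (\<exists>k\<le>n. c k \<noteq> 0) \<and> (\<Sum>k\<le>n. cs (c k) (w k)) = 0"
proof -
  obtain c where c: "\<exists>k\<le>n. c k \<noteq> 0" "\<And>r. r < n \<Longrightarrow> (\<Sum>k\<le>n. c k * w k r) = 0"
    using linear_dependence[of n w] by blast
  have app: "(\<Sum>k\<in>K. g k) r = (\<Sum>k\<in>K. g k r)" for g :: "nat \<Rightarrow> nat \<Rightarrow> complex" and K r
    by (induction K rule: infinite_finite_induct) auto
  have "(\<Sum>k\<le>n. cs (c k) (w k)) r = 0" for r
    using c(2)[of r] assms by (cases "r < n") (auto simp: app cs_def Vn_def)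
  with c(1) show ?thesis by (intro exI[of _ c]) (auto simp: fun_eq_iff)
qed

lemma annihilating_list_Vn:
  assumes A: "cvs.clin A" "\<And>v. v \<in> Vn n \<Longrightarrow> A v \<in> Vn n" "v \<in> Vn n"
  shows "\<exists>as. cvs.prodl A as v = 0"
proof -
  have "(A ^^ k) v \<in> Vn n" for k by (induction k) (use A in auto)
  then obtain c where c: "\<exists>k\<le>n. c k \<noteq> 0" "(\<Sum>k\<le>n. cs (c k) ((A ^^ k) v)) = 0"
    using linear_dependence_Vn[of n "\<lambda>k. (A ^^ k) v"] by blast
  define p where "p = (\<Sum>k\<le>n. monom (c k) k)"
  have co: "coeff p k = (if k \<le> n then c k else 0)" for k
    by (simp add: p_def coeff_sum if_distrib cong: if_cong)
  have "p \<noteq> 0" using c(1) co by (metis coeff_0)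
  moreover have "degree p \<le> n" by (rule degree_le) (simp add: co)
  moreover have "(\<Sum>k\<le>n. cs (coeff p k) ((A ^^ k) v)) = 0"
  proof -
    have "(\<Sum>k\<le>n. cs (coeff p k) ((A ^^ k) v)) = (\<Sum>k\<le>n. cs (c k) ((A ^^ k) v))"
      by (intro sum.cong refl) (simp add: co)
    then show ?thesis using c(2) by simp
  qed
  ultimately show ?thesis using cvs.annihilating_list[OF A(1)] by blast
qed

text \<open>Columns are needed because \<open>jspec\<close> speaks of right eigenvectors, rows
  because the intertwiners built later have row vectors as data.\<close>

definition colact :: "nat \<Rightarrow> complex mat \<Rightarrow> (nat \<Rightarrow> complex) \<Rightarrow> nat \<Rightarrow> complex" where
  "colact n A v = (\<lambda>r. if r < n then \<Sum>c<n. A $$ (r, c) * v c else 0)"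

definition rowact :: "nat \<Rightarrow> complex mat \<Rightarrow> (nat \<Rightarrow> complex) \<Rightarrow> nat \<Rightarrow> complex" where
  "rowact n A y = (\<lambda>c. if c < n then \<Sum>r<n. y r * A $$ (r, c) else 0)"

lemma clin_colact: "cvs.clin (colact n A)"
  unfolding cvs.clin_def
  by (auto simp: colact_def cs_def fun_eq_iff sum.distrib distrib_left sum_distrib_left mult.left_commute)

lemma clin_rowact: "cvs.clin (rowact n A)"
  unfolding cvs.clin_def
  by (auto simp: rowact_def cs_def fun_eq_iff sum.distrib distrib_right sum_distrib_left mult.assoc)

lemma colact_Vn: "colact n A v \<in> Vn n" and rowact_Vn: "rowact n A v \<in> Vn n"
  by (auto simp: Vn_def colact_def rowact_def)

lemma colact_mult:
  assumes "A \<in> carrier_mat n n" "B \<in> carrier_mat n n"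
  shows "colact n A (colact n B v) = colact n (A * B) v"
proof
  fix r
  have "(\<Sum>c<n. A $$ (r, c) * (\<Sum>k<n. B $$ (c, k) * v k)) = (\<Sum>k<n. (\<Sum>c<n. A $$ (r, c) * B $$ (c, k)) * v k)"
    by (simp add: sum_distrib_left sum_distrib_right mult.assoc) (rule sum.swap)
  also have "\<dots> = (\<Sum>k<n. (A * B) $$ (r, k) * v k)" if "r < n"
    using assms that by (intro sum.cong refl) (subst mat_mult_index, auto)
  finally show "colact n A (colact n B v) r = colact n (A * B) v r"
    using \<open>r < n \<Longrightarrow> _\<close> by (auto simp: colact_def)
qed

lemma rowact_mult:
  assumes "A \<in> carrier_mat n n" "B \<in> carrier_mat n n"
  shows "rowact n B (rowact n A v) = rowact n (A * B) v"
proof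
  fix c
  have "(\<Sum>k<n. (\<Sum>r<n. v r * A $$ (r, k)) * B $$ (k, c)) = (\<Sum>r<n. v r * (\<Sum>k<n. A $$ (r, k) * B $$ (k, c)))"
    by (simp add: sum_distrib_left sum_distrib_right mult.assoc) (rule sum.swap)
  also have "\<dots> = (\<Sum>r<n. v r * (A * B) $$ (r, c))" if "c < n"
    using assms that by (intro sum.cong refl) (subst mat_mult_index, auto)
  finally show "rowact n B (rowact n A v) c = rowact n (A * B) v c"
    using \<open>c < n \<Longrightarrow> _\<close> by (auto simp: rowact_def)
qed

context
  fixes n :: nat and T :: "('d::finite) mtuple"
  assumes mT: "is_mtuple n T" and comm: "commuting T"
begin

lemma Ti: "T i \<in> carrier_mat n n"
  using mT by (simp add: is_mtuple_def)

lemma col_span: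
  assumes "v \<in> Vn n"
  shows "v \<in> cvs.span {u \<in> Vn n. \<exists>l m. u \<in> cvs.joint_gen UNIV (\<lambda>i. colact n (T i)) l m}"
proof (rule cvs.joint_gen_eigen_span[OF clin_colact colact_Vn subspace_Vn])
  fix i k v show "colact n (T i) (colact n (T k) v) = colact n (T k) (colact n (T i) v)"
    using comm by (simp add: colact_mult[OF Ti Ti] commuting_def)
  fix i v assume "v \<in> Vn n" then show "\<exists>as. cvs.prodl (colact n (T i)) as v = 0"
    by (intro annihilating_list_Vn[OF clin_colact colact_Vn])
qed (use assms in auto)

lemma row_span:
  assumes "v \<in> Vn n"
  shows "v \<in> cvs.span {u \<in> Vn n. \<exists>l m. u \<in> cvs.joint_gen UNIV (\<lambda>i. rowact n (T i)) l m}"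
proof (rule cvs.joint_gen_eigen_span[OF clin_rowact rowact_Vn subspace_Vn])
  fix i k v show "rowact n (T i) (rowact n (T k) v) = rowact n (T k) (rowact n (T i) v)"
    using comm by (simp add: rowact_mult[OF Ti Ti] commuting_def)
  fix i v assume "v \<in> Vn n" then show "\<exists>as. cvs.prodl (rowact n (T i)) as v = 0"
    by (intro annihilating_list_Vn[OF clin_rowact rowact_Vn])
qed (use assms in auto)

lemma col_gen_eigen_jspec:
  assumes u: "u \<in> Vn n" "u \<noteq> 0" "u \<in> cvs.joint_gen UNIV (\<lambda>i. colact n (T i)) l m"
  shows "vec_lambda l \<in> jspec n T"
proof -
  obtain w where w: "w \<in> Vn n" "w \<noteq> 0" "\<And>i. colact n (T i) w = cs (l i) w"
    using cvs.joint_eigenvector[OF clin_colact colact_Vn subspace_Vn u] by blast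
  show ?thesis unfolding jspec_def mem_Collect_eq
  proof (intro bexI[of _ "vec n w"] conjI allI)
    show "vec n w \<noteq> 0\<^sub>v n"
    proof
      assume a: "vec n w = 0\<^sub>v n"
      have "w k = 0" for k
      proof (cases "k < n")
        case True
        then have "w k = vec_index (vec n w) k" by simp
        also have "\<dots> = 0" unfolding a using True by simp
        finally show ?thesis .
      qed (use w(1) in \<open>simp add: Vn_def\<close>)
      then show False using w(2) by (auto simp: fun_eq_iff)
    qed
    fix i show "T i *\<^sub>v vec n w = vec_nth (vec_lambda l) i \<cdot>\<^sub>v vec n w"
    proof (rule eq_vecI)
      fix r assume "r < dim_vec (vec_nth (vec_lambda l) i \<cdot>\<^sub>v vec n w)"
      then have r: "r < n" by simp
      then have "vec_index (T i *\<^sub>v vec n w) r = colact n (T i) w r"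
        using Ti[of i] by (simp add: colact_def scalar_prod_def atLeast0LessThan)
      then show "vec_index (T i *\<^sub>v vec n w) r = vec_index (vec_nth (vec_lambda l) i \<cdot>\<^sub>v vec n w) r"
        using r w(3) by (simp add: cs_def)
    qed (use Ti in auto)
  qed simp
qed

text \<open>A left eigenvector y for l pairs to 0 with every right generalized eigenvector for a
  different l', as y takes T i to l i. If l were no right joint eigenvalue, y would annihilate a
  spanning set and vanish.\<close>

lemma row_gen_eigen_jspec:
  assumes u: "u \<in> Vn n" "u \<noteq> 0" "u \<in> cvs.joint_gen UNIV (\<lambda>i. rowact n (T i)) l m"
  shows "vec_lambda l \<in> jspec n T"
proof (rule ccontr)
  assume nj: "vec_lambda l \<notin> jspec n T"
  obtain y where y: "y \<in> Vn n" "y \<noteq> 0" "\<And>i. rowact n (T i) y = cs (l i) y"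
    using cvs.joint_eigenvector[OF clin_rowact rowact_Vn subspace_Vn u] by blast
  define pr where "pr v = (\<Sum>k<n. y k * v k)" for v
  have pr_add: "pr (v + w) = pr v + pr w" and pr_diff: "pr (v - w) = pr v - pr w" and pr_cs: "pr (cs c v) = c * pr v" for v w c
    by (simp_all add: pr_def cs_def sum.distrib distrib_left sum_subtractf right_diff_distrib sum_distrib_left mult.left_commute)
  have prT: "pr (colact n (T i) v) = l i * pr v" for i v
  proof -
    have "pr (colact n (T i) v) = (\<Sum>k<n. rowact n (T i) y k * v k)"
      by (simp add: pr_def colact_def rowact_def sum_distrib_left sum_distrib_right mult.assoc) (rule sum.swap)
    then show ?thesis unfolding y(3) by (simp add: pr_def cs_def sum_distrib_left mult.assoc)
  qed
  have orth: "pr v = 0" if "v \<in> cvs.joint_gen UNIV (\<lambda>i. colact n (T i)) l' m" and ne: "l' \<noteq> l" for v l' m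
    using that
  proof (induction m arbitrary: v)
    case 0
    then show ?case by (simp add: pr_def)
  next
    case (Suc m)
    obtain i where i: "l' i \<noteq> l i" using ne by auto
    have "pr (colact n (T i) v - cs (l' i) v) = 0" using Suc by (simp del: minus_apply)
    then have "(l i - l' i) * pr v = 0" by (simp only: pr_diff pr_cs prT left_diff_distrib)
    then show ?case using i by simp
  qed
  have "pr v = 0" if "v \<in> Vn n" for v
    using col_span[OF that]
  proof (induction rule: cvs.span_induct_alt)
    case base
    show ?case by (simp add: pr_def)
  next
    case (step c x z)
    then obtain l' m where x: "x \<in> Vn n" "x \<in> cvs.joint_gen UNIV (\<lambda>i. colact n (T i)) l' m" by blast
    have "pr x = 0"
    proof (cases "x = 0")
      case True
      then show ?thesis by (simp add: pr_def)
    next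
      case False
      then have "l' \<noteq> l" using col_gen_eigen_jspec[OF x(1) _ x(2)] nj by auto
      then show ?thesis using orth x(2) by blast
    qed
    then show ?case using step(2) by (simp only: pr_add pr_cs) simp
  qed
  note pr0 = this
  have "y k = 0" for k
  proof (cases "k < n")
    case True
    have "pr (\<lambda>j. if j = k then 1 else 0) = y k" using True by (simp add: pr_def if_distrib cong: if_cong)
    then show ?thesis using pr0[of "\<lambda>j. if j = k then 1 else 0"] True by (simp add: Vn_def)
  qed (use y(1) in \<open>simp add: Vn_def\<close>)
  then show False using y(2) by (auto simp: fun_eq_iff)
qed

text \<open>The order n comes from the dimension bound and is exactly the order of contact that
  \<open>fcalc\<close> prescribes.\<close>

lemma row_decomposition:
  assumes "y \<in> Vn n"
  shows "y \<in> cvs.span {u \<in> Vn n. \<exists>\<mu>\<in>jspec n T. u \<in> cvs.joint_gen UNIV (\<lambda>i. rowact n (T i)) (vec_nth \<mu>) n}"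
proof -
  let ?G = "{u \<in> Vn n. \<exists>l m. u \<in> cvs.joint_gen UNIV (\<lambda>i. rowact n (T i)) l m}"
  let ?H = "{u \<in> Vn n. \<exists>\<mu>\<in>jspec n T. u \<in> cvs.joint_gen UNIV (\<lambda>i. rowact n (T i)) (vec_nth \<mu>) n}"
  have "?G \<subseteq> cvs.span ?H"
  proof
    fix u assume "u \<in> ?G"
    then obtain l m where u: "u \<in> Vn n" "u \<in> cvs.joint_gen UNIV (\<lambda>i. rowact n (T i)) l m" by blast
    show "u \<in> cvs.span ?H"
    proof (cases "u = 0")
      case True
      then show ?thesis using cvs.span_zero by simp
    next
      case False
      have "u \<in> cvs.joint_gen UNIV (\<lambda>i. rowact n (T i)) l n"
        by (rule cvs.joint_gen_dimension_bound[OF clin_rowact rowact_Vn subspace_Vn linear_dependence_Vn u])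
      moreover have "l = vec_nth (vec_lambda l)" by (simp add: fun_eq_iff)
      ultimately show ?thesis using row_gen_eigen_jspec[OF u(1) False u(2)] u(1) by (intro cvs.span_base) force
    qed
  qed
  then show ?thesis using row_span[OF assms] cvs.span_minimal[OF _ cvs.subspace_span] by blast
qed

end

section \<open>Positive semidefinite forms\<close>

definition qf :: "nat \<Rightarrow> (nat \<Rightarrow> nat \<Rightarrow> complex) \<Rightarrow> (nat \<Rightarrow> complex) \<Rightarrow> complex" where
  "qf n K x = (\<Sum>p<n. \<Sum>q<n. K p q * x p * cnj (x q))"

definition psd :: "nat \<Rightarrow> (nat \<Rightarrow> nat \<Rightarrow> complex) \<Rightarrow> bool" where
  "psd n K \<longleftrightarrow> (\<forall>p<n. \<forall>q<n. K q p = cnj (K p q)) \<and> (\<forall>x. 0 \<le> Re (qf n K x))"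

lemma qf_Suc:
  assumes "\<And>p q. p < Suc n \<Longrightarrow> q < Suc n \<Longrightarrow> K q p = cnj (K p q)"
  shows "qf (Suc n) K x = qf n K x + (\<Sum>p<n. K p n * x p) * cnj (x n) + cnj (\<Sum>p<n. K p n * x p) * x n
     + K n n * x n * cnj (x n)"
proof -
  have "(\<Sum>q<n. K n q * x n * cnj (x q)) = cnj (\<Sum>p<n. K p n * x p) * x n"
    unfolding cnj_sum sum_distrib_right
  proof (rule sum.cong[OF refl])
    fix q assume "q \<in> {..<n}"
    then show "K n q * x n * cnj (x q) = cnj (K q n * x q) * x n" using assms[of q n] by simp
  qed
  then show ?thesis
    by (simp add: qf_def sum.distrib sum_distrib_right)
qed

lemma qf_rank_one: "qf n (\<lambda>p q. u p * cnj (u q)) x = (\<Sum>p<n. u p * x p) * cnj (\<Sum>p<n. u p * x p)"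
  by (simp add: qf_def sum_product mult_ac)

lemma qf_diff: "qf n (\<lambda>p q. K p q - L p q) x = qf n K x - qf n L x"
  by (simp add: qf_def sum_subtractf left_diff_distrib)

text \<open>Induction by the Schur complement of the last diagonal entry d. If d = 0, positivity
  forces the whole last column to vanish.\<close>

lemma cholesky:
  "psd n K \<Longrightarrow> \<exists>L. \<forall>p<n. \<forall>q<n. K p q = (\<Sum>k<n. L p k * cnj (L q k))"
proof (induction n arbitrary: K)
  case (Suc n)
  have h: "\<And>p q. p < Suc n \<Longrightarrow> q < Suc n \<Longrightarrow> K q p = cnj (K p q)" and pos: "\<And>x. 0 \<le> Re (qf (Suc n) K x)"
    using Suc.prems unfolding psd_def by blast+
  have qS: "qf (Suc n) K x = qf n K x + (\<Sum>p<n. K p n * x p) * cnj (x n) + cnj (\<Sum>p<n. K p n * x p) * x n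
     + K n n * x n * cnj (x n)" for x
    by (rule qf_Suc) (rule h)
  define d where "d = Re (K n n)"
  have dK: "K n n = of_real d" 
  proof -
    have "Im (K n n) = Im (cnj (K n n))" by (rule arg_cong[of _ _ Im], rule h) auto
    then show ?thesis by (simp add: d_def complex_eq_iff)
  qed
  have "qf (Suc n) K (\<lambda>k. if k = n then 1 else 0) = K n n"
    unfolding qS by (simp add: qf_def)
  then have d0: "d \<ge> 0" using pos[of "\<lambda>k. if k = n then 1 else 0"] by (simp add: d_def)
  show ?case
  proof (cases "d = 0")
    case True
    have Kn: "K p n = 0" if p: "p < n" for p
    proof (rule ccontr)
      assume nz: "K p n \<noteq> 0"
      \<comment> \<open>With this M the form takes the value -1 at x.\<close>
      define M where "M = (Re (K p p) + 1) / (2 * (cmod (K p n))\<^sup>2)"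
      define x where "x k = (if k = p then 1 else if k = n then - (of_real M * K p n) else 0)" for k
      have s: "(\<Sum>j<n. K j n * x j) = K p n"
        using p by (simp add: x_def if_distrib cong: if_cong)
      have q1: "qf n K x = K p p"
        using p by (simp add: qf_def x_def if_distrib[of "\<lambda>u. _ * u"] if_distrib[of "\<lambda>u. u * _"] if_distrib[of cnj] cong: if_cong)
      have "qf (Suc n) K x = K p p - 2 * of_real M * (K p n * cnj (K p n))"
        unfolding qS s q1 using p True by (simp add: x_def dK mult_ac)
      then have "Re (qf (Suc n) K x) = Re (K p p) - 2 * M * (cmod (K p n))\<^sup>2"
        by (simp add: complex_norm_square[symmetric] del: of_real_power)
      also have "\<dots> = -1" using nz by (simp add: M_def field_simps)
      finally show False using pos[of x] by simp
    qed
    have "psd n K"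
      unfolding psd_def
    proof (intro conjI allI impI)
      fix x
      have "qf (Suc n) K (\<lambda>k. if k < n then x k else 0) = qf n K x"
        unfolding qS by (simp add: qf_def)
      then show "0 \<le> Re (qf n K x)" using pos by metis
    qed (rule h; simp)
    from Suc.IH[OF this] obtain L where L: "\<And>p q. p < n \<Longrightarrow> q < n \<Longrightarrow> K p q = (\<Sum>k<n. L p k * cnj (L q k))" by blast
    show ?thesis
    proof (intro exI[of _ "\<lambda>p k. if p < n \<and> k < n then L p k else 0"] allI impI)
      fix p q assume "p < Suc n" "q < Suc n"
      then consider "p < n" "q < n" | "p = n" "q = n" | "p < n" "q = n" | "p = n" "q < n" by linarith
      then show "K p q = (\<Sum>k<Suc n. (if p < n \<and> k < n then L p k else 0) * cnj (if q < n \<and> k < n then L q k else 0))"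
        using L Kn dK True h[of q n] h[of n q] by cases auto
    qed
  next
    case False
    with d0 have d: "d > 0" by simp
    have sd: "of_real (sqrt d) * of_real (sqrt d) = (of_real d :: complex)" using d by (simp flip: of_real_mult)
    define u where "u p = K p n / of_real (sqrt d)" for p
    define K' where "K' p q = K p q - u p * cnj (u q)" for p q
    have uu: "K p n * cnj (K q n) / of_real d = u p * cnj (u q)" for p q
      using d by (simp add: u_def sd)
    have "psd n K'"
      unfolding psd_def
    proof (intro conjI allI impI)
      fix p q assume "p < n" "q < n"
      then show "K' q p = cnj (K' p q)" using h[of p q] by (simp add: K'_def mult.commute)
    next
      fix x
      define s where "s = (\<Sum>p<n. K p n * x p)"
      \<comment> \<open>The last coordinate minimizes the form, i.e. completes the square, and the
        value there is the Schur complement at x.\<close>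
      define y where "y k = (if k < n then x k else - (s / of_real d))" for k
      have "(\<Sum>p<n. K p n * y p) = s" by (simp add: y_def s_def)
      moreover have "qf n K y = qf n K x" by (simp add: qf_def y_def)
      ultimately have "qf (Suc n) K y = qf n K x - s * cnj s / of_real d"
        unfolding qS using d by (simp add: y_def dK) (simp add: field_simps)?
      also have "s * cnj s / of_real d = (\<Sum>p<n. u p * x p) * cnj (\<Sum>p<n. u p * x p)"
        unfolding s_def u_def using d by (simp add: sum_divide_distrib[symmetric] sd)
      finally have "qf n K' x = qf (Suc n) K y"
        by (simp add: K'_def[abs_def] qf_diff qf_rank_one)
      then show "0 \<le> Re (qf n K' x)" using pos by simp
    qed
    from Suc.IH[OF this] obtain L where L: "\<And>p q. p < n \<Longrightarrow> q < n \<Longrightarrow> K' p q = (\<Sum>k<n. L p k * cnj (L q k))" by blast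
    define L' where "L' p k = (if k = n then u p else if p < n then L p k else 0)" for p k
    show ?thesis
    proof (intro exI[of _ L'] allI impI)
      fix p q assume pq: "p < Suc n" "q < Suc n"
      have "(\<Sum>k<Suc n. L' p k * cnj (L' q k)) = (\<Sum>k<n. L' p k * cnj (L' q k)) + u p * cnj (u q)"
        by (simp add: L'_def)
      also have "\<dots> = K p q"
      proof (cases "p < n \<and> q < n")
        case True
        then have "(\<Sum>k<n. L' p k * cnj (L' q k)) = K' p q" unfolding L[OF True[THEN conjunct1] True[THEN conjunct2]]
          by (intro sum.cong) (auto simp: L'_def)
        then show ?thesis by (simp add: K'_def)
      next
        case False
        then have "(\<Sum>k<n. L' p k * cnj (L' q k)) = 0" by (intro sum.neutral) (auto simp: L'_def)
        moreover have "u p * cnj (u q) = K p q"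
        proof (cases "q = n")
          case True
          then show ?thesis unfolding uu[symmetric] using d by (simp add: dK)
        next
          case False
          with \<open>\<not> (p < n \<and> q < n)\<close> pq have "p = n" by auto
          then show ?thesis unfolding uu[symmetric] using d h[of q n] pq by (simp add: dK)
        qed
        ultimately show ?thesis by simp
      qed
      finally show "K p q = (\<Sum>k<Suc n. L' p k * cnj (L' q k))" by simp
    qed
  qed
qed simp

lemma qf_gram:
  assumes "\<And>p q. p < n \<Longrightarrow> q < n \<Longrightarrow> K p q = (\<Sum>k<m. L p k * cnj (L q k))"
  shows "qf n K x = of_real (\<Sum>k<m. (cmod (\<Sum>p<n. L p k * x p))\<^sup>2)"
proof -
  have "qf n K x = (\<Sum>p<n. \<Sum>q<n. \<Sum>k<m. (L p k * x p) * cnj (L q k * x q))"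
    unfolding qf_def using assms by (intro sum.cong refl) (simp add: sum_distrib_left sum_distrib_right mult_ac)
  also have "\<dots> = (\<Sum>k<m. \<Sum>p<n. \<Sum>q<n. (L p k * x p) * cnj (L q k * x q))"
    by (subst sum.swap, subst (2) sum.swap, subst sum.swap) (rule sum.cong[OF refl], rule sum.swap)
  also have "\<dots> = (\<Sum>k<m. (\<Sum>p<n. L p k * x p) * cnj (\<Sum>p<n. L p k * x p))"
    by (simp add: sum_product)
  finally show ?thesis by (simp only: complex_norm_square[symmetric] of_real_sum)
qed

lemma invertible_matI:
  assumes A: "A \<in> carrier_mat n n" and inj: "\<And>x. (\<And>r. r < n \<Longrightarrow> app A x r = 0) \<Longrightarrow> (\<And>k. k < n \<Longrightarrow> x k = 0)"
  shows "\<exists>B\<in>carrier_mat n n. A * B = 1\<^sub>m n \<and> B * A = 1\<^sub>m n"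
proof -
  have "det A \<noteq> 0"
  proof
    assume "det A = 0"
    then obtain v where v: "v \<in> carrier_vec n" "v \<noteq> 0\<^sub>v n" "A *\<^sub>v v = 0\<^sub>v n"
      using det_0_iff_vec_prod_zero_field[OF A] by blast
    have "app A (vec_index v) r = 0" if r: "r < n" for r
    proof -
      have "vec_index (A *\<^sub>v v) r = 0" using v(3) r by simp
      then show ?thesis using A v(1) r by (simp add: app_def scalar_prod_def atLeast0LessThan)
    qed
    from inj[OF this] have "v = 0\<^sub>v n" using v(1) by (intro eq_vecI) auto
    with v(2) show False ..
  qed
  then have "A \<in> Units (ring_mat TYPE(complex) n ())" by (rule det_non_zero_imp_unit[OF A])
  then show ?thesis by (auto simp: Units_def ring_mat_def)
qed

text \<open>The truncated shift: the multiplication operators of the coordinates on the polynomials of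
  degree less than n, and their deformation with distinct joint eigenvalues on a grid of mesh th.\<close>

definition MI :: "nat \<Rightarrow> ('d::finite \<Rightarrow> nat) set" where
  "MI n = {\<alpha>. sum \<alpha> UNIV < n}"

lemma finite_MI: "finite (MI n :: ('d::finite \<Rightarrow> nat) set)"
proof (rule finite_subset)
  show "MI n \<subseteq> PiE (UNIV :: 'd set) (\<lambda>_. {..n})"
  proof
    fix \<alpha> :: "'d \<Rightarrow> nat" assume a: "\<alpha> \<in> MI n"
    have "\<alpha> i \<le> sum \<alpha> UNIV" for i by (rule member_le_sum) auto
    then show "\<alpha> \<in> PiE UNIV (\<lambda>_. {..n})" using a by (auto simp: MI_def intro: order_trans less_imp_le)
  qed
qed (intro finite_PiE; simp)

definition inc :: "'d \<Rightarrow> ('d \<Rightarrow> nat) \<Rightarrow> 'd \<Rightarrow> nat" where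
  "inc i \<alpha> = \<alpha>(i := Suc (\<alpha> i))"

lemma sum_inc: "sum (inc i \<alpha>) UNIV = Suc (sum \<alpha> (UNIV :: 'd::finite set))"
proof -
  have "sum (inc i \<alpha>) UNIV = inc i \<alpha> i + sum (inc i \<alpha>) (UNIV - {i})" by (rule sum.remove) auto
  also have "sum (inc i \<alpha>) (UNIV - {i}) = sum \<alpha> (UNIV - {i})" by (intro sum.cong) (auto simp: inc_def)
  also have "inc i \<alpha> i + sum \<alpha> (UNIV - {i}) = Suc (\<alpha> i + sum \<alpha> (UNIV - {i}))" by (simp add: inc_def)
  also have "\<alpha> i + sum \<alpha> (UNIV - {i}) = sum \<alpha> UNIV" by (rule sum.remove[symmetric]) auto
  finally show ?thesis .
qed

text \<open>Products of falling factorials. Multiplied by h^|\<alpha>| they are the Newton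
  polynomials of the grid with mesh h, evaluated at the grid point h \<beta>.\<close>

definition falling :: "('d::finite \<Rightarrow> nat) \<Rightarrow> ('d \<Rightarrow> nat) \<Rightarrow> complex" where
  "falling \<beta> \<alpha> = (\<Prod>i\<in>UNIV. \<Prod>j<\<alpha> i. (of_nat (\<beta> i) - of_nat j))"

lemma falling_inc: "falling \<beta> (inc i \<alpha>) = (of_nat (\<beta> i) - of_nat (\<alpha> i)) * falling \<beta> \<alpha>"
proof -
  let ?f = "\<lambda>\<alpha> i. \<Prod>j<\<alpha> i. (of_nat (\<beta> i) - of_nat j :: complex)"
  have "falling \<beta> (inc i \<alpha>) = ?f (inc i \<alpha>) i * prod (?f (inc i \<alpha>)) (UNIV - {i})"
    unfolding falling_def by (rule prod.remove) auto
  also have "prod (?f (inc i \<alpha>)) (UNIV - {i}) = prod (?f \<alpha>) (UNIV - {i})"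
    by (intro prod.cong) (auto simp: inc_def)
  also have "?f (inc i \<alpha>) i = (of_nat (\<beta> i) - of_nat (\<alpha> i)) * ?f \<alpha> i" by (simp add: inc_def)
  also have "(of_nat (\<beta> i) - of_nat (\<alpha> i)) * ?f \<alpha> i * prod (?f \<alpha>) (UNIV - {i}) = (of_nat (\<beta> i) - of_nat (\<alpha> i)) * falling \<beta> \<alpha>"
    unfolding falling_def by (subst prod.remove[of UNIV i "?f \<alpha>"]) auto
  finally show ?thesis .
qed

lemma falling_zero: "falling \<beta> (\<lambda>_. 0) = 1"
  by (simp add: falling_def)

lemma falling_eq_0: "\<beta> i < \<alpha> i \<Longrightarrow> falling \<beta> \<alpha> = 0"
proof -
  assume "\<beta> i < \<alpha> i"
  then have "(\<Prod>j<\<alpha> i. (of_nat (\<beta> i) - of_nat j :: complex)) = 0" by (intro prod_zero) auto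
  then show ?thesis unfolding falling_def by (intro prod_zero) auto
qed

lemma falling_self: "falling \<beta> \<beta> \<noteq> 0"
  by (auto simp: falling_def)

text \<open>If the value is nonzero then \<alpha> \<le> \<beta> in every coordinate. Hence the
  Newton system is triangular with respect to total degree.\<close>

lemma falling_eq_0_degree:
  assumes "sum \<beta> UNIV \<le> sum \<alpha> UNIV" "\<alpha> \<noteq> \<beta>" shows "falling \<beta> \<alpha> = 0"
proof (rule ccontr)
  assume "falling \<beta> \<alpha> \<noteq> 0"
  then have le: "\<alpha> i \<le> \<beta> i" for i using falling_eq_0 not_le by blast
  obtain i where "\<alpha> i \<noteq> \<beta> i" using assms(2) by auto
  then have "\<alpha> i < \<beta> i" using le[of i] by simp
  then have "sum \<alpha> UNIV < sum \<beta> UNIV" using le by (intro sum_strict_mono_ex1) auto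
  with assms(1) show False by simp
qed

text \<open>Newton interpolation on a shrinking grid: data of order n at the grid points force all
  divided differences of order below n to tend to 0.\<close>

lemma divided_differences_tendsto_0:
  fixes u :: "nat \<Rightarrow> ('d::finite \<Rightarrow> nat) \<Rightarrow> complex" and h :: "nat \<Rightarrow> real"
  assumes h: "\<And>k. 0 < h k" "\<And>k. h k \<le> 1" "h \<longlonglongrightarrow> 0"
    and C: "eventually (\<lambda>k. \<forall>\<beta>\<in>MI n. cmod (\<Sum>\<alpha>\<in>MI n. u k \<alpha> * (of_real (h k) ^ sum \<alpha> UNIV * falling \<beta> \<alpha>)) \<le> C * h k ^ n) sequentially"
    and \<beta>: "\<beta> \<in> MI n"
  shows "(\<lambda>k. u k \<beta>) \<longlonglongrightarrow> 0"
proof -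
  have *: "\<exists>K. eventually (\<lambda>k. cmod (u k \<beta>) * h k ^ sum \<beta> UNIV \<le> K * h k ^ n) sequentially" if "\<beta> \<in> MI n" for \<beta>
    using that
  proof (induction "sum \<beta> UNIV" arbitrary: \<beta> rule: less_induct)
    case less
    let ?L = "{\<alpha> :: 'd \<Rightarrow> nat. \<alpha> \<in> MI n \<and> sum \<alpha> UNIV < sum \<beta> UNIV}"
    have fL: "finite ?L" by (rule finite_subset[OF _ finite_MI[of n]]) auto
    have "\<forall>\<alpha>\<in>?L. \<exists>K. eventually (\<lambda>k. cmod (u k \<alpha>) * h k ^ sum \<alpha> UNIV \<le> K * h k ^ n) sequentially"
      using less.hyps by blast
    from bchoice[OF this] obtain K where
      K: "\<forall>\<alpha>\<in>?L. eventually (\<lambda>k. cmod (u k \<alpha>) * h k ^ sum \<alpha> UNIV \<le> K \<alpha> * h k ^ n) sequentially"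
      by blast
    have ev: "eventually (\<lambda>k. \<forall>\<alpha>\<in>?L. cmod (u k \<alpha>) * h k ^ sum \<alpha> UNIV \<le> K \<alpha> * h k ^ n) sequentially"
      by (rule eventually_ball_finite[OF fL K])
    let ?K = "(C + (\<Sum>\<alpha>\<in>?L. K \<alpha> * cmod (falling \<beta> \<alpha>))) / cmod (falling \<beta> \<beta>)"
    have "eventually (\<lambda>k. cmod (u k \<beta>) * h k ^ sum \<beta> UNIV \<le> ?K * h k ^ n) sequentially"
      using C ev
    proof eventually_elim
      case (elim k)
      let ?g = "\<lambda>\<alpha>. u k \<alpha> * (of_real (h k) ^ sum \<alpha> UNIV * falling \<beta> \<alpha>)"
      have "(\<Sum>\<alpha>\<in>MI n. ?g \<alpha>) = ?g \<beta> + (\<Sum>\<alpha>\<in>MI n - {\<beta>}. ?g \<alpha>)"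
        using finite_MI less.prems by (rule sum.remove)
      also have "(\<Sum>\<alpha>\<in>MI n - {\<beta>}. ?g \<alpha>) = (\<Sum>\<alpha>\<in>?L. ?g \<alpha>)"
        using finite_MI falling_eq_0_degree[of \<beta>] by (intro sum.mono_neutral_right) (auto simp: not_less)
      finally have "?g \<beta> = (\<Sum>\<alpha>\<in>MI n. ?g \<alpha>) - (\<Sum>\<alpha>\<in>?L. ?g \<alpha>)" by simp
      then have "cmod (?g \<beta>) \<le> cmod (\<Sum>\<alpha>\<in>MI n. ?g \<alpha>) + cmod (\<Sum>\<alpha>\<in>?L. ?g \<alpha>)"
        using norm_triangle_ineq4[of "\<Sum>\<alpha>\<in>MI n. ?g \<alpha>" "\<Sum>\<alpha>\<in>?L. ?g \<alpha>"] by simp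
      also have "\<dots> \<le> cmod (\<Sum>\<alpha>\<in>MI n. ?g \<alpha>) + (\<Sum>\<alpha>\<in>?L. cmod (?g \<alpha>))"
        by (intro add_left_mono norm_sum)
      also have "\<dots> \<le> C * h k ^ n + (\<Sum>\<alpha>\<in>?L. K \<alpha> * h k ^ n * cmod (falling \<beta> \<alpha>))"
      proof (intro add_mono sum_mono)
        show "cmod (\<Sum>\<alpha>\<in>MI n. ?g \<alpha>) \<le> C * h k ^ n" using elim(1) less.prems by blast
        fix \<alpha> assume "\<alpha> \<in> ?L"
        then have "cmod (u k \<alpha>) * h k ^ sum \<alpha> UNIV * cmod (falling \<beta> \<alpha>) \<le> K \<alpha> * h k ^ n * cmod (falling \<beta> \<alpha>)"
          using elim(2) by (intro mult_right_mono) auto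
        then show "cmod (?g \<alpha>) \<le> K \<alpha> * h k ^ n * cmod (falling \<beta> \<alpha>)"
          using h(1)[of k] by (simp add: norm_mult norm_power mult.assoc)
      qed
      also have "\<dots> = (C + (\<Sum>\<alpha>\<in>?L. K \<alpha> * cmod (falling \<beta> \<alpha>))) * h k ^ n"
        by (simp add: ring_distribs sum_distrib_right sum_distrib_left mult_ac)
      finally have "cmod (u k \<beta>) * h k ^ sum \<beta> UNIV * cmod (falling \<beta> \<beta>) \<le> (C + (\<Sum>\<alpha>\<in>?L. K \<alpha> * cmod (falling \<beta> \<alpha>))) * h k ^ n"
        using h(1)[of k] by (simp add: norm_mult norm_power mult.assoc)
      then show ?case using falling_self[of \<beta>] by (simp add: field_simps)
    qed
    then show ?case by blast
  qed
  obtain K where K: "eventually (\<lambda>k. cmod (u k \<beta>) * h k ^ sum \<beta> UNIV \<le> K * h k ^ n) sequentially"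
    using *[OF \<beta>] by blast
  \<comment> \<open>Since the degree of \<beta> is less than n, at least one factor h remains after
    division, and it tends to 0.\<close>
  have "eventually (\<lambda>k. cmod (u k \<beta>) \<le> \<bar>K\<bar> * h k) sequentially"
    using K
  proof eventually_elim
    case (elim k)
    let ?b = "sum \<beta> UNIV"
    have b: "?b < n" using \<beta> by (simp add: MI_def)
    have "h k ^ n = h k ^ ?b * h k ^ (n - ?b)" using b by (simp flip: power_add)
    moreover have "h k ^ (n - ?b) \<le> h k ^ 1" using b h(1,2)[of k] by (intro power_decreasing) auto
    ultimately have "K * h k ^ n \<le> \<bar>K\<bar> * (h k ^ ?b * h k)"
      using h(1)[of k] by (intro mult_mono) (auto intro: mult_left_mono)
    with elim have "cmod (u k \<beta>) * h k ^ ?b \<le> (\<bar>K\<bar> * h k) * h k ^ ?b" by (simp add: mult_ac)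
    then show ?case using h(1)[of k] by (simp add: mult_le_cancel_right_pos)
  qed
  moreover have "(\<lambda>k. \<bar>K\<bar> * h k) \<longlonglongrightarrow> 0" using tendsto_mult_right_zero[OF h(3)] .
  ultimately show ?thesis by (rule Lim_null_comparison)
qed

section \<open>Tuples of scalar matrices\<close>

lemma word_eval_scalar_mat:
  "word_eval n (\<lambda>i. vec_nth z i \<cdot>\<^sub>m 1\<^sub>m n) w = wmon w z \<cdot>\<^sub>m 1\<^sub>m n"
proof (induction w)
  case (Cons i w)
  have "(vec_nth z i \<cdot>\<^sub>m 1\<^sub>m n) * (wmon w z \<cdot>\<^sub>m 1\<^sub>m n) = (vec_nth z i * wmon w z) \<cdot>\<^sub>m (1\<^sub>m n :: complex mat)"
    by (rule eq_matI) auto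
  then show ?case using Cons by (simp add: wmon_def)
qed (rule eq_matI; simp add: wmon_def)

lemma fp_eval_scalar_mat: "fp_eval n p (\<lambda>i. vec_nth z i \<cdot>\<^sub>m 1\<^sub>m n) = fp_scalar p z \<cdot>\<^sub>m 1\<^sub>m n"
  by (rule eq_matI) (auto simp: fp_eval_def word_eval_scalar_mat fp_scalar_eq)

lemma delta_scalar_mat:
  assumes "n \<ge> 1"
  shows "delta_eval a b \<delta> n (\<lambda>i. vec_nth z i \<cdot>\<^sub>m 1\<^sub>m n) = kron (delta_eval a b \<delta> 1 (scal z)) (1\<^sub>m n)"
proof (rule eq_matI)
  fix r c assume "r < dim_row (kron (delta_eval a b \<delta> 1 (scal z)) (1\<^sub>m n))" "c < dim_col (kron (delta_eval a b \<delta> 1 (scal z)) (1\<^sub>m n))"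
  then have r: "r < a * n" and c: "c < b * n" by auto
  note r' = div_mod_less[OF r] and c' = div_mod_less[OF c]
  have "delta_eval a b \<delta> 1 (scal z) $$ (r div n, c div n) = fp_scalar (\<delta> (r div n) (c div n)) z"
    using r' c' by (simp add: delta_index fp_scalar_def)
  then show "delta_eval a b \<delta> n (\<lambda>i. vec_nth z i \<cdot>\<^sub>m 1\<^sub>m n) $$ (r, c) = kron (delta_eval a b \<delta> 1 (scal z)) (1\<^sub>m n) $$ (r, c)"
    using r c r' c' by (simp add: kron_index delta_index fp_eval_scalar_mat)
qed auto

lemma Gd_scalar_mat:
  assumes "z \<in> Ucom a b \<delta>" "n \<ge> 1"
  shows "(\<lambda>i. vec_nth z i \<cdot>\<^sub>m 1\<^sub>m n) \<in> Gd a b \<delta> n"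
  using assms bdd_by_kron_one_right[of _ "delta_eval a b \<delta> 1 (scal z)" n]
  by (auto simp: Gd_iff Ucom_def delta_scalar_mat is_mtuple_def)

text \<open>e numbers the multi-indices of degree less than n. The position \<open>k0\<close> of the
  zero multi-index is singled out because row \<open>k0\<close> of a value contains its divided
  differences.\<close>

context
  fixes n N :: nat and e :: "nat \<Rightarrow> ('d::finite) \<Rightarrow> nat" and k0 :: nat
  assumes e: "bij_betw e {..<N} (MI n)" and k0: "k0 < N" "e k0 = (\<lambda>_. 0)"
begin

text \<open>For t h \<noteq> 0 the tuple has distinct joint eigenvalues \<mu> + t h \<beta>; for h = 0 it is \<mu> plus t times the
  truncated shift.\<close>

definition grid_tuple :: "complex ^ 'd \<Rightarrow> real \<Rightarrow> real \<Rightarrow> 'd mtuple" where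
  "grid_tuple \<mu> t h i = mat N N (\<lambda>(r, c). (if r = c then vec_nth \<mu> i + of_real (t * h) * of_nat (e r i) else 0) +
      (if e c = inc i (e r) then of_real t else 0))"

lemma grid_tuple_mtuple: "is_mtuple N (grid_tuple \<mu> t h)"
  by (simp add: is_mtuple_def grid_tuple_def)

lemma e_MI: "r < N \<Longrightarrow> e r \<in> MI n"
  using e by (auto simp: bij_betw_def)

lemma sum_MI: "(\<Sum>c<N. F (e c)) = (\<Sum>\<alpha>\<in>MI n. F \<alpha>)"
  using e by (rule sum.reindex_bij_betw)

lemma app_grid_tuple:
  assumes "r < N"
  shows "app (grid_tuple \<mu> t h i) (\<lambda>k. X (e k)) r = (vec_nth \<mu> i + of_real (t * h) * of_nat (e r i)) * X (e r) +
     (if inc i (e r) \<in> MI n then of_real t * X (inc i (e r)) else 0)"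
proof -
  have "app (grid_tuple \<mu> t h i) (\<lambda>k. X (e k)) r = (\<Sum>c<N. (if r = c then (vec_nth \<mu> i + of_real (t * h) * of_nat (e r i)) * X (e c) else 0)) +
      (\<Sum>c<N. (if e c = inc i (e r) then of_real t * X (e c) else 0))"
    using assms unfolding sum.distrib[symmetric] app_def
    by (intro sum.cong) (auto simp: grid_tuple_def distrib_right)
  also have "(\<Sum>c<N. (if e c = inc i (e r) then of_real t * X (e c) else 0)) =
      (\<Sum>\<alpha>\<in>MI n. (if \<alpha> = inc i (e r) then of_real t * X \<alpha> else 0))"
    by (rule sum_MI)
  finally show ?thesis using assms by (simp add: sum.delta[OF finite_MI])
qed

text \<open>The values of the Newton polynomials at a grid point form a joint eigenvector:
  \<open>falling_inc\<close> is the eigenvalue equation, and the truncation does no harm because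
  terms of degree n or more vanish at \<beta>.\<close>

lemma grid_tuple_eigenvector:
  assumes "\<beta> \<in> MI n"
  shows "intw 1 N (mat N 1 (\<lambda>(r, _). of_real h ^ sum (e r) UNIV * falling \<beta> (e r)))
     (scal (\<chi> i. vec_nth \<mu> i + of_real (t * h) * of_nat (\<beta> i))) (grid_tuple \<mu> t h)" (is "intw 1 N ?S ?X _")
proof (rule intwI[OF scal_mtuple grid_tuple_mtuple])
  fix i x r assume r: "r < N"
  let ?x = "\<lambda>\<alpha>. of_real h ^ sum \<alpha> UNIV * falling \<beta> \<alpha> :: complex"
  have "app (grid_tuple \<mu> t h i) (app ?S x) r = app (grid_tuple \<mu> t h i) (\<lambda>k. x 0 * ?x (e k)) r"
    by (intro app_cong_eq refl) (auto simp: app_def grid_tuple_def)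
  also have "\<dots> = x 0 * app (grid_tuple \<mu> t h i) (\<lambda>k. ?x (e k)) r" by (rule app_scale)
  also have "app (grid_tuple \<mu> t h i) (\<lambda>k. ?x (e k)) r = (vec_nth \<mu> i + of_real (t * h) * of_nat (\<beta> i)) * ?x (e r)"
  proof -
    have "(if inc i (e r) \<in> MI n then of_real t * ?x (inc i (e r)) else 0) =
        of_real (t * h) * (of_nat (\<beta> i) - of_nat (e r i)) * ?x (e r)"
    proof (cases "inc i (e r) \<in> MI n")
      case True
      then show ?thesis by (simp add: sum_inc falling_inc mult_ac)
    next
      case False
      then have "sum \<beta> UNIV < sum (inc i (e r)) UNIV" using assms by (simp add: MI_def)
      then have "falling \<beta> (inc i (e r)) = 0" by (intro falling_eq_0_degree) auto
      then show ?thesis using False by (auto simp: falling_inc)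
    qed
    then show ?thesis unfolding app_grid_tuple[OF r, of \<mu> t h i ?x] by (simp add: algebra_simps)
  qed
  finally show "app ?S (app (?X i) x) r = app (grid_tuple \<mu> t h i) (app ?S x) r"
    using r by (simp add: app_def scal_def mult_ac)
qed simp

text \<open>Entry \<open>k0\<close> of each eigenvector is 1, so row \<open>k0\<close> of \<phi> at
  the grid tuple, paired with the eigenvector, gives \<phi> at the eigenvalue; likewise for p. The
  difference of the rows therefore has data of size h^n on the grid and tends to 0, while continuity
  of \<phi> identifies the limit.\<close>

lemma grid_tuple_row:
  fixes \<phi> :: "'d mtuple \<Rightarrow> complex mat"
  assumes nc: "is_nc_fun a b \<delta> \<phi>" and C: "\<And>Z. Z \<in> Gall a b \<delta> \<Longrightarrow> opnorm (\<phi> Z) \<le> C"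
    and \<mu>: "\<mu> \<in> Ucom a b \<delta>" and jet: "jet0 n \<mu> (\<lambda>z. \<phi> (scal z) $$ (0, 0) - fp_scalar p z)"
  shows "\<exists>t>0. grid_tuple \<mu> t 0 \<in> Gd a b \<delta> N \<and> (\<forall>c<N. \<phi> (grid_tuple \<mu> t 0) $$ (k0, c) = fp_eval N p (grid_tuple \<mu> t 0) $$ (k0, c))"
proof -
  have N1: "N \<ge> 1" using k0 by simp
  define h where "h k = inverse (real (Suc k))" for k
  have h: "\<And>k. 0 < h k" "\<And>k. h k \<le> 1" "h \<longlonglongrightarrow> 0"
    unfolding h_def using LIMSEQ_inverse_real_of_nat by (auto simp: divide_simps)
  have hc: "(\<lambda>k. complex_of_real (h k)) \<longlonglongrightarrow> 0" using tendsto_of_real[OF h(3), where 'a = complex] by simp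
  have "tconv N (\<lambda>k. grid_tuple \<mu> (h k) 0) (\<lambda>i. vec_nth \<mu> i \<cdot>\<^sub>m 1\<^sub>m N) sequentially"
    unfolding tconv_def
  proof (intro conjI allI impI grid_tuple_mtuple)
    show "is_mtuple N (\<lambda>i. vec_nth \<mu> i \<cdot>\<^sub>m 1\<^sub>m N)" by (simp add: is_mtuple_def)
    fix i r c assume rc: "r < N" "c < N"
    have "(\<lambda>k. if e c = inc i (e r) then complex_of_real (h k) else 0) \<longlonglongrightarrow> 0"
      using hc by (cases "e c = inc i (e r)") auto
    then have "(\<lambda>k. (if r = c then vec_nth \<mu> i else 0) + (if e c = inc i (e r) then complex_of_real (h k) else 0)) \<longlonglongrightarrow> (if r = c then vec_nth \<mu> i else 0) + 0"
      by (intro tendsto_add tendsto_const)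
    then show "(\<lambda>k. grid_tuple \<mu> (h k) 0 i $$ (r, c)) \<longlonglongrightarrow> (vec_nth \<mu> i \<cdot>\<^sub>m 1\<^sub>m N) $$ (r, c)"
      using rc by (cases "r = c") (simp_all add: grid_tuple_def)
  qed
  \<comment> \<open>The weight t is fixed here, before the mesh is refined: for small weights the
    tuple with h = 0 is close to the scalar tuple at \<mu>.\<close>
  from Gd_open[OF this Gd_scalar_mat[OF \<mu> N1]] obtain m where m: "grid_tuple \<mu> (h m) 0 \<in> Gd a b \<delta> N"
    by (auto simp: eventually_sequentially)
  define t where "t = h m"
  have t: "t > 0" "grid_tuple \<mu> t 0 \<in> Gd a b \<delta> N" using m h by (auto simp: t_def)
  have conv: "tconv N (\<lambda>k. grid_tuple \<mu> t (h k)) (grid_tuple \<mu> t 0) sequentially"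
    unfolding tconv_def
  proof (intro conjI allI impI grid_tuple_mtuple)
    fix i r c assume rc: "r < N" "c < N"
    have "(\<lambda>k. vec_nth \<mu> i + of_real t * complex_of_real (h k) * of_nat (e r i) + q) \<longlonglongrightarrow>
        vec_nth \<mu> i + of_real t * 0 * of_nat (e r i) + q" for q
      by (intro tendsto_intros hc)
    from this[of "if e c = inc i (e r) then of_real t else 0"]
    show "(\<lambda>k. grid_tuple \<mu> t (h k) i $$ (r, c)) \<longlonglongrightarrow> grid_tuple \<mu> t 0 i $$ (r, c)"
      using rc by (cases "r = c") (simp_all add: grid_tuple_def)
  qed
  let ?z = "\<lambda>\<beta> k. (\<chi> i. vec_nth \<mu> i + of_real (t * h k) * of_nat (\<beta> i)) :: complex ^ 'd"
  define d where "d = the_inv_into {..<N} e"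
  have de: "d (e c) = c" if "c < N" for c
    unfolding d_def using e that by (intro the_inv_into_f_f) (auto simp: bij_betw_def)
  define u where "u k \<alpha> = \<phi> (grid_tuple \<mu> t (h k)) $$ (k0, d \<alpha>) - fp_eval N p (grid_tuple \<mu> t (h k)) $$ (k0, d \<alpha>)" for k \<alpha>
  obtain K0 e0 where K0: "e0 > 0" "\<And>z. norm (z - \<mu>) < e0 \<Longrightarrow> cmod (\<phi> (scal z) $$ (0, 0) - fp_scalar p z) \<le> K0 * norm (z - \<mu>) ^ n"
    using jet by (auto simp: jet0_def)
  \<comment> \<open>The grid points have distance at most t * CARD('d) * n * h from \<mu>; raised to
    the power n this is the constant in front of h^n.\<close>
  define K where "K = \<bar>K0\<bar> * (t * (real CARD('d) * real n)) ^ n"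
  have zn: "norm (?z \<beta> k - \<mu>) \<le> t * (real CARD('d) * real n) * h k" if "\<beta> \<in> MI n" for \<beta> k
  proof -
    have b: "\<beta> i \<le> n" for i
      using that member_le_sum[of i UNIV \<beta>] by (simp add: MI_def)
    have "norm (?z \<beta> k - \<mu>) \<le> (\<Sum>i\<in>UNIV. cmod (vec_nth (?z \<beta> k - \<mu>) i))" by (rule norm_le_sum_nth)
    also have "\<dots> \<le> (\<Sum>i\<in>(UNIV :: 'd set). t * h k * real n)"
      using t h(1)[of k] b by (intro sum_mono) (auto simp: norm_mult intro!: mult_left_mono)
    finally show ?thesis by (simp add: mult_ac)
  qed
  have evz: "eventually (\<lambda>k. ?z \<beta> k \<in> Ucom a b \<delta> \<and> norm (?z \<beta> k - \<mu>) < e0) sequentially" if "\<beta> \<in> MI n" for \<beta>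
  proof -
    have "(\<lambda>k. t * (real CARD('d) * real n) * h k) \<longlonglongrightarrow> 0" using tendsto_mult_right_zero[OF h(3)] .
    then have "(\<lambda>k. ?z \<beta> k - \<mu>) \<longlonglongrightarrow> 0"
      by (rule Lim_null_comparison[rotated]) (rule always_eventually, rule allI, rule zn[OF that])
    then have lim: "(\<lambda>k. ?z \<beta> k) \<longlonglongrightarrow> \<mu>" by (rule LIM_zero_cancel)
    show ?thesis
      using topological_tendstoD[OF lim open_Ucom \<mu>] tendstoD[OF lim K0(1)]
      by eventually_elim (auto simp: dist_norm)
  qed
  have main: "eventually (\<lambda>k. \<forall>\<beta>\<in>MI n. cmod (\<Sum>\<alpha>\<in>MI n. u k \<alpha> * (of_real (h k) ^ sum \<alpha> UNIV * falling \<beta> \<alpha>)) \<le> K * h k ^ n) sequentially"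
  proof (rule eventually_ball_finite[OF finite_MI], rule ballI)
    fix \<beta> :: "'d \<Rightarrow> nat" assume \<beta>: "\<beta> \<in> MI n"
    show "eventually (\<lambda>k. cmod (\<Sum>\<alpha>\<in>MI n. u k \<alpha> * (of_real (h k) ^ sum \<alpha> UNIV * falling \<beta> \<alpha>)) \<le> K * h k ^ n) sequentially"
      using evz[OF \<beta>] Gd_open[OF conv t(2)]
    proof eventually_elim
      case (elim k)
      let ?A = "grid_tuple \<mu> t (h k)" and ?w = "?z \<beta> k"
      let ?S = "mat N 1 (\<lambda>(r, _). of_real (h k) ^ sum (e r) UNIV * falling \<beta> (e r)) :: complex mat"
      note I = grid_tuple_eigenvector[OF \<beta>, of "h k" \<mu> t]
      have w: "scal ?w \<in> Gd a b \<delta> 1" using elim by (simp add: Ucom_def)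
      have S0: "?S $$ (k0, 0) = 1" using k0 by (simp add: falling_zero)
      have aS: "app ?S (\<lambda>_. 1) c = of_real (h k) ^ sum (e c) UNIV * falling \<beta> (e c)" if "c < N" for c
        using that by (simp add: app_def)
      have row: "(\<Sum>c<N. B $$ (k0, c) * (of_real (h k) ^ sum (e c) UNIV * falling \<beta> (e c))) = app B (app ?S (\<lambda>_. 1)) k0"
        if "B \<in> carrier_mat N N" for B
        unfolding app_def[of B] using that by (intro sum.cong) (auto simp: aS[unfolded One_nat_def])
      have 1: "app (\<phi> ?A) (app ?S (\<lambda>_. 1)) k0 = \<phi> (scal ?w) $$ (0, 0)"
        using nc_intw_app[OF nc _ N1 w elim(2) I k0(1), of "\<lambda>_. 1"] nc_carrier[OF nc _ w] k0 S0 by (simp add: app_def)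
      have 2: "app (fp_eval N p ?A) (app ?S (\<lambda>_. 1)) k0 = fp_scalar p ?w"
        using app_intw[OF intw_fp[OF I, of p] fp_eval_carrier fp_eval_carrier _ k0(1), of "\<lambda>_. 1"] k0 S0
        by (simp add: app_def fp_scalar_def)
      have "(\<Sum>\<alpha>\<in>MI n. u k \<alpha> * (of_real (h k) ^ sum \<alpha> UNIV * falling \<beta> \<alpha>)) =
        (\<Sum>c<N. u k (e c) * (of_real (h k) ^ sum (e c) UNIV * falling \<beta> (e c)))"
        by (rule sum_MI[symmetric])
      also have "\<dots> = (\<Sum>c<N. \<phi> ?A $$ (k0, c) * (of_real (h k) ^ sum (e c) UNIV * falling \<beta> (e c))) -
          (\<Sum>c<N. fp_eval N p ?A $$ (k0, c) * (of_real (h k) ^ sum (e c) UNIV * falling \<beta> (e c)))"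
        unfolding sum_subtractf[symmetric] by (intro sum.cong) (auto simp: u_def de left_diff_distrib)
      also have "\<dots> = \<phi> (scal ?w) $$ (0, 0) - fp_scalar p ?w"
        by (simp only: row[OF nc_carrier[OF nc N1 elim(2)]] row[OF fp_eval_carrier] 1 2)
      finally have "cmod (\<Sum>\<alpha>\<in>MI n. u k \<alpha> * (of_real (h k) ^ sum \<alpha> UNIV * falling \<beta> \<alpha>)) \<le> K0 * norm (?w - \<mu>) ^ n"
        using K0(2) elim by simp
      also have "\<dots> \<le> \<bar>K0\<bar> * norm (?w - \<mu>) ^ n" by (intro mult_right_mono) auto
      also have "\<dots> \<le> \<bar>K0\<bar> * (t * (real CARD('d) * real n) * h k) ^ n"
        using zn[OF \<beta>] by (intro mult_left_mono power_mono) auto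
      finally show ?case by (simp add: K_def power_mult_distrib mult_ac)
    qed
  qed
  have "\<phi> (grid_tuple \<mu> t 0) $$ (k0, c) = fp_eval N p (grid_tuple \<mu> t 0) $$ (k0, c)" if c: "c < N" for c
  proof -
    have "(\<lambda>k. u k (e c)) \<longlonglongrightarrow> 0" by (rule divided_differences_tendsto_0[OF h main e_MI[OF c]])
    moreover have "(\<lambda>k. u k (e c)) \<longlonglongrightarrow> \<phi> (grid_tuple \<mu> t 0) $$ (k0, c) - fp_eval N p (grid_tuple \<mu> t 0) $$ (k0, c)"
      unfolding u_def de[OF c]
      by (intro tendsto_diff nc_continuous[OF nc C N1 conv t(2)] tendsto_fp_eval[OF conv] k0 c)
    ultimately show ?thesis using LIMSEQ_unique by fastforce
  qed
  then show ?thesis using t by blast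
qed

text \<open>Row \<alpha> of S is the product of the shifted right multiplications (T i - \<mu>
  i)^(\<alpha> i) applied to y, divided by t^|\<alpha>| to match the weight of the shift. The
  products of length n kill y, so cutting off at degree n is consistent.\<close>

lemma grid_tuple_row_intw:
  assumes T: "is_mtuple n T" "commuting T"
    and y: "y \<in> cvs.joint_gen UNIV (\<lambda>i. rowact n (T i)) (vec_nth \<mu>) n" and t: "t > 0"
  shows "\<exists>S. intw n N S T (grid_tuple \<mu> t 0) \<and> (\<forall>c<n. S $$ (k0, c) = y c)"
proof -
  define L where "L i v = rowact n (T i) v - cs (vec_nth \<mu> i) v" for i v
  let ?Z = "cvs.joint_gen UNIV (\<lambda>i. rowact n (T i)) (vec_nth \<mu>)"
  have Ti: "T i \<in> carrier_mat n n" for i using T by (simp add: is_mtuple_def)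
  note cl = clin_rowact
  have clL: "cvs.clin (L i)" for i unfolding L_def[abs_def] by (rule cvs.clin_shift[OF cl])
  have Lcomm: "L i (L j v) = L j (L i v)" for i j v
  proof -
    have "rowact n (T i) (rowact n (T j) v) = rowact n (T j) (rowact n (T i) v)"
      using T(2) by (simp add: rowact_mult[OF Ti Ti] commuting_def)
    then show ?thesis
      by (simp add: L_def cvs.clin_diff[OF cl] cvs.clin_scale[OF cl] cvs.scale_right_diff_distrib mult.commute del: minus_apply)
  qed
  have LZ: "L i v \<in> ?Z (m - 1)" if "v \<in> ?Z m" for i v m
  proof (cases m)
    case 0
    then show ?thesis using that cvs.clin_zero[OF clL] by simp
  next
    case (Suc m')
    then show ?thesis using that by (simp add: L_def del: minus_apply)
  qed
  obtain js :: "'d list" where js: "set js = UNIV" "distinct js" using finite_distinct_list[OF finite[of "UNIV :: 'd set"]] by blast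
  \<comment> \<open>The factors are composed in the order of a fixed list; commutativity lets an
    additional factor be moved to the front, which is \<open>P_inc\<close>.\<close>
  define P where "P \<alpha> = foldr (\<lambda>i v. (L i ^^ \<alpha> i) v) js y" for \<alpha>
  have powc: "L j ((L i ^^ k) v) = (L i ^^ k) (L j v)" for i j k v
    by (induction k) (simp_all add: Lcomm)
  have fold_inc: "foldr (\<lambda>i v. (L i ^^ inc j \<alpha> i) v) is v = L j (foldr (\<lambda>i v. (L i ^^ \<alpha> i) v) is v)"
    if "j \<in> set is" "distinct is" for j \<alpha> v "is"
    using that
  proof (induction "is")
    case (Cons i "is")
    show ?case
    proof (cases "i = j")
      case True
      then have "foldr (\<lambda>i v. (L i ^^ inc j \<alpha> i) v) is v = foldr (\<lambda>i v. (L i ^^ \<alpha> i) v) is v"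
        using Cons.prems by (intro foldr_cong) (auto simp: inc_def)
      then show ?thesis using True by (simp add: inc_def)
    next
      case False
      then show ?thesis using Cons by (simp add: powc) (simp add: inc_def)
    qed
  qed simp
  have P_inc: "P (inc i \<alpha>) = L i (P \<alpha>)" for i \<alpha> unfolding P_def by (rule fold_inc) (use js in auto)
  have powZ: "(L i ^^ k) v \<in> ?Z (m - k)" if "v \<in> ?Z m" for i k v m
  proof (induction k)
    case (Suc k)
    have "m - k - 1 = m - Suc k" by simp
    then show ?case using LZ[OF Suc, of i] by simp
  qed (use that in simp)
  have "foldr (\<lambda>i v. (L i ^^ \<alpha> i) v) is y \<in> ?Z (n - sum_list (map \<alpha> is))" for \<alpha> "is"
  proof (induction "is")
    case (Cons i "is")
    show ?case using powZ[OF Cons, where i = i and k = "\<alpha> i"] by (simp add: add.commute)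
  qed (use y in simp)
  from this[of _ js] have PZ: "P \<alpha> \<in> ?Z (n - sum \<alpha> UNIV)" for \<alpha>
  proof -
    have "sum_list (map \<alpha> js) = sum \<alpha> UNIV" using sum_list_distinct_conv_sum_set[OF js(2), of \<alpha>] js(1) by simp
    then show ?thesis using \<open>\<And>\<alpha>. foldr (\<lambda>i v. (L i ^^ \<alpha> i) v) js y \<in> ?Z (n - sum_list (map \<alpha> js))\<close>[of \<alpha>]
      by (simp only: P_def)
  qed
  have P0: "P \<alpha> = 0" if "\<alpha> \<notin> MI n" for \<alpha> using PZ[of \<alpha>] that by (simp add: MI_def)
  have Py: "P (\<lambda>_. 0) = y" unfolding P_def by (induction js) auto
  define S where "S = mat N n (\<lambda>(r, c). inverse (of_real t ^ sum (e r) UNIV) * P (e r) c)"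
  have "intw n N S T (grid_tuple \<mu> t 0)"
    unfolding intw_def
  proof (intro conjI allI T(1) grid_tuple_mtuple)
    show "S \<in> carrier_mat N n" by (simp add: S_def)
    fix i
    show "S * T i = grid_tuple \<mu> t 0 i * S"
    proof (rule eq_matI)
      fix r c assume "r < dim_row (grid_tuple \<mu> t 0 i * S)" "c < dim_col (grid_tuple \<mu> t 0 i * S)"
      then have rc: "r < N" "c < n" by (auto simp: grid_tuple_def S_def)
      let ?\<alpha> = "e r" and ?s = "\<lambda>\<alpha>. inverse (of_real t ^ sum \<alpha> UNIV) :: complex"
      have "(S * T i) $$ (r, c) = (\<Sum>k<n. ?s ?\<alpha> * (P ?\<alpha> k * T i $$ (k, c)))"
        using rc Ti[of i] by (subst mat_mult_index) (auto simp: S_def mult.assoc)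
      also have "\<dots> = ?s ?\<alpha> * rowact n (T i) (P ?\<alpha>) c" using rc by (simp add: rowact_def sum_distrib_left)
      also have "rowact n (T i) (P ?\<alpha>) c = vec_nth \<mu> i * P ?\<alpha> c + P (inc i ?\<alpha>) c"
        unfolding P_inc by (simp add: L_def cs_def)
      finally have l: "(S * T i) $$ (r, c) = vec_nth \<mu> i * (?s ?\<alpha> * P ?\<alpha> c) + ?s ?\<alpha> * P (inc i ?\<alpha>) c"
        by (simp add: algebra_simps)
      have "(grid_tuple \<mu> t 0 i * S) $$ (r, c) = app (grid_tuple \<mu> t 0 i) (\<lambda>k. ?s (e k) * P (e k) c) r"
        unfolding app_def using rc by (subst mat_mult_index) (auto simp: S_def grid_tuple_def intro!: sum.cong)
      also have "\<dots> = vec_nth \<mu> i * (?s ?\<alpha> * P ?\<alpha> c) + (if inc i ?\<alpha> \<in> MI n then of_real t * (?s (inc i ?\<alpha>) * P (inc i ?\<alpha>) c) else 0)"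
        using app_grid_tuple[OF rc(1), of \<mu> t 0 i "\<lambda>\<alpha>. ?s \<alpha> * P \<alpha> c"] by simp
      also have "(if inc i ?\<alpha> \<in> MI n then of_real t * (?s (inc i ?\<alpha>) * P (inc i ?\<alpha>) c) else 0) = ?s ?\<alpha> * P (inc i ?\<alpha>) c"
        using t P0[of "inc i ?\<alpha>"] by (auto simp: sum_inc)
      finally show "(S * T i) $$ (r, c) = (grid_tuple \<mu> t 0 i * S) $$ (r, c)" using l by simp
    qed (use Ti in \<open>auto simp: grid_tuple_def S_def\<close>)
  qed
  moreover have "S $$ (k0, c) = y c" if "c < n" for c using that k0 by (simp add: S_def Py)
  ultimately show ?thesis by blast
qed

end

section \<open>Contractivity on commuting tuples\<close>

lemma nrm2_kron_left:
  "nrm2 (m * dim_row M) (app (kron (1\<^sub>m m) M) v) = (\<Sum>i<m. nrm2 (dim_row M) (app M (\<lambda>s. v (i * dim_col M + s))))"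
  unfolding nrm2_block by (intro sum.cong refl nrm2_cong) (simp add: app_kron_one_left)

lemma cauchy_schwarz_set:
  "(cmod (\<Sum>u\<in>t. a u * b u))\<^sup>2 \<le> (\<Sum>u\<in>t. (cmod (a u))\<^sup>2) * (\<Sum>u\<in>t. (cmod (b u))\<^sup>2)"
proof -
  have "cmod (\<Sum>u\<in>t. a u * b u) \<le> (\<Sum>u\<in>t. \<bar>cmod (a u)\<bar> * \<bar>cmod (b u)\<bar>)"
    using norm_sum[of "\<lambda>u. a u * b u" t] by (simp add: norm_mult)
  also have "\<dots> \<le> L2_set (\<lambda>u. cmod (a u)) t * L2_set (\<lambda>u. cmod (b u)) t"
    by (rule L2_set_mult_ineq)
  finally have "(cmod (\<Sum>u\<in>t. a u * b u))\<^sup>2 \<le> (L2_set (\<lambda>u. cmod (a u)) t * L2_set (\<lambda>u. cmod (b u)) t)\<^sup>2"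
    by (intro power_mono) auto
  then show ?thesis by (simp add: power_mult_distrib L2_set_def sum_nonneg)
qed

lemma qf_add: "qf n (\<lambda>p q. K p q + L p q) x = qf n K x + qf n L x"
  by (simp add: qf_def sum.distrib distrib_right)

lemma qf_sum: "qf n (\<lambda>p q. \<Sum>y\<in>Y. K y p q) x = (\<Sum>y\<in>Y. qf n (K y) x)"
  by (induction Y rule: infinite_finite_induct) (simp_all add: qf_add, simp_all add: qf_def)

lemma qf_scale: "qf n (\<lambda>p q. c * K p q) x = c * qf n K x"
  by (simp add: qf_def sum_distrib_left mult.assoc)

lemma qf_mat:
  assumes "S \<in> carrier_mat N n"
  shows "qf n (\<lambda>p q. \<Sum>k<N. S $$ (k, p) * cnj (S $$ (k, q))) x = of_real (nrm2 N (app S x))"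
  using assms by (subst qf_gram[of n _ "\<lambda>p k. S $$ (k, p)" N]) (auto simp: nrm2_def app_def)

lemma qf_id: "qf n (\<lambda>p q. if p = q then 1 else 0) x = of_real (nrm2 n x)"
  by (simp add: qf_def nrm2_def complex_norm_square if_distrib[of "\<lambda>u. u * _"] cong: if_cong del: of_real_power)

lemma qf_sqrt:
  assumes "psd n K"
  shows "\<exists>R\<in>carrier_mat n n. \<forall>x. qf n K x = of_real (nrm2 n (app R x))"
proof -
  obtain L where L: "\<And>p q. p < n \<Longrightarrow> q < n \<Longrightarrow> K p q = (\<Sum>k<n. L p k * cnj (L q k))"
    using cholesky[OF assms] by blast
  let ?R = "mat n n (\<lambda>(k, p). L p k)"
  have "qf n K x = of_real (nrm2 n (app ?R x))" for x
  proof -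
    have "qf n K x = of_real (\<Sum>k<n. (cmod (\<Sum>p<n. L p k * x p))\<^sup>2)" by (rule qf_gram) (rule L)
    then show ?thesis by (simp add: nrm2_def app_def)
  qed
  then show ?thesis by (intro bexI[of _ ?R]) auto
qed

text \<open>R is a square root, obtained from \<open>cholesky\<close>, of the standard form plus
  \<epsilon> times the pulled back forms. It is injective because this form dominates the standard
  one.\<close>

lemma renorm:
  assumes Y: "finite Y" "\<And>y. y \<in> Y \<Longrightarrow> S y \<in> carrier_mat N n" and \<epsilon>: "\<epsilon> > 0"
  shows "\<exists>R\<in>carrier_mat n n. \<exists>Ri\<in>carrier_mat n n. R * Ri = 1\<^sub>m n \<and> Ri * R = 1\<^sub>m n \<and>
     (\<forall>x. nrm2 n (app R x) = nrm2 n x + \<epsilon> * (\<Sum>y\<in>Y. nrm2 N (app (S y) x)))"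
proof -
  define K where "K p q = (if p = q then 1 else 0) + of_real \<epsilon> * (\<Sum>y\<in>Y. \<Sum>k<N. S y $$ (k, p) * cnj (S y $$ (k, q)))" for p q
  have q: "qf n K x = of_real (nrm2 n x + \<epsilon> * (\<Sum>y\<in>Y. nrm2 N (app (S y) x)))" for x
  proof -
    have "(\<Sum>y\<in>Y. qf n (\<lambda>p q. \<Sum>k<N. S y $$ (k, p) * cnj (S y $$ (k, q))) x) = (\<Sum>y\<in>Y. of_real (nrm2 N (app (S y) x)))"
      by (intro sum.cong refl qf_mat Y)
    then show ?thesis unfolding K_def[abs_def] qf_add qf_id qf_scale qf_sum by simp
  qed
  have "psd n K"
    unfolding psd_def
  proof (intro conjI allI impI)
    fix p q show "K q p = cnj (K p q)" by (auto simp: K_def mult.commute)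
  next
    fix x show "0 \<le> Re (qf n K x)" unfolding q using \<epsilon> by (simp add: sum_nonneg)
  qed
  from qf_sqrt[OF this] obtain R where R0: "R \<in> carrier_mat n n" "\<And>x. qf n K x = of_real (nrm2 n (app R x))" by blast
  have R: "R \<in> carrier_mat n n" "nrm2 n (app R x) = nrm2 n x + \<epsilon> * (\<Sum>y\<in>Y. nrm2 N (app (S y) x))" for x
    using R0 q[of x] by (auto simp only: of_real_eq_iff)
  have "x k = 0" if "\<And>r. r < n \<Longrightarrow> app R x r = 0" "k < n" for x k
  proof -
    have "nrm2 n (app R x) = 0" using that(1) by (simp add: nrm2_eq_0_iff)
    moreover have "0 \<le> \<epsilon> * (\<Sum>y\<in>Y. nrm2 N (app (S y) x))" using \<epsilon> by (simp add: sum_nonneg)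
    ultimately have "nrm2 n x = 0" using R(2)[of x] nrm2_nonneg[of n x] by linarith
    then show ?thesis using that(2) by (simp add: nrm2_eq_0_iff)
  qed
  then have "\<exists>B\<in>carrier_mat n n. R * B = 1\<^sub>m n \<and> B * R = 1\<^sub>m n"
    by (intro invertible_matI[OF R(1)]) blast
  with R show ?thesis by blast
qed

lemma intw_conj:
  assumes T: "is_mtuple n T" and R: "R \<in> carrier_mat n n" "Ri \<in> carrier_mat n n" "Ri * R = 1\<^sub>m n"
  shows "intw n n R T (\<lambda>i. R * T i * Ri)"
  unfolding intw_def
proof (intro conjI allI T R(1))
  have Ti: "T i \<in> carrier_mat n n" for i using T by (simp add: is_mtuple_def)
  show "is_mtuple n (\<lambda>i. R * T i * Ri)" using Ti R by (auto simp: is_mtuple_def intro!: mult_carrier_mat)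
  fix i
  have "R * T i * Ri * R = R * T i * (Ri * R)"
    by (rule assoc_mult_mat[OF mult_carrier_mat[OF R(1) Ti] R(2,1)])
  also have "\<dots> = R * T i" unfolding R(3) by (rule right_mult_one_mat[OF mult_carrier_mat[OF R(1) Ti]])
  finally show "R * T i = R * T i * Ri * R" by simp
qed

lemma intw_inverse:
  assumes I: "intw n n R T X" and R: "Ri \<in> carrier_mat n n" "R * Ri = 1\<^sub>m n" "Ri * R = 1\<^sub>m n"
  shows "intw n n Ri X T"
  unfolding intw_def
proof (intro conjI allI R(1))
  have Rc: "R \<in> carrier_mat n n" and mT: "is_mtuple n T" and mX: "is_mtuple n X" and e: "\<And>i. R * T i = X i * R"
    using I by (auto simp: intw_def)
  show "is_mtuple n X" "is_mtuple n T" by fact+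
  fix i
  have Ti: "T i \<in> carrier_mat n n" and Xi: "X i \<in> carrier_mat n n" using mT mX by (auto simp: is_mtuple_def)
  have "Ri * X i = Ri * (X i * (R * Ri))" using Xi R(2) by simp
  also have "\<dots> = Ri * (X i * R * Ri)" using assoc_mult_mat[OF Xi Rc R(1)] by simp
  also have "\<dots> = Ri * (R * (T i * Ri))" unfolding e[symmetric] using assoc_mult_mat[OF Rc Ti R(1)] by simp
  also have "\<dots> = Ri * R * (T i * Ri)" using assoc_mult_mat[OF R(1) Rc mult_carrier_mat[OF Ti R(1)]] by simp
  also have "\<dots> = T i * Ri" unfolding R(3) by (rule left_mult_one_mat[OF mult_carrier_mat[OF Ti R(1)]])
  finally show "Ri * X i = T i * Ri" .
qed

lemma intw_trans:
  assumes "intw n m S X Y" "intw m k R Y Z" shows "intw n k (R * S) X Z"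
proof (rule intwI)
  show "is_mtuple n X" "is_mtuple k Z" "R * S \<in> carrier_mat k n"
    using assms by (auto simp: intw_def)
  have S: "S \<in> carrier_mat m n" and R: "R \<in> carrier_mat k m" and c: "X i \<in> carrier_mat n n" "Y i \<in> carrier_mat m m" "Z i \<in> carrier_mat k k"
    and e: "S * X i = Y i * S" "R * Y i = Z i * R" for i
    using assms by (auto simp: intw_def is_mtuple_def)
  fix i x r assume r: "r < k"
  have "app (R * S) (app (X i) x) r = app R (app S (app (X i) x)) r" using R S r by (simp add: app_mult)
  also have "\<dots> = app R (app (Y i) (app S x)) r"
    by (intro app_cong_eq refl app_intw[OF e(1) c(1,2) S]) (use R in simp)
  also have "\<dots> = app (Z i) (app R (app S x)) r" by (rule app_intw[OF e(2) c(2,3) R r])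
  also have "\<dots> = app (Z i) (app (R * S) x) r"
    by (rule app_cong_eq[OF refl]) (use carrier_matD[OF R] carrier_matD[OF S] carrier_matD[OF c(3)[of i]] in \<open>simp add: app_mult\<close>)
  finally show "app (R * S) (app (X i) x) r = app (Z i) (app (R * S) x) r" .
qed

text \<open>Conjugation by R replaces the standard inner product by the one with norm |R x|, so a
  bound for \<open>\<delta>\<close> at T in the latter is a standard bound at R T Ri.\<close>

lemma bdd_by_delta_conj:
  assumes I: "intw n n R T X" and R: "Ri \<in> carrier_mat n n" "R * Ri = 1\<^sub>m n" and "0 \<le> \<rho>"
    and le: "\<And>v. nrm2 (a * n) (app (kron (1\<^sub>m a) R) (app (delta_eval a b \<delta> n T) v)) \<le>
      \<rho>\<^sup>2 * nrm2 (b * n) (app (kron (1\<^sub>m b) R) v)"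
  shows "bdd_by \<rho> (delta_eval a b \<delta> n X)"
  unfolding bdd_by_def
proof (intro conjI allI \<open>0 \<le> \<rho>\<close>)
  have Rc: "R \<in> carrier_mat n n" using I by (simp add: intw_def)
  fix w
  define v where "v = app (kron (1\<^sub>m b) Ri) w"
  have w: "app (kron (1\<^sub>m b) R) v k = w k" if "k < b * n" for k
  proof -
    have "app (kron (1\<^sub>m b) R) v k = app (kron (1\<^sub>m b) R * kron (1\<^sub>m b) Ri) w k"
      unfolding v_def using R Rc that by (subst app_mult) auto
    also have "kron (1\<^sub>m b) R * kron (1\<^sub>m b) Ri = 1\<^sub>m (b * n)" using R Rc by (subst kron_mult) (auto simp: kron_one)
    finally show ?thesis using that by (simp add: app_one)
  qed
  have "nrm2 (a * n) (app (delta_eval a b \<delta> n X) w) = nrm2 (a * n) (app (kron (1\<^sub>m a) R) (app (delta_eval a b \<delta> n T) v))"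
  proof (rule nrm2_cong)
    fix k assume k: "k < a * n"
    have "app (delta_eval a b \<delta> n X) w k = app (delta_eval a b \<delta> n X) (app (kron (1\<^sub>m b) R) v) k"
      by (intro app_cong_eq refl) (simp add: w)
    also have "\<dots> = app (delta_eval a b \<delta> n X * kron (1\<^sub>m b) R) v k"
      using Rc k by (subst app_mult) auto
    also have "\<dots> = app (kron (1\<^sub>m a) R) (app (delta_eval a b \<delta> n T) v) k"
      unfolding intw_delta[OF I, symmetric] using Rc k by (subst app_mult) auto
    finally show "app (delta_eval a b \<delta> n X) w k = app (kron (1\<^sub>m a) R) (app (delta_eval a b \<delta> n T) v) k" .
  qed
  also have "\<dots> \<le> \<rho>\<^sup>2 * nrm2 (b * n) (app (kron (1\<^sub>m b) R) v)" by (rule le)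
  also have "nrm2 (b * n) (app (kron (1\<^sub>m b) R) v) = nrm2 (b * n) w" by (rule nrm2_cong) (rule w)
  finally show "nrm2 (dim_row (delta_eval a b \<delta> n X)) (app (delta_eval a b \<delta> n X) w) \<le>
      \<rho>\<^sup>2 * nrm2 (dim_col (delta_eval a b \<delta> n X)) w" by simp
qed

text \<open>The inner products G for which T is a contraction under delta form a convex cone. It contains
  the standard one, and a strict one is supplied by the embeddings of T into small truncated
  shifts, so the standard inner product is approximated by strict ones.\<close>

lemma com_bound:
  fixes \<phi> :: "('d::finite) mtuple \<Rightarrow> complex mat"
  assumes nc: "is_nc_fun a b \<delta> \<phi>" and C: "\<And>Z. Z \<in> Gall a b \<delta> \<Longrightarrow> opnorm (\<phi> Z) \<le> C" "0 \<le> C"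
    and n: "n \<ge> 1" and T: "is_mtuple n T" "commuting T" "bdd_by 1 (delta_eval a b \<delta> n T)"
    and sp: "jspec n T \<subseteq> Ucom a b \<delta>"
    and jet: "\<And>\<mu>. \<mu> \<in> jspec n T \<Longrightarrow> jet0 n \<mu> (\<lambda>z. \<phi> (scal z) $$ (0, 0) - fp_scalar p z)"
  shows "bdd_by C (fp_eval n p T)"
proof -
  obtain e0 where e0: "bij_betw e0 {0..<card (MI n :: ('d \<Rightarrow> nat) set)} (MI n :: ('d \<Rightarrow> nat) set)"
    using ex_bij_betw_nat_finite[OF finite_MI] by blast
  define N where "N = card (MI n :: ('d \<Rightarrow> nat) set)"
  have e: "bij_betw e0 {..<N} (MI n)" using e0 by (simp add: N_def atLeast0LessThan)
  have "(\<lambda>_. 0) \<in> (MI n :: ('d \<Rightarrow> nat) set)" using n by (simp add: MI_def)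
  then have "(\<lambda>_. 0) \<in> e0 ` {..<N}" using e by (simp add: bij_betw_def)
  then obtain k0 where k0: "k0 < N" "e0 k0 = (\<lambda>_. 0)" by (metis imageE lessThan_iff)
  have N1: "N \<ge> 1" using k0 by simp
  let ?G = "{u \<in> Vn n. \<exists>\<mu>\<in>jspec n T. u \<in> cvs.joint_gen UNIV (\<lambda>i. rowact n (T i)) (vec_nth \<mu>) n}"
  have ex: "\<exists>S A. intw n N S T A \<and> A \<in> Gd a b \<delta> N \<and> (\<forall>c<n. S $$ (k0, c) = y c) \<and>
      (\<forall>c<N. \<phi> A $$ (k0, c) = fp_eval N p A $$ (k0, c))" if "y \<in> ?G" for y
  proof -
    obtain \<mu> where \<mu>: "\<mu> \<in> jspec n T" "y \<in> cvs.joint_gen UNIV (\<lambda>i. rowact n (T i)) (vec_nth \<mu>) n" using \<open>y \<in> ?G\<close> by blast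
    obtain t where t: "t > 0" "grid_tuple N e0 \<mu> t 0 \<in> Gd a b \<delta> N"
      "\<forall>c<N. \<phi> (grid_tuple N e0 \<mu> t 0) $$ (k0, c) = fp_eval N p (grid_tuple N e0 \<mu> t 0) $$ (k0, c)"
      using grid_tuple_row[OF e k0 nc C(1) _ jet] \<mu>(1) sp by blast
    then show ?thesis using grid_tuple_row_intw[OF e k0 T(1,2) \<mu>(2) t(1)] by blast
  qed
  have "\<exists>t r. finite t \<and> t \<subseteq> ?G \<and> (\<lambda>c. if c = k then 1 else 0) = (\<Sum>u\<in>t. cs (r u) u)" if "k < n" for k
  proof -
    have "(\<lambda>c. if c = k then 1 else 0) \<in> Vn n" using that by (simp add: Vn_def)
    from row_decomposition[OF T(1,2) this] show ?thesis unfolding cvs.span_explicit by blast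
  qed
  then have "\<forall>k\<in>{..<n}. \<exists>tr. finite (fst tr) \<and> fst tr \<subseteq> ?G \<and> (\<lambda>c. if c = k then 1 else 0) = (\<Sum>u\<in>fst tr. cs (snd tr u) u)"
    by simp
  from bchoice[OF this] obtain tr where tr: "\<forall>k\<in>{..<n}. finite (fst (tr k)) \<and> fst (tr k) \<subseteq> ?G \<and>
      (\<lambda>c. if c = k then 1 else 0) = (\<Sum>u\<in>fst (tr k). cs (snd (tr k) u) u)" by blast
  define ts rs where "ts k = fst (tr k)" and "rs k = snd (tr k)" for k
  have ts: "finite (ts k)" "ts k \<subseteq> ?G" "(\<lambda>c. if c = k then 1 else 0) = (\<Sum>u\<in>ts k. cs (rs k u) u)" if "k < n" for k
    using tr that unfolding ts_def rs_def by blast+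
  \<comment> \<open>Finitely many generalized left eigenvectors that express all n coordinate
    functionals.\<close>
  define Y where "Y = (\<Union>k<n. ts k)"
  have fY: "finite Y" and YG: "Y \<subseteq> ?G" using ts unfolding Y_def by blast+
  have "\<forall>y\<in>Y. \<exists>SA. intw n N (fst SA) T (snd SA) \<and> snd SA \<in> Gd a b \<delta> N \<and> (\<forall>c<n. fst SA $$ (k0, c) = y c) \<and>
      (\<forall>c<N. \<phi> (snd SA) $$ (k0, c) = fp_eval N p (snd SA) $$ (k0, c))"
  proof
    fix y assume "y \<in> Y"
    then have "y \<in> ?G" using YG by blast
    from ex[OF this] obtain S A where "intw n N S T A \<and> A \<in> Gd a b \<delta> N \<and> (\<forall>c<n. S $$ (k0, c) = y c) \<and>
      (\<forall>c<N. \<phi> A $$ (k0, c) = fp_eval N p A $$ (k0, c))" by blast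
    then show "\<exists>SA. intw n N (fst SA) T (snd SA) \<and> snd SA \<in> Gd a b \<delta> N \<and> (\<forall>c<n. fst SA $$ (k0, c) = y c) \<and>
      (\<forall>c<N. \<phi> (snd SA) $$ (k0, c) = fp_eval N p (snd SA) $$ (k0, c))" by (intro exI[of _ "(S, A)"]) simp
  qed
  from bchoice[OF this] obtain SA where SA: "\<forall>y\<in>Y. intw n N (fst (SA y)) T (snd (SA y)) \<and> snd (SA y) \<in> Gd a b \<delta> N \<and>
      (\<forall>c<n. fst (SA y) $$ (k0, c) = y c) \<and> (\<forall>c<N. \<phi> (snd (SA y)) $$ (k0, c) = fp_eval N p (snd (SA y)) $$ (k0, c))" by blast
  define S A where "S y = fst (SA y)" and "A y = snd (SA y)" for y
  have S: "intw n N (S y) T (A y)" "A y \<in> Gd a b \<delta> N" "\<And>c. c < n \<Longrightarrow> S y $$ (k0, c) = y c"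
    "\<And>c. c < N \<Longrightarrow> \<phi> (A y) $$ (k0, c) = fp_eval N p (A y) $$ (k0, c)" if "y \<in> Y" for y
    using SA that by (auto simp: S_def A_def)
  have Sc: "S y \<in> carrier_mat N n" if "y \<in> Y" for y using S(1)[OF that] by (simp add: intw_def)
  define q where "q x = (\<Sum>y\<in>Y. nrm2 N (app (S y) x))" for x
  have q0: "q x \<ge> 0" for x by (simp add: q_def sum_nonneg)
  \<comment> \<open>A common strict bound for the finitely many tuples \<open>A y\<close>. The
    inserted 0 keeps the maximum defined for empty Y and r nonnegative.\<close>
  define r where "r = Max (insert 0 ((\<lambda>y. opnorm (delta_eval a b \<delta> N (A y))) ` Y))"
  have r: "0 \<le> r" "r < 1" using fY S(2) by (auto simp: r_def Gd_def)
  have rb: "bdd_by r (delta_eval a b \<delta> N (A y))" if "y \<in> Y" for y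
    by (rule bdd_by_mono[OF bdd_by_opnorm]) (use fY that in \<open>auto simp: r_def\<close>)
  \<comment> \<open>The constant by which the pulled back forms dominate the standard one: each
    coordinate is a combination of the functionals y, and these are entries \<open>k0\<close> of the
    vectors S y x.\<close>
  define \<kappa> where "\<kappa> = (\<Sum>k<n. \<Sum>u\<in>ts k. (cmod (rs k u))\<^sup>2)"
  have \<kappa>0: "\<kappa> \<ge> 0" by (simp add: \<kappa>_def sum_nonneg)
  have coord: "x k = (\<Sum>u\<in>ts k. rs k u * (\<Sum>c<n. u c * x c))" if k: "k < n" for x k
  proof -
    have sum_app: "(\<Sum>u\<in>t. g u) c = (\<Sum>u\<in>t. g u c)" for g :: "(nat \<Rightarrow> complex) \<Rightarrow> nat \<Rightarrow> complex" and t c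
      by (induction t rule: infinite_finite_induct) auto
    have d: "(if c = k then 1 else 0) = (\<Sum>u\<in>ts k. rs k u * u c)" for c
    proof -
      have "(\<lambda>c. if c = k then 1 else 0) c = (\<Sum>u\<in>ts k. cs (rs k u) u) c" using fun_cong[OF ts(3)[OF k], of c] .
      then show ?thesis by (simp only: sum_app cs_def)
    qed
    have "x k = (\<Sum>c<n. (if c = k then 1 else 0) * x c)" using k by (simp add: if_distrib[of "\<lambda>u. u * _"] cong: if_cong)
    also have "\<dots> = (\<Sum>c<n. \<Sum>u\<in>ts k. rs k u * (u c * x c))" unfolding d by (simp add: sum_distrib_right mult.assoc)
    also have "\<dots> = (\<Sum>u\<in>ts k. rs k u * (\<Sum>c<n. u c * x c))" by (subst sum.swap) (simp add: sum_distrib_left)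
    finally show ?thesis .
  qed
  have Sk0: "app (S y) x k0 = (\<Sum>c<n. y c * x c)" if "y \<in> Y" for y x
    using Sc[OF that] S(3)[OF that] by (simp add: app_def)
  have \<kappa>: "nrm2 n x \<le> \<kappa> * q x" for x
  proof -
    have "(cmod (x k))\<^sup>2 \<le> (\<Sum>u\<in>ts k. (cmod (rs k u))\<^sup>2) * q x" if k: "k < n" for k
    proof -
      have tY: "ts k \<subseteq> Y" using k by (auto simp: Y_def)
      have "(cmod (x k))\<^sup>2 \<le> (\<Sum>u\<in>ts k. (cmod (rs k u))\<^sup>2) * (\<Sum>u\<in>ts k. (cmod (app (S u) x k0))\<^sup>2)"
        unfolding coord[OF k, of x] using cauchy_schwarz_set[of "rs k" "\<lambda>u. \<Sum>c<n. u c * x c" "ts k"] Sk0 tY by (simp add: subset_iff)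
      also have "(\<Sum>u\<in>ts k. (cmod (app (S u) x k0))\<^sup>2) \<le> (\<Sum>u\<in>ts k. nrm2 N (app (S u) x))"
        by (intro sum_mono nrm2_component k0)
      also have "\<dots> \<le> q x" unfolding q_def by (intro sum_mono2 fY tY) auto
      finally show ?thesis by (simp add: mult_left_mono sum_nonneg)
    qed
    then show ?thesis unfolding nrm2_def[of n x] \<kappa>_def sum_distrib_right by (intro sum_mono) auto
  qed
  have key: "nrm2 n (app (fp_eval n p T) x) \<le> C\<^sup>2 * (nrm2 n x + \<epsilon> * q x)" if \<epsilon>: "\<epsilon> > 0" for \<epsilon> x
  proof -
    obtain R Ri where R: "R \<in> carrier_mat n n" "Ri \<in> carrier_mat n n" "R * Ri = 1\<^sub>m n" "Ri * R = 1\<^sub>m n"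
      and Rn: "\<And>x. nrm2 n (app R x) = nrm2 n x + \<epsilon> * q x"
    proof -
      have "\<exists>R\<in>carrier_mat n n. \<exists>Ri\<in>carrier_mat n n. R * Ri = 1\<^sub>m n \<and> Ri * R = 1\<^sub>m n \<and>
         (\<forall>x. nrm2 n (app R x) = nrm2 n x + \<epsilon> * q x)"
        unfolding q_def by (rule renorm[OF fY Sc \<epsilon>])
      then show ?thesis using that by blast
    qed
    define X where "X i = R * T i * Ri" for i
    have I: "intw n n R T X" unfolding X_def[abs_def] by (rule intw_conj[OF T(1) R(1,2,4)])
    note I' = intw_inverse[OF I R(2-4)]
    have mX: "is_mtuple n X" using I by (simp add: intw_def)
    define Q where "Q m v = (\<Sum>i<m. q (\<lambda>s. v (i * n + s)))" for m v
    have Q: "Q m v = (\<Sum>y\<in>Y. nrm2 (m * N) (app (kron (1\<^sub>m m) (S y)) v))" for m v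
    proof -
      have "Q m v = (\<Sum>y\<in>Y. \<Sum>i<m. nrm2 N (app (S y) (\<lambda>s. v (i * n + s))))"
        unfolding Q_def q_def by (rule sum.swap)
      also have "\<dots> = (\<Sum>y\<in>Y. nrm2 (m * N) (app (kron (1\<^sub>m m) (S y)) v))"
      proof (rule sum.cong[OF refl])
        fix y assume "y \<in> Y"
        then have "dim_row (S y) = N" "dim_col (S y) = n" using Sc by auto
        then show "(\<Sum>i<m. nrm2 N (app (S y) (\<lambda>s. v (i * n + s)))) = nrm2 (m * N) (app (kron (1\<^sub>m m) (S y)) v)"
          using nrm2_kron_left[of m "S y" v] by simp
      qed
      finally show ?thesis .
    qed
    have RQ: "nrm2 (m * n) (app (kron (1\<^sub>m m) R) v) = nrm2 (m * n) v + \<epsilon> * Q m v" for m v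
      using nrm2_kron_left[of m R v] R(1) by (simp add: Rn nrm2_block[of m n v] Q_def sum.distrib sum_distrib_left)
    have Q\<kappa>: "nrm2 (m * n) v \<le> \<kappa> * Q m v" for m v
      unfolding nrm2_block Q_def sum_distrib_left by (intro sum_mono \<kappa>)
    have Q0: "Q m v \<ge> 0" for m v by (simp add: Q_def sum_nonneg q0)
    \<comment> \<open>On the standard part \<open>\<delta>\<close> at T gains nothing, on the part
      with weight \<epsilon> it gains the factor r^2. Domination by \<kappa> spreads this gain over
      the whole form; \<theta> is the largest share for which this estimate closes.\<close>
    define \<theta> where "\<theta> = \<epsilon> * (1 - r\<^sup>2) / (\<kappa> + \<epsilon>)"
    have r2: "0 \<le> r\<^sup>2" "r\<^sup>2 < 1" using r by (auto simp: power_less_one_iff abs_square_less_1)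
    have \<theta>: "0 < \<theta>" "\<theta> \<le> 1" "\<theta> * (\<kappa> + \<epsilon>) = \<epsilon> * (1 - r\<^sup>2)"
    proof -
      show "0 < \<theta>" using \<epsilon> \<kappa>0 r2 by (simp add: \<theta>_def)
      show e: "\<theta> * (\<kappa> + \<epsilon>) = \<epsilon> * (1 - r\<^sup>2)" using \<epsilon> \<kappa>0 by (simp add: \<theta>_def)
      have "\<epsilon> * (1 - r\<^sup>2) \<le> \<epsilon> * 1" using \<epsilon> r2 by (intro mult_left_mono) auto
      then have "\<epsilon> * (1 - r\<^sup>2) \<le> \<kappa> + \<epsilon>" using \<kappa>0 by linarith
      then show "\<theta> \<le> 1" unfolding \<theta>_def using \<epsilon> \<kappa>0 by simp
    qed
    have dT: "nrm2 (a * n) (app (kron (1\<^sub>m a) R) (app (delta_eval a b \<delta> n T) v)) \<le> (1 - \<theta>) * nrm2 (b * n) (app (kron (1\<^sub>m b) R) v)" for v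
    proof -
      have "Q a (app (delta_eval a b \<delta> n T) v) \<le> r\<^sup>2 * Q b v"
        unfolding Q sum_distrib_left
      proof (rule sum_mono)
        fix y assume y: "y \<in> Y"
        have "nrm2 (a * N) (app (kron (1\<^sub>m a) (S y)) (app (delta_eval a b \<delta> n T) v)) =
          nrm2 (a * N) (app (delta_eval a b \<delta> N (A y)) (app (kron (1\<^sub>m b) (S y)) v))"
        proof (rule nrm2_cong)
          fix k assume k: "k < a * N"
          have "app (kron (1\<^sub>m a) (S y)) (app (delta_eval a b \<delta> n T) v) k = app (kron (1\<^sub>m a) (S y) * delta_eval a b \<delta> n T) v k"
            using Sc[OF y] k by (simp add: app_mult)
          also have "\<dots> = app (delta_eval a b \<delta> N (A y)) (app (kron (1\<^sub>m b) (S y)) v) k"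
            unfolding intw_delta[OF S(1)[OF y]] using Sc[OF y] k by (simp add: app_mult)
          finally show "app (kron (1\<^sub>m a) (S y)) (app (delta_eval a b \<delta> n T) v) k = app (delta_eval a b \<delta> N (A y)) (app (kron (1\<^sub>m b) (S y)) v) k" .
        qed
        then show "nrm2 (a * N) (app (kron (1\<^sub>m a) (S y)) (app (delta_eval a b \<delta> n T) v)) \<le> r\<^sup>2 * nrm2 (b * N) (app (kron (1\<^sub>m b) (S y)) v)"
          using bdd_byD[OF rb[OF y], of "app (kron (1\<^sub>m b) (S y)) v"] by simp
      qed
      then have "nrm2 (a * n) (app (kron (1\<^sub>m a) R) (app (delta_eval a b \<delta> n T) v)) \<le> nrm2 (b * n) v + \<epsilon> * (r\<^sup>2 * Q b v)"
        unfolding RQ using bdd_byD[OF T(3), of v] \<epsilon> by (intro add_mono mult_left_mono) auto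
      also have "\<dots> \<le> (1 - \<theta>) * (nrm2 (b * n) v + \<epsilon> * Q b v)"
      proof -
        have "\<theta> * nrm2 (b * n) v \<le> \<theta> * (\<kappa> * Q b v)" using Q\<kappa> \<theta> by (intro mult_left_mono) auto
        moreover have "\<theta> * (\<kappa> + \<epsilon>) * Q b v = \<epsilon> * (1 - r\<^sup>2) * Q b v" unfolding \<theta>(3) ..
        ultimately show ?thesis by (simp add: algebra_simps)
      qed
      finally show ?thesis unfolding RQ .
    qed
    have "bdd_by (sqrt (1 - \<theta>)) (delta_eval a b \<delta> n X)"
      using dT \<theta> by (intro bdd_by_delta_conj[OF I R(2,3)]) auto
    moreover have "sqrt (1 - \<theta>) < 1" using \<theta> by simp
    ultimately have XG: "X \<in> Gd a b \<delta> n" using mX unfolding Gd_iff by blast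
    have pX: "\<phi> X \<in> carrier_mat n n" using nc_carrier[OF nc n XG] .
    have "\<phi> X = fp_eval n p X"
    proof -
      define D where "D x r = app (\<phi> X) x r - app (fp_eval n p X) x r" for x r
      \<comment> \<open>\<phi> and p agree in row \<open>k0\<close> at \<open>A y\<close>. Pulled
        back along the intertwiner from X to \<open>A y\<close>, this makes the functional y vanish
        on their difference at X, transported by Ri; as these functionals generate all coordinates,
        the difference is 0.\<close>
      have yD: "(\<Sum>c<n. y c * app Ri (D x) c) = 0" if y: "y \<in> Y" for y x
      proof -
        have J: "intw n N (S y * Ri) X (A y)" by (rule intw_trans[OF I' S(1)[OF y]])
        have SR: "S y * Ri \<in> carrier_mat N n" using J by (simp add: intw_def)
        have pA: "\<phi> (A y) \<in> carrier_mat N N" using nc_carrier[OF nc N1 S(2)[OF y]] .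
        have "app (S y * Ri) (app (\<phi> X) x) k0 = app (\<phi> (A y)) (app (S y * Ri) x) k0"
          by (rule nc_intw_app[OF nc n N1 XG S(2)[OF y] J k0(1)])
        also have "\<dots> = app (fp_eval N p (A y)) (app (S y * Ri) x) k0"
          unfolding app_def[of "\<phi> _"] app_def[of "fp_eval _ _ _"] using pA S(4)[OF y] by simp
        also have "\<dots> = app (S y * Ri) (app (fp_eval n p X) x) k0"
          by (rule app_intw[OF intw_fp[OF J] fp_eval_carrier fp_eval_carrier SR k0(1), symmetric])
        finally have "app (S y * Ri) (D x) k0 = 0"
          unfolding D_def by (simp add: app_def[of "S y * Ri"] right_diff_distrib sum_subtractf)
        then have "app (S y) (app Ri (D x)) k0 = 0" using Sc[OF y] R k0 by (subst (asm) app_mult) auto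
        then show ?thesis using Sk0[OF y] by simp
      qed
      have RiD: "app Ri (D x) k = 0" if k: "k < n" for x k
      proof -
        have "(\<Sum>c<n. u c * app Ri (D x) c) = 0" if "u \<in> ts k" for u
          using yD that k by (auto simp: Y_def)
        then show ?thesis unfolding coord[OF k, of "app Ri (D x)"] by simp
      qed
      have D0: "D x r = 0" if "r < n" for x r
      proof -
        have "D x r = app (R * Ri) (D x) r" unfolding R(3) using that by (simp add: app_one)
        also have "\<dots> = app R (app Ri (D x)) r" using R that by (subst app_mult) auto
        also have "\<dots> = 0" using RiD R by (simp add: app_def[of R])
        finally show ?thesis .
      qed
      show ?thesis by (rule mat_eq_app[OF pX fp_eval_carrier]) (use D0 in \<open>simp add: D_def\<close>)
    qed
    moreover have "X \<in> Gall a b \<delta>" using XG n by (auto simp: Gall_def)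
    ultimately have bX: "bdd_by C (fp_eval n p X)" using C opnorm_le_iff by metis
    have "nrm2 n (app (fp_eval n p T) x) \<le> nrm2 n (app R (app (fp_eval n p T) x))"
      unfolding Rn using \<epsilon> q0 by simp
    also have "\<dots> = nrm2 n (app (fp_eval n p X) (app R x))"
      by (rule nrm2_cong) (rule app_intw[OF intw_fp[OF I] fp_eval_carrier fp_eval_carrier R(1)])
    also have "\<dots> \<le> C\<^sup>2 * nrm2 n (app R x)" using bdd_byD[OF bX, of "app R x"] by simp
    finally show ?thesis unfolding Rn .
  qed
  \<comment> \<open>R and X depend on \<epsilon>, but the two sides of \<open>key\<close> involve
    only T, x and q, so \<epsilon> can tend to 0.\<close>
  have "nrm2 n (app (fp_eval n p T) x) \<le> C\<^sup>2 * nrm2 n x" for x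
  proof (rule field_le_epsilon)
    fix \<epsilon> :: real assume \<epsilon>: "\<epsilon> > 0"
    have c: "C\<^sup>2 * q x + 1 > 0" using q0[of x] by (simp add: add_nonneg_pos)
    have "C\<^sup>2 * q x * (\<epsilon> / (C\<^sup>2 * q x + 1)) \<le> \<epsilon>" using c \<epsilon> by (simp add: field_simps)
    then show "nrm2 n (app (fp_eval n p T) x) \<le> C\<^sup>2 * nrm2 n x + \<epsilon>"
      using key[of "\<epsilon> / (C\<^sup>2 * q x + 1)" x] \<epsilon> c by (simp add: algebra_simps)
  qed
  then show ?thesis using C(2) by (simp add: bdd_by_def)
qed

section \<open>The Agler decomposition\<close>

lemma compact_Pi:
  fixes S :: "'i \<Rightarrow> complex set"
  assumes "\<And>i. compact (S i)" shows "compact {f. \<forall>i. f i \<in> S i}"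
proof -
  have "compactin (product_topology (\<lambda>i. euclidean) UNIV) (PiE UNIV S)"
    using assms by (simp add: compactin_PiE)
  then have "compact (PiE UNIV S)" by (simp add: euclidean_product_topology)
  moreover have "PiE UNIV S = {f. \<forall>i. f i \<in> S i}" by (auto simp: PiE_def extensional_def)
  ultimately show ?thesis by simp
qed

text \<open>The inner product of u i and u j minus that of D i (u i) and D j (u j), with D i an a x
  m matrix.\<close>

definition agler_kernel :: "nat \<Rightarrow> nat \<Rightarrow> (nat \<Rightarrow> nat \<Rightarrow> nat \<Rightarrow> complex) \<Rightarrow> (nat \<Rightarrow> nat \<Rightarrow> complex) \<Rightarrow> nat \<Rightarrow> nat \<Rightarrow> complex" where
  "agler_kernel a m D u i j = (\<Sum>l<m. u i l * cnj (u j l)) -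
     (\<Sum>r<a. (\<Sum>l<m. D i r l * u i l) * cnj (\<Sum>l<m. D j r l * u j l))"

lemma agler_kernel_cnj: "agler_kernel a m D u j i = cnj (agler_kernel a m D u i j)"
  by (simp add: agler_kernel_def mult.commute)

lemma agler_kernel_diag: "agler_kernel a m D u i i = of_real (nrm2 m (u i) - nrm2 a (\<lambda>r. \<Sum>l<m. D i r l * u i l))"
  by (simp add: agler_kernel_def nrm2_def complex_norm_square del: of_real_power)

text \<open>All vectors are packed into one function L on index pairs, so that the product topology
  supplies compactness.\<close>

definition agler_sum :: "nat \<Rightarrow> nat \<Rightarrow> (nat \<Rightarrow> nat \<Rightarrow> nat \<Rightarrow> complex) \<Rightarrow> nat \<Rightarrow> (nat \<times> nat \<Rightarrow> complex) \<Rightarrow> nat \<Rightarrow> nat \<Rightarrow> complex" where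
  "agler_sum a m D M L i j = (\<Sum>k<M. agler_kernel a m D (\<lambda>i l. L (i * m + l, k)) i j)"

text \<open>A sum of Agler kernels depends only on the Gram matrix \<Gamma> of the packed vectors,
  and linearly so.\<close>

definition agler_gram :: "nat \<Rightarrow> nat \<Rightarrow> (nat \<Rightarrow> nat \<Rightarrow> nat \<Rightarrow> complex) \<Rightarrow> (nat \<Rightarrow> nat \<Rightarrow> complex) \<Rightarrow> nat \<Rightarrow> nat \<Rightarrow> complex" where
  "agler_gram a m D \<Gamma> i j = (\<Sum>l<m. \<Gamma> (i * m + l) (j * m + l)) -
     (\<Sum>r<a. \<Sum>l<m. \<Sum>l'<m. D i r l * cnj (D j r l') * \<Gamma> (i * m + l) (j * m + l'))"

lemma agler_sum_eq_agler_gram: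
  assumes "\<And>p q. p < N * m \<Longrightarrow> q < N * m \<Longrightarrow> \<Gamma> p q = (\<Sum>k<M. L (p, k) * cnj (L (q, k)))" "i < N" "j < N"
  shows "agler_sum a m D M L i j = agler_gram a m D \<Gamma> i j"
proof -
  have idx: "i * m + l < N * m" if "i < N" "l < m" for i l
    using that by (metis add.commute add_less_mono1 less_le_trans mult_Suc Suc_leI mult_le_mono1)
  have \<Gamma>: "\<Gamma> (i * m + l) (j * m + l') = (\<Sum>k<M. L (i * m + l, k) * cnj (L (j * m + l', k)))" if "l < m" "l' < m" for l l'
    using that assms by (intro assms(1) idx) auto
  have 1: "(\<Sum>k<M. \<Sum>l<m. L (i * m + l, k) * cnj (L (j * m + l, k))) = (\<Sum>l<m. \<Gamma> (i * m + l) (j * m + l))"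
    by (subst sum.swap) (simp add: \<Gamma>)
  have "(\<Sum>k<M. \<Sum>r<a. (\<Sum>l<m. D i r l * L (i * m + l, k)) * cnj (\<Sum>l<m. D j r l * L (j * m + l, k))) =
     (\<Sum>r<a. \<Sum>k<M. \<Sum>l<m. \<Sum>l'<m. D i r l * cnj (D j r l') * (L (i * m + l, k) * cnj (L (j * m + l', k))))"
    by (subst sum.swap) (simp add: sum_product mult_ac)
  also have "\<dots> = (\<Sum>r<a. \<Sum>l<m. \<Sum>l'<m. \<Sum>k<M. D i r l * cnj (D j r l') * (L (i * m + l, k) * cnj (L (j * m + l', k))))"
  proof (rule sum.cong[OF refl])
    fix r
    show "(\<Sum>k<M. \<Sum>l<m. \<Sum>l'<m. D i r l * cnj (D j r l') * (L (i * m + l, k) * cnj (L (j * m + l', k)))) =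
      (\<Sum>l<m. \<Sum>l'<m. \<Sum>k<M. D i r l * cnj (D j r l') * (L (i * m + l, k) * cnj (L (j * m + l', k))))"
      by (subst sum.swap, rule sum.cong[OF refl], rule sum.swap)
  qed
  also have "\<dots> = (\<Sum>r<a. \<Sum>l<m. \<Sum>l'<m. D i r l * cnj (D j r l') * \<Gamma> (i * m + l) (j * m + l'))"
    by (intro sum.cong refl) (simp add: \<Gamma> sum_distrib_left)
  finally show ?thesis unfolding agler_sum_def agler_kernel_def agler_gram_def sum_subtractf 1 by simp
qed

lemma agler_gram_add: "agler_gram a m D (\<lambda>p q. \<Gamma> p q + \<Delta> p q) i j = agler_gram a m D \<Gamma> i j + agler_gram a m D \<Delta> i j"
  by (simp add: agler_gram_def sum.distrib distrib_left)

lemma agler_gram_scale: "agler_gram a m D (\<lambda>p q. c * \<Gamma> p q) i j = c * agler_gram a m D \<Gamma> i j"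
  by (simp add: agler_gram_def sum_distrib_left right_diff_distrib mult_ac)

definition gram :: "nat \<Rightarrow> (nat \<times> nat \<Rightarrow> complex) \<Rightarrow> nat \<Rightarrow> nat \<Rightarrow> complex" where
  "gram M L p q = (\<Sum>k<M. L (p, k) * cnj (L (q, k)))"

text \<open>The number of terms stays at N * m: the Gram matrix of the combination has size N * m,
  so \<open>cholesky\<close> factors it with N * m columns. Thus a fixed finite-dimensional
  parameter space describes the whole convex cone.\<close>

lemma agler_sum_add:
  assumes "s \<ge> 0" "t \<ge> 0"
  shows "\<exists>L. \<forall>i<N. \<forall>j<N. agler_sum a m D (N * m) L i j =
     of_real s * agler_sum a m D (N * m) L1 i j + of_real t * agler_sum a m D (N * m) L2 i j"
proof -
  let ?M = "N * m"
  let ?K = "\<lambda>p q. of_real s * gram ?M L1 p q + of_real t * gram ?M L2 p q"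
  have q: "qf ?M (gram ?M L) x = of_real (\<Sum>k<?M. (cmod (\<Sum>p<?M. L (p, k) * x p))\<^sup>2)" for L x
    by (rule qf_gram) (simp add: gram_def)
  have "psd ?M ?K"
    unfolding psd_def
  proof (intro conjI allI impI)
    fix p q show "?K q p = cnj (?K p q)" by (simp add: gram_def mult.commute)
  next
    fix x show "0 \<le> Re (qf ?M ?K x)" unfolding qf_add qf_scale q using assms by (simp add: sum_nonneg)
  qed
  from cholesky[OF this] obtain L where L: "\<And>p q. p < ?M \<Longrightarrow> q < ?M \<Longrightarrow> ?K p q = (\<Sum>k<?M. L p k * cnj (L q k))" by blast
  have "agler_sum a m D ?M (\<lambda>(p, k). L p k) i j = of_real s * agler_sum a m D ?M L1 i j + of_real t * agler_sum a m D ?M L2 i j"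
    if "i < N" "j < N" for i j
  proof -
    have "agler_sum a m D ?M (\<lambda>(p, k). L p k) i j = agler_gram a m D ?K i j"
      using that by (intro agler_sum_eq_agler_gram) (auto simp: L)
    moreover have "agler_sum a m D ?M L' i j = agler_gram a m D (gram ?M L') i j" for L'
      using that by (intro agler_sum_eq_agler_gram) (auto simp: gram_def)
    ultimately show ?thesis by (simp only: agler_gram_add agler_gram_scale)
  qed
  then show ?thesis by blast
qed

text \<open>The one-sided first order condition at a minimum: for small t the linear term
  prevails.\<close>

lemma quadratic_nonneg:
  fixes c d :: real
  assumes "\<And>t. 0 < t \<Longrightarrow> t \<le> 1 \<Longrightarrow> 0 \<le> 2 * t * c + t\<^sup>2 * d" "d \<ge> 0"
  shows "c \<ge> 0"
proof (rule ccontr)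
  assume "\<not> c \<ge> 0"
  define t where "t = min 1 (- c / (d + 1))"
  have t: "0 < t" "t \<le> 1" using \<open>\<not> c \<ge> 0\<close> assms(2) by (auto simp: t_def divide_neg_pos)
  have "t * d \<le> - c / (d + 1) * d" using assms(2) by (intro mult_right_mono) (auto simp: t_def)
  also have "\<dots> \<le> - c" using assms(2) \<open>\<not> c \<ge> 0\<close> by (simp add: divide_simps mult_left_mono_neg)
  finally have "2 * c + t * d < 0" using \<open>\<not> c \<ge> 0\<close> by simp
  then have "t * (2 * c + t * d) < 0" using t by (simp add: mult_pos_neg)
  then show False using assms(1)[OF t] by (simp add: algebra_simps power2_eq_square)
qed

text \<open>The point of the cone of Agler kernels nearest to A equals A, since otherwise the difference
  is a separating functional.\<close>

lemma agler_decomposition: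
  fixes A :: "nat \<Rightarrow> nat \<Rightarrow> complex"
  assumes m: "m \<ge> 1"
    and D: "\<And>i u. i < N \<Longrightarrow> nrm2 a (\<lambda>r. \<Sum>l<m. D i r l * u l) \<le> \<rho> * nrm2 m u" "\<rho> < 1"
    and A: "\<And>i j. A j i = cnj (A i j)"
    and H: "\<And>G \<eta>. (\<And>i j. G j i = cnj (G i j)) \<Longrightarrow> \<eta> > 0 \<Longrightarrow>
       (\<And>u. \<eta> * (\<Sum>i<N. nrm2 m (u i)) \<le> Re (\<Sum>i<N. \<Sum>j<N. G i j * agler_kernel a m D u i j)) \<Longrightarrow>
       0 \<le> Re (\<Sum>i<N. \<Sum>j<N. G i j * A i j)"
  shows "\<exists>L. \<forall>i<N. \<forall>j<N. A i j = agler_sum a m D (N * m) L i j"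
proof -
  let ?M = "N * m"
  let ?X = "agler_sum a m D ?M"
  define F where "F L = (\<Sum>i<N. \<Sum>j<N. (cmod (?X L i j - A i j))\<^sup>2)" for L
  have F0: "F L \<ge> 0" for L by (simp add: F_def sum_nonneg)
  have cF: "continuous_on S F" for S
    unfolding F_def agler_sum_def agler_kernel_def
    by (intro continuous_intros continuous_on_subset[OF continuous_on_product_coordinates]) auto
  \<comment> \<open>If L is no worse than the zero family, then B bounds the diagonal of its kernel.
    By the gap 1 - \<rho> the diagonal bounds the coefficients, whence R.\<close>
  define B where "B = sqrt (F (\<lambda>_. 0)) + (\<Sum>i<N. cmod (A i i))"
  have B0: "B \<ge> 0" by (simp add: B_def sum_nonneg F0)
  define R where "R = sqrt (B / (1 - \<rho>))"
  have idx: "i * m + l < N * m" if "i < N" "l < m" for i l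
    using that by (metis add.commute add_less_mono1 less_le_trans mult_Suc Suc_leI mult_le_mono1)
  have bound: "cmod (L (p, k)) \<le> R" if FL: "F L \<le> F (\<lambda>_. 0)" and p: "p < ?M" and k: "k < ?M" for L p k
  proof -
    define i l where "i = p div m" and "l = p mod m"
    have il: "i < N" "l < m" using div_mod_less[OF p] by (auto simp: i_def l_def)
    have pil: "p = i * m + l" by (simp add: i_def l_def)
    define d where "d k = nrm2 m (\<lambda>l. L (i * m + l, k)) - nrm2 a (\<lambda>r. \<Sum>l<m. D i r l * L (i * m + l, k))" for k
    have d: "(1 - \<rho>) * nrm2 m (\<lambda>l. L (i * m + l, k)) \<le> d k" for k
      using D(1)[OF il(1), of "\<lambda>l. L (i * m + l, k)"] by (simp add: d_def algebra_simps)
    have dk: "d k \<ge> 0" for k using order_trans[OF _ d[of k]] D(2) by (simp add: mult_nonneg_nonneg)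
    have Xd: "?X L i i = of_real (\<Sum>k<?M. d k)"
      unfolding agler_sum_def agler_kernel_diag d_def by simp
    have "(cmod (?X L i i - A i i))\<^sup>2 \<le> (\<Sum>j<N. (cmod (?X L i j - A i j))\<^sup>2)"
      using il(1) by (intro member_le_sum) auto
    also have "\<dots> \<le> F L" unfolding F_def using il(1) by (intro member_le_sum sum_nonneg) (auto intro: sum_nonneg)
    finally have "cmod (?X L i i - A i i) \<le> sqrt (F (\<lambda>_. 0))" using FL real_le_rsqrt order_trans by blast
    moreover have "cmod (?X L i i) \<le> cmod (?X L i i - A i i) + cmod (A i i)"
      using norm_triangle_ineq[of "?X L i i - A i i" "A i i"] by simp
    moreover have "cmod (A i i) \<le> (\<Sum>i<N. cmod (A i i))" using il(1) by (intro member_le_sum) auto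
    ultimately have "cmod (?X L i i) \<le> B" by (simp add: B_def)
    then have "(\<Sum>k<?M. d k) \<le> B" unfolding Xd norm_of_real by simp
    moreover have "d k \<le> (\<Sum>k<?M. d k)" using k dk by (intro member_le_sum) auto
    ultimately have "(1 - \<rho>) * nrm2 m (\<lambda>l. L (i * m + l, k)) \<le> B" using d[of k] by linarith
    moreover have "(cmod (L (p, k)))\<^sup>2 \<le> nrm2 m (\<lambda>l. L (i * m + l, k))"
      unfolding pil by (rule nrm2_component[OF il(2)])
    ultimately have "(1 - \<rho>) * (cmod (L (p, k)))\<^sup>2 \<le> B"
      using D(2) by (meson diff_gt_0_iff_gt mult_left_mono less_imp_le order_trans)
    then have "(cmod (L (p, k)))\<^sup>2 \<le> B / (1 - \<rho>)" using D(2) by (simp add: field_simps)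
    then show ?thesis unfolding R_def by (rule real_le_rsqrt)
  qed
  define Box where "Box = {L :: nat \<times> nat \<Rightarrow> complex. \<forall>pk. L pk \<in> (if fst pk < ?M \<and> snd pk < ?M then cball 0 R else {0})}"
  have R0: "R \<ge> 0" using B0 D(2) by (simp add: R_def)
  have "compact Box" unfolding Box_def by (rule compact_Pi) auto
  moreover have "(\<lambda>_. 0) \<in> Box" using R0 by (auto simp: Box_def)
  ultimately obtain L0 where L0: "L0 \<in> Box" "\<And>L. L \<in> Box \<Longrightarrow> F L0 \<le> F L"
    using continuous_attains_inf[OF _ _ cF, of Box] by blast
  have Xcong: "?X L i j = ?X L' i j" if "\<And>p k. p < ?M \<Longrightarrow> k < ?M \<Longrightarrow> L (p, k) = L' (p, k)" "i < N" "j < N" for L L' i j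
  proof -
    have "agler_kernel a m D (\<lambda>i l. L (i * m + l, k)) i j = agler_kernel a m D (\<lambda>i l. L' (i * m + l, k)) i j" if "k < ?M" for k
      unfolding agler_kernel_def using \<open>\<And>p k. p < ?M \<Longrightarrow> k < ?M \<Longrightarrow> L (p, k) = L' (p, k)\<close> that idx \<open>i < N\<close> \<open>j < N\<close> by simp
    then show ?thesis by (simp add: agler_sum_def)
  qed
  have min: "F L0 \<le> F L" for L
  proof (cases "F L \<le> F (\<lambda>_. 0)")
    case True
    define L' where "L' pk = (if fst pk < ?M \<and> snd pk < ?M then L pk else 0)" for pk
    have "L' \<in> Box" using bound[OF True] by (auto simp: Box_def L'_def)
    moreover have "?X L' i j = ?X L i j" if "i < N" "j < N" for i j
      using that by (intro Xcong) (auto simp: L'_def)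
    then have "F L' = F L" by (simp add: F_def)
    ultimately show ?thesis using L0(2) by metis
  next
    case False
    then show ?thesis using L0(2)[OF \<open>(\<lambda>_. 0) \<in> Box\<close>] by simp
  qed
  define Y where "Y i j = ?X L0 i j - A i j" for i j
  define ip where "ip U V = (\<Sum>i<N. \<Sum>j<N. U i j \<bullet> V i j)" for U V :: "nat \<Rightarrow> nat \<Rightarrow> complex"
  have FY: "F L0 = ip Y Y" by (simp add: F_def ip_def Y_def power2_norm_eq_inner)
  have var: "2 * t * ip Y V + t\<^sup>2 * ip V V \<ge> 0"
    if L: "\<And>i j. i < N \<Longrightarrow> j < N \<Longrightarrow> ?X L i j = ?X L0 i j + of_real t * V i j" for L t V
  proof -
    have "F L = (\<Sum>i<N. \<Sum>j<N. (cmod (Y i j + of_real t * V i j))\<^sup>2)"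
      unfolding F_def by (intro sum.cong refl) (auto simp: L Y_def algebra_simps)
    also have "\<dots> = (\<Sum>i<N. \<Sum>j<N. Y i j \<bullet> Y i j + (2 * t * (Y i j \<bullet> V i j) + t\<^sup>2 * (V i j \<bullet> V i j)))"
    proof (intro sum.cong refl)
      fix i j
      have "(cmod (Y i j + of_real t * V i j))\<^sup>2 = (Y i j + t *\<^sub>R V i j) \<bullet> (Y i j + t *\<^sub>R V i j)"
        unfolding scaleR_conv_of_real by (rule power2_norm_eq_inner)
      also have "\<dots> = Y i j \<bullet> Y i j + (2 * t * (Y i j \<bullet> V i j) + t\<^sup>2 * (V i j \<bullet> V i j))"
        by (simp add: inner_add_left inner_add_right inner_commute power2_eq_square)
      finally show "(cmod (Y i j + of_real t * V i j))\<^sup>2 = Y i j \<bullet> Y i j + (2 * t * (Y i j \<bullet> V i j) + t\<^sup>2 * (V i j \<bullet> V i j))" .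
    qed
    also have "\<dots> = ip Y Y + (2 * t * ip Y V + t\<^sup>2 * ip V V)"
      by (simp add: ip_def sum.distrib sum_distrib_left)
    finally show ?thesis using min[of L] FY by simp
  qed
  have ipV: "ip V V \<ge> 0" for V by (simp add: ip_def sum_nonneg)
  have pos: "ip Y (?X L) \<ge> 0" for L
  proof (rule quadratic_nonneg)
    fix t :: real assume t: "0 < t" "t \<le> 1"
    obtain L' where "\<forall>i<N. \<forall>j<N. ?X L' i j = of_real 1 * ?X L0 i j + of_real t * ?X L i j"
      using agler_sum_add[of 1 t N a m D L0 L] t by auto
    then show "0 \<le> 2 * t * ip Y (?X L) + t\<^sup>2 * ip (?X L) (?X L)" by (intro var[of L']) auto
  qed (rule ipV)
  \<comment> \<open>Shrinking the nearest point by the factor 1 - t stays in the cone; this is the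
    variation towards 0.\<close>
  have neg: "ip Y (\<lambda>i j. - ?X L0 i j) \<ge> 0"
  proof (rule quadratic_nonneg)
    fix t :: real assume t: "0 < t" "t \<le> 1"
    obtain L' where "\<forall>i<N. \<forall>j<N. ?X L' i j = of_real (1 - t) * ?X L0 i j + of_real 0 * ?X L0 i j"
      using agler_sum_add[of "1 - t" 0 N a m D L0 L0] t by auto
    then show "0 \<le> 2 * t * ip Y (\<lambda>i j. - ?X L0 i j) + t\<^sup>2 * ip (\<lambda>i j. - ?X L0 i j) (\<lambda>i j. - ?X L0 i j)"
      by (intro var[of L']) (auto simp: algebra_simps)
  qed (rule ipV)
  have YA: "ip Y A \<ge> - (\<epsilon> * (\<Sum>i<N. Re (A i i)))" if \<epsilon>: "\<epsilon> > 0" for \<epsilon>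
  proof -
    \<comment> \<open>Y is nonnegative on the cone, whereas \<open>H\<close> asks for strict
      positivity. The diagonal term \<epsilon> provides it with constant \<epsilon> (1 - \<rho>),
      and \<epsilon> is sent to 0 afterwards.\<close>
    define G where "G i j = cnj (Y i j) + (if i = j then of_real \<epsilon> else 0)" for i j
    have sumG: "Re (\<Sum>i<N. \<Sum>j<N. G i j * V i j) = ip Y V + \<epsilon> * (\<Sum>i<N. Re (V i i))" for V
    proof -
      have "(\<Sum>i<N. \<Sum>j<N. G i j * V i j) = (\<Sum>i<N. \<Sum>j<N. cnj (Y i j) * V i j) + (\<Sum>i<N. of_real \<epsilon> * V i i)"
        unfolding sum.distrib[symmetric]
        by (intro sum.cong refl) (simp add: G_def distrib_right sum.distrib if_distrib[of "\<lambda>u. u * _"] cong: if_cong)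
      then show ?thesis by (simp add: ip_def inner_complex_def sum_distrib_left)
    qed
    have "0 \<le> Re (\<Sum>i<N. \<Sum>j<N. G i j * A i j)"
    proof (rule H)
      fix i j
      have "?X L0 j i = cnj (?X L0 i j)" unfolding agler_sum_def cnj_sum by (intro sum.cong refl agler_kernel_cnj)
      then have "Y j i = cnj (Y i j)" using A[of j i] by (simp add: Y_def)
      then show "G j i = cnj (G i j)" by (auto simp: G_def)
    next
      show "\<epsilon> * (1 - \<rho>) > 0" using \<epsilon> D(2) by simp
      fix u :: "nat \<Rightarrow> nat \<Rightarrow> complex"
      \<comment> \<open>A single kernel as a member of the packed cone: u fills column 0, which
        exists because N and m are positive here.\<close>
      define L where "L pk = (if snd pk = 0 then u (fst pk div m) (fst pk mod m) else 0)" for pk :: "nat \<times> nat"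
      have XL: "?X L i j = agler_kernel a m D u i j" if "i < N" "j < N" for i j
      proof -
        have "agler_kernel a m D (\<lambda>i l. L (i * m + l, k)) i j = (if k = 0 then agler_kernel a m D u i j else 0)" for k
          by (auto simp: L_def agler_kernel_def)
        then have "?X L i j = (\<Sum>k<?M. if k = 0 then agler_kernel a m D u i j else 0)" by (simp add: agler_sum_def)
        then show ?thesis using that m by (auto simp: sum.delta)
      qed
      have "ip Y (agler_kernel a m D u) = ip Y (?X L)" by (simp add: ip_def XL)
      then have "ip Y (agler_kernel a m D u) \<ge> 0" using pos by simp
      moreover have "(1 - \<rho>) * (\<Sum>i<N. nrm2 m (u i)) \<le> (\<Sum>i<N. Re (agler_kernel a m D u i i))"
        unfolding sum_distrib_left agler_kernel_diag using D(1) by (intro sum_mono) (simp add: algebra_simps)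
      then have "\<epsilon> * ((1 - \<rho>) * (\<Sum>i<N. nrm2 m (u i))) \<le> \<epsilon> * (\<Sum>i<N. Re (agler_kernel a m D u i i))"
        using \<epsilon> by (intro mult_left_mono) auto
      ultimately show "\<epsilon> * (1 - \<rho>) * (\<Sum>i<N. nrm2 m (u i)) \<le> Re (\<Sum>i<N. \<Sum>j<N. G i j * agler_kernel a m D u i j)"
        unfolding sumG by simp
    qed
    then show ?thesis unfolding sumG by simp
  qed
  have "ip Y A \<ge> 0"
  proof (rule field_le_epsilon)
    fix e :: real assume e: "e > 0"
    let ?s = "\<Sum>i<N. Re (A i i)"
    have "(e / (\<bar>?s\<bar> + 1)) * ?s \<le> (e / (\<bar>?s\<bar> + 1)) * (\<bar>?s\<bar> + 1)" using e by (intro mult_left_mono) auto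
    also have "\<dots> = e" using e by simp
    finally show "0 \<le> ip Y A + e" using YA[of "e / (\<bar>?s\<bar> + 1)"] e by (simp add: add_pos_nonneg)
  qed
  \<comment> \<open>Y is the nearest point minus A. Its pairing with the nearest point is at most 0
    by \<open>neg\<close> and its pairing with A at least 0, so its square norm cannot be
    positive.\<close>
  moreover have "ip Y Y = - ip Y (\<lambda>i j. - ?X L0 i j) - ip Y A"
    by (simp add: ip_def Y_def inner_diff_right sum_subtractf sum_negf)
  ultimately have "ip Y Y \<le> 0" using neg by simp
  then have Y0: "ip Y Y = 0" using ipV[of Y] by simp
  have "Y i j = 0" if "i < N" "j < N" for i j
  proof -
    have "Y i j \<bullet> Y i j \<le> (\<Sum>j<N. Y i j \<bullet> Y i j)" using that by (intro member_le_sum) auto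
    also have "\<dots> \<le> ip Y Y" unfolding ip_def using that by (intro member_le_sum sum_nonneg) (auto intro: sum_nonneg)
    finally have "Y i j \<bullet> Y i j = 0" using Y0 inner_ge_zero[of "Y i j"] by linarith
    then show ?thesis by (rule inner_eq_zero_iff[THEN iffD1])
  qed
  then show ?thesis by (intro exI[of _ L0]) (auto simp: Y_def)
qed

section \<open>Transfer functions\<close>

definition ipr :: "nat \<Rightarrow> (nat \<Rightarrow> complex) \<Rightarrow> (nat \<Rightarrow> complex) \<Rightarrow> complex" where
  "ipr n x y = (\<Sum>k<n. x k * cnj (y k))"

lemma ipr_self: "ipr n x x = of_real (nrm2 n x)"
  by (simp add: ipr_def nrm2_def complex_norm_square del: of_real_power)

lemma ipr_diff: "ipr n (\<lambda>k. x k - y k) z = ipr n x z - ipr n y z"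
  and ipr_diff_right: "ipr n z (\<lambda>k. x k - y k) = ipr n z x - ipr n z y"
  and ipr_scale: "ipr n (\<lambda>k. c * x k) z = c * ipr n x z"
  and ipr_scale_right: "ipr n z (\<lambda>k. c * x k) = cnj c * ipr n z x"
  and ipr_commute: "ipr n y x = cnj (ipr n x y)"
  by (simp_all add: ipr_def sum_subtractf left_diff_distrib right_diff_distrib sum_distrib_left mult_ac)

lemma ipr_sum: "ipr n (\<lambda>k. \<Sum>j\<in>J. x j k) z = (\<Sum>j\<in>J. ipr n (x j) z)"
  and ipr_sum_right: "ipr n z (\<lambda>k. \<Sum>j\<in>J. x j k) = (\<Sum>j\<in>J. ipr n z (x j))"
  by (simp_all add: ipr_def sum_distrib_right sum_distrib_left) (rule sum.swap)+

text \<open>Gram-Schmidt without normalization: e is the part of \<open>g N\<close> orthogonal to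
  the earlier vectors, and a multiple of it is subtracted from the residue. Linear dependence is
  harmless, since then e has norm 0.\<close>

lemma normal_equations:
  fixes g :: "nat \<Rightarrow> nat \<Rightarrow> complex" and N :: nat
  shows "\<exists>c. \<forall>i<N. ipr n (\<lambda>k. x k - (\<Sum>j<N. c j * g j k)) (g i) = 0"
proof (induction N arbitrary: x)
  case (Suc N)
  obtain c where c: "\<And>i. i < N \<Longrightarrow> ipr n (\<lambda>k. x k - (\<Sum>j<N. c j * g j k)) (g i) = 0" using Suc by blast
  obtain d where d: "\<And>i. i < N \<Longrightarrow> ipr n (\<lambda>k. g N k - (\<Sum>j<N. d j * g j k)) (g i) = 0" using Suc by blast
  define r where "r k = x k - (\<Sum>j<N. c j * g j k)" for k
  define e where "e k = g N k - (\<Sum>j<N. d j * g j k)" for k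
  define t where "t = ipr n r e / ipr n e e"
  have rg: "ipr n r (g i) = 0" and eg: "ipr n e (g i) = 0" if "i < N" for i
    using c[OF that] d[OF that] by (simp_all add: r_def[abs_def] e_def[abs_def])
  have te: "ipr n (\<lambda>k. r k - t * e k) e = 0"
  proof (cases "nrm2 n e = 0")
    case True
    then have "\<forall>k<n. e k = 0" by (simp add: nrm2_eq_0_iff)
    then show ?thesis by (simp add: ipr_def)
  next
    case False
    then have "ipr n e e \<noteq> 0" by (simp add: ipr_self)
    moreover have "ipr n (\<lambda>k. r k - t * e k) e = ipr n r e - t * ipr n e e" by (simp only: ipr_diff ipr_scale)
    ultimately show ?thesis by (simp add: t_def)
  qed
  have tg: "ipr n (\<lambda>k. r k - t * e k) (g i) = 0" if "i < N" for i
    by (simp add: ipr_diff ipr_scale rg[OF that] eg[OF that])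
  have "g N = (\<lambda>k. e k - (\<Sum>j<N. (- d j) * g j k))" by (auto simp: e_def sum_negf)
  then have tN: "ipr n (\<lambda>k. r k - t * e k) (g N) = 0"
    by (simp only: ipr_diff_right ipr_sum_right ipr_scale_right te) (simp add: tg)
  define c' where "c' j = (if j < N then c j - t * d j else t)" for j
  have "x k - (\<Sum>j<Suc N. c' j * g j k) = r k - t * e k" for k
  proof -
    have "(\<Sum>j<Suc N. c' j * g j k) = (\<Sum>j<N. c j * g j k - t * (d j * g j k)) + t * g N k"
      by (simp add: c'_def algebra_simps)
    then show ?thesis by (simp add: r_def e_def sum_subtractf sum_distrib_left[symmetric] algebra_simps)
  qed
  then show ?case using tg tN by (intro exI[of _ c']) (simp add: less_Suc_eq)
qed simp

text \<open>The inequality makes the assignment of h i to g i well defined and contractive on the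
  span of the g i. V is this map preceded by the orthogonal projection onto the span.\<close>

lemma contraction_from_gram:
  fixes g h :: "nat \<Rightarrow> nat \<Rightarrow> complex"
  assumes le: "\<And>c. nrm2 P (\<lambda>p. \<Sum>i<N. c i * h i p) \<le> nrm2 Q (\<lambda>q. \<Sum>i<N. c i * g i q)"
  shows "\<exists>V\<in>carrier_mat P Q. bdd_by 1 V \<and> (\<forall>i<N. \<forall>p<P. app V (g i) p = h i p)"
proof -
  have "\<forall>q. \<exists>c. \<forall>i<N. ipr Q (\<lambda>k. (if k = q then 1 else 0) - (\<Sum>j<N. c j * g j k)) (g i) = 0"
    by (intro allI normal_equations)
  from choice[OF this] obtain R where
    R: "\<And>q i. i < N \<Longrightarrow> ipr Q (\<lambda>k. (if k = q then 1 else 0) - (\<Sum>j<N. R q j * g j k)) (g i) = 0" by blast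
  \<comment> \<open>Coefficients of the projection of x, built linearly from those of the unit
    vectors; the coefficients are not unique, and only a linear choice makes V a matrix.\<close>
  define Rx where "Rx x j = (\<Sum>q<Q. x q * R q j)" for x j
  define pj where "pj x k = (\<Sum>j<N. Rx x j * g j k)" for x k
  have orth: "ipr Q (\<lambda>k. x k - pj x k) (g i) = 0" if "i < N" for x i
  proof -
    have "x k - pj x k = (\<Sum>q<Q. x q * ((if k = q then 1 else 0) - (\<Sum>j<N. R q j * g j k)))" if "k < Q" for k
    proof -
      have "pj x k = (\<Sum>q<Q. x q * (\<Sum>j<N. R q j * g j k))"
        unfolding pj_def Rx_def sum_distrib_right sum_distrib_left
        by (subst sum.swap) (simp add: mult.assoc)
      moreover have "x k = (\<Sum>q<Q. x q * (if k = q then 1 else 0))" using that by (simp add: if_distrib cong: if_cong)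
      ultimately show ?thesis by (simp add: right_diff_distrib sum_subtractf)
    qed
    then have "ipr Q (\<lambda>k. x k - pj x k) (g i) = ipr Q (\<lambda>k. \<Sum>q<Q. x q * ((if k = q then 1 else 0) - (\<Sum>j<N. R q j * g j k))) (g i)"
      by (simp add: ipr_def)
    also have "\<dots> = 0" unfolding ipr_sum ipr_scale using R[OF that] by simp
    finally show ?thesis .
  qed
  have orth': "ipr Q (\<lambda>k. x k - pj x k) (\<lambda>k. \<Sum>j<N. c j * g j k) = 0" for x c
    unfolding ipr_sum_right ipr_scale_right by (simp add: orth)
  have pyth: "nrm2 Q (pj x) \<le> nrm2 Q x" for x
  proof -
    let ?r = "\<lambda>k. x k - pj x k"
    have 0: "ipr Q ?r (pj x) = 0" using orth'[of x "Rx x"] by (simp add: pj_def[abs_def])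
    have "ipr Q x x = ipr Q (\<lambda>k. ?r k - (-1) * pj x k) (\<lambda>k. ?r k - (-1) * pj x k)" by simp
    also have "\<dots> = ipr Q ?r ?r + ipr Q (pj x) (pj x)"
      unfolding ipr_diff[of Q ?r "\<lambda>k. (-1) * pj x k"] ipr_diff_right[of Q _ ?r "\<lambda>k. (-1) * pj x k"] ipr_scale ipr_scale_right
      using 0 ipr_commute[of Q "pj x" ?r] by simp
    finally have "nrm2 Q x = nrm2 Q ?r + nrm2 Q (pj x)" by (simp only: ipr_self of_real_add[symmetric] of_real_eq_iff)
    then show ?thesis by simp
  qed
  define V where "V = mat P Q (\<lambda>(p, q). \<Sum>j<N. R q j * h j p)"
  have V: "app V x p = (\<Sum>j<N. Rx x j * h j p)" if "p < P" for x p
    using that unfolding app_def V_def Rx_def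
    by (simp add: sum_distrib_right sum_distrib_left) (subst sum.swap, simp add: mult_ac)
  have "bdd_by 1 V"
    unfolding bdd_by_def
  proof (intro conjI allI)
    fix x
    have "nrm2 P (app V x) = nrm2 P (\<lambda>p. \<Sum>j<N. Rx x j * h j p)" by (rule nrm2_cong) (rule V)
    also have "\<dots> \<le> nrm2 Q (pj x)" unfolding pj_def[abs_def] by (rule le)
    also have "\<dots> \<le> nrm2 Q x" by (rule pyth)
    finally show "nrm2 (dim_row V) (app V x) \<le> 1\<^sup>2 * nrm2 (dim_col V) x" by (simp add: V_def)
  qed simp
  moreover have "app V (g i) p = h i p" if i: "i < N" and p: "p < P" for i p
  proof -
    \<comment> \<open>The combination with these coefficients is g i minus its own projection, so it
      has norm 0; the inequality transfers this to the h i.\<close>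
    let ?c = "\<lambda>j. (if j = i then 1 else 0) - Rx (g i) j"
    have gc: "(\<Sum>j<N. ?c j * f j k) = f i k - (\<Sum>j<N. Rx (g i) j * f j k)" for f :: "nat \<Rightarrow> nat \<Rightarrow> complex" and k
      using i by (simp add: left_diff_distrib sum_subtractf if_distrib[of "\<lambda>u. u * _"] cong: if_cong)
    have "ipr Q (\<lambda>k. \<Sum>j<N. ?c j * g j k) (\<lambda>k. \<Sum>j<N. ?c j * g j k) = 0"
      using orth'[of "g i" ?c] unfolding gc by (simp add: pj_def)
    then have "nrm2 Q (\<lambda>k. \<Sum>j<N. ?c j * g j k) = 0" by (simp only: ipr_self of_real_eq_0_iff)
    then have "nrm2 P (\<lambda>p. \<Sum>j<N. ?c j * h j p) = 0"
      using le[of ?c] nrm2_nonneg[of P "\<lambda>p. \<Sum>j<N. ?c j * h j p"] by linarith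
    then have "(\<Sum>j<N. ?c j * h j p) = 0" using p by (simp only: nrm2_eq_0_iff)
    then show ?thesis unfolding gc V[OF p] by simp
  qed
  ultimately show ?thesis by (intro bexI[of _ V]) (auto simp: V_def)
qed

text \<open>Row and column 0 carry the scalar channel; the rest is a block diagonal sum of copies of \<delta>.\<close>

definition bigdelta :: "nat \<Rightarrow> nat \<Rightarrow> (nat \<Rightarrow> nat \<Rightarrow> 'd fpoly) \<Rightarrow> nat \<Rightarrow> nat \<Rightarrow> 'd fpoly" where
  "bigdelta a b \<delta> i j = (if i = 0 \<or> j = 0 \<or> (i - 1) div a \<noteq> (j - 1) div b then (\<lambda>_. 0) else \<delta> ((i - 1) mod a) ((j - 1) mod b))"

lemma fp_eval_zero: "r < n \<Longrightarrow> app (fp_eval n (\<lambda>_. 0) X) x r = 0"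
  by (simp add: app_def fp_eval_def)

lemma bigdelta_row0:
  assumes "s < n"
  shows "app (delta_eval (Suc (K * a)) (Suc (K * b)) (bigdelta a b \<delta>) n X) x s = 0"
  using delta_row[of 0 "Suc (K * a)" s n "Suc (K * b)" "bigdelta a b \<delta>" X x] assms by (simp add: bigdelta_def fp_eval_zero)

lemma bigdelta_row:
  assumes "k < K" "r < a" "s < n"
  shows "app (delta_eval (Suc (K * a)) (Suc (K * b)) (bigdelta a b \<delta>) n X) x (Suc (k * a + r) * n + s) =
    app (delta_eval a b \<delta> n X) (\<lambda>p. x (n + k * (b * n) + p)) (r * n + s)"
proof -
  have i: "Suc (k * a + r) < Suc (K * a)"
    using assms by (metis add.commute add_less_mono1 less_le_trans mult_Suc Suc_leI mult_le_mono1 Suc_less_eq)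
  have kr: "(k * a + r) div a = k" "(k * a + r) mod a = r" using assms by auto
  let ?f = "\<lambda>j. app (fp_eval n (bigdelta a b \<delta> (Suc (k * a + r)) j) X) (\<lambda>t. x (j * n + t)) s"
  let ?g = "\<lambda>k' l. if k = k' then app (fp_eval n (\<delta> r l) X) (\<lambda>t. x (n + k * (b * n) + (l * n + t))) s else 0"
  have "app (delta_eval (Suc (K * a)) (Suc (K * b)) (bigdelta a b \<delta>) n X) x (Suc (k * a + r) * n + s) = (\<Sum>j<Suc (K * b). ?f j)"
    using delta_row[OF i assms(3)] .
  also have "\<dots> = ?f 0 + (\<Sum>j<K * b. ?f (Suc j))" by (rule sum.lessThan_Suc_shift)
  also have "?f 0 = 0" using assms by (simp add: bigdelta_def fp_eval_zero)
  also have "(\<Sum>j<K * b. ?f (Suc j)) = (\<Sum>j<K * b. ?g (j div b) (j mod b))"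
  proof (rule sum.cong[OF refl])
    fix j
    show "?f (Suc j) = ?g (j div b) (j mod b)"
    proof (cases "k = j div b")
      case True
      have "Suc j * n + t = n + k * (b * n) + (j mod b * n + t)" for t
      proof -
        have "j = k * b + j mod b" using True by simp
        then have "Suc j * n = (Suc (k * b + j mod b)) * n" by simp
        then show ?thesis by (simp add: algebra_simps)
      qed
      then show ?thesis using True kr by (simp add: bigdelta_def add.assoc)
    next
      case False
      then show ?thesis using kr assms by (simp add: bigdelta_def fp_eval_zero)
    qed
  qed
  also have "\<dots> = (\<Sum>k'<K. \<Sum>l<b. ?g k' l)" by (rule sum_div_mod)
  also have "\<dots> = (\<Sum>l<b. app (fp_eval n (\<delta> r l) X) (\<lambda>t. x (n + k * (b * n) + (l * n + t))) s)"
    using assms by (simp add: sum.swap[of _ "{..<b}"] sum.delta')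
  also have "\<dots> = app (delta_eval a b \<delta> n X) (\<lambda>p. x (n + k * (b * n) + p)) (r * n + s)"
    by (rule delta_row[OF assms(2,3), symmetric])
  finally show ?thesis by simp
qed

lemma nrm2_split: "nrm2 (Suc (K * b) * n) y = nrm2 n y + (\<Sum>k<K. nrm2 (b * n) (\<lambda>p. y (n + k * (b * n) + p)))"
proof -
  have "Suc (K * b) * n = n + K * (b * n)" by (simp add: mult.assoc)
  then have "nrm2 (Suc (K * b) * n) y = nrm2 (n + K * (b * n)) y" by (simp only:)
  also have "\<dots> = nrm2 n y + nrm2 (K * (b * n)) (\<lambda>p. y (n + p))"
    by (simp add: nrm2_def sum_lessThan_add)
  finally show ?thesis by (simp only: nrm2_block[of K "b * n"] add.assoc)
qed

text \<open>Column 0 is zero, so the scalar channel of y does not enter. The subtracted term is what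
  later yields the bound on the transfer function.\<close>

lemma bigdelta_bound:
  assumes "bdd_by r (delta_eval a b \<delta> n X)"
  shows "nrm2 (Suc (K * a) * n) (app (delta_eval (Suc (K * a)) (Suc (K * b)) (bigdelta a b \<delta>) n X) y) \<le>
     r\<^sup>2 * (nrm2 (Suc (K * b) * n) y - nrm2 n y)"
proof -
  let ?\<Delta> = "delta_eval (Suc (K * a)) (Suc (K * b)) (bigdelta a b \<delta>) n X"
  have "nrm2 (Suc (K * a) * n) (app ?\<Delta> y) = (\<Sum>k<K. nrm2 (a * n) (\<lambda>p. app ?\<Delta> y (n + k * (a * n) + p)))"
  proof -
    have "nrm2 n (app ?\<Delta> y) = 0" unfolding nrm2_eq_0_iff using bigdelta_row0 by blast
    then show ?thesis unfolding nrm2_split by simp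
  qed
  also have "\<dots> = (\<Sum>k<K. nrm2 (a * n) (app (delta_eval a b \<delta> n X) (\<lambda>p. y (n + k * (b * n) + p))))"
  proof (intro sum.cong refl nrm2_cong)
    fix k p assume k: "k \<in> {..<K}" and p: "p < a * n"
    note p' = div_mod_less[OF p]
    have "n + k * (a * n) + p = Suc (k * a + p div n) * n + p mod n"
    proof -
      have "Suc (k * a + p div n) * n + p mod n = n + k * a * n + (p div n * n + p mod n)" by (simp add: algebra_simps)
      then show ?thesis by (simp add: mult.assoc)
    qed
    then have "app ?\<Delta> y (n + k * (a * n) + p) = app ?\<Delta> y (Suc (k * a + p div n) * n + p mod n)" by (simp only:)
    also have "\<dots> = app (delta_eval a b \<delta> n X) (\<lambda>p. y (n + k * (b * n) + p)) (p div n * n + p mod n)"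
      using k p' by (intro bigdelta_row) auto
    finally show "app ?\<Delta> y (n + k * (a * n) + p) = app (delta_eval a b \<delta> n X) (\<lambda>p. y (n + k * (b * n) + p)) p" by simp
  qed
  also have "\<dots> \<le> (\<Sum>k<K. r\<^sup>2 * nrm2 (b * n) (\<lambda>p. y (n + k * (b * n) + p)))"
    using bdd_byD[OF assms] by (intro sum_mono) simp
  also have "\<dots> = r\<^sup>2 * (nrm2 (Suc (K * b) * n) y - nrm2 n y)" unfolding nrm2_split by (simp add: sum_distrib_left)
  finally show ?thesis .
qed

lemma kron_one_one: "kron (1\<^sub>m (Suc 0)) S = S"
  by (rule eq_matI) (auto simp: kron_index)

lemma kron_smult_intw:
  assumes "V \<in> carrier_mat p q" "S \<in> carrier_mat m n"
  shows "kron (1\<^sub>m p) S * kron V (1\<^sub>m n) = kron V (1\<^sub>m m) * kron (1\<^sub>m q) S"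
  using assms by (simp add: kron_mult)

section \<open>Transfer functions as solutions of a feedback equation\<close>

context
  fixes a b K :: nat and \<delta> :: "nat \<Rightarrow> nat \<Rightarrow> ('d::finite) fpoly" and V :: "complex mat"
  assumes Vc: "V \<in> carrier_mat (Suc (K * b)) (Suc (K * a))" and V1: "bdd_by 1 V"
begin

abbreviation (input) "realiz_P \<equiv> Suc (K * b)"
abbreviation (input) "realiz_Q \<equiv> Suc (K * a)"

definition realiz_D :: "nat \<Rightarrow> 'd mtuple \<Rightarrow> complex mat" where
  "realiz_D n X = delta_eval realiz_Q realiz_P (bigdelta a b \<delta>) n X"

definition realiz_M :: "nat \<Rightarrow> 'd mtuple \<Rightarrow> complex mat" where
  "realiz_M n X = 1\<^sub>m (realiz_P * n) - kron V (1\<^sub>m n) * realiz_D n X"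

definition realiz_J :: "nat \<Rightarrow> complex mat" where
  "realiz_J n = kron (mat realiz_Q 1 (\<lambda>(r, _). if r = 0 then 1 else 0)) (1\<^sub>m n)"

definition realiz_E :: "nat \<Rightarrow> complex mat" where
  "realiz_E n = kron (mat 1 realiz_P (\<lambda>(_, c). if c = 0 then 1 else 0)) (1\<^sub>m n)"

definition realiz_W :: "nat \<Rightarrow> 'd mtuple \<Rightarrow> complex mat" where
  "realiz_W n X = (SOME W. W \<in> carrier_mat (realiz_P * n) (realiz_P * n) \<and> realiz_M n X * W = 1\<^sub>m (realiz_P * n) \<and> W * realiz_M n X = 1\<^sub>m (realiz_P * n))"

text \<open>The value at \<xi> is the scalar channel of the solution y of y = V (J \<xi> + D y), in
  closed form E (1 - V D)^-1 V J. The matrix size is read off from the tuple.\<close>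

definition realiz :: "'d mtuple \<Rightarrow> complex mat" where
  "realiz X = (let n = dim_row (X (SOME i. True)) in realiz_E n * (realiz_W n X * (kron V (1\<^sub>m n) * realiz_J n)))"

lemma realiz_dims [simp]: "realiz_D n X \<in> carrier_mat (realiz_Q * n) (realiz_P * n)" "realiz_M n X \<in> carrier_mat (realiz_P * n) (realiz_P * n)"
  "realiz_J n \<in> carrier_mat (realiz_Q * n) n" "realiz_E n \<in> carrier_mat n (realiz_P * n)" "kron V (1\<^sub>m n) \<in> carrier_mat (realiz_P * n) (realiz_Q * n)"
  using Vc by (auto simp: realiz_D_def realiz_M_def realiz_J_def realiz_E_def simp del: mult_Suc)

lemmas realiz_dims' [simp] = realiz_dims[THEN carrier_matD(1)] realiz_dims[THEN carrier_matD(2)]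

lemma app_realiz_J: "q < realiz_Q * n \<Longrightarrow> app (realiz_J n) x q = (if q < n then x q else 0)"
proof -
  assume q: "q < realiz_Q * n"
  note q' = div_mod_less[OF q]
  let ?e = "mat realiz_Q 1 (\<lambda>(r, _). if r = 0 then 1 else 0) :: complex mat"
  have "app (realiz_J n) x (q div n * n + q mod n) = app ?e (\<lambda>i. x (i * n + q mod n)) (q div n)"
    unfolding realiz_J_def using q' by (intro app_kron_one_right) auto
  also have "\<dots> = (if q div n = 0 then x (q mod n) else 0)" using q' by (simp add: app_def)
  also have "\<dots> = (if q < n then x q else 0)" using q' by (auto simp: div_eq_0_iff)
  finally show ?thesis by simp
qed

lemma app_realiz_E: "s < n \<Longrightarrow> app (realiz_E n) y s = y s"
  using app_kron_one_right[of 0 "mat 1 realiz_P (\<lambda>(_, c). if c = 0 then 1 else 0)" s n y]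
  by (simp add: realiz_E_def app_def[of "mat _ _ _"] if_distrib[of "\<lambda>u. u * _"] cong: if_cong del: sum.lessThan_Suc)

lemma realiz_D_first: "s < n \<Longrightarrow> app (realiz_D n X) y s = 0"
  unfolding realiz_D_def by (rule bigdelta_row0)

lemma realiz_D_bound:
  assumes "bdd_by r (delta_eval a b \<delta> n X)"
  shows "nrm2 (realiz_Q * n) (app (realiz_D n X) y) \<le> r\<^sup>2 * (nrm2 (realiz_P * n) y - nrm2 n y)"
  unfolding realiz_D_def by (rule bigdelta_bound[OF assms])

lemma app_realiz_M: "k < realiz_P * n \<Longrightarrow> app (realiz_M n X) y k = y k - app (kron V (1\<^sub>m n)) (app (realiz_D n X) y) k"
proof -
  assume k: "k < realiz_P * n"
  have "app (realiz_M n X) y k = app (1\<^sub>m (realiz_P * n)) y k - app (kron V (1\<^sub>m n) * realiz_D n X) y k"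
    unfolding realiz_M_def using k Vc by (simp add: app_def left_diff_distrib sum_subtractf del: mult_Suc index_mult_mat(1) index_one_mat(1))
  moreover have "app (kron V (1\<^sub>m n) * realiz_D n X) y k = app (kron V (1\<^sub>m n)) (app (realiz_D n X) y) k"
    using k Vc by (intro app_mult) (simp_all del: mult_Suc)
  ultimately show ?thesis using k by (simp add: app_one del: mult_Suc)
qed

lemma kron_V_bound: "nrm2 (realiz_P * n) (app (kron V (1\<^sub>m n)) z) \<le> nrm2 (realiz_Q * n) z"
  using bdd_byD[OF bdd_by_kron_one_right[OF V1], of n z] Vc by (simp del: mult_Suc)

text \<open>A kernel vector satisfies y = V D y, but D shrinks norms by a factor r < 1 and V does
  not increase them, so y = 0.\<close>

lemma realiz_W:
  assumes X: "X \<in> Gd a b \<delta> n"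
  shows "realiz_W n X \<in> carrier_mat (realiz_P * n) (realiz_P * n) \<and> realiz_M n X * realiz_W n X = 1\<^sub>m (realiz_P * n) \<and> realiz_W n X * realiz_M n X = 1\<^sub>m (realiz_P * n)"
proof -
  obtain r where r: "r < 1" "bdd_by r (delta_eval a b \<delta> n X)" using X by (auto simp: Gd_iff)
  have r0: "r \<ge> 0" using r(2) by (rule bdd_by_nonneg)
  have "y k = 0" if y: "\<And>k. k < realiz_P * n \<Longrightarrow> app (realiz_M n X) y k = 0" and k: "k < realiz_P * n" for y k
  proof -
    have "nrm2 (realiz_P * n) y = nrm2 (realiz_P * n) (app (kron V (1\<^sub>m n)) (app (realiz_D n X) y))"
      using y app_realiz_M[of _ n X y] by (intro nrm2_cong) auto
    also have "\<dots> \<le> nrm2 (realiz_Q * n) (app (realiz_D n X) y)" by (rule kron_V_bound)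
    also have "\<dots> \<le> r\<^sup>2 * (nrm2 (realiz_P * n) y - nrm2 n y)" by (rule realiz_D_bound[OF r(2)])
    also have "\<dots> \<le> r\<^sup>2 * nrm2 (realiz_P * n) y" by (intro mult_left_mono) auto
    finally have "(1 - r\<^sup>2) * nrm2 (realiz_P * n) y \<le> 0" by (simp add: algebra_simps)
    moreover have "r\<^sup>2 < 1" using r r0 by (simp add: abs_square_less_1)
    ultimately have "nrm2 (realiz_P * n) y \<le> 0" by (simp add: mult_le_0_iff)
    then have "nrm2 (realiz_P * n) y = 0" using nrm2_nonneg[of "realiz_P * n" y] by linarith
    then show ?thesis using k by (simp only: nrm2_eq_0_iff)
  qed
  then have "\<exists>B\<in>carrier_mat (realiz_P * n) (realiz_P * n). realiz_M n X * B = 1\<^sub>m (realiz_P * n) \<and> B * realiz_M n X = 1\<^sub>m (realiz_P * n)"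
    by (intro invertible_matI realiz_dims) blast
  then have "\<exists>W. W \<in> carrier_mat (realiz_P * n) (realiz_P * n) \<and> realiz_M n X * W = 1\<^sub>m (realiz_P * n) \<and> W * realiz_M n X = 1\<^sub>m (realiz_P * n)" by blast
  from someI_ex[OF this] show ?thesis unfolding realiz_W_def .
qed

lemma dim_mtuple:
  assumes "X \<in> Gd a b \<delta> n" shows "dim_row (X (SOME i. True)) = n"
  using is_mtuple_dim[OF GdD[OF assms]] by blast

lemma realiz_eq: "X \<in> Gd a b \<delta> n \<Longrightarrow> realiz X = realiz_E n * (realiz_W n X * (kron V (1\<^sub>m n) * realiz_J n))"
  by (simp add: realiz_def dim_mtuple)

lemma realiz_carrier: "X \<in> Gd a b \<delta> n \<Longrightarrow> realiz X \<in> carrier_mat n n"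
  unfolding realiz_eq using realiz_W by (intro mult_carrier_mat[OF realiz_dims(4) mult_carrier_mat[OF _ mult_carrier_mat[OF realiz_dims(5,3)]]]) blast

lemma realiz_app:
  assumes X: "X \<in> Gd a b \<delta> n" and "s < n"
  shows "app (realiz X) \<xi> s = app (realiz_W n X) (app (kron V (1\<^sub>m n)) (app (realiz_J n) \<xi>)) s"
proof -
  have W: "realiz_W n X \<in> carrier_mat (realiz_P * n) (realiz_P * n)" using realiz_W[OF X] by blast
  have sP: "s < realiz_P * n" using assms(2) by simp
  have "app (realiz X) \<xi> s = app (realiz_E n) (app (realiz_W n X * (kron V (1\<^sub>m n) * realiz_J n)) \<xi>) s"
    unfolding realiz_eq[OF X] using W assms(2) by (intro app_mult) (simp_all del: mult_Suc)
  also have "\<dots> = app (realiz_W n X * (kron V (1\<^sub>m n) * realiz_J n)) \<xi> s" by (rule app_realiz_E[OF assms(2)])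
  also have "\<dots> = app (realiz_W n X) (app (kron V (1\<^sub>m n) * realiz_J n) \<xi>) s"
    using W sP Vc by (intro app_mult) (simp_all del: mult_Suc)
  also have "\<dots> = app (realiz_W n X) (app (kron V (1\<^sub>m n)) (app (realiz_J n) \<xi>)) s"
    using W Vc by (intro app_cong_eq refl app_mult) (simp_all del: mult_Suc)
  finally show ?thesis .
qed

lemma realiz_solution:
  fixes \<xi> :: "nat \<Rightarrow> complex"
  assumes X: "X \<in> Gd a b \<delta> n" and "k < realiz_P * n"
  defines "y \<equiv> app (realiz_W n X) (app (kron V (1\<^sub>m n)) (app (realiz_J n) \<xi>))"
  shows "y k = app (kron V (1\<^sub>m n)) (\<lambda>q. app (realiz_J n) \<xi> q + app (realiz_D n X) y q) k"
proof -
  have W: "realiz_W n X \<in> carrier_mat (realiz_P * n) (realiz_P * n)" "realiz_M n X * realiz_W n X = 1\<^sub>m (realiz_P * n)" using realiz_W[OF X] by auto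
  let ?v = "app (kron V (1\<^sub>m n)) (app (realiz_J n) \<xi>)"
  have "app (realiz_M n X) y k = app (realiz_M n X * realiz_W n X) ?v k"
    unfolding y_def using W(1) assms(2) by (intro app_mult[symmetric]) (simp_all del: mult_Suc)
  also have "\<dots> = ?v k" unfolding W(2) using assms(2) by (rule app_one)
  finally show ?thesis unfolding app_realiz_M[OF assms(2)] app_lin by (simp add: algebra_simps)
qed

text \<open>Any solution of the feedback equation computes the value. Compatibility with
  intertwiners and the interpolation property are both verified by exhibiting a solution.\<close>

lemma realiz_unique:
  assumes X: "X \<in> Gd a b \<delta> n" and s: "s < n"
    and y: "\<And>k. k < realiz_P * n \<Longrightarrow> y k = app (kron V (1\<^sub>m n)) (\<lambda>q. app (realiz_J n) \<xi> q + app (realiz_D n X) y q) k"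
  shows "app (realiz X) \<xi> s = y s"
proof -
  have W: "realiz_W n X \<in> carrier_mat (realiz_P * n) (realiz_P * n)" "realiz_W n X * realiz_M n X = 1\<^sub>m (realiz_P * n)" using realiz_W[OF X] by auto
  have sP: "s < realiz_P * n" using s by simp
  have "app (realiz_M n X) y k = app (kron V (1\<^sub>m n)) (app (realiz_J n) \<xi>) k" if "k < realiz_P * n" for k
    using y[OF that] unfolding app_realiz_M[OF that] app_lin by simp
  then have "app (realiz X) \<xi> s = app (realiz_W n X) (app (realiz_M n X) y) s"
    unfolding realiz_app[OF X s] by (intro app_cong_eq[OF refl, of "realiz_W n X"]) (use W(1) in \<open>simp del: mult_Suc\<close>)
  also have "\<dots> = app (realiz_W n X * realiz_M n X) y s" using W(1) sP by (intro app_mult[symmetric]) (simp_all del: mult_Suc)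
  also have "\<dots> = y s" unfolding W(2) using sP by (rule app_one)
  finally show ?thesis .
qed

text \<open>Energy balance: J \<xi> and D y occupy disjoint coordinates, so |y|^2 \<le> |\<xi>|^2 +
  |D y|^2 \<le> |\<xi>|^2 + |y|^2 - |y0|^2, where y0 is the scalar channel and hence the
  value.\<close>

lemma realiz_contractive:
  assumes X: "X \<in> Gd a b \<delta> n" shows "bdd_by 1 (realiz X)"
  unfolding bdd_by_def
proof (intro conjI allI)
  fix \<xi>
  obtain r where r: "r < 1" "bdd_by r (delta_eval a b \<delta> n X)" using X by (auto simp: Gd_iff)
  have r2: "r\<^sup>2 \<le> 1" using r bdd_by_nonneg[OF r(2)] by (simp add: abs_square_le_1)
  define y where "y = app (realiz_W n X) (app (kron V (1\<^sub>m n)) (app (realiz_J n) \<xi>))"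
  let ?z = "\<lambda>q. app (realiz_J n) \<xi> q + app (realiz_D n X) y q"
  have "nrm2 (realiz_P * n) y = nrm2 (realiz_P * n) (app (kron V (1\<^sub>m n)) ?z)"
    unfolding y_def by (rule nrm2_cong) (rule realiz_solution[OF X])
  also have "\<dots> \<le> nrm2 (realiz_Q * n) ?z" by (rule kron_V_bound)
  also have "\<dots> = nrm2 n \<xi> + nrm2 (realiz_Q * n) (app (realiz_D n X) y)"
  proof -
    have "nrm2 n ?z = nrm2 n \<xi>" by (intro nrm2_cong) (simp add: app_realiz_J realiz_D_first)
    moreover have "nrm2 n (app (realiz_D n X) y) = 0" unfolding nrm2_eq_0_iff using realiz_D_first by blast
    moreover have "nrm2 (a * n) (\<lambda>p. ?z (n + k * (a * n) + p)) = nrm2 (a * n) (\<lambda>p. app (realiz_D n X) y (n + k * (a * n) + p))"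
      if "k < K" for k
    proof (rule nrm2_cong)
      fix p assume "p < a * n"
      then have "k * (a * n) + p < K * (a * n)"
        using that by (metis add.commute add_less_mono1 less_le_trans mult_Suc Suc_leI mult_le_mono1)
      then have "n + k * (a * n) + p < realiz_Q * n" by (simp add: mult.assoc)
      then show "?z (n + k * (a * n) + p) = app (realiz_D n X) y (n + k * (a * n) + p)" by (simp only: app_realiz_J) simp
    qed
    ultimately show ?thesis unfolding nrm2_split by simp
  qed
  also have "\<dots> \<le> nrm2 n \<xi> + 1 * (nrm2 (realiz_P * n) y - nrm2 n y)"
  proof -
    have "nrm2 n y \<le> nrm2 (realiz_P * n) y" unfolding nrm2_split by (simp add: sum_nonneg)
    then have "r\<^sup>2 * (nrm2 (realiz_P * n) y - nrm2 n y) \<le> 1 * (nrm2 (realiz_P * n) y - nrm2 n y)"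
      using r2 by (intro mult_right_mono) auto
    then show ?thesis using realiz_D_bound[OF r(2), of y] by linarith
  qed
  finally have "nrm2 n y \<le> nrm2 n \<xi>" by simp
  moreover have "nrm2 n (app (realiz X) \<xi>) = nrm2 n y"
    unfolding y_def by (rule nrm2_cong) (rule realiz_app[OF X])
  ultimately show "nrm2 (dim_row (realiz X)) (app (realiz X) \<xi>) \<le> 1\<^sup>2 * nrm2 (dim_col (realiz X)) \<xi>"
    using realiz_carrier[OF X] by simp
qed simp

text \<open>An intertwiner, amplified by the identity, commutes with each of the four ingredients E,
  V, J, D and so carries the solution at X to a solution at Y.\<close>

lemma realiz_nc: "is_nc_fun a b \<delta> realiz"
proof (rule is_nc_funI)
  fix n m S and X Y :: "'d mtuple"
  assume X: "X \<in> Gd a b \<delta> n" and Y: "Y \<in> Gd a b \<delta> m" and I: "intw n m S X Y"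
  have S: "S \<in> carrier_mat m n" using I by (simp add: intw_def)
  let ?SP = "kron (1\<^sub>m realiz_P) S" and ?SQ = "kron (1\<^sub>m realiz_Q) S"
  have SP: "?SP \<in> carrier_mat (realiz_P * m) (realiz_P * n)" and SQ: "?SQ \<in> carrier_mat (realiz_Q * m) (realiz_Q * n)" using S by (auto simp del: mult_Suc)
  have D: "?SQ * realiz_D n X = realiz_D m Y * ?SP" unfolding realiz_D_def by (rule intw_delta[OF I])
  have V: "?SP * kron V (1\<^sub>m n) = kron V (1\<^sub>m m) * ?SQ" by (rule kron_smult_intw[OF Vc S])
  have J: "?SQ * realiz_J n = realiz_J m * S"
    using kron_smult_intw[of "mat realiz_Q 1 (\<lambda>(r, _). if r = 0 then 1 else 0)" realiz_Q 1 S m n] S by (simp add: realiz_J_def kron_one_one)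
  have E: "S * realiz_E n = realiz_E m * ?SP"
    using kron_smult_intw[of "mat 1 realiz_P (\<lambda>(_, c). if c = 0 then 1 else 0)" 1 realiz_P S m n] S by (simp add: realiz_E_def kron_one_one)
  show "S * realiz X = realiz Y * S"
  proof (rule mat_eq_app)
    show "S * realiz X \<in> carrier_mat m n" "realiz Y * S \<in> carrier_mat m n"
      using S realiz_carrier[OF X] realiz_carrier[OF Y] by auto
    fix x :: "nat \<Rightarrow> complex" and s assume s: "s < m"
    define y where "y = app (realiz_W n X) (app (kron V (1\<^sub>m n)) (app (realiz_J n) x))"
    have "app (realiz Y) (app S x) s = app ?SP y s"
    proof (rule realiz_unique[OF Y s])
      fix k assume k: "k < realiz_P * m"
      have "app ?SP y k = app ?SP (app (kron V (1\<^sub>m n)) (\<lambda>q. app (realiz_J n) x q + app (realiz_D n X) y q)) k"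
        unfolding y_def by (rule app_cong_eq[OF refl], rule realiz_solution[OF X]) (use S in \<open>simp del: mult_Suc\<close>)
      also have "\<dots> = app (?SP * kron V (1\<^sub>m n)) (\<lambda>q. app (realiz_J n) x q + app (realiz_D n X) y q) k"
        using S Vc k by (intro app_mult[symmetric]) (simp_all del: mult_Suc)
      also have "\<dots> = app (kron V (1\<^sub>m m)) (app ?SQ (\<lambda>q. app (realiz_J n) x q + app (realiz_D n X) y q)) k"
        unfolding V using S Vc k by (intro app_mult) (simp_all del: mult_Suc)
      also have "\<dots> = app (kron V (1\<^sub>m m)) (\<lambda>q. app (realiz_J m) (app S x) q + app (realiz_D m Y) (app ?SP y) q) k"
      proof (rule app_cong_eq[OF refl])
        fix q assume "q < dim_col (kron V (1\<^sub>m m))"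
        then have q: "q < realiz_Q * m" using Vc by (simp del: mult_Suc)
        have "app ?SQ (app (realiz_J n) x) q = app (realiz_J m) (app S x) q"
          using app_mult[of ?SQ "realiz_J n" q x] app_mult[of "realiz_J m" S q x] J S q by (simp del: mult_Suc)
        moreover have "app ?SQ (app (realiz_D n X) y) q = app (realiz_D m Y) (app ?SP y) q"
          using app_mult[of ?SQ "realiz_D n X" q y] app_mult[of "realiz_D m Y" ?SP q y] D S q by (simp del: mult_Suc)
        ultimately show "app ?SQ (\<lambda>q. app (realiz_J n) x q + app (realiz_D n X) y q) q = app (realiz_J m) (app S x) q + app (realiz_D m Y) (app ?SP y) q"
          by (simp only: app_lin)
      qed
      finally show "app ?SP y k = app (kron V (1\<^sub>m m)) (\<lambda>q. app (realiz_J m) (app S x) q + app (realiz_D m Y) (app ?SP y) q) k" .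
    qed
    moreover have "app ?SP y s = app S (app (realiz X) x) s"
    proof -
      have "app ?SP y s = app (realiz_E m) (app ?SP y) s" by (rule app_realiz_E[OF s, symmetric])
      also have "\<dots> = app (realiz_E m * ?SP) y s" using S s by (intro app_mult[symmetric]) (simp_all del: mult_Suc)
      also have "\<dots> = app S (app (realiz_E n) y) s" unfolding E[symmetric] using S s by (intro app_mult) (simp_all del: mult_Suc)
      also have "\<dots> = app S (app (realiz X) x) s"
        by (rule app_cong_eq[OF refl]) (use S realiz_app[OF X] in \<open>simp add: app_realiz_E y_def\<close>)
      finally show ?thesis .
    qed
    ultimately show "app (S * realiz X) x s = app (realiz Y * S) x s"
      using app_mult[of S "realiz X" s x] app_mult[of "realiz Y" S s x] S s realiz_carrier[OF X] realiz_carrier[OF Y] by simp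
  qed
qed (rule realiz_carrier)

end

section \<open>Interpolation\<close>

text \<open>Pairing a form G with an Agler kernel compares the G-norm of u with that of its image.
  Nonnegativity for all u thus says that \<open>\<delta>\<close> at the multiplication tuple is a
  contraction for G.\<close>

lemma agler_kernel_qf:
  "(\<Sum>i<N. \<Sum>j<N. G i j * agler_kernel a m D u i j) =
     (\<Sum>l<m. qf N G (\<lambda>s. u s l)) - (\<Sum>r<a. qf N G (\<lambda>s. \<Sum>l<m. D s r l * u s l))"
proof -
  have swap3: "(\<Sum>i<N. \<Sum>j<N. G i j * (\<Sum>l\<in>K. x i l * cnj (x j l))) = (\<Sum>l\<in>K. qf N G (\<lambda>s. x s l))"
    for x :: "nat \<Rightarrow> nat \<Rightarrow> complex" and K
  proof -
    have "(\<Sum>i<N. \<Sum>j<N. G i j * (\<Sum>l\<in>K. x i l * cnj (x j l))) = (\<Sum>i<N. \<Sum>l\<in>K. \<Sum>j<N. G i j * x i l * cnj (x j l))"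
    proof (rule sum.cong[OF refl])
      fix i
      show "(\<Sum>j<N. G i j * (\<Sum>l\<in>K. x i l * cnj (x j l))) = (\<Sum>l\<in>K. \<Sum>j<N. G i j * x i l * cnj (x j l))"
        unfolding sum_distrib_left mult.assoc by (rule sum.swap)
    qed
    also have "\<dots> = (\<Sum>l\<in>K. \<Sum>i<N. \<Sum>j<N. G i j * x i l * cnj (x j l))" by (rule sum.swap)
    finally show ?thesis by (simp add: qf_def)
  qed
  show ?thesis
    unfolding agler_kernel_def right_diff_distrib sum_subtractf swap3
    ..
qed

section \<open>Diagonal tuples and joint eigenvectors\<close>

definition diag_tuple :: "nat \<Rightarrow> (nat \<Rightarrow> complex ^ 'd) \<Rightarrow> 'd mtuple" where
  "diag_tuple N z i = mat N N (\<lambda>(r, c). if r = c then vec_nth (z r) i else 0)"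

lemma diag_tuple_mtuple: "is_mtuple N (diag_tuple N z)"
  by (simp add: is_mtuple_def diag_tuple_def)

lemma app_diag_tuple: "r < N \<Longrightarrow> app (diag_tuple N z i) x r = vec_nth (z r) i * x r"
  by (simp add: app_def diag_tuple_def if_distrib[of "\<lambda>u. u * _"] cong: if_cong)

lemma word_eval_diag: "r < N \<Longrightarrow> c < N \<Longrightarrow> word_eval N (diag_tuple N z) w $$ (r, c) = (if r = c then wmon w (z r) else 0)"
proof (induction w arbitrary: r)
  case (Cons i w)
  have "word_eval N (diag_tuple N z) (i # w) $$ (r, c) =
      (\<Sum>k<N. diag_tuple N z i $$ (r, k) * word_eval N (diag_tuple N z) w $$ (k, c))"
    unfolding word_eval_Cons using Cons.prems word_eval_dim[OF diag_tuple_mtuple, of N z w]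
    by (subst mat_mult_index) (auto simp: diag_tuple_def)
  also have "\<dots> = (\<Sum>k<N. if k = r then vec_nth (z r) i * word_eval N (diag_tuple N z) w $$ (r, c) else 0)"
    using Cons.prems by (intro sum.cong) (auto simp: diag_tuple_def)
  also have "\<dots> = (if r = c then wmon (i # w) (z r) else 0)" using Cons by (simp add: wmon_def)
  finally show ?case .
qed (simp add: wmon_def)

lemma app_fp_eval_diag: "r < N \<Longrightarrow> app (fp_eval N p (diag_tuple N z)) x r = fp_scalar p (z r) * x r"
proof -
  assume r: "r < N"
  have "fp_eval N p (diag_tuple N z) $$ (r, c) = (if r = c then fp_scalar p (z r) else 0)" if "c < N" for c
    using r that by (simp add: fp_eval_def word_eval_diag fp_scalar_eq)
  then have "app (fp_eval N p (diag_tuple N z)) x r = (\<Sum>c<N. (if r = c then fp_scalar p (z r) else 0) * x c)"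
    unfolding app_def by (intro sum.cong) auto
  then show ?thesis using r by (simp add: if_distrib[of "\<lambda>u. u * _"] cong: if_cong)
qed

lemma commuting_conj:
  assumes X: "is_mtuple n X" "commuting X" and R: "R \<in> carrier_mat n n" "Ri \<in> carrier_mat n n" "Ri * R = 1\<^sub>m n" "R * Ri = 1\<^sub>m n"
  shows "commuting (\<lambda>i. R * X i * Ri)"
  unfolding commuting_def
proof (intro allI)
  fix i j
  have Xi: "X i \<in> carrier_mat n n" for i using X by (simp add: is_mtuple_def)
  have "R * X i * Ri * (R * X j * Ri) = R * (X i * X j) * Ri" for i j
  proof -
    have 1: "R * X i \<in> carrier_mat n n" "R * X i * Ri \<in> carrier_mat n n" "X j * Ri \<in> carrier_mat n n" "R * X j \<in> carrier_mat n n" for i j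
      using R Xi by (auto intro: mult_carrier_mat)
    have "R * X i * Ri * (R * X j * Ri) = R * X i * (Ri * (R * (X j * Ri)))"
      using assoc_mult_mat[OF R(1) Xi[of j] R(2)] assoc_mult_mat[OF 1(1)[of i] R(2) mult_carrier_mat[OF R(1) 1(3)[of j]]] by simp
    also have "Ri * (R * (X j * Ri)) = X j * Ri"
      using assoc_mult_mat[OF R(2,1) 1(3)[of j]] R(3) left_mult_one_mat[OF 1(3)[of j]] by simp
    also have "R * X i * (X j * Ri) = R * X i * X j * Ri"
      using assoc_mult_mat[OF 1(1)[of i] Xi[of j] R(2)] by simp
    also have "R * X i * X j = R * (X i * X j)" by (rule assoc_mult_mat[OF R(1) Xi Xi])
    finally show ?thesis .
  qed
  then show "R * X i * Ri * (R * X j * Ri) = R * X j * Ri * (R * X i * Ri)"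
    using X(2) by (simp add: commuting_def)
qed

lemma commuting_diag: "commuting (diag_tuple N z)"
  unfolding commuting_def
proof (intro allI mat_eq_app)
  fix i j and x :: "nat \<Rightarrow> complex" and r assume r: "r < N"
  have d: "dim_row (diag_tuple N z i) = N" "dim_col (diag_tuple N z i) = N" for i by (simp_all add: diag_tuple_def)
  have "app (diag_tuple N z i * diag_tuple N z j) x r = vec_nth (z r) i * (vec_nth (z r) j * x r)" for i j
    using r d by (simp add: app_mult app_diag_tuple)
  then show "app (diag_tuple N z i * diag_tuple N z j) x r = app (diag_tuple N z j * diag_tuple N z i) x r"
    by (simp add: mult.left_commute)
qed (auto simp: diag_tuple_def intro!: mult_carrier_mat)

lemma jspecI:
  assumes T: "is_mtuple n T" and x: "\<And>i r. r < n \<Longrightarrow> app (T i) x r = vec_nth \<mu> i * x r" "r < n" "x r \<noteq> 0"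
  shows "\<mu> \<in> jspec n T"
  unfolding jspec_def mem_Collect_eq
proof (intro bexI[of _ "vec n x"] conjI allI)
  show "vec n x \<noteq> 0\<^sub>v n"
  proof
    assume "vec n x = 0\<^sub>v n"
    then have "vec_index (vec n x) r = vec_index (0\<^sub>v n) r" by simp
    then show False using x by simp
  qed
  fix i
  show "T i *\<^sub>v vec n x = vec_nth \<mu> i \<cdot>\<^sub>v vec n x"
  proof (rule eq_vecI)
    fix r assume "r < dim_vec (vec_nth \<mu> i \<cdot>\<^sub>v vec n x)"
    then have r: "r < n" by simp
    then have "vec_index (T i *\<^sub>v vec n x) r = app (T i) x r"
      using is_mtuple_dim[OF T, of i] by (simp add: app_def scalar_prod_def atLeast0LessThan)
    then show "vec_index (T i *\<^sub>v vec n x) r = vec_index (vec_nth \<mu> i \<cdot>\<^sub>v vec n x) r" using r x(1) by simp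
  qed (use is_mtuple_dim[OF T] in auto)
qed simp

lemma jspecE:
  assumes T: "is_mtuple n T" and "\<mu> \<in> jspec n T"
  obtains x r where "\<And>i r. r < n \<Longrightarrow> app (T i) x r = vec_nth \<mu> i * x r" "r < n" "x r \<noteq> 0"
proof -
  obtain v where v: "v \<in> carrier_vec n" "v \<noteq> 0\<^sub>v n" "\<And>i. T i *\<^sub>v v = vec_nth \<mu> i \<cdot>\<^sub>v v"
    using assms(2) by (auto simp: jspec_def)
  have "app (T i) (vec_index v) r = vec_nth \<mu> i * vec_index v r" if "r < n" for i r
  proof -
    have "vec_index (T i *\<^sub>v v) r = vec_index (vec_nth \<mu> i \<cdot>\<^sub>v v) r" using v(3) by simp
    then show ?thesis using that v(1) is_mtuple_dim[OF T, of i] by (simp add: app_def scalar_prod_def atLeast0LessThan)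
  qed
  moreover obtain r where "r < n" "vec_index v r \<noteq> 0"
  proof (rule ccontr)
    assume "\<not> thesis"
    then have "v = 0\<^sub>v n" using v(1) that by (intro eq_vecI) auto
    with v(2) show False ..
  qed
  ultimately show ?thesis using that by blast
qed

text \<open>A positive definite G satisfying the hypothesis of the Agler decomposition makes the
  multiplication operators by the coordinates on functions on the point set, written in a
  G-orthonormal basis, an admissible commuting tuple.\<close>

lemma agler_points:
  fixes f :: "complex ^ 'd::finite \<Rightarrow> complex"
  assumes f: "sepholo f (Ucom a b \<delta>)" and c: "c > 0"
    and com: "\<And>n T. n \<ge> 1 \<Longrightarrow> is_mtuple n T \<Longrightarrow> commuting T \<Longrightarrow> opnorm (delta_eval a b \<delta> n T) \<le> 1 \<Longrightarrow>
      jspec n T \<subseteq> Ucom a b \<delta> \<Longrightarrow> opnorm (fcalc n f T) \<le> c"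
    and z: "\<And>i. i < N \<Longrightarrow> z i \<in> Ucom a b \<delta>" and N: "N \<ge> 1"
  defines "D \<equiv> \<lambda>i r l. if l < b then delta_eval a b \<delta> 1 (scal (z i)) $$ (r, l) else 0"
  shows "\<exists>L. \<forall>i<N. \<forall>j<N. 1 - (f (z i) / c) * cnj (f (z j) / c) = agler_sum a (Suc b) D (N * Suc b) L i j"
proof (rule agler_decomposition)
  define \<rho> where "\<rho> = Max ((\<lambda>i. (opnorm (delta_eval a b \<delta> 1 (scal (z i))))\<^sup>2) ` {..<N})"
  have Dsum: "(\<Sum>l<Suc b. D i r l * u l) = app (delta_eval a b \<delta> 1 (scal (z i))) u r" for i r u
    by (simp add: D_def app_def)
  show "nrm2 a (\<lambda>r. \<Sum>l<Suc b. D i r l * u l) \<le> \<rho> * nrm2 (Suc b) u" if i: "i < N" for i u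
  proof -
    let ?o = "opnorm (delta_eval a b \<delta> 1 (scal (z i)))"
    have "nrm2 a (\<lambda>r. \<Sum>l<Suc b. D i r l * u l) \<le> ?o\<^sup>2 * nrm2 b u"
      unfolding Dsum using bdd_byD[OF bdd_by_opnorm[of "delta_eval a b \<delta> 1 (scal (z i))"], of u] by simp
    also have "\<dots> \<le> \<rho> * nrm2 (Suc b) u"
    proof (rule mult_mono)
      show \<rho>: "?o\<^sup>2 \<le> \<rho>" unfolding \<rho>_def using i by (intro Max_ge) auto
      show "0 \<le> \<rho>" using \<rho> zero_le_power2[of ?o] by linarith
    qed (simp_all add: nrm2_def sum_nonneg)
    finally show ?thesis .
  qed
  show "\<rho> < 1"
    unfolding \<rho>_def using N z opnorm_nonneg
    by (subst Max_less_iff) (auto simp: lessThan_empty_iff abs_square_less_1 Ucom_def Gd_def)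
  fix G \<eta>
  assume G: "\<And>i j. G j i = cnj (G i j)" and \<eta>: "\<eta> > 0"
    and pos: "\<And>u. \<eta> * (\<Sum>i<N. nrm2 (Suc b) (u i)) \<le> Re (\<Sum>i<N. \<Sum>j<N. G i j * agler_kernel a (Suc b) D u i j)"
  have posd: "\<eta> * nrm2 N x \<le> Re (qf N G x)" for x
  proof -
    \<comment> \<open>Only the additional slot b is filled. There D is 0, so the kernel is of the
      form x i times cnj (x j) and the hypothesis becomes positive definiteness of G.\<close>
    let ?u = "\<lambda>i l. if l = b then x i else 0"
    have "(\<Sum>i<N. nrm2 (Suc b) (?u i)) = nrm2 N x" by (simp add: nrm2_def)
    moreover have "(\<Sum>i<N. \<Sum>j<N. G i j * agler_kernel a (Suc b) D ?u i j) = qf N G x"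
      unfolding agler_kernel_qf by (simp add: D_def qf_def)
    ultimately show ?thesis using pos[of ?u] by simp
  qed
  have "psd N G"
    unfolding psd_def
  proof (intro conjI allI impI G)
    fix x
    have "0 \<le> \<eta> * nrm2 N x" using \<eta> by simp
    then show "0 \<le> Re (qf N G x)" using posd[of x] by linarith
  qed
  from qf_sqrt[OF this] obtain R where R: "R \<in> carrier_mat N N" and Rq: "\<And>x. qf N G x = of_real (nrm2 N (app R x))" by blast
  have "x k = 0" if "\<And>r. r < N \<Longrightarrow> app R x r = 0" "k < N" for x k
  proof -
    have "nrm2 N (app R x) = 0" using that(1) by (simp add: nrm2_eq_0_iff)
    then have "\<eta> * nrm2 N x \<le> 0" using posd[of x] by (simp add: Rq)
    then have "nrm2 N x \<le> 0" using \<eta> by (simp add: mult_le_0_iff)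
    then have "nrm2 N x = 0" using nrm2_nonneg[of N x] by linarith
    then show ?thesis using that(2) by (simp add: nrm2_eq_0_iff)
  qed
  then have "\<exists>B\<in>carrier_mat N N. R * B = 1\<^sub>m N \<and> B * R = 1\<^sub>m N" by (intro invertible_matI[OF R]) blast
  then obtain Ri where Ri: "Ri \<in> carrier_mat N N" "R * Ri = 1\<^sub>m N" "Ri * R = 1\<^sub>m N" by blast
  define Z where "Z = diag_tuple N z"
  have mZ: "is_mtuple N Z" unfolding Z_def by (rule diag_tuple_mtuple)
  define T where "T = (\<lambda>i. R * Z i * Ri)"
  have I: "intw N N R Z T" unfolding T_def by (rule intw_conj[OF mZ R Ri(1,3)])
  note I' = intw_inverse[OF I Ri]
  have mT: "is_mtuple N T" using I by (simp add: intw_def)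
  have Zc: "Z i \<in> carrier_mat N N" and Tc: "T i \<in> carrier_mat N N" for i using mZ mT by (auto simp: is_mtuple_def)
  have cT: "commuting T" unfolding T_def using commuting_diag by (intro commuting_conj[OF mZ _ R Ri(1,3,2)]) (simp add: Z_def)
  have "bdd_by 1 (delta_eval a b \<delta> N T)"
  proof (rule bdd_by_delta_conj[OF I Ri(1,2)])
    fix v :: "nat \<Rightarrow> complex"
    define u where "u s l = (if l < b then v (l * N + s) else 0)" for s l
    have dR: "dim_row R = N" "dim_col R = N" using R by auto
    have "app R (\<lambda>s. app (delta_eval a b \<delta> N Z) v (r * N + s)) = app R (\<lambda>s. \<Sum>l<Suc b. D s r l * u s l)" if r: "r < a" for r
    proof (rule app_cong)
      fix s assume "s < dim_col R"
      then have s: "s < N" using dR by simp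
      have "app (delta_eval a b \<delta> N Z) v (r * N + s) = (\<Sum>l<b. fp_scalar (\<delta> r l) (z s) * v (l * N + s))"
        unfolding delta_row[OF r s] Z_def by (intro sum.cong refl app_fp_eval_diag s)
      also have "\<dots> = (\<Sum>l<Suc b. D s r l * u s l)"
        using r by (simp add: D_def u_def delta_index fp_scalar_def)
      finally show "app (delta_eval a b \<delta> N Z) v (r * N + s) = (\<Sum>l<Suc b. D s r l * u s l)" .
    qed
    then have l: "of_real (nrm2 (a * N) (app (kron (1\<^sub>m a) R) (app (delta_eval a b \<delta> N Z) v))) =
       (\<Sum>r<a. qf N G (\<lambda>s. \<Sum>l<Suc b. D s r l * u s l))"
      using nrm2_kron_left[of a R "app (delta_eval a b \<delta> N Z) v"] dR by (simp add: Rq)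
    have "of_real (nrm2 (b * N) (app (kron (1\<^sub>m b) R) v)) = (\<Sum>l<b. qf N G (\<lambda>s. v (l * N + s)))"
      using nrm2_kron_left[of b R v] dR by (simp add: Rq)
    also have "\<dots> = (\<Sum>l<Suc b. qf N G (\<lambda>s. u s l))" by (simp add: u_def qf_def)
    finally have r: "of_real (nrm2 (b * N) (app (kron (1\<^sub>m b) R) v)) = (\<Sum>l<Suc b. qf N G (\<lambda>s. u s l))" .
    have "0 \<le> \<eta> * (\<Sum>i<N. nrm2 (Suc b) (u i))" using \<eta> by (simp add: sum_nonneg)
    also have "\<dots> \<le> Re (of_real (nrm2 (b * N) (app (kron (1\<^sub>m b) R) v)) - of_real (nrm2 (a * N) (app (kron (1\<^sub>m a) R) (app (delta_eval a b \<delta> N Z) v))))"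
      using pos[of u] unfolding agler_kernel_qf l r .
    finally show "nrm2 (a * N) (app (kron (1\<^sub>m a) R) (app (delta_eval a b \<delta> N Z) v)) \<le> 1\<^sup>2 * nrm2 (b * N) (app (kron (1\<^sub>m b) R) v)"
      by simp
  qed simp
  then have dT: "opnorm (delta_eval a b \<delta> N T) \<le> 1" by (rule opnorm_le)
  \<comment> \<open>Ri turns a joint eigenvector of T into one of the diagonal tuple, and any
    nonzero entry s of it identifies the eigenvalue as z s.\<close>
  have sub: "jspec N T \<subseteq> z ` {..<N}"
  proof
    fix \<mu> assume "\<mu> \<in> jspec N T"
    from jspecE[OF mT this] obtain x r where x: "\<And>i r. r < N \<Longrightarrow> app (T i) x r = vec_nth \<mu> i * x r" "r < N" "x r \<noteq> 0" by blast
    have Rid: "app (R * Ri) x k = x k" if "k < N" for k unfolding Ri(2) using that by (rule app_one)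
    obtain s where s: "s < N" "app Ri x s \<noteq> 0"
    proof (rule ccontr)
      assume "\<not> thesis"
      then have 0: "app Ri x s = 0" if "s < N" for s using \<open>\<And>s. s < N \<Longrightarrow> app Ri x s \<noteq> 0 \<Longrightarrow> thesis\<close> that by blast
      have "x r = app R (app Ri x) r" using Rid[OF x(2)] app_mult[of R Ri r x] R Ri(1) x(2) by simp
      also have "\<dots> = 0" using 0 R by (simp add: app_def[of R])
      finally show False using x(3) by simp
    qed
    have "vec_nth (z s) i = vec_nth \<mu> i" for i
    proof -
      have "vec_nth (z s) i * app Ri x s = app (Z i) (app Ri x) s" using s(1) by (simp add: Z_def app_diag_tuple)
      also have "\<dots> = app Ri (app (T i) x) s"
        using app_intw[of Ri "T i" "Z i" N N s x] I' Tc Zc Ri(1) s(1) by (simp add: intw_def)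
      also have "\<dots> = app Ri (\<lambda>k. vec_nth \<mu> i * x k) s"
        by (rule app_cong_eq[OF refl]) (use Ri(1) x(1) in simp)
      also have "\<dots> = vec_nth \<mu> i * app Ri x s" by (rule app_scale)
      finally show ?thesis using s(2) by simp
    qed
    then show "\<mu> \<in> z ` {..<N}" using s(1) by (intro image_eqI[of _ _ s]) (auto simp: Finite_Cartesian_Product.vec_eq_iff)
  qed
  then have sp: "jspec N T \<subseteq> Ucom a b \<delta>" using z by auto
  have zj: "z s \<in> jspec N T" if s: "s < N" for s
  proof -
    let ?e = "\<lambda>k. if k = s then 1 else 0 :: complex"
    have e1: "app (T i) (app R ?e) r = vec_nth (z s) i * app R ?e r" if r: "r < N" for i r
    proof -
      have "app (T i) (app R ?e) r = app R (app (Z i) ?e) r"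
        using app_intw[of R "Z i" "T i" N N r ?e] I Tc Zc R r by (simp add: intw_def)
      also have "\<dots> = app R (\<lambda>k. vec_nth (z s) i * ?e k) r"
        by (rule app_cong_eq[OF refl]) (use R in \<open>auto simp: Z_def app_diag_tuple\<close>)
      also have "\<dots> = vec_nth (z s) i * app R ?e r" by (rule app_scale)
      finally show ?thesis .
    qed
    obtain r where r: "r < N" "app R ?e r \<noteq> 0"
    proof (rule ccontr)
      assume "\<not> thesis"
      then have 0: "app R ?e r = 0" if "r < N" for r using \<open>\<And>r. r < N \<Longrightarrow> app R ?e r \<noteq> 0 \<Longrightarrow> thesis\<close> that by blast
      have "?e s = app (Ri * R) ?e s" unfolding Ri(3) using s by (simp only: app_one)
      also have "\<dots> = app Ri (app R ?e) s" using Ri(1) R s by (intro app_mult) auto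
      also have "\<dots> = 0" using 0 Ri(1) by (simp add: app_def[of Ri])
      finally show False by simp
    qed
    show ?thesis by (rule jspecI[OF mT e1 r])
  qed
  obtain p where p: "\<And>\<mu>. \<mu> \<in> jspec N T \<Longrightarrow> jet0 N \<mu> (\<lambda>w. f w - fp_scalar p w)" "fcalc N f T = fp_eval N p T"
    using fcalc_poly[OF open_Ucom f mT sp] by blast
  \<comment> \<open>Contact of order N with N \<ge> 1 contains equality of values at the point
    itself.\<close>
  have pz: "fp_scalar p (z s) = f (z s)" if s: "s < N" for s
  proof -
    obtain C e where C: "e > 0" "\<And>w. norm (w - z s) < e \<Longrightarrow> cmod (f w - fp_scalar p w) \<le> C * norm (w - z s) ^ N"
      using p(1)[OF zj[OF s]] by (auto simp: jet0_def)
    have "cmod (f (z s) - fp_scalar p (z s)) \<le> C * norm (z s - z s) ^ N" by (rule C(2)) (use C(1) in simp)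
    also have "\<dots> = 0" using N by (simp add: zero_power)
    finally show ?thesis by simp
  qed
  have "bdd_by c (fp_eval N p T)"
    using com[OF N mT cT dT sp] c unfolding p(2) by (simp add: opnorm_le_iff)
  \<comment> \<open>R maps the constant function 1 to a vector on which f(T) produces the image of
    the function s \<mapsto> f (z s). The norm bound there is exactly the positivity to be shown for
    G.\<close>
  from bdd_byD[OF this, of "app R (\<lambda>_. 1)"]
  have le0: "nrm2 N (app (fp_eval N p T) (app R (\<lambda>_. 1))) \<le> c\<^sup>2 * nrm2 N (app R (\<lambda>_. 1))" by simp
  have "nrm2 N (app (fp_eval N p T) (app R (\<lambda>_. 1))) = nrm2 N (app R (\<lambda>s. f (z s)))"
  proof (rule nrm2_cong)
    fix r assume r: "r < N"
    have "app (fp_eval N p T) (app R (\<lambda>_. 1)) r = app R (app (fp_eval N p Z) (\<lambda>_. 1)) r"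
      by (rule app_intw[OF intw_fp[OF I] fp_eval_carrier fp_eval_carrier R r, symmetric])
    also have "\<dots> = app R (\<lambda>s. f (z s)) r"
      by (rule app_cong_eq[OF refl]) (use R in \<open>auto simp: Z_def app_fp_eval_diag pz\<close>)
    finally show "app (fp_eval N p T) (app R (\<lambda>_. 1)) r = app R (\<lambda>s. f (z s)) r" .
  qed
  with le0 have le: "nrm2 N (app R (\<lambda>s. f (z s))) \<le> c\<^sup>2 * nrm2 N (app R (\<lambda>_. 1))" by simp
  have "(\<Sum>i<N. \<Sum>j<N. G i j * (1 - (f (z i) / c) * cnj (f (z j) / c))) = qf N G (\<lambda>_. 1) - qf N G (\<lambda>s. f (z s)) / of_real (c\<^sup>2)"
    by (simp add: qf_def right_diff_distrib sum_subtractf sum_divide_distrib power2_eq_square mult.assoc)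
  also have "\<dots> = of_real (nrm2 N (app R (\<lambda>_. 1)) - nrm2 N (app R (\<lambda>s. f (z s))) / c\<^sup>2)"
    by (simp only: Rq of_real_diff of_real_divide)
  finally have "Re (\<Sum>i<N. \<Sum>j<N. G i j * (1 - (f (z i) / c) * cnj (f (z j) / c))) = nrm2 N (app R (\<lambda>_. 1)) - nrm2 N (app R (\<lambda>s. f (z s))) / c\<^sup>2"
    by (simp only: Re_complex_of_real)
  moreover have "0 \<le> nrm2 N (app R (\<lambda>_. 1)) - nrm2 N (app R (\<lambda>s. f (z s))) / c\<^sup>2"
    using le c by (simp add: divide_le_eq mult.commute)
  ultimately show "0 \<le> Re (\<Sum>i<N. \<Sum>j<N. G i j * (1 - (f (z i) / c) * cnj (f (z j) / c)))" by simp
qed (simp_all add: mult.commute)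

lemma nrm2_lincomb: "complex_of_real (nrm2 n (\<lambda>k. \<Sum>i<N. c i * x i k)) = (\<Sum>i<N. \<Sum>j<N. c i * cnj (c j) * ipr n (x i) (x j))"
  unfolding ipr_self[symmetric] ipr_sum ipr_sum_right ipr_scale ipr_scale_right
  by (simp add: sum_distrib_left mult.assoc)

lemma kron_one_right: "kron A (1\<^sub>m (Suc 0)) = A"
  by (rule eq_matI) (auto simp: kron_index)

text \<open>The Agler decomposition, with negative terms moved across, says that the vectors g i =
  (1, A i) have a Gram matrix at least that of h i = (w i, u i). The resulting contraction V sends g
  i to h i, and its transfer function takes the value w i at z i.\<close>

lemma finite_interpolation:
  fixes f :: "complex ^ 'd::finite \<Rightarrow> complex" and N :: nat and z :: "nat \<Rightarrow> complex ^ 'd"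
  assumes f: "sepholo f (Ucom a b \<delta>)" and c: "c > 0"
    and com: "\<And>n T. n \<ge> 1 \<Longrightarrow> is_mtuple n T \<Longrightarrow> commuting T \<Longrightarrow> opnorm (delta_eval a b \<delta> n T) \<le> 1 \<Longrightarrow>
      jspec n T \<subseteq> Ucom a b \<delta> \<Longrightarrow> opnorm (fcalc n f T) \<le> c"
    and z: "\<And>i. i < N \<Longrightarrow> z i \<in> Ucom a b \<delta>" and N: "N \<ge> 1"
  shows "\<exists>\<phi>. is_nc_fun a b \<delta> \<phi> \<and> (\<forall>n. \<forall>X\<in>Gd a b \<delta> n. bdd_by c (\<phi> X)) \<and> (\<forall>i<N. \<phi> (scal (z i)) $$ (0, 0) = f (z i))"
proof -
  define D where "D = (\<lambda>i r l. if l < b then delta_eval a b \<delta> 1 (scal (z i)) $$ (r, l) else 0)"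
  define w where "w i = f (z i) / c" for i
  obtain L where L: "\<And>i j. i < N \<Longrightarrow> j < N \<Longrightarrow> 1 - w i * cnj (w j) = agler_sum a (Suc b) D (N * Suc b) L i j"
  proof -
    have "\<exists>L. \<forall>i<N. \<forall>j<N. 1 - w i * cnj (w j) = agler_sum a (Suc b) D (N * Suc b) L i j"
      unfolding D_def w_def by (rule agler_points[OF f c]) (rule com z N | assumption)+
    then show ?thesis using that by blast
  qed
  define K where "K = N * Suc b"
  define u where "u i k l = L (i * Suc b + l, k)" for i k l
  define A where "A i k = app (delta_eval a b \<delta> 1 (scal (z i))) (u i k)" for i k
  \<comment> \<open>Entry 0 is the scalar channel; the shift by 1 in the remaining indices matches
    the layout of \<open>bigdelta\<close>.\<close>
  define g where "g i q = (if q = 0 then 1 else A i ((q - 1) div a) ((q - 1) mod a))" for i q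
  define h where "h i p = (if p = 0 then w i else u i ((p - 1) div b) ((p - 1) mod b))" for i p
  have Dsum: "(\<Sum>l<Suc b. D i r l * v l) = app (delta_eval a b \<delta> 1 (scal (z i))) v r" for i r v
    by (simp add: D_def app_def)
  have gg: "ipr (Suc (K * a)) (g i) (g j) = 1 + (\<Sum>k<K. \<Sum>r<a. A i k r * cnj (A j k r))" for i j
    unfolding ipr_def sum.lessThan_Suc_shift
    using sum_div_mod[of "\<lambda>k r. A i k r * cnj (A j k r)" a K] by (simp add: g_def)
  have hh: "ipr (Suc (K * b)) (h i) (h j) = w i * cnj (w j) + (\<Sum>k<K. \<Sum>l<b. u i k l * cnj (u j k l))" for i j
    unfolding ipr_def sum.lessThan_Suc_shift
    using sum_div_mod[of "\<lambda>k l. u i k l * cnj (u j k l)" b K] by (simp add: h_def)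
  \<comment> \<open>The slot b is left out of h and A. Its contribution is a positive semidefinite
    surplus, so V is a contraction and need not be isometric.\<close>
  have gram: "ipr (Suc (K * a)) (g i) (g j) = ipr (Suc (K * b)) (h i) (h j) + ipr K (\<lambda>k. u i k b) (\<lambda>k. u j k b)" if "i < N" "j < N" for i j
  proof -
    have "1 - w i * cnj (w j) = (\<Sum>k<K. (\<Sum>l<Suc b. u i k l * cnj (u j k l)) - (\<Sum>r<a. A i k r * cnj (A j k r)))"
      unfolding L[OF that] agler_sum_def agler_kernel_def Dsum by (simp only: A_def u_def[abs_def] K_def)
    then have "1 - w i * cnj (w j) = (\<Sum>k<K. \<Sum>l<b. u i k l * cnj (u j k l)) + ipr K (\<lambda>k. u i k b) (\<lambda>k. u j k b) - (\<Sum>k<K. \<Sum>r<a. A i k r * cnj (A j k r))"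
      by (simp add: ipr_def sum_subtractf sum.distrib)
    then show ?thesis unfolding gg hh by (simp add: algebra_simps)
  qed
  have "nrm2 (Suc (K * b)) (\<lambda>p. \<Sum>i<N. x i * h i p) \<le> nrm2 (Suc (K * a)) (\<lambda>q. \<Sum>i<N. x i * g i q)" for x
  proof -
    have "complex_of_real (nrm2 (Suc (K * a)) (\<lambda>q. \<Sum>i<N. x i * g i q)) =
        (\<Sum>i<N. \<Sum>j<N. x i * cnj (x j) * (ipr (Suc (K * b)) (h i) (h j) + ipr K (\<lambda>k. u i k b) (\<lambda>k. u j k b)))"
      unfolding nrm2_lincomb by (intro sum.cong refl) (simp add: gram)
    also have "\<dots> = of_real (nrm2 (Suc (K * b)) (\<lambda>p. \<Sum>i<N. x i * h i p) + nrm2 K (\<lambda>k. \<Sum>i<N. x i * u i k b))"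
      unfolding of_real_add nrm2_lincomb by (simp add: distrib_left sum.distrib)
    finally show ?thesis unfolding of_real_eq_iff by simp
  qed
  from contraction_from_gram[OF this] obtain V where V: "V \<in> carrier_mat (Suc (K * b)) (Suc (K * a))" "bdd_by 1 V"
    and Vg: "\<And>i p. i < N \<Longrightarrow> p < Suc (K * b) \<Longrightarrow> app V (g i) p = h i p" by blast
  let ?R = "realiz a b K \<delta> V"
  define \<phi> where "\<phi> X = of_real c \<cdot>\<^sub>m ?R X" for X
  have "is_nc_fun a b \<delta> \<phi>"
  proof (rule is_nc_funI)
    fix n m S and X Y :: "'d mtuple"
    assume n: "n \<ge> 1" "m \<ge> 1" and X: "X \<in> Gd a b \<delta> n" and Y: "Y \<in> Gd a b \<delta> m" and I: "intw n m S X Y"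
    have S: "S \<in> carrier_mat m n" using I by (simp add: intw_def)
    show "S * \<phi> X = \<phi> Y * S"
      unfolding \<phi>_def using nc_intw[OF realiz_nc[OF V] n X Y I] S realiz_carrier[OF V X] realiz_carrier[OF V Y]
      by (simp add: mult_smult_distrib mult_smult_assoc_mat)
  qed (simp add: \<phi>_def realiz_carrier[OF V])
  moreover have "bdd_by c (\<phi> X)" if X: "X \<in> Gd a b \<delta> n" for n X
    unfolding \<phi>_def using bdd_by_smult[OF realiz_contractive[OF V X], of "of_real c"] c by simp
  moreover have "\<phi> (scal (z i)) $$ (0, 0) = f (z i)" if i: "i < N" for i
  proof -
    have X: "scal (z i) \<in> Gd a b \<delta> 1" using z[OF i] by (simp add: Ucom_def)
    \<comment> \<open>The vector h i solves the feedback equation with input 1: J 1 + D (h i) equals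
      g i, and V sends g i to h i.\<close>
    have "app (?R (scal (z i))) (\<lambda>_. 1) 0 = h i 0"
    proof (rule realiz_unique[OF V X])
      fix p assume p: "p < Suc (K * b) * 1"
      have "h i p = app V (g i) p" using Vg[OF i] p by simp
      also have "\<dots> = app V (\<lambda>q. app (realiz_J a K 1) (\<lambda>_. 1) q + app (realiz_D a b K \<delta> 1 (scal (z i))) (h i) q) p"
      proof (rule app_cong_eq[OF refl])
        fix q assume "q < dim_col V"
        then have q: "q < Suc (K * a) * 1" using V(1) by simp
        have "app (realiz_D a b K \<delta> 1 (scal (z i))) (h i) q = (if q < 1 then 0 else g i q)"
        proof (cases q)
          case 0
          then show ?thesis using realiz_D_first[OF V, of 0 1] by simp
        next
          case (Suc q')
          define k r where "k = q' div a" and "r = q' mod a"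
          have kr: "k < K" "r < a" "q = Suc (k * a + r) * 1 + 0"
            using q Suc div_mod_less[of q' K a] by (simp_all add: k_def r_def)
          have "app (realiz_D a b K \<delta> 1 (scal (z i))) (h i) q = app (delta_eval a b \<delta> 1 (scal (z i))) (\<lambda>p. h i (1 + k * (b * 1) + p)) (r * 1 + 0)"
            unfolding realiz_D_def[OF V] kr(3) by (rule bigdelta_row[OF kr(1,2)]) simp
          also have "\<dots> = A i k (r * 1 + 0)"
            unfolding A_def by (rule app_cong_eq[OF refl]) (auto simp: h_def)
          finally show ?thesis using Suc by (simp add: g_def k_def r_def)
        qed
        then show "g i q = app (realiz_J a K 1) (\<lambda>_. 1) q + app (realiz_D a b K \<delta> 1 (scal (z i))) (h i) q"
          unfolding app_realiz_J[OF V q] by (simp add: g_def)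
      qed
      finally show "h i p = app (kron V (1\<^sub>m 1)) (\<lambda>q. app (realiz_J a K 1) (\<lambda>_. 1) q + app (realiz_D a b K \<delta> 1 (scal (z i))) (h i) q) p"
        by (simp add: kron_one_right)
    qed simp
    then have "?R (scal (z i)) $$ (0, 0) = w i"
      using realiz_carrier[OF V X] by (simp add: app_def h_def)
    then show ?thesis using realiz_carrier[OF V X] c by (simp add: \<phi>_def w_def)
  qed
  ultimately show ?thesis by blast
qed

text \<open>Witness for the empty family of interpolation conditions, since
  \<open>finite_interpolation\<close> asks for at least one point.\<close>

lemma is_nc_fun_zero: "is_nc_fun a b \<delta> (\<lambda>X. 0\<^sub>m (dim_row (X (SOME i. True))) (dim_row (X (SOME i. True))))"
proof (rule is_nc_funI)
  fix n m S and X Y :: "'a mtuple"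
  assume X: "X \<in> Gd a b \<delta> n" and Y: "Y \<in> Gd a b \<delta> m" and I: "intw n m S X Y"
  have "dim_row (X i) = n" "dim_row (Y i) = m" for i using is_mtuple_dim[OF GdD[OF X]] is_mtuple_dim[OF GdD[OF Y]] by auto
  then show "S * 0\<^sub>m (dim_row (X (SOME i. True))) (dim_row (X (SOME i. True))) =
      0\<^sub>m (dim_row (Y (SOME i. True))) (dim_row (Y (SOME i. True))) * S"
    using I by (auto simp: intw_def)
next
  fix n and X :: "'a mtuple"
  assume X: "X \<in> Gd a b \<delta> n"
  have "dim_row (X i) = n" for i using is_mtuple_dim[OF GdD[OF X]] by auto
  then show "0\<^sub>m (dim_row (X (SOME i. True))) (dim_row (X (SOME i. True))) \<in> carrier_mat n n" by simp
qed

text \<open>An nc function is encoded as the family of its entries, a point of a product of closed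
  discs. Each intertwining equation, each norm bound for a fixed vector and each interpolation
  condition involves finitely many entries, so all are closed.\<close>

lemma interpolation:
  fixes f :: "complex ^ 'd::finite \<Rightarrow> complex"
  assumes f: "sepholo f (Ucom a b \<delta>)" and c: "c > 0"
    and com: "\<And>n T. n \<ge> 1 \<Longrightarrow> is_mtuple n T \<Longrightarrow> commuting T \<Longrightarrow> opnorm (delta_eval a b \<delta> n T) \<le> 1 \<Longrightarrow>
      jspec n T \<subseteq> Ucom a b \<delta> \<Longrightarrow> opnorm (fcalc n f T) \<le> c"
  shows "\<exists>\<phi>. is_nc_fun a b \<delta> \<phi> \<and> (\<forall>X\<in>Gall a b \<delta>. opnorm (\<phi> X) \<le> c) \<and> (\<forall>z\<in>Ucom a b \<delta>. \<phi> (scal z) $$ (0, 0) = f z)"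
proof -
  define dm where "dm X = dim_row (X (SOME i. True))" for X :: "'d mtuple"
  have dm: "dm X = n" if "X \<in> Gd a b \<delta> n" for n X unfolding dm_def using is_mtuple_dim[OF GdD[OF that]] by blast
  define C where "C = {F :: 'd mtuple \<times> nat \<times> nat \<Rightarrow> complex. \<forall>i. F i \<in> cball 0 c}"
  define E where "E = {F :: 'd mtuple \<times> nat \<times> nat \<Rightarrow> complex. \<forall>n m S X Y. n \<ge> 1 \<longrightarrow> m \<ge> 1 \<longrightarrow> X \<in> Gd a b \<delta> n \<longrightarrow> Y \<in> Gd a b \<delta> m \<longrightarrow> intw n m S X Y \<longrightarrow>
      (\<forall>r s. r < m \<longrightarrow> s < n \<longrightarrow> (\<Sum>k<n. S $$ (r, k) * F (X, k, s)) = (\<Sum>k<m. F (Y, r, k) * S $$ (k, s)))}"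
  define B where "B = {F :: 'd mtuple \<times> nat \<times> nat \<Rightarrow> complex. \<forall>n X x. n \<ge> 1 \<longrightarrow> X \<in> Gd a b \<delta> n \<longrightarrow>
      (\<Sum>r<n. (cmod (\<Sum>k<n. F (X, r, k) * x k))\<^sup>2) \<le> c\<^sup>2 * nrm2 n x}"
  define P where "P w = {F :: 'd mtuple \<times> nat \<times> nat \<Rightarrow> complex. F (scal w, 0, 0) = f w}" for w
  have cont: "continuous_on UNIV (\<lambda>F :: 'd mtuple \<times> nat \<times> nat \<Rightarrow> complex. F i)" for i
    by (rule continuous_on_product_coordinates)
  have "closed E" unfolding E_def
    by (intro closed_Collect_all closed_Collect_imp open_Collect_const closed_Collect_eq continuous_intros cont)
  moreover have "closed B" unfolding B_def
    by (intro closed_Collect_all closed_Collect_imp open_Collect_const closed_Collect_le continuous_intros cont)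
  moreover have "compact C" unfolding C_def by (rule compact_Pi) simp
  ultimately have cpt: "compact (C \<inter> E \<inter> B)" by (intro compact_Int_closed)
  have "C \<inter> E \<inter> B \<inter> \<Inter>(P ` Ucom a b \<delta>) \<noteq> {}"
  proof (rule compact_imp_fip[OF cpt])
    fix T assume "T \<in> P ` Ucom a b \<delta>"
    then show "closed T" unfolding P_def by (auto intro!: closed_Collect_eq cont continuous_on_const)
  next
    fix \<F> assume "finite \<F>" "\<F> \<subseteq> P ` Ucom a b \<delta>"
    then obtain Z0 where Z0: "finite Z0" "Z0 \<subseteq> Ucom a b \<delta>" "\<F> = P ` Z0" by (meson finite_subset_image)
    have "\<exists>\<phi>. is_nc_fun a b \<delta> \<phi> \<and> (\<forall>n. \<forall>X\<in>Gd a b \<delta> n. bdd_by c (\<phi> X)) \<and> (\<forall>w\<in>Z0. \<phi> (scal w) $$ (0, 0) = f w)"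
    proof (cases "Z0 = {}")
      case True
      have "bdd_by c (0\<^sub>m p q)" for p q using c by (simp add: bdd_by_def nrm2_def app_def sum_nonneg)
      then show ?thesis using is_nc_fun_zero True by blast
    next
      case False
      obtain z where z: "bij_betw z {0..<card Z0} Z0" using ex_bij_betw_nat_finite[OF Z0(1)] by blast
      have zZ: "Z0 = z ` {..<card Z0}" using z by (simp add: bij_betw_def atLeast0LessThan)
      have "\<exists>\<phi>. is_nc_fun a b \<delta> \<phi> \<and> (\<forall>n. \<forall>X\<in>Gd a b \<delta> n. bdd_by c (\<phi> X)) \<and> (\<forall>i<card Z0. \<phi> (scal (z i)) $$ (0, 0) = f (z i))"
      proof (rule finite_interpolation[OF f c])
        show "z i \<in> Ucom a b \<delta>" if "i < card Z0" for i using that zZ Z0(2) by auto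
        show "card Z0 \<ge> 1" using False Z0(1) by (simp add: Suc_le_eq card_gt_0_iff)
      qed (rule com)
      then obtain \<phi> where \<phi>: "is_nc_fun a b \<delta> \<phi>" "\<forall>n. \<forall>X\<in>Gd a b \<delta> n. bdd_by c (\<phi> X)" "\<And>i. i < card Z0 \<Longrightarrow> \<phi> (scal (z i)) $$ (0, 0) = f (z i)"
        by blast
      moreover have "\<phi> (scal w) $$ (0, 0) = f w" if "w \<in> Z0" for w using that \<phi>(3) by (subst (asm) zZ) auto
      ultimately show ?thesis by blast
    qed
    then obtain \<phi> where nc: "is_nc_fun a b \<delta> \<phi>" and bd: "\<And>n X. X \<in> Gd a b \<delta> n \<Longrightarrow> bdd_by c (\<phi> X)"
      and val: "\<And>w. w \<in> Z0 \<Longrightarrow> \<phi> (scal w) $$ (0, 0) = f w" by blast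
    \<comment> \<open>Entries outside the domain or the matrix are set to 0 so that they too lie in
      the disc of radius c.\<close>
    define F where "F = (\<lambda>(X, r, s). if X \<in> Gall a b \<delta> \<and> r < dm X \<and> s < dm X then \<phi> X $$ (r, s) else 0)"
    have FX: "F (X, r, s) = \<phi> X $$ (r, s)" if "n \<ge> 1" "X \<in> Gd a b \<delta> n" "r < n" "s < n" for n X r s
      using that dm[OF that(2)] by (auto simp: F_def Gall_def)
    have car: "\<phi> X \<in> carrier_mat n n" if "n \<ge> 1" "X \<in> Gd a b \<delta> n" for n X using nc_carrier[OF nc] that by blast
    have "F \<in> C"
      unfolding C_def mem_Collect_eq
    proof
      fix i :: "'d mtuple \<times> nat \<times> nat"
      obtain X r s where i: "i = (X, r, s)" by (cases i)
      show "F i \<in> cball 0 c"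
      proof (cases "X \<in> Gall a b \<delta> \<and> r < dm X \<and> s < dm X")
        case True
        then obtain n where n: "n \<ge> 1" "X \<in> Gd a b \<delta> n" by (auto simp: Gall_def)
        then show ?thesis using True bdd_by_entry[OF bd[OF n(2)], of r s] car[OF n] dm[OF n(2)] by (simp add: i F_def)
      next
        case False
        then have "F i = 0" by (simp only: i F_def prod.case if_False)
        then show ?thesis using c by simp
      qed
    qed
    moreover have "F \<in> E"
      unfolding E_def mem_Collect_eq
    proof (intro allI impI)
      fix n m S X Y and r s :: nat
      assume n: "n \<ge> 1" "m \<ge> 1" "X \<in> Gd a b \<delta> n" "Y \<in> Gd a b \<delta> m" and I: "intw n m S X Y" and r: "r < m" and s: "s < n"
      have S: "S \<in> carrier_mat m n" using I by (simp add: intw_def)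
      have "(\<Sum>k<n. S $$ (r, k) * F (X, k, s)) = (S * \<phi> X) $$ (r, s)"
        using S car[OF n(1,3)] r s by (subst mat_mult_index) (auto simp: FX[OF n(1,3)])
      also have "\<dots> = (\<phi> Y * S) $$ (r, s)" using nc_intw[OF nc n I] by simp
      also have "\<dots> = (\<Sum>k<m. F (Y, r, k) * S $$ (k, s))"
        using S car[OF n(2,4)] r s by (subst mat_mult_index) (auto simp: FX[OF n(2,4)])
      finally show "(\<Sum>k<n. S $$ (r, k) * F (X, k, s)) = (\<Sum>k<m. F (Y, r, k) * S $$ (k, s))" .
    qed
    moreover have "F \<in> B"
      unfolding B_def mem_Collect_eq
    proof (intro allI impI)
      fix n X and x :: "nat \<Rightarrow> complex"
      assume n: "n \<ge> 1" "X \<in> Gd a b \<delta> n"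
      have "(\<Sum>r<n. (cmod (\<Sum>k<n. F (X, r, k) * x k))\<^sup>2) = nrm2 n (app (\<phi> X) x)"
        using car[OF n] by (simp add: nrm2_def app_def FX[OF n])
      then show "(\<Sum>r<n. (cmod (\<Sum>k<n. F (X, r, k) * x k))\<^sup>2) \<le> c\<^sup>2 * nrm2 n x"
        using bdd_byD[OF bd[OF n(2)], of x] car[OF n] by simp
    qed
    moreover have "F \<in> P w" if w: "w \<in> Z0" for w
    proof -
      have "scal w \<in> Gd a b \<delta> 1" using Z0(2) w by (auto simp: Ucom_def)
      then show ?thesis using FX[of 1 "scal w" 0 0] val[OF w] by (simp add: P_def)
    qed
    ultimately show "C \<inter> E \<inter> B \<inter> \<Inter>\<F> \<noteq> {}" unfolding Z0(3) by blast
  qed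
  then obtain F where E: "F \<in> E" and B: "F \<in> B" and P: "\<And>w. w \<in> Ucom a b \<delta> \<Longrightarrow> F (scal w, 0, 0) = f w"
    unfolding P_def by blast
  define \<phi> where "\<phi> X = mat (dm X) (dm X) (\<lambda>(r, s). F (X, r, s))" for X
  have "is_nc_fun a b \<delta> \<phi>"
  proof (rule is_nc_funI)
    fix n m S and X Y :: "'d mtuple"
    assume n: "n \<ge> 1" "m \<ge> 1" "X \<in> Gd a b \<delta> n" "Y \<in> Gd a b \<delta> m" and I: "intw n m S X Y"
    have S: "S \<in> carrier_mat m n" using I by (simp add: intw_def)
    note d = dm[OF n(3)] dm[OF n(4)]
    show "S * \<phi> X = \<phi> Y * S"
    proof (rule eq_matI)
      fix r s assume "r < dim_row (\<phi> Y * S)" "s < dim_col (\<phi> Y * S)"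
      then have r: "r < m" and s: "s < n" using S d by (auto simp: \<phi>_def)
      have "(S * \<phi> X) $$ (r, s) = (\<Sum>k<n. S $$ (r, k) * F (X, k, s))"
        using S d r s by (subst mat_mult_index) (auto simp: \<phi>_def)
      also have "\<dots> = (\<Sum>k<m. F (Y, r, k) * S $$ (k, s))" using E n I r s unfolding E_def by blast
      also have "\<dots> = (\<phi> Y * S) $$ (r, s)"
        using S d r s by (subst mat_mult_index) (auto simp: \<phi>_def)
      finally show "(S * \<phi> X) $$ (r, s) = (\<phi> Y * S) $$ (r, s)" .
    qed (use S d in \<open>auto simp: \<phi>_def\<close>)
  qed (auto simp: \<phi>_def dm)
  moreover have "opnorm (\<phi> X) \<le> c" if "X \<in> Gall a b \<delta>" for X
  proof (rule opnorm_le)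
    from that obtain n where n: "n \<ge> 1" "X \<in> Gd a b \<delta> n" by (auto simp: Gall_def)
    have "nrm2 n (app (\<phi> X) x) \<le> c\<^sup>2 * nrm2 n x" for x
    proof -
      have "nrm2 n (app (\<phi> X) x) = (\<Sum>r<n. (cmod (\<Sum>k<n. F (X, r, k) * x k))\<^sup>2)"
        by (simp add: nrm2_def app_def \<phi>_def dm[OF n(2)])
      then show ?thesis using B n unfolding B_def by auto
    qed
    then show "bdd_by c (\<phi> X)" using c by (simp add: bdd_by_def \<phi>_def dm[OF n(2)])
  qed
  moreover have "\<phi> (scal w) $$ (0, 0) = f w" if w: "w \<in> Ucom a b \<delta>" for w
    using P[OF w] w dm[of "scal w" 1] by (simp add: \<phi>_def Ucom_def)
  ultimately show ?thesis by blast
qed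

section \<open>The quotient algebra\<close>

lemma HinfD: "\<phi> \<in> Hinf a b \<delta> \<Longrightarrow> is_nc_fun a b \<delta> \<phi>"
  by (simp add: Hinf_def)

lemma GallI: "n \<ge> 1 \<Longrightarrow> X \<in> Gd a b \<delta> n \<Longrightarrow> X \<in> Gall a b \<delta>"
  by (auto simp: Gall_def)

lemma Hinf_norm_upper:
  assumes "\<phi> \<in> Hinf a b \<delta>"
  shows "0 \<le> Hinf_norm a b \<delta> \<phi>" "X \<in> Gall a b \<delta> \<Longrightarrow> opnorm (\<phi> X) \<le> Hinf_norm a b \<delta> \<phi>"
proof -
  obtain C where "\<And>X. X \<in> Gall a b \<delta> \<Longrightarrow> opnorm (\<phi> X) \<le> C" using assms by (auto simp: Hinf_def)
  then have "bdd_above (insert 0 {opnorm (\<phi> X) |X. X \<in> Gall a b \<delta>})"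
    by (intro bdd_aboveI[of _ "max 0 C"]) (auto simp: le_max_iff_disj)
  then show "0 \<le> Hinf_norm a b \<delta> \<phi>" "X \<in> Gall a b \<delta> \<Longrightarrow> opnorm (\<phi> X) \<le> Hinf_norm a b \<delta> \<phi>"
    unfolding Hinf_norm_def by (auto intro!: cSup_upper)
qed

lemma Hinf_norm_le: "0 \<le> c \<Longrightarrow> (\<And>X. X \<in> Gall a b \<delta> \<Longrightarrow> opnorm (\<phi> X) \<le> c) \<Longrightarrow> Hinf_norm a b \<delta> \<phi> \<le> c"
  unfolding Hinf_norm_def by (rule cSup_least) auto

lemma Hinf_nc_add:
  assumes "\<phi> \<in> Hinf a b \<delta>" "\<psi> \<in> Hinf a b \<delta>" shows "nc_add \<phi> \<psi> \<in> Hinf a b \<delta>"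
proof -
  note c = nc_carrier[OF HinfD[OF assms(1)]] nc_carrier[OF HinfD[OF assms(2)]]
  have "is_nc_fun a b \<delta> (nc_add \<phi> \<psi>)"
  proof (rule is_nc_funI)
    fix n m S and X Y :: "'a mtuple"
    assume n: "n \<ge> 1" "m \<ge> 1" "X \<in> Gd a b \<delta> n" "Y \<in> Gd a b \<delta> m" and I: "intw n m S X Y"
    have S: "S \<in> carrier_mat m n" using I by (simp add: intw_def)
    show "S * nc_add \<phi> \<psi> X = nc_add \<phi> \<psi> Y * S"
      unfolding nc_add_def mult_add_distrib_mat[OF S c(1)[OF n(1,3)] c(2)[OF n(1,3)]]
        add_mult_distrib_mat[OF c(1)[OF n(2,4)] c(2)[OF n(2,4)] S]
        nc_intw[OF HinfD[OF assms(1)] n I] nc_intw[OF HinfD[OF assms(2)] n I] ..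
  qed (simp add: nc_add_def c)
  moreover have "opnorm (nc_add \<phi> \<psi> X) \<le> Hinf_norm a b \<delta> \<phi> + Hinf_norm a b \<delta> \<psi>" if X: "X \<in> Gall a b \<delta>" for X
  proof -
    obtain n where n: "n \<ge> 1" "X \<in> Gd a b \<delta> n" using X by (auto simp: Gall_def)
    have "opnorm (nc_add \<phi> \<psi> X) \<le> opnorm (\<phi> X) + opnorm (\<psi> X)"
      unfolding nc_add_def using c(1)[OF n] c(2)[OF n] by (intro opnorm_add) auto
    then show ?thesis using Hinf_norm_upper(2)[OF assms(1) X] Hinf_norm_upper(2)[OF assms(2) X] by linarith
  qed
  ultimately show ?thesis unfolding Hinf_def by blast
qed

lemma Hinf_nc_mult:
  assumes "\<phi> \<in> Hinf a b \<delta>" "\<psi> \<in> Hinf a b \<delta>" shows "nc_mult \<phi> \<psi> \<in> Hinf a b \<delta>"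
proof -
  note c = nc_carrier[OF HinfD[OF assms(1)]] nc_carrier[OF HinfD[OF assms(2)]]
  have "is_nc_fun a b \<delta> (nc_mult \<phi> \<psi>)"
  proof (rule is_nc_funI)
    fix n m S and X Y :: "'a mtuple"
    assume n: "n \<ge> 1" "m \<ge> 1" "X \<in> Gd a b \<delta> n" "Y \<in> Gd a b \<delta> m" and I: "intw n m S X Y"
    have S: "S \<in> carrier_mat m n" using I by (simp add: intw_def)
    have "S * (\<phi> X * \<psi> X) = \<phi> Y * S * \<psi> X"
      unfolding assoc_mult_mat[OF S c(1)[OF n(1,3)] c(2)[OF n(1,3)], symmetric] nc_intw[OF HinfD[OF assms(1)] n I] ..
    also have "\<dots> = \<phi> Y * \<psi> Y * S"
      unfolding assoc_mult_mat[OF c(1)[OF n(2,4)] S c(2)[OF n(1,3)]] nc_intw[OF HinfD[OF assms(2)] n I]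
        assoc_mult_mat[OF c(1)[OF n(2,4)] c(2)[OF n(2,4)] S] ..
    finally show "S * nc_mult \<phi> \<psi> X = nc_mult \<phi> \<psi> Y * S" by (simp only: nc_mult_def)
  qed (unfold nc_mult_def, rule mult_carrier_mat[OF c])
  moreover have "opnorm (nc_mult \<phi> \<psi> X) \<le> Hinf_norm a b \<delta> \<phi> * Hinf_norm a b \<delta> \<psi>" if X: "X \<in> Gall a b \<delta>" for X
  proof -
    obtain n where n: "n \<ge> 1" "X \<in> Gd a b \<delta> n" using X by (auto simp: Gall_def)
    have "opnorm (nc_mult \<phi> \<psi> X) \<le> opnorm (\<phi> X) * opnorm (\<psi> X)"
      unfolding nc_mult_def using c(1)[OF n] c(2)[OF n] by (intro opnorm_mult) auto
    also have "\<dots> \<le> Hinf_norm a b \<delta> \<phi> * Hinf_norm a b \<delta> \<psi>"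
      using Hinf_norm_upper[OF assms(1)] Hinf_norm_upper[OF assms(2)] X by (intro mult_mono opnorm_nonneg) auto
    finally show ?thesis .
  qed
  ultimately show ?thesis unfolding Hinf_def by blast
qed

lemma Hinf_nc_smult:
  assumes "\<phi> \<in> Hinf a b \<delta>" shows "nc_smult k \<phi> \<in> Hinf a b \<delta>"
proof -
  note c = nc_carrier[OF HinfD[OF assms]]
  have "is_nc_fun a b \<delta> (nc_smult k \<phi>)"
  proof (rule is_nc_funI)
    fix n m S and X Y :: "'a mtuple"
    assume n: "n \<ge> 1" "m \<ge> 1" "X \<in> Gd a b \<delta> n" "Y \<in> Gd a b \<delta> m" and I: "intw n m S X Y"
    have S: "S \<in> carrier_mat m n" using I by (simp add: intw_def)
    show "S * nc_smult k \<phi> X = nc_smult k \<phi> Y * S"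
      unfolding nc_smult_def mult_smult_distrib[OF S c[OF n(1,3)]] mult_smult_assoc_mat[OF c[OF n(2,4)] S]
        nc_intw[OF HinfD[OF assms] n I] ..
  qed (simp add: nc_smult_def c)
  moreover have "opnorm (nc_smult k \<phi> X) \<le> cmod k * Hinf_norm a b \<delta> \<phi>" if X: "X \<in> Gall a b \<delta>" for X
    unfolding nc_smult_def using opnorm_smult[of k "\<phi> X"] mult_left_mono[OF Hinf_norm_upper(2)[OF assms X], of "cmod k"] by simp
  ultimately show ?thesis unfolding Hinf_def by blast
qed

lemma Hinf_nc_one: "nc_one \<in> Hinf a b \<delta>"
proof -
  have one: "nc_one X = 1\<^sub>m n" if "X \<in> Gd a b \<delta> n" for n and X :: "'a mtuple"
    unfolding nc_one_def using is_mtuple_dim[OF GdD[OF that]] by simp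
  have "is_nc_fun a b \<delta> nc_one" by (rule is_nc_funI) (auto simp: one intw_def)
  moreover have "opnorm (nc_one X) \<le> 1" if "X \<in> Gall a b \<delta>" for X :: "'a mtuple"
    using that one by (auto simp: Gall_def intro!: opnorm_le[OF bdd_by_one])
  ultimately show ?thesis unfolding Hinf_def by blast
qed

section \<open>Restriction to the scalar points\<close>

definition restr :: "nat \<Rightarrow> nat \<Rightarrow> (nat \<Rightarrow> nat \<Rightarrow> 'd fpoly) \<Rightarrow> ('d mtuple \<Rightarrow> complex mat) \<Rightarrow> complex ^ 'd \<Rightarrow> complex" where
  "restr a b \<delta> \<phi> z = (if z \<in> Ucom a b \<delta> then \<phi> (scal z) $$ (0, 0) else 0)"

lemma restr_carrier: "\<phi> \<in> Hinf a b \<delta> \<Longrightarrow> z \<in> Ucom a b \<delta> \<Longrightarrow> \<phi> (scal z) \<in> carrier_mat (Suc 0) (Suc 0)"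
  using nc_carrier[OF HinfD, of \<phi> a b \<delta> 1 "scal z"] by (simp add: Ucom_def)

lemma restr_add: "\<phi> \<in> Hinf a b \<delta> \<Longrightarrow> \<psi> \<in> Hinf a b \<delta> \<Longrightarrow>
    restr a b \<delta> (nc_add \<phi> \<psi>) = (\<lambda>z. restr a b \<delta> \<phi> z + restr a b \<delta> \<psi> z)"
  using restr_carrier[of \<phi> a b \<delta>] restr_carrier[of \<psi> a b \<delta>] by (fastforce simp: restr_def nc_add_def)

lemma restr_mult:
  assumes "\<phi> \<in> Hinf a b \<delta>" "\<psi> \<in> Hinf a b \<delta>"
  shows "restr a b \<delta> (nc_mult \<phi> \<psi>) = (\<lambda>z. restr a b \<delta> \<phi> z * restr a b \<delta> \<psi> z)"
proof
  fix z
  show "restr a b \<delta> (nc_mult \<phi> \<psi>) z = restr a b \<delta> \<phi> z * restr a b \<delta> \<psi> z"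
  proof (cases "z \<in> Ucom a b \<delta>")
    case True
    then have "(\<phi> (scal z) * \<psi> (scal z)) $$ (0, 0) = \<phi> (scal z) $$ (0, 0) * \<psi> (scal z) $$ (0, 0)"
      using restr_carrier[OF assms(1) True] restr_carrier[OF assms(2) True] by (subst mat_mult_index) auto
    then show ?thesis by (simp add: restr_def nc_mult_def)
  qed (simp add: restr_def)
qed

lemma restr_smult: "\<phi> \<in> Hinf a b \<delta> \<Longrightarrow> restr a b \<delta> (nc_smult k \<phi>) = (\<lambda>z. k * restr a b \<delta> \<phi> z)"
  using restr_carrier[of \<phi> a b \<delta>] by (fastforce simp: restr_def nc_smult_def)

lemma restr_one: "restr a b \<delta> nc_one = com_one a b \<delta>"
  by (auto simp: restr_def nc_one_def com_one_def)

lemma Gd_one_scal: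
  fixes X :: "('d::finite) mtuple"
  assumes "X \<in> Gd a b \<delta> 1" obtains z where "z \<in> Ucom a b \<delta>" "X = scal z"
proof
  let ?z = "\<chi> i. X i $$ (0, 0)"
  have "X i = scal ?z i" for i
    using is_mtuple_dim[OF GdD[OF assms], of i] by (intro eq_matI) (auto simp: scal_def)
  then show "X = scal ?z" by blast
  then show "?z \<in> Ucom a b \<delta>" using assms by (simp add: Ucom_def)
qed

text \<open>Cosets of the ideal are the fibres of restriction, because every 1 x 1 tuple in the
  domain is a scalar point. The quotient is thereby replaced by the image of
  \<open>restr\<close>.\<close>

lemma coset_eq:
  fixes \<phi> :: "('d::finite) mtuple \<Rightarrow> complex mat"
  assumes \<phi>: "\<phi> \<in> Hinf a b \<delta>"
  shows "coset a b \<delta> \<phi> = {\<psi> \<in> Hinf a b \<delta>. restr a b \<delta> \<psi> = restr a b \<delta> \<phi>}"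
proof (intro Set.set_eqI iffI)
  fix \<psi> assume "\<psi> \<in> coset a b \<delta> \<phi>"
  then obtain \<eta> where \<psi>: "\<psi> \<in> Hinf a b \<delta>" and \<eta>: "\<eta> \<in> Iideal a b \<delta>" and eq: "\<And>X. X \<in> Gall a b \<delta> \<Longrightarrow> \<psi> X = \<phi> X + \<eta> X"
    by (auto simp: coset_def)
  have "\<psi> (scal z) $$ (0, 0) = \<phi> (scal z) $$ (0, 0)" if z: "z \<in> Ucom a b \<delta>" for z
  proof -
    have 1: "scal z \<in> Gd a b \<delta> 1" using z by (simp add: Ucom_def)
    have "\<psi> (scal z) = \<phi> (scal z) + 0\<^sub>m 1 1" using eq[OF GallI[OF _ 1]] \<eta> 1 by (simp add: Iideal_def)
    then show ?thesis by simp
  qed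
  then show "\<psi> \<in> {\<psi> \<in> Hinf a b \<delta>. restr a b \<delta> \<psi> = restr a b \<delta> \<phi>}" using \<psi> by (auto simp: restr_def)
next
  fix \<psi> assume "\<psi> \<in> {\<psi> \<in> Hinf a b \<delta>. restr a b \<delta> \<psi> = restr a b \<delta> \<phi>}"
  then have \<psi>: "\<psi> \<in> Hinf a b \<delta>" and r: "restr a b \<delta> \<psi> = restr a b \<delta> \<phi>" by auto
  define \<eta> where "\<eta> = nc_add \<psi> (nc_smult (- 1) \<phi>)"
  have H: "\<eta> \<in> Hinf a b \<delta>" unfolding \<eta>_def by (intro Hinf_nc_add Hinf_nc_smult \<phi> \<psi>)
  have "\<eta> X = 0\<^sub>m 1 1" if "X \<in> Gd a b \<delta> 1" for X
  proof -
    obtain z where z: "z \<in> Ucom a b \<delta>" "X = scal z" using Gd_one_scal[OF \<open>X \<in> Gd a b \<delta> 1\<close>] by blast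
    have "\<psi> (scal z) $$ (0, 0) = \<phi> (scal z) $$ (0, 0)" using fun_cong[OF r, of z] z(1) by (simp add: restr_def)
    then show ?thesis using restr_carrier[OF \<phi> z(1)] restr_carrier[OF \<psi> z(1)]
      by (intro eq_matI) (auto simp: \<eta>_def nc_add_def nc_smult_def z(2))
  qed
  then have "\<eta> \<in> Iideal a b \<delta>" using H by (simp add: Iideal_def)
  moreover have "\<psi> X = \<phi> X + \<eta> X" if "X \<in> Gall a b \<delta>" for X
  proof -
    from that obtain n where n: "n \<ge> 1" "X \<in> Gd a b \<delta> n" by (auto simp: Gall_def)
    show ?thesis using nc_carrier[OF HinfD[OF \<phi>] n] nc_carrier[OF HinfD[OF \<psi>] n]
      by (intro eq_matI) (auto simp: \<eta>_def nc_add_def nc_smult_def)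
  qed
  ultimately show "\<psi> \<in> coset a b \<delta> \<phi>" using \<psi> by (auto simp: coset_def)
qed

lemma restr_holo:
  fixes \<phi> :: "('d::finite) mtuple \<Rightarrow> complex mat"
  assumes \<phi>: "\<phi> \<in> Hinf a b \<delta>"
  shows "holo_on (restr a b \<delta> \<phi>) (Ucom a b \<delta>)"
proof -
  have "sepholo (\<lambda>z. \<phi> (scal z) $$ (0, 0)) (Ucom a b \<delta>)"
    by (rule nc_scal_sepholo[OF HinfD[OF \<phi>] Hinf_norm_upper(2)[OF \<phi>]])
  then have h: "holo_on (\<lambda>z. \<phi> (scal z) $$ (0, 0)) (Ucom a b \<delta>)" by (rule sepholo_holo_on[OF open_Ucom])
  show ?thesis unfolding holo_on_def
  proof
    fix z assume z: "z \<in> Ucom a b \<delta>"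
    then obtain L where L: "((\<lambda>z. \<phi> (scal z) $$ (0, 0)) has_derivative L) (at z)" "\<forall>c w. L (\<chi> i. c * vec_nth w i) = c * L w"
      using h by (auto simp: holo_on_def)
    have "(restr a b \<delta> \<phi> has_derivative L) (at z)"
      by (rule has_derivative_transform_within_open[OF L(1) open_Ucom z]) (simp add: restr_def)
    then show "\<exists>L. (restr a b \<delta> \<phi> has_derivative L) (at z) \<and> (\<forall>c w. L (\<chi> i. c * vec_nth w i) = c * L w)"
      using L(2) by blast
  qed
qed

lemma com_norm_restr:
  fixes \<phi> :: "('d::finite) mtuple \<Rightarrow> complex mat"
  assumes \<phi>: "\<phi> \<in> Hinf a b \<delta>"
  shows "com_norm a b \<delta> (restr a b \<delta> \<phi>) \<le> ereal (Hinf_norm a b \<delta> \<phi>)"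
  unfolding com_norm_def
proof (rule Sup_least)
  fix x assume "x \<in> insert 0 {ereal (opnorm (fcalc n (restr a b \<delta> \<phi>) T)) |n T. 1 \<le> n \<and> is_mtuple n T \<and> commuting T \<and>
      opnorm (delta_eval a b \<delta> n T) \<le> 1 \<and> jspec n T \<subseteq> Ucom a b \<delta>}"
  then consider "x = 0" | n T where "x = ereal (opnorm (fcalc n (restr a b \<delta> \<phi>) T))" "1 \<le> n" "is_mtuple n T" "commuting T"
      "opnorm (delta_eval a b \<delta> n T) \<le> 1" "jspec n T \<subseteq> Ucom a b \<delta>" by blast
  then show "x \<le> ereal (Hinf_norm a b \<delta> \<phi>)"
  proof cases
    case 1
    then show ?thesis using Hinf_norm_upper(1)[OF \<phi>] by simp
  next
    case (2 n T)
    obtain p where p: "\<And>\<mu>. \<mu> \<in> jspec n T \<Longrightarrow> jet0 n \<mu> (\<lambda>z. restr a b \<delta> \<phi> z - fp_scalar p z)"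
        "fcalc n (restr a b \<delta> \<phi>) T = fp_eval n p T"
      using fcalc_poly[OF open_Ucom holo_on_sepholo[OF restr_holo[OF \<phi>]] 2(3,6)] by blast
    \<comment> \<open>Jets are local and the scalar domain is open, so the extension by 0 in
      \<open>restr\<close> does not affect them.\<close>
    have "jet0 n \<mu> (\<lambda>z. \<phi> (scal z) $$ (0, 0) - fp_scalar p z)" if \<mu>: "\<mu> \<in> jspec n T" for \<mu>
    proof -
      obtain C e where C: "e > 0" "\<And>z. norm (z - \<mu>) < e \<Longrightarrow> cmod (restr a b \<delta> \<phi> z - fp_scalar p z) \<le> C * norm (z - \<mu>) ^ n"
        using p(1)[OF \<mu>] by (auto simp: jet0_def)
      obtain d where d: "d > 0" "ball \<mu> d \<subseteq> Ucom a b \<delta>" using open_Ucom[of a b \<delta>] 2(6) \<mu> open_contains_ball by blast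
      show ?thesis unfolding jet0_def
      proof (rule exI[of _ C], rule exI[of _ "min d e"], intro conjI allI impI)
        fix z :: "complex ^ 'd" assume z: "norm (z - \<mu>) < min d e"
        then have "z \<in> Ucom a b \<delta>" using d(2) by (auto simp: dist_norm norm_minus_commute)
        then show "cmod (\<phi> (scal z) $$ (0, 0) - fp_scalar p z) \<le> C * norm (z - \<mu>) ^ n"
          using C(2)[of z] z by (simp add: restr_def)
      qed (use C(1) d(1) in simp)
    qed
    moreover have "bdd_by 1 (delta_eval a b \<delta> n T)" using 2(5) by (simp add: opnorm_le_iff)
    ultimately have "bdd_by (Hinf_norm a b \<delta> \<phi>) (fp_eval n p T)"
      by (intro com_bound[OF HinfD[OF \<phi>] Hinf_norm_upper(2)[OF \<phi>] Hinf_norm_upper(1)[OF \<phi>] 2(2,3,4) _ 2(6)])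
    then show ?thesis unfolding 2(1) p(2) by (simp add: opnorm_le)
  qed
qed

lemma restr_Hcom:
  fixes \<phi> :: "('d::finite) mtuple \<Rightarrow> complex mat"
  assumes "\<phi> \<in> Hinf a b \<delta>" shows "restr a b \<delta> \<phi> \<in> Hcom a b \<delta>"
proof -
  have "com_norm a b \<delta> (restr a b \<delta> \<phi>) < \<infinity>"
    by (rule order.strict_trans1[OF com_norm_restr[OF assms]]) simp
  then show ?thesis using restr_holo[OF assms] by (simp add: Hcom_def restr_def)
qed

lemma com_norm_nonneg: "0 \<le> com_norm a b \<delta> f"
  unfolding com_norm_def by (rule Sup_upper) simp

text \<open>Surjectivity of restriction with norm control. The bound c may equal the com-norm when
  that is positive.\<close>

lemma extension:
  fixes f :: "complex ^ 'd::finite \<Rightarrow> complex"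
  assumes f: "f \<in> Hcom a b \<delta>" and c: "c > 0" "com_norm a b \<delta> f \<le> ereal c"
  shows "\<exists>\<phi>\<in>Hinf a b \<delta>. restr a b \<delta> \<phi> = f \<and> Hinf_norm a b \<delta> \<phi> \<le> c"
proof -
  have "opnorm (fcalc n f T) \<le> c" if "n \<ge> 1" "is_mtuple n T" "commuting T" "opnorm (delta_eval a b \<delta> n T) \<le> 1" "jspec n T \<subseteq> Ucom a b \<delta>" for n T
  proof -
    have "ereal (opnorm (fcalc n f T)) \<le> com_norm a b \<delta> f" unfolding com_norm_def using that by (intro Sup_upper) blast
    then have "ereal (opnorm (fcalc n f T)) \<le> ereal c" using c(2) by (rule order_trans)
    then show ?thesis by simp
  qed
  then obtain \<phi> where \<phi>: "is_nc_fun a b \<delta> \<phi>" "\<And>X. X \<in> Gall a b \<delta> \<Longrightarrow> opnorm (\<phi> X) \<le> c" "\<And>z. z \<in> Ucom a b \<delta> \<Longrightarrow> \<phi> (scal z) $$ (0, 0) = f z"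
    using interpolation[OF holo_on_sepholo c(1), of f a b \<delta>] f unfolding Hcom_def by blast
  have "restr a b \<delta> \<phi> = f" using \<phi>(3) f by (auto simp: restr_def Hcom_def)
  moreover have "\<phi> \<in> Hinf a b \<delta>" using \<phi> by (auto simp: Hinf_def)
  moreover have "Hinf_norm a b \<delta> \<phi> \<le> c" using c(1) \<phi>(2) by (intro Hinf_norm_le) auto
  ultimately show ?thesis by blast
qed

lemma quotient_norm_eq:
  fixes \<phi> :: "('d::finite) mtuple \<Rightarrow> complex mat"
  assumes \<phi>: "\<phi> \<in> Hinf a b \<delta>"
  shows "com_norm a b \<delta> (restr a b \<delta> \<phi>) = ereal (quotient_norm a b \<delta> (coset a b \<delta> \<phi>))"
proof -
  obtain r where r: "com_norm a b \<delta> (restr a b \<delta> \<phi>) = ereal r" "0 \<le> r"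
    using com_norm_restr[OF \<phi>] com_norm_nonneg[of a b \<delta> "restr a b \<delta> \<phi>"]
    by (cases "com_norm a b \<delta> (restr a b \<delta> \<phi>)") auto
  have lower: "r \<le> Hinf_norm a b \<delta> \<psi>" if "\<psi> \<in> coset a b \<delta> \<phi>" for \<psi>
    using that com_norm_restr[of \<psi> a b \<delta>] r(1) by (simp add: coset_eq[OF \<phi>])
  have "quotient_norm a b \<delta> (coset a b \<delta> \<phi>) = r"
    unfolding quotient_norm_def
  proof (rule antisym)
    show "r \<le> Inf (Hinf_norm a b \<delta> ` coset a b \<delta> \<phi>)"
      using lower \<phi> by (intro cInf_greatest) (auto simp: coset_eq[OF \<phi>])
    show "Inf (Hinf_norm a b \<delta> ` coset a b \<delta> \<phi>) \<le> r"
    proof (rule field_le_epsilon)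
      fix e :: real assume e: "e > 0"
      \<comment> \<open>The margin e keeps the bound positive also for r = 0, as
        \<open>extension\<close> requires.\<close>
      obtain \<psi> where \<psi>: "\<psi> \<in> Hinf a b \<delta>" "restr a b \<delta> \<psi> = restr a b \<delta> \<phi>" "Hinf_norm a b \<delta> \<psi> \<le> r + e"
        using extension[OF restr_Hcom[OF \<phi>], of "r + e"] r e by auto
      have "Inf (Hinf_norm a b \<delta> ` coset a b \<delta> \<phi>) \<le> Hinf_norm a b \<delta> \<psi>"
        using \<psi> lower by (intro cInf_lower) (auto simp: coset_eq[OF \<phi>] intro!: bdd_belowI2[of _ r])
      then show "Inf (Hinf_norm a b \<delta> ` coset a b \<delta> \<phi>) \<le> r + e" using \<psi>(3) by linarith
    qed
  qed
  then show ?thesis using r(1) by simp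
qed

theorem theorem8p18:
  fixes a b :: nat and \<delta> :: "nat \<Rightarrow> nat \<Rightarrow> ('d::finite) fpoly"
  assumes "is_fpoly_matrix a b \<delta>"
  shows "\<exists>\<Phi>. bij_betw \<Phi> (quotient_space a b \<delta>) (Hcom a b \<delta>) \<and>
    (\<forall>\<phi>\<in>Hinf a b \<delta>. \<forall>\<psi>\<in>Hinf a b \<delta>.
        \<Phi> (coset a b \<delta> (nc_add \<phi> \<psi>)) = (\<lambda>z. \<Phi> (coset a b \<delta> \<phi>) z + \<Phi> (coset a b \<delta> \<psi>) z) \<and>
        \<Phi> (coset a b \<delta> (nc_mult \<phi> \<psi>)) = (\<lambda>z. \<Phi> (coset a b \<delta> \<phi>) z * \<Phi> (coset a b \<delta> \<psi>) z)) \<and>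
    (\<forall>c. \<forall>\<phi>\<in>Hinf a b \<delta>.
        \<Phi> (coset a b \<delta> (nc_smult c \<phi>)) = (\<lambda>z. c * \<Phi> (coset a b \<delta> \<phi>) z)) \<and>
    \<Phi> (coset a b \<delta> nc_one) = com_one a b \<delta> \<and>
    (\<forall>\<phi>\<in>Hinf a b \<delta>.
        com_norm a b \<delta> (\<Phi> (coset a b \<delta> \<phi>)) = ereal (quotient_norm a b \<delta> (coset a b \<delta> \<phi>)))"
proof -
  \<comment> \<open>The chosen representative does not matter: restriction is constant on a coset by
    \<open>coset_eq\<close>.\<close>
  define \<Phi> where "\<Phi> A = restr a b \<delta> (SOME \<phi>. \<phi> \<in> A)" for A
  have \<Phi>: "\<Phi> (coset a b \<delta> \<phi>) = restr a b \<delta> \<phi>" if \<phi>: "\<phi> \<in> Hinf a b \<delta>" for \<phi>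
  proof -
    have "\<phi> \<in> coset a b \<delta> \<phi>" using \<phi> by (simp add: coset_eq)
    then have "(SOME \<psi>. \<psi> \<in> coset a b \<delta> \<phi>) \<in> coset a b \<delta> \<phi>" by (rule someI[of "\<lambda>\<psi>. \<psi> \<in> coset a b \<delta> \<phi>"])
    then show ?thesis unfolding \<Phi>_def by (simp add: coset_eq[OF \<phi>])
  qed
  have "bij_betw \<Phi> (quotient_space a b \<delta>) (Hcom a b \<delta>)"
    unfolding bij_betw_def
  proof
    show "inj_on \<Phi> (quotient_space a b \<delta>)"
    proof (rule inj_onI)
      fix A B assume "A \<in> quotient_space a b \<delta>" "B \<in> quotient_space a b \<delta>" "\<Phi> A = \<Phi> B"
      then obtain \<phi> \<psi> where "\<phi> \<in> Hinf a b \<delta>" "\<psi> \<in> Hinf a b \<delta>" "A = coset a b \<delta> \<phi>" "B = coset a b \<delta> \<psi>"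
        "restr a b \<delta> \<phi> = restr a b \<delta> \<psi>" by (auto simp: quotient_space_def \<Phi>)
      then show "A = B" by (simp add: coset_eq)
    qed
    show "\<Phi> ` quotient_space a b \<delta> = Hcom a b \<delta>"
    proof (intro Set.set_eqI iffI)
      fix f assume "f \<in> Hcom a b \<delta>"
      moreover obtain c where "c > 0" "com_norm a b \<delta> f \<le> ereal c"
      proof -
        have "com_norm a b \<delta> f < \<infinity>" using \<open>f \<in> Hcom a b \<delta>\<close> by (simp add: Hcom_def)
        then obtain r where "com_norm a b \<delta> f = ereal r" "0 \<le> r"
          using com_norm_nonneg[of a b \<delta> f] by (cases "com_norm a b \<delta> f") auto
        then show ?thesis using that[of "r + 1"] by simp
      qed
      ultimately obtain \<phi> where "\<phi> \<in> Hinf a b \<delta>" "restr a b \<delta> \<phi> = f" using extension by blast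
      then show "f \<in> \<Phi> ` quotient_space a b \<delta>" using \<Phi> by (force simp: quotient_space_def)
    qed (auto simp: quotient_space_def \<Phi> restr_Hcom)
  qed
  then show ?thesis
    by (intro exI[of _ \<Phi>])
      (simp add: \<Phi> Hinf_nc_add Hinf_nc_mult Hinf_nc_smult Hinf_nc_one restr_add restr_mult restr_smult restr_one quotient_norm_eq)
qed

end
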